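(* Let $(M,\omega)$ be a compact symplectic Fano manifold (i.e. $2\pi c_1(M)=[\omega]$), let $G$ be a compact connected Lie subgroup of the group $Ham(M,\omega)$ of Hamiltonian symplectomorphisms, and let $\xi$ be an element of the center of $\mathfrak{g}=Lie(G)$. Suppose that there exists $J\in AK^G_\omega$ which induces a GeAKRS with respect to the vector field $\xi$, and that there exists $\tilde{J}\in AK^G_\omega$ which induces an almost-Kähler metric of constant Chern scalar curvature. Then $\xi\equiv 0$.
   Context: Let $(M,\omega)$ be a symplectic manifold of real dimension $2n$. An almost-complex structure $J$ is compatible with $\omega$ if $\omega(J\cdot,J\cdot)=\omega(\cdot,\cdot)$ and $g:=\omega(\cdot,J\cdot)$ is a Riemannian metric; $g$ is then called the almost-Kähler metric induced by $J$ (or by $(\omega,J)$). $D^g$ is the Levi-Civita connection. The canonical Hermitian connection is $\nabla_XY=D^g_XY-\frac12 J(D^g_XJ)Y$, its curvature is $R^\nabla_{X,Y}=\nabla_{[X,Y]}-[\nabla_X,\nabla_Y]$, and the first-Chern--Ricci form is $\rho^\nabla(X,Y)=\frac12\sum_{i=1}^{2n}g(R^\nabla_{X,Y}e_i,Je_i)$ for a $J$-adapted $g$-orthonormal local frame $\{e_i\}$; it is a closed real 2-form representing $2\pi c_1(M)$. The Chern scalar curvature $s^c$ is defined by $s^c\omega^n=n\,\rho^\nabla\wedge\omega^{n-1}$. $\Delta^g$ denotes the Riemannian Laplacian $\delta^gd+d\delta^g$ (nonnegative). $AK^G_\omega$ is the space of $G$-invariant almost-complex structures compatible with $\omega$. An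 element $\xi$ of the center of $\mathfrak{g}$ is identified with the vector field it defines on $M$; $f_\xi$ is the potential defined by $\omega(\xi,\cdot)=-df_\xi$ and $\int_M f_\xi e^{-2f_\xi}\omega^n=0$. For $J\in AK^G_\omega$ inducing $g$, the modified Chern scalar curvature is $s^c_\xi(J)=s^c(J)-n-2\Delta^gf_\xi+2f_\xi-2|df_\xi|_g^2$. The metric $g$ (or $J$) is a generalized almost-Kähler--Ricci soliton (GeAKRS) with respect to $\xi$ if $s^c_\xi(J)\equiv0$. *)

theory Defs
  imports "HOL-Analysis.Analysis" "HOL-Library.Function_Algebras" "HOL-Combinatorics.Permutations"
begin

section \<open>Smooth manifolds\<close>

text \<open>\<open>Ck_on k f S\<close> is meant for open \<open>S\<close> in a finite-dimensional space; there the existence and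
  continuity of all iterated directional derivatives is the usual \<open>k\<close>-fold differentiability
  condition as soon as it holds for all \<open>k\<close>.\<close>

primrec Ck_on :: "nat \<Rightarrow> ('a::real_normed_vector \<Rightarrow> 'b::real_normed_vector) \<Rightarrow> 'a set \<Rightarrow> bool" where
  "Ck_on 0 f S \<longleftrightarrow> continuous_on S f"
| "Ck_on (Suc k) f S \<longleftrightarrow>
     f differentiable_on S \<and> (\<forall>v. Ck_on k (\<lambda>x. frechet_derivative f (at x) v) S)"

definition smooth_on :: "('a::real_normed_vector \<Rightarrow> 'b::real_normed_vector) \<Rightarrow> 'a set \<Rightarrow> bool" where
  "smooth_on f S \<longleftrightarrow> (\<forall>k. Ck_on k f S)"

text \<open>A manifold is given by an atlas; its set of points is the union of the chart domains, and its
  topology is the one for which the charts are homeomorphisms onto open sets. The model space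
  is only required to be a finite-dimensional normed space (it may be trivial), so that Lie groups
  of dimension zero are not excluded.\<close>

type_synonym ('m, 'e) atlas = "('m set \<times> ('m \<Rightarrow> 'e)) set"

definition pts :: "('m, 'e) atlas \<Rightarrow> 'm set" where
  "pts A = \<Union>(fst ` A)"

definition smooth_atlas :: "('m, 'e::real_normed_vector) atlas \<Rightarrow> bool" where
  "smooth_atlas A \<longleftrightarrow>
     (\<forall>(U, \<phi>) \<in> A. inj_on \<phi> U) \<and>
     (\<forall>(U, \<phi>) \<in> A. \<forall>(V, \<psi>) \<in> A.
        open (\<phi> ` (U \<inter> V)) \<and> smooth_on (\<psi> \<circ> inv_into U \<phi>) (\<phi> ` (U \<inter> V)))"

definition atlas_topology :: "('m, 'e::real_normed_vector) atlas \<Rightarrow> 'm topology" where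
  "atlas_topology A = topology (\<lambda>W. W \<subseteq> pts A \<and> (\<forall>(U, \<phi>) \<in> A. open (\<phi> ` (W \<inter> U))))"

lemma istopology_atlas:
  assumes "smooth_atlas A"
  shows "istopology (\<lambda>W. W \<subseteq> pts A \<and> (\<forall>(U, \<phi>) \<in> A. open (\<phi> ` (W \<inter> U))))"
proof -
  have *: "\<phi> ` (S \<inter> T \<inter> U) = \<phi> ` (S \<inter> U) \<inter> \<phi> ` (T \<inter> U)" if "(U, \<phi>) \<in> A" for U \<phi> S T
    using assms that by (fastforce simp: smooth_atlas_def inj_on_def)
  have **: "\<phi> ` (\<Union>K \<inter> U) = (\<Union>S\<in>K. \<phi> ` (S \<inter> U))" for \<phi> :: "'a \<Rightarrow> 'b" and K U
    by blast
  show ?thesis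
    unfolding istopology_def by (auto simp: * ** intro!: open_Int open_UN)
qed

lemma openin_atlas_topology:
  assumes "smooth_atlas A"
  shows "openin (atlas_topology A) W \<longleftrightarrow> W \<subseteq> pts A \<and> (\<forall>(U, \<phi>) \<in> A. open (\<phi> ` (W \<inter> U)))"
  unfolding atlas_topology_def topology_inverse'[OF istopology_atlas[OF assms]] ..

definition smooth_manifold :: "('m, 'e::real_normed_vector) atlas \<Rightarrow> bool" where
  "smooth_manifold A \<longleftrightarrow>
     (\<exists>E :: 'e set. finite E \<and> span E = UNIV) \<and> smooth_atlas A \<and>
     Hausdorff_space (atlas_topology A) \<and> second_countable (atlas_topology A)"

definition smooth_map :: "('m, 'e::real_normed_vector) atlas \<Rightarrow> ('l, 'h::real_normed_vector) atlas
    \<Rightarrow> ('m \<Rightarrow> 'l) \<Rightarrow> bool" where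
  "smooth_map A B F \<longleftrightarrow>
     F ` pts A \<subseteq> pts B \<and>
     (\<forall>(U, \<phi>) \<in> A. \<forall>(V, \<psi>) \<in> B.
        open (\<phi> ` (U \<inter> F -` V)) \<and> smooth_on (\<psi> \<circ> F \<circ> inv_into U \<phi>) (\<phi> ` (U \<inter> F -` V)))"

definition prod_atlas :: "('m, 'e) atlas \<Rightarrow> ('l, 'h) atlas \<Rightarrow> ('m \<times> 'l, 'e \<times> 'h) atlas" where
  "prod_atlas A B = {(U \<times> V, map_prod \<phi> \<psi>) | U \<phi> V \<psi>. (U, \<phi>) \<in> A \<and> (V, \<psi>) \<in> B}"

definition line_atlas :: "(real, real) atlas" where
  "line_atlas = {(UNIV, id)}"

definition smooth_functions :: "('m, 'e::real_normed_vector) atlas \<Rightarrow> ('m \<Rightarrow> real) set" where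
  "smooth_functions A = {f. smooth_map A line_atlas f}"


section \<open>Tangent vectors, vector fields, forms\<close>

text \<open>Tangent vectors at \<open>p\<close> are derivations at \<open>p\<close> of the algebra of smooth functions; by
  convention they vanish on non-smooth functions. Vector fields vanish outside the manifold.
  These conventions make equality of tangent vectors and vector fields plain equality of functions.\<close>

type_synonym 'm tvec = "('m \<Rightarrow> real) \<Rightarrow> real"
type_synonym 'm vfield = "'m \<Rightarrow> 'm tvec"
type_synonym 'm form1 = "'m \<Rightarrow> 'm tvec \<Rightarrow> real"
type_synonym 'm form2 = "'m \<Rightarrow> 'm tvec \<Rightarrow> 'm tvec \<Rightarrow> real"
type_synonym 'm endo = "'m \<Rightarrow> 'm tvec \<Rightarrow> 'm tvec"
type_synonym 'm conn = "'m vfield \<Rightarrow> 'm vfield \<Rightarrow> 'm vfield"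

definition tscale :: "real \<Rightarrow> 'm tvec \<Rightarrow> 'm tvec" (infixr "*\<^sub>t" 75) where
  "c *\<^sub>t v = (\<lambda>f. c * v f)"

definition fscale :: "('m \<Rightarrow> real) \<Rightarrow> 'm vfield \<Rightarrow> 'm vfield" (infixr "*\<^sub>f" 75) where
  "h *\<^sub>f X = (\<lambda>p. h p *\<^sub>t X p)"

definition tangent_space :: "('m, 'e::real_normed_vector) atlas \<Rightarrow> 'm \<Rightarrow> 'm tvec set" where
  "tangent_space A p =
     {v. (\<forall>f. f \<notin> smooth_functions A \<longrightarrow> v f = 0) \<and>
         (\<forall>f \<in> smooth_functions A. \<forall>g \<in> smooth_functions A. \<forall>c.
            v (f + g) = v f + v g \<and> v (\<lambda>x. c * f x) = c * v f \<and>
            v (f * g) = f p * v g + g p * v f)}"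

definition vfields :: "('m, 'e::real_normed_vector) atlas \<Rightarrow> 'm vfield set" where
  "vfields A =
     {X. (\<forall>p \<in> pts A. X p \<in> tangent_space A p) \<and> (\<forall>p. p \<notin> pts A \<longrightarrow> X p = 0) \<and>
         (\<forall>f \<in> smooth_functions A. (\<lambda>p. X p f) \<in> smooth_functions A)}"

definition bracket :: "'m vfield \<Rightarrow> 'm vfield \<Rightarrow> 'm vfield" where
  "bracket X Y = (\<lambda>p f. X p (\<lambda>q. Y q f) - Y p (\<lambda>q. X q f))"

definition pushforward :: "('m, 'e::real_normed_vector) atlas \<Rightarrow> ('l, 'h::real_normed_vector) atlas
    \<Rightarrow> ('m \<Rightarrow> 'l) \<Rightarrow> 'm tvec \<Rightarrow> 'l tvec" where
  "pushforward A B F v = (\<lambda>f. if f \<in> smooth_functions B then v (f \<circ> F) else 0)"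

definition coord_vec :: "('m, 'e::real_normed_vector) atlas \<Rightarrow> 'm set \<times> ('m \<Rightarrow> 'e) \<Rightarrow> 'm \<Rightarrow> 'e
    \<Rightarrow> 'm tvec" where
  "coord_vec A c p b =
     (\<lambda>f. if f \<in> smooth_functions A
          then frechet_derivative (f \<circ> inv_into (fst c) (snd c)) (at (snd c p)) b else 0)"

definition bilinear_tensor :: "('m, 'e::real_normed_vector) atlas \<Rightarrow> 'm form2 \<Rightarrow> bool" where
  "bilinear_tensor A \<beta> \<longleftrightarrow>
     (\<forall>p \<in> pts A. \<forall>u \<in> tangent_space A p. \<forall>v \<in> tangent_space A p. \<forall>w \<in> tangent_space A p. \<forall>c.
        \<beta> p (u + v) w = \<beta> p u w + \<beta> p v w \<and> \<beta> p w (u + v) = \<beta> p w u + \<beta> p w v \<and>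
        \<beta> p (c *\<^sub>t u) w = c * \<beta> p u w \<and> \<beta> p u (c *\<^sub>t w) = c * \<beta> p u w) \<and>
     (\<forall>X \<in> vfields A. \<forall>Y \<in> vfields A. (\<lambda>p. \<beta> p (X p) (Y p)) \<in> smooth_functions A)"

definition is_form1 :: "('m, 'e::real_normed_vector) atlas \<Rightarrow> 'm form1 \<Rightarrow> bool" where
  "is_form1 A \<alpha> \<longleftrightarrow>
     (\<forall>p \<in> pts A. \<forall>u \<in> tangent_space A p. \<forall>v \<in> tangent_space A p. \<forall>c.
        \<alpha> p (u + v) = \<alpha> p u + \<alpha> p v \<and> \<alpha> p (c *\<^sub>t u) = c * \<alpha> p u) \<and>
     (\<forall>X \<in> vfields A. (\<lambda>p. \<alpha> p (X p)) \<in> smooth_functions A)"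

definition is_form2 :: "('m, 'e::real_normed_vector) atlas \<Rightarrow> 'm form2 \<Rightarrow> bool" where
  "is_form2 A \<beta> \<longleftrightarrow> bilinear_tensor A \<beta> \<and>
     (\<forall>p \<in> pts A. \<forall>u \<in> tangent_space A p. \<forall>v \<in> tangent_space A p. \<beta> p v u = - \<beta> p u v)"

definition d_form1 :: "'m form1 \<Rightarrow> 'm vfield \<Rightarrow> 'm vfield \<Rightarrow> 'm \<Rightarrow> real" where
  "d_form1 \<alpha> X Y p =
     X p (\<lambda>q. \<alpha> q (Y q)) - Y p (\<lambda>q. \<alpha> q (X q)) - \<alpha> p (bracket X Y p)"

definition d_form2 :: "'m form2 \<Rightarrow> 'm vfield \<Rightarrow> 'm vfield \<Rightarrow> 'm vfield \<Rightarrow> 'm \<Rightarrow> real" where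
  "d_form2 \<beta> X Y Z p =
     X p (\<lambda>q. \<beta> q (Y q) (Z q)) - Y p (\<lambda>q. \<beta> q (X q) (Z q)) + Z p (\<lambda>q. \<beta> q (X q) (Y q))
     - \<beta> p (bracket X Y p) (Z p) + \<beta> p (bracket X Z p) (Y p) - \<beta> p (bracket Y Z p) (X p)"

definition closed_form2 :: "('m, 'e::real_normed_vector) atlas \<Rightarrow> 'm form2 \<Rightarrow> bool" where
  "closed_form2 A \<beta> \<longleftrightarrow> is_form2 A \<beta> \<and>
     (\<forall>X \<in> vfields A. \<forall>Y \<in> vfields A. \<forall>Z \<in> vfields A. \<forall>p \<in> pts A. d_form2 \<beta> X Y Z p = 0)"

definition cohomologous :: "('m, 'e::real_normed_vector) atlas \<Rightarrow> 'm form2 \<Rightarrow> 'm form2 \<Rightarrow> bool" where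
  "cohomologous A \<beta> \<gamma> \<longleftrightarrow>
     (\<exists>\<alpha>. is_form1 A \<alpha> \<and>
        (\<forall>X \<in> vfields A. \<forall>Y \<in> vfields A. \<forall>p \<in> pts A.
           \<beta> p (X p) (Y p) - \<gamma> p (X p) (Y p) = d_form1 \<alpha> X Y p))"

definition de_rham_class :: "('m, 'e::real_normed_vector) atlas \<Rightarrow> 'm form2 \<Rightarrow> 'm form2 set" where
  "de_rham_class A \<beta> = {\<gamma>. closed_form2 A \<gamma> \<and> cohomologous A \<gamma> \<beta>}"


text \<open>A form of degree \<open>k\<close> at a point is a function of a sequence of tangent vectors that
  only uses the entries with index \<open>< k\<close>.\<close>

definition wedge :: "nat \<Rightarrow> nat \<Rightarrow> ((nat \<Rightarrow> 'v) \<Rightarrow> real) \<Rightarrow> ((nat \<Rightarrow> 'v) \<Rightarrow> real)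
    \<Rightarrow> (nat \<Rightarrow> 'v) \<Rightarrow> real" where
  "wedge k l \<alpha> \<beta> v =
     1 / (fact k * fact l) *
     (\<Sum>\<sigma> | \<sigma> permutes {..<k + l}.
        of_int (sign \<sigma>) * \<alpha> (\<lambda>i. v (\<sigma> i)) * \<beta> (\<lambda>i. v (\<sigma> (k + i))))"

definition seq2 :: "('v \<Rightarrow> 'v \<Rightarrow> real) \<Rightarrow> (nat \<Rightarrow> 'v) \<Rightarrow> real" where
  "seq2 \<beta> v = \<beta> (v 0) (v 1)"

primrec wedge_power :: "('v \<Rightarrow> 'v \<Rightarrow> real) \<Rightarrow> nat \<Rightarrow> (nat \<Rightarrow> 'v) \<Rightarrow> real" where
  "wedge_power \<beta> 0 = (\<lambda>v. 1)"
| "wedge_power \<beta> (Suc m) = wedge 2 (2 * m) (seq2 \<beta>) (wedge_power \<beta> m)"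


section \<open>Symplectic manifolds and Hamiltonian symplectomorphisms\<close>

definition symplectic_manifold :: "('m, 'e::euclidean_space) atlas \<Rightarrow> nat \<Rightarrow> 'm form2 \<Rightarrow> bool" where
  "symplectic_manifold A n \<omega> \<longleftrightarrow>
     smooth_manifold A \<and> pts A \<noteq> {} \<and> DIM('e) = 2 * n \<and> closed_form2 A \<omega> \<and>
     (\<forall>p \<in> pts A. \<forall>v \<in> tangent_space A p. (\<forall>w \<in> tangent_space A p. \<omega> p v w = 0) \<longrightarrow> v = 0)"

definition potential :: "('m, 'e::real_normed_vector) atlas \<Rightarrow> 'm form2 \<Rightarrow> 'm vfield
    \<Rightarrow> ('m \<Rightarrow> real) \<Rightarrow> bool" where
  "potential A \<omega> X f \<longleftrightarrow>
     f \<in> smooth_functions A \<and> (\<forall>p \<in> pts A. \<forall>v \<in> tangent_space A p. \<omega> p (X p) v = - v f)"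

text \<open>Diffeomorphisms are extended by the identity outside the manifold.\<close>

definition diffeos :: "('m, 'e::real_normed_vector) atlas \<Rightarrow> ('m \<Rightarrow> 'm) set" where
  "diffeos A = {\<phi>. \<phi> permutes pts A \<and> smooth_map A A \<phi> \<and> smooth_map A A (inv \<phi>)}"

text \<open>Time-one maps of the flows of smooth time-dependent Hamiltonians (letting time range over
  all reals gives the same time-one maps on a compact manifold).\<close>

definition Ham :: "('m, 'e::real_normed_vector) atlas \<Rightarrow> 'm form2 \<Rightarrow> ('m \<Rightarrow> 'm) set" where
  "Ham A \<omega> =
     {\<psi>. \<exists>H \<Phi> X.
        smooth_map (prod_atlas line_atlas A) line_atlas (\<lambda>(t, p). H t p) \<and>
        smooth_map (prod_atlas line_atlas A) A (\<lambda>(t, p). \<Phi> t p) \<and>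
        (\<forall>t. \<Phi> t \<in> diffeos A \<and> X t \<in> vfields A \<and> potential A \<omega> (X t) (H t)) \<and>
        (\<forall>f \<in> smooth_functions A. \<forall>p \<in> pts A. \<forall>t.
           ((\<lambda>s. f (\<Phi> s p)) has_real_derivative X t (\<Phi> t p) f) (at t)) \<and>
        \<Phi> 0 = id \<and> \<Phi> 1 = \<psi>}"


section \<open>Lie groups of Hamiltonian symplectomorphisms\<close>

text \<open>\<open>B\<close> is the smooth structure of the Lie group whose set of points is the subgroup.\<close>

definition lie_subgroup_Ham :: "('m, 'e::real_normed_vector) atlas \<Rightarrow> 'm form2
    \<Rightarrow> ('m \<Rightarrow> 'm) set \<Rightarrow> ('m \<Rightarrow> 'm, 'h::real_normed_vector) atlas \<Rightarrow> bool" where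
  "lie_subgroup_Ham A \<omega> G B \<longleftrightarrow>
     G \<subseteq> Ham A \<omega> \<and> id \<in> G \<and> (\<forall>a \<in> G. \<forall>b \<in> G. a \<circ> b \<in> G) \<and> (\<forall>a \<in> G. inv a \<in> G) \<and>
     smooth_manifold B \<and> pts B = G \<and>
     smooth_map (prod_atlas B B) B (\<lambda>(a, b). a \<circ> b) \<and> smooth_map B B (\<lambda>a. inv a) \<and>
     smooth_map (prod_atlas B A) A (\<lambda>(a, p). a p)"

text \<open>The Lie algebra is the tangent space at the identity, with the bracket of left-invariant
  vector fields.\<close>

definition lie_algebra :: "('m \<Rightarrow> 'm, 'h::real_normed_vector) atlas \<Rightarrow> ('m \<Rightarrow> 'm) tvec set" where
  "lie_algebra B = tangent_space B id"

definition left_invariant :: "('m \<Rightarrow> 'm, 'h::real_normed_vector) atlas \<Rightarrow> ('m \<Rightarrow> 'm) tvec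
    \<Rightarrow> ('m \<Rightarrow> 'm) vfield" where
  "left_invariant B \<xi> a = (if a \<in> pts B then pushforward B B (\<lambda>b. a \<circ> b) \<xi> else 0)"

definition lie_center :: "('m \<Rightarrow> 'm, 'h::real_normed_vector) atlas \<Rightarrow> ('m \<Rightarrow> 'm) tvec set" where
  "lie_center B =
     {\<xi> \<in> lie_algebra B. \<forall>\<eta> \<in> lie_algebra B.
        bracket (left_invariant B \<xi>) (left_invariant B \<eta>) id = 0}"

definition fundamental_field :: "('m, 'e::real_normed_vector) atlas
    \<Rightarrow> ('m \<Rightarrow> 'm, 'h::real_normed_vector) atlas \<Rightarrow> ('m \<Rightarrow> 'm) tvec \<Rightarrow> 'm vfield" where
  "fundamental_field A B \<xi> p = (if p \<in> pts A then pushforward B A (\<lambda>a. a p) \<xi> else 0)"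


section \<open>Compatible almost-complex structures\<close>

definition endo_apply :: "('m, 'e::real_normed_vector) atlas \<Rightarrow> 'm endo \<Rightarrow> 'm vfield \<Rightarrow> 'm vfield" where
  "endo_apply A J X p = (if p \<in> pts A then J p (X p) else 0)"

definition almost_complex :: "('m, 'e::real_normed_vector) atlas \<Rightarrow> 'm endo \<Rightarrow> bool" where
  "almost_complex A J \<longleftrightarrow>
     (\<forall>p \<in> pts A. \<forall>u \<in> tangent_space A p. \<forall>v \<in> tangent_space A p. \<forall>c.
        J p u \<in> tangent_space A p \<and> J p (u + v) = J p u + J p v \<and>
        J p (c *\<^sub>t u) = c *\<^sub>t J p u \<and> J p (J p u) = - u) \<and>
     (\<forall>X \<in> vfields A. endo_apply A J X \<in> vfields A)"

definition riemannian_metric :: "('m, 'e::real_normed_vector) atlas \<Rightarrow> 'm form2 \<Rightarrow> bool" where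
  "riemannian_metric A g \<longleftrightarrow> bilinear_tensor A g \<and>
     (\<forall>p \<in> pts A. \<forall>u \<in> tangent_space A p. \<forall>v \<in> tangent_space A p. g p u v = g p v u) \<and>
     (\<forall>p \<in> pts A. \<forall>u \<in> tangent_space A p. u \<noteq> 0 \<longrightarrow> g p u u > 0)"

definition induced_metric :: "'m form2 \<Rightarrow> 'm endo \<Rightarrow> 'm form2" where
  "induced_metric \<omega> J p u v = \<omega> p u (J p v)"

definition AK :: "('m, 'e::real_normed_vector) atlas \<Rightarrow> 'm form2 \<Rightarrow> 'm endo set" where
  "AK A \<omega> =
     {J. almost_complex A J \<and>
         (\<forall>p \<in> pts A. \<forall>u \<in> tangent_space A p. \<forall>v \<in> tangent_space A p.
            \<omega> p (J p u) (J p v) = \<omega> p u v) \<and>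
         riemannian_metric A (induced_metric \<omega> J)}"

definition AK_inv :: "('m, 'e::real_normed_vector) atlas \<Rightarrow> 'm form2 \<Rightarrow> ('m \<Rightarrow> 'm) set
    \<Rightarrow> 'm endo set" where
  "AK_inv A \<omega> G =
     {J \<in> AK A \<omega>. \<forall>\<phi> \<in> G. \<forall>p \<in> pts A. \<forall>v \<in> tangent_space A p.
        pushforward A A \<phi> (J p v) = J (\<phi> p) (pushforward A A \<phi> v)}"


section \<open>Connections and curvature\<close>

definition connection :: "('m, 'e::real_normed_vector) atlas \<Rightarrow> 'm conn \<Rightarrow> bool" where
  "connection A D \<longleftrightarrow>
     (\<forall>X \<in> vfields A. \<forall>Y \<in> vfields A. \<forall>Z \<in> vfields A. \<forall>h \<in> smooth_functions A.
        D X Y \<in> vfields A \<and>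
        D (X + Y) Z = D X Z + D Y Z \<and> D (h *\<^sub>f X) Y = h *\<^sub>f D X Y \<and>
        D X (Y + Z) = D X Y + D X Z \<and> D X (h *\<^sub>f Y) = (\<lambda>p. X p h) *\<^sub>f Y + h *\<^sub>f D X Y)"

definition metric_connection :: "('m, 'e::real_normed_vector) atlas \<Rightarrow> 'm form2 \<Rightarrow> 'm conn \<Rightarrow> bool" where
  "metric_connection A g D \<longleftrightarrow> connection A D \<and>
     (\<forall>X \<in> vfields A. \<forall>Y \<in> vfields A. \<forall>Z \<in> vfields A. \<forall>p \<in> pts A.
        X p (\<lambda>q. g q (Y q) (Z q)) = g p (D X Y p) (Z p) + g p (Y p) (D X Z p))"

text \<open>The choice is unique on vector fields.\<close>

definition levi_civita :: "('m, 'e::real_normed_vector) atlas \<Rightarrow> 'm form2 \<Rightarrow> 'm conn" where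
  "levi_civita A g =
     (SOME D. metric_connection A g D \<and>
        (\<forall>X \<in> vfields A. \<forall>Y \<in> vfields A. D X Y - D Y X = bracket X Y))"

definition hermitian_connection :: "('m, 'e::real_normed_vector) atlas \<Rightarrow> 'm form2 \<Rightarrow> 'm endo
    \<Rightarrow> 'm conn \<Rightarrow> bool" where
  "hermitian_connection A g J D \<longleftrightarrow> metric_connection A g D \<and>
     (\<forall>X \<in> vfields A. \<forall>Y \<in> vfields A. D X (endo_apply A J Y) = endo_apply A J (D X Y))"

definition canonical_connection :: "('m, 'e::real_normed_vector) atlas \<Rightarrow> 'm form2 \<Rightarrow> 'm endo
    \<Rightarrow> 'm conn" where
  "canonical_connection A g J X Y =
     (let D = levi_civita A g;
          DJ = D X (endo_apply A J Y) - endo_apply A J (D X Y)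
      in D X Y - (\<lambda>p. 1 / 2) *\<^sub>f endo_apply A J DJ)"

definition curvature :: "'m conn \<Rightarrow> 'm vfield \<Rightarrow> 'm vfield \<Rightarrow> 'm vfield \<Rightarrow> 'm vfield" where
  "curvature D X Y Z = D (bracket X Y) Z - (D X (D Y Z) - D Y (D X Z))"

text \<open>Local frames are given by global vector fields: by cutting off, every local frame near \<open>p\<close>
  agrees near \<open>p\<close> with such a family.\<close>

definition adapted_frame :: "('m, 'e::euclidean_space) atlas \<Rightarrow> 'm form2 \<Rightarrow> 'm endo \<Rightarrow> 'm
    \<Rightarrow> (nat \<Rightarrow> 'm vfield) \<Rightarrow> bool" where
  "adapted_frame A g J p e \<longleftrightarrow>
     (\<forall>i < DIM('e). e i \<in> vfields A) \<and>
     (\<exists>W. openin (atlas_topology A) W \<and> p \<in> W \<and>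
        (\<forall>q \<in> W. (\<forall>i < DIM('e). \<forall>j < DIM('e). g q (e i q) (e j q) = (if i = j then 1 else 0)) \<and>
           (\<forall>i. 2 * i + 1 < DIM('e) \<longrightarrow> e (2 * i + 1) q = J q (e (2 * i) q))))"

definition some_frame :: "('m, 'e::euclidean_space) atlas \<Rightarrow> 'm form2 \<Rightarrow> 'm endo \<Rightarrow> 'm
    \<Rightarrow> nat \<Rightarrow> 'm vfield" where
  "some_frame A g J p = (SOME e. adapted_frame A g J p e)"

definition extension :: "('m, 'e::real_normed_vector) atlas \<Rightarrow> 'm \<Rightarrow> 'm tvec \<Rightarrow> 'm vfield" where
  "extension A p v = (SOME X. X \<in> vfields A \<and> X p = v)"

text \<open>For the canonical connection this is the first Chern--Ricci form. For any Hermitian connection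
  it is the trace of \<open>\<i>\<close> times the curvature of the complex vector bundle \<open>(TM, J)\<close>, i.e.
  the Chern--Weil form of \<open>2 \<pi> c\<^sub>1\<close>; note that \<open>curvature\<close> is the negative of the
  operator \<open>[D X, D Y] - D [X, Y]\<close>. The values do not depend on the frame and the extensions.\<close>

definition ricci_form :: "('m, 'e::euclidean_space) atlas \<Rightarrow> 'm form2 \<Rightarrow> 'm endo \<Rightarrow> 'm conn
    \<Rightarrow> 'm form2" where
  "ricci_form A g J D p u v =
     1 / 2 * (\<Sum>i < DIM('e).
        g p (curvature D (extension A p u) (extension A p v) (some_frame A g J p i) p)
            (J p (some_frame A g J p i p)))"

text \<open>The de Rham class of the Chern--Weil forms of \<open>c\<^sub>1\<close>. The complex structure of \<open>TM\<close> is any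
  compatible one and the connection any Hermitian one; the class does not depend on these choices.\<close>

definition first_chern_class :: "('m, 'e::euclidean_space) atlas \<Rightarrow> 'm form2 \<Rightarrow> 'm form2 set" where
  "first_chern_class A \<omega> =
     {\<beta>. \<exists>J \<in> AK A \<omega>. \<exists>D. hermitian_connection A (induced_metric \<omega> J) J D \<and>
        \<beta> \<in> de_rham_class A (\<lambda>p u v. 1 / (2 * pi) * ricci_form A (induced_metric \<omega> J) J D p u v)}"

definition symplectic_fano :: "('m, 'e::euclidean_space) atlas \<Rightarrow> 'm form2 \<Rightarrow> bool" where
  "symplectic_fano A \<omega> \<longleftrightarrow>
     (\<lambda>\<beta> p u v. 2 * pi * \<beta> p u v) ` first_chern_class A \<omega> = de_rham_class A \<omega>"

definition chern_ricci_form :: "('m, 'e::euclidean_space) atlas \<Rightarrow> 'm form2 \<Rightarrow> 'm endo \<Rightarrow> 'm form2" where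
  "chern_ricci_form A \<omega> J =
     (let g = induced_metric \<omega> J in ricci_form A g J (canonical_connection A g J))"

definition chern_scalar :: "('m, 'e::euclidean_space) atlas \<Rightarrow> nat \<Rightarrow> 'm form2 \<Rightarrow> 'm endo
    \<Rightarrow> 'm \<Rightarrow> real" where
  "chern_scalar A n \<omega> J p =
     (THE s. \<forall>v. (\<forall>i < 2 * n. v i \<in> tangent_space A p) \<longrightarrow>
        s * wedge_power (\<omega> p) n v =
        real n * wedge 2 (2 * (n - 1)) (seq2 (chern_ricci_form A \<omega> J p)) (wedge_power (\<omega> p) (n - 1)) v)"


section \<open>Integration and generalized almost-Kaehler--Ricci solitons\<close>

definition partition_of_unity :: "('m, 'e::real_normed_vector) atlas \<Rightarrow> nat
    \<Rightarrow> (nat \<Rightarrow> 'm set \<times> ('m \<Rightarrow> 'e)) \<Rightarrow> (nat \<Rightarrow> 'm \<Rightarrow> real) \<Rightarrow> bool" where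
  "partition_of_unity A k c \<theta> \<longleftrightarrow>
     (\<forall>i < k. c i \<in> A \<and> \<theta> i \<in> smooth_functions A \<and> (\<forall>p \<in> pts A. 0 \<le> \<theta> i p) \<and>
        atlas_topology A closure_of {p \<in> pts A. \<theta> i p \<noteq> 0} \<subseteq> fst (c i)) \<and>
     (\<forall>p \<in> pts A. (\<Sum>i < k. \<theta> i p) = 1)"

definition basis_enum :: "nat \<Rightarrow> 'e::euclidean_space" where
  "basis_enum = (SOME b. bij_betw b {..<DIM('e)} Basis)"

text \<open>The integral of \<open>h \<omega>\<^sup>n\<close> over a compact manifold oriented by \<open>\<omega>\<^sup>n\<close>. The absolute
  value of the coefficient of \<open>\<omega>\<^sup>n\<close> accounts for charts that do not preserve the orientation, and
  makes the enumeration of the basis irrelevant.\<close>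

definition liouville_integral :: "('m, 'e::euclidean_space) atlas \<Rightarrow> nat \<Rightarrow> 'm form2
    \<Rightarrow> ('m \<Rightarrow> real) \<Rightarrow> real" where
  "liouville_integral A n \<omega> h =
     (let (k, c, \<theta>) = (SOME (k, c, \<theta>). partition_of_unity A k c \<theta>)
      in \<Sum>i < k. LINT x : snd (c i) ` fst (c i) | lborel.
           (let p = inv_into (fst (c i)) (snd (c i)) x
            in \<theta> i p * h p * \<bar>wedge_power (\<omega> p) n (\<lambda>j. coord_vec A (c i) p (basis_enum j))\<bar>))"

definition normalized_potential :: "('m, 'e::euclidean_space) atlas \<Rightarrow> nat \<Rightarrow> 'm form2
    \<Rightarrow> 'm vfield \<Rightarrow> ('m \<Rightarrow> real) \<Rightarrow> bool" where
  "normalized_potential A n \<omega> X f \<longleftrightarrow>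
     potential A \<omega> X f \<and> liouville_integral A n \<omega> (\<lambda>p. f p * exp (- 2 * f p)) = 0"

definition codifferential :: "('m, 'e::euclidean_space) atlas \<Rightarrow> 'm form2 \<Rightarrow> 'm endo
    \<Rightarrow> 'm form1 \<Rightarrow> 'm \<Rightarrow> real" where
  "codifferential A g J \<alpha> p =
     - (\<Sum>i < DIM('e). let E = some_frame A g J p i
          in E p (\<lambda>q. \<alpha> q (E q)) - \<alpha> p (levi_civita A g E E p))"

definition laplacian :: "('m, 'e::euclidean_space) atlas \<Rightarrow> 'm form2 \<Rightarrow> 'm endo
    \<Rightarrow> ('m \<Rightarrow> real) \<Rightarrow> 'm \<Rightarrow> real" where
  "laplacian A g J f = codifferential A g J (\<lambda>p v. v f)"

definition norm_df_sq :: "('m, 'e::euclidean_space) atlas \<Rightarrow> 'm form2 \<Rightarrow> 'm endo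
    \<Rightarrow> ('m \<Rightarrow> real) \<Rightarrow> 'm \<Rightarrow> real" where
  "norm_df_sq A g J f p = (\<Sum>i < DIM('e). (some_frame A g J p i p f)\<^sup>2)"

definition modified_chern_scalar :: "('m, 'e::euclidean_space) atlas \<Rightarrow> nat \<Rightarrow> 'm form2
    \<Rightarrow> ('m \<Rightarrow> real) \<Rightarrow> 'm endo \<Rightarrow> 'm \<Rightarrow> real" where
  "modified_chern_scalar A n \<omega> f J p =
     (let g = induced_metric \<omega> J
      in chern_scalar A n \<omega> J p - real n - 2 * laplacian A g J f p + 2 * f p
         - 2 * norm_df_sq A g J f p)"

text \<open>On a compact connected symplectic manifold the normalized potential of a Hamiltonian vector
  field exists and is unique (on the manifold).\<close>

definition GeAKRS :: "('m, 'e::euclidean_space) atlas \<Rightarrow> nat \<Rightarrow> 'm form2 \<Rightarrow> 'm vfield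
    \<Rightarrow> 'm endo \<Rightarrow> bool" where
  "GeAKRS A n \<omega> X J \<longleftrightarrow>
     (\<exists>f. normalized_potential A n \<omega> X f \<and>
        (\<forall>p \<in> pts A. modified_chern_scalar A n \<omega> f J p = 0))"

definition constant_chern_scalar :: "('m, 'e::euclidean_space) atlas \<Rightarrow> nat \<Rightarrow> 'm form2
    \<Rightarrow> 'm endo \<Rightarrow> bool" where
  "constant_chern_scalar A n \<omega> J \<longleftrightarrow> (\<exists>c. \<forall>p \<in> pts A. chern_scalar A n \<omega> J p = c)"

end

theory Submission
 imports Defs "HOL-Real_Asymp.Real_Asymp"
begin

text \<open>
Let \<open>J\<close> induce the soliton and \<open>J0\<close> the metric of constant Chern scalar curvature, with Laplacians \<open>\<Delta>\<close> and \<open>\<Delta>\<^sub>0\<close>,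
and let \<open>f\<close> be the normalised potential of \<open>\<xi>\<close>. The proof is an integration by parts against \<open>k = exp (-2 f)\<close>.

The isomorphism \<open>\<Phi> = (1 - J0 J) / 2\<close> of complex vector bundles from \<open>(TM, J)\<close> to \<open>(TM, J0)\<close> transports a Hermitian
connection of \<open>J0\<close> to a connection commuting with \<open>J\<close>. Its difference \<open>a\<close> from a Hermitian connection of \<open>J\<close>
provides the primitive \<open>\<theta> / 2\<close>, \<open>\<theta>(X) = tr (J a\<^sub>X)\<close>, of the difference of the two Chern-Ricci forms
(\<open>chern_ricci_transgression\<close>). As \<open>J\<close> and \<open>J0\<close> are invariant under the group, \<open>\<xi>\<close> is an infinitesimal
automorphism of both (\<open>fundamental_field_invariance\<close>), and since the construction is natural, \<open>\<theta>(\<xi>)\<close> is a difference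
of moment maps for the Chern-Ricci forms, \<open>\<theta>(\<xi>) = \<Delta>\<^sub>0 f - \<Delta> f\<close> (\<open>moment_laplacian\<close>).

The Chern scalar curvature is the contraction of the Chern-Ricci form with \<open>\<omega>\<close>, an operation that does not
involve \<open>J\<close>. Almost-Kaehler metrics are balanced, so for \<open>\<theta> = \<omega>(W, \<cdot>)\<close> the contraction of \<open>d\<theta>\<close> is the divergence
of \<open>W\<close> (\<open>contraction_exact\<close>). The scalar curvatures of \<open>J0\<close> and \<open>J\<close> hence differ by half the divergence of a
field with \<open>W f = \<Delta>\<^sub>0 f - \<Delta> f\<close>. The same argument, applied to a connection that represents the Fano condition, shows
that the constant scalar curvature of \<open>J0\<close> is \<open>n\<close> (\<open>fano_constant\<close>). In the vanishing integral of the divergence of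
\<open>k W\<close> the scalar curvature of \<open>J\<close> is now known from the soliton equation. The integral of \<open>k \<Delta>f\<close> is \<open>-2\<close> times that of
\<open>k |df|\<^sup>2\<close> for both metrics (\<open>weighted_laplacian\<close>), and the integral of \<open>f k\<close> is 0. All that remains is that the
integral of \<open>k |df|\<^sup>2\<close> in the metric of \<open>J0\<close> vanishes, so \<open>df = 0\<close> and \<open>\<xi> = 0\<close> (\<open>soliton_trivial\<close>).

Tensors are maps on global vector fields. Finitely many fields \<open>E k\<close> and functions \<open>\<beta> k\<close> with
\<open>X = (\<Sum>k. X(\<beta> k) E k)\<close> for every field \<open>X\<close> take the place of a frame, for traces and for integration alike.
\<close>

section \<open>Coordinates on finite-dimensional normed spaces\<close>

text \<open>The model space of a manifold need not carry an inner product: that of a Lie group is only a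
 finite-dimensional normed space. Smoothness, bump functions and Taylor expansions are therefore expressed in
 the coordinates of a chosen basis, whose continuity has to be derived from compactness.\<close>

definition finite_dim :: "'a::real_normed_vector itself => bool" where
 "finite_dim T \<longleftrightarrow> (\<exists>E :: 'a set. finite E \<and> span E = UNIV)"

definition model_basis :: "'a::real_normed_vector set" where
 "model_basis = (SOME B. finite B \<and> independent B \<and> span B = UNIV)"

definition coord :: "'a::real_normed_vector => 'a => real" where
 "coord b x = representation model_basis x b"

lemma coefficient_box_compact:
 fixes B :: "'a::real_normed_vector set"
 shows "finite B ==> compact ((%c. \<Sum>b\<in>B. c b *\<^sub>R b) ` {c. \<forall>b\<in>B. \<bar>c b\<bar> \<le> r})"
proof (induction B rule: finite_induct)
 case (insert a B)
 let ?S = "(%c. \<Sum>b\<in>B. c b *\<^sub>R b) ` {c. \<forall>b\<in>B. \<bar>c b\<bar> \<le> r}"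
 let ?T = "(%t. t *\<^sub>R a) ` {-r..r}"
 have "compact ?T" by (intro compact_continuous_image continuous_intros) auto
 then have "compact {x + y | x y. x \<in> ?T \<and> y \<in> ?S}"
  using insert by (intro compact_sums) auto
 also have "{x + y | x y. x \<in> ?T \<and> y \<in> ?S} =
  (%c. \<Sum>b\<in>insert a B. c b *\<^sub>R b) ` {c. \<forall>b\<in>insert a B. \<bar>c b\<bar> \<le> r}" (is "_ = ?R")
 proof (intro equalityI subsetI)
  fix z assume "z \<in> {x + y | x y. x \<in> ?T \<and> y \<in> ?S}"
  then obtain t c where z: "t \<in> {-r..r}" "\<forall>b\<in>B. \<bar>c b\<bar> \<le> r" "z = t *\<^sub>R a + (\<Sum>b\<in>B. c b *\<^sub>R b)" by auto
  let ?c = "c(a := t)"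
  have "(\<Sum>b\<in>B. ?c b *\<^sub>R b) = (\<Sum>b\<in>B. c b *\<^sub>R b)"
   using insert.hyps by (intro sum.cong) auto
  then have "z = (\<Sum>b\<in>insert a B. ?c b *\<^sub>R b)" using z insert.hyps by simp
  moreover have "\<forall>b\<in>insert a B. \<bar>?c b\<bar> \<le> r" using z by auto
  ultimately show "z \<in> ?R" by blast
 next
  fix z assume "z \<in> ?R"
  then obtain c where c: "\<forall>b\<in>insert a B. \<bar>c b\<bar> \<le> r" "z = (\<Sum>b\<in>insert a B. c b *\<^sub>R b)" by auto
  then have "z = c a *\<^sub>R a + (\<Sum>b\<in>B. c b *\<^sub>R b)" "c a \<in> {-r..r}" "c \<in> {c. \<forall>b\<in>B. \<bar>c b\<bar> \<le> r}"
   using insert.hyps by auto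
  then show "z \<in> {x + y | x y. x \<in> ?T \<and> y \<in> ?S}" by blast
 qed
 finally show ?case .
qed auto

text \<open>Scaling the largest coefficient to 1 puts the vector on the image of a face of the unit cube.
 These images are compact and, by independence, avoid the origin, so they have a positive distance from it.\<close>

lemma independent_coefficients_bounded:
 fixes S :: "'a::real_normed_vector set"
 assumes "finite S" "independent S"
 shows "\<exists>C. \<forall>c. \<forall>b\<in>S. \<bar>c b\<bar> \<le> C * norm (\<Sum>b\<in>S. c b *\<^sub>R b)"
proof -
 have "\<exists>d>0. \<forall>c. (\<forall>b\<in>S. \<bar>c b\<bar> \<le> 1) \<and> c a = 1 --> d \<le> norm (\<Sum>b\<in>S. c b *\<^sub>R b)" if a: "a \<in> S" for a
 proof -
  let ?K = "(+) a ` (%c. \<Sum>b\<in>S - {a}. c b *\<^sub>R b) ` {c. \<forall>b\<in>S - {a}. \<bar>c b\<bar> \<le> 1}"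
  have "compact ?K" by (rule compact_translation, rule coefficient_box_compact) (simp add: assms(1))
  then have cl: "closed ?K" by (rule compact_imp_closed)
  have "0 \<notin> ?K"
  proof
   assume "0 \<in> ?K"
   then obtain c where "0 = a + (\<Sum>b\<in>S - {a}. c b *\<^sub>R b)" by blast
   then have "a = - (\<Sum>b\<in>S - {a}. c b *\<^sub>R b)" by (simp add: eq_neg_iff_add_eq_0)
   moreover have "(\<Sum>b\<in>S - {a}. c b *\<^sub>R b) \<in> span (S - {a})" by (intro span_sum span_scale span_base)
   ultimately have "a \<in> span (S - {a})" by (metis span_neg)
   then show False using assms(2) a by (auto simp: dependent_def)
  qed
  moreover have "(%_. 0) \<in> {c. \<forall>b\<in>S - {a}. \<bar>c b\<bar> \<le> (1 :: real)}" by simp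
  then have "?K \<noteq> {}" unfolding image_is_empty by (rule ex_in_conv[THEN iffD1, OF exI])
  ultimately have d: "infdist 0 ?K > 0" using cl by (intro infdist_pos_not_in_closed)
  have "(\<Sum>b\<in>S. c b *\<^sub>R b) \<in> ?K" if "\<forall>b\<in>S. \<bar>c b\<bar> \<le> 1" "c a = 1" for c
   unfolding sum.remove[OF assms(1) a] using that by auto
  then show ?thesis using d infdist_le[of _ ?K 0] by (intro exI[of _ "infdist 0 ?K"]) (simp add: dist_norm)
 qed
 then obtain d where d: "!!a. a \<in> S ==> d a > 0"
  "!!a c. a \<in> S ==> \<forall>b\<in>S. \<bar>c b\<bar> \<le> 1 ==> c a = 1 ==> d a \<le> norm (\<Sum>b\<in>S. c b *\<^sub>R b)" by metis
 have "\<bar>c b\<bar> \<le> (\<Sum>a\<in>S. 1 / d a) * norm (\<Sum>b\<in>S. c b *\<^sub>R b)" if b: "b \<in> S" for c b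
 proof -
  let ?x = "\<Sum>b\<in>S. c b *\<^sub>R b"
  have "Max ((%b. \<bar>c b\<bar>) ` S) \<in> (%b. \<bar>c b\<bar>) ` S" using assms(1) b by (intro Max_in) auto
  then obtain a where a: "Max ((%b. \<bar>c b\<bar>) ` S) = \<bar>c a\<bar>" "a \<in> S" by (rule imageE)
  have le: "\<bar>c b'\<bar> \<le> \<bar>c a\<bar>" if "b' \<in> S" for b'
   unfolding a(1)[symmetric] using assms(1) that by (intro Max_ge) auto
  have "d a * \<bar>c a\<bar> \<le> norm ?x"
  proof (cases "c a = 0")
   case False
   have "d a \<le> norm (\<Sum>b\<in>S. (c b / c a) *\<^sub>R b)" using a(2) le False by (intro d(2)) auto
   also have "(\<Sum>b\<in>S. (c b / c a) *\<^sub>R b) = (1 / c a) *\<^sub>R ?x" by (simp add: scaleR_sum_right)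
   finally show ?thesis using False by (simp add: field_simps)
  qed simp
  then have "\<bar>c a\<bar> \<le> 1 / d a * norm ?x" using d(1)[OF a(2)] by (simp add: field_simps)
  also have "... \<le> (\<Sum>a\<in>S. 1 / d a) * norm ?x"
   by (intro mult_right_mono member_le_sum a(2)) (use d(1) assms(1) in \<open>auto intro: less_imp_le\<close>)
  finally show ?thesis using le[OF b] by simp
 qed
 then show ?thesis by blast
qed

context
 assumes fin: "finite_dim TYPE('a::real_normed_vector)"
begin

lemma model_basis: "finite (model_basis :: 'a set)" "independent (model_basis :: 'a set)"
 "span (model_basis :: 'a set) = UNIV"
proof -
 obtain E :: "'a set" where E: "finite E" "span E = UNIV"
  using fin by (auto simp: finite_dim_def)
 obtain B where "B \<subseteq> E" "independent B" "E \<subseteq> span B"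
  using maximal_independent_subset by blast
 then have "finite B \<and> independent B \<and> span B = UNIV"
  using E finite_subset span_mono[of E "span B"] span_span by (metis top.extremum_uniqueI)
 then have "finite (model_basis :: 'a set) \<and> independent (model_basis :: 'a set)
   \<and> span (model_basis :: 'a set) = UNIV"
  unfolding model_basis_def by (rule someI)
 then show "finite (model_basis :: 'a set)" "independent (model_basis :: 'a set)"
  "span (model_basis :: 'a set) = UNIV" by auto
qed

lemma coord_expand: "(\<Sum>b\<in>model_basis. coord b x *\<^sub>R b) = (x :: 'a)"
 unfolding coord_def using model_basis by (intro sum_representation_eq) auto

lemma coord_basis: "b \<in> model_basis ==> coord c (b :: 'a) = (if c = b then 1 else 0)"
 unfolding coord_def using model_basis by (auto simp: representation_basis)

lemma bounded_linear_coord: "bounded_linear (coord (b :: 'a))"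
proof (cases "b \<in> model_basis")
 case True
 obtain C where C: "!!c b. b \<in> model_basis ==> \<bar>c b\<bar> \<le> C * norm (\<Sum>b\<in>model_basis. c b *\<^sub>R (b::'a))"
  using independent_coefficients_bounded[OF model_basis(1,2)] by blast
 show ?thesis
 proof (rule bounded_linear_intro)
  show "coord b (x + y) = coord b x + coord b y" for x y
   unfolding coord_def using model_basis by (simp add: representation_add)
  show "coord b (r *\<^sub>R x) = r *\<^sub>R coord b x" for r x
   unfolding coord_def using model_basis by (simp add: representation_scale)
  show "norm (coord b x) \<le> norm x * C" for x
   using C[OF True, of "%b. coord b x"] by (simp add: coord_expand mult.commute)
 qed
next
 case False
 then have "coord b = (%x. 0)"
  unfolding coord_def by (meson ext representation_ne_zero)
 then show ?thesis by simp
qed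

lemma norm_le_coord: "norm x \<le> (\<Sum>b\<in>model_basis. \<bar>coord b x\<bar> * norm (b::'a))"
 by (subst coord_expand[symmetric]) (auto intro!: norm_sum[THEN order_trans] sum_mono)

lemma linear_expand:
 assumes "linear (f :: 'a => 'b::real_vector)"
 shows "f x = (\<Sum>b\<in>model_basis. coord b x *\<^sub>R f b)"
 by (subst coord_expand[of x, symmetric]) (simp add: linear_sum[OF assms] linear_scale[OF assms])

lemma coord_box_compact: "compact {x :: 'a. \<forall>b\<in>model_basis. \<bar>coord b x\<bar> \<le> r}"
proof -
 let ?K = "(%c. \<Sum>b\<in>model_basis. c b *\<^sub>R (b::'a)) ` {c. \<forall>b\<in>model_basis. \<bar>c b\<bar> \<le> r}"
 have "{x :: 'a. \<forall>b\<in>model_basis. \<bar>coord b x\<bar> \<le> r} = {x \<in> ?K. \<forall>b\<in>model_basis. \<bar>coord b x\<bar> \<le> r}"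
  by (auto intro!: image_eqI[where x="%b. coord b x" for x] simp: coord_expand)
 also have "... = ?K \<inter> (\<Inter>b\<in>model_basis. {x. \<bar>coord b x\<bar> \<le> r})" by auto
 also have "compact ..."
 proof (intro compact_Int_closed coefficient_box_compact closed_INT ballI model_basis(1))
  show "closed {x::'a. \<bar>coord b x\<bar> \<le> r}" for b
   by (intro closed_Collect_le continuous_intros)
    (auto intro!: linear_continuous_on bounded_linear_coord)
 qed
 finally show ?thesis .
qed

end

lemma finite_dim_euclidean: "finite_dim TYPE('a::euclidean_space)"
 unfolding finite_dim_def by (intro exI[of _ Basis]) auto

lemma finite_dim_prod:
 assumes "finite_dim TYPE('a::real_normed_vector)" "finite_dim TYPE('b::real_normed_vector)"
 shows "finite_dim TYPE('a \<times> 'b)"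
proof -
 let ?E = "(%b. (b, 0)) ` (model_basis :: 'a set) \<union> (%b. (0, b)) ` (model_basis :: 'b set)"
 have "(x, y) \<in> span ?E" for x :: 'a and y :: 'b
 proof -
  have "(x, y) = (\<Sum>b\<in>model_basis. coord b x *\<^sub>R (b, 0)) + (\<Sum>b\<in>model_basis. coord b y *\<^sub>R (0, b))"
   using coord_expand[OF assms(1), of x] coord_expand[OF assms(2), of y]
   by (auto simp: prod_eq_iff fst_sum snd_sum)
  also have "... \<in> span ?E"
   by (intro span_add span_sum span_scale span_base) auto
  finally show ?thesis .
 qed
 then show ?thesis unfolding finite_dim_def
  using model_basis(1)[OF assms(1)] model_basis(1)[OF assms(2)]
  by (intro exI[of _ ?E]) auto
qed

section \<open>Calculus of smooth functions\<close>

lemma Ck_on_cong: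
 assumes "open S" "!!x. x \<in> S ==> f x = g x"
 shows "Ck_on k f S \<longleftrightarrow> Ck_on k g S"
proof -
 have *: "Ck_on k g S" if "Ck_on k f S" "!!x. x \<in> S ==> f x = g x" for f g :: "'a => 'b"
  using that
 proof (induction k arbitrary: f g)
  case 0
  then show ?case using continuous_on_eq[of S f g] by simp
 next
  case (Suc k)
  have d: "(g has_derivative frechet_derivative f (at x)) (at x)" if "x \<in> S" for x
  proof (rule has_derivative_transform_within_open[OF _ assms(1) that Suc.prems(2)])
   show "(f has_derivative frechet_derivative f (at x)) (at x)"
    using Suc.prems(1) that assms(1)
    by (simp add: frechet_derivative_works[symmetric] differentiable_on_eq_differentiable_at)
  qed
  have "g differentiable_on S"
   by (rule differentiable_at_imp_differentiable_on) (use d in \<open>auto simp: differentiable_def\<close>)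
  moreover have eq: "frechet_derivative f (at x) = frechet_derivative g (at x)" if "x \<in> S" for x
   using frechet_derivative_at[OF d[OF that]] .
  have "Ck_on k (%x. frechet_derivative g (at x) v) S" for v
  proof (rule Suc.IH)
   show "Ck_on k (%x. frechet_derivative f (at x) v) S" using Suc.prems(1) by simp
  qed (simp add: eq)
  ultimately show ?case by simp
 qed
 show ?thesis
  by (rule iffI; erule *) (simp_all add: assms(2))
qed

lemma Ck_on_Suc_iff:
 assumes "open S"
 shows "Ck_on (Suc k) f S \<longleftrightarrow>
  (\<exists>f'. (\<forall>x\<in>S. (f has_derivative f' x) (at x)) \<and> (\<forall>v. Ck_on k (%x. f' x v) S))"
  (is "_ \<longleftrightarrow> ?R")
proof
 assume "Ck_on (Suc k) f S"
 then show ?R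
  using assms by (intro exI[of _ "%x. frechet_derivative f (at x)"])
   (simp add: frechet_derivative_works[symmetric] differentiable_on_eq_differentiable_at)
next
 assume ?R
 then obtain f' where f': "!!x. x \<in> S ==> (f has_derivative f' x) (at x)"
  "!!v. Ck_on k (%x. f' x v) S" by auto
 have "f differentiable_on S"
  by (rule differentiable_at_imp_differentiable_on) (use f'(1) in \<open>auto simp: differentiable_def\<close>)
 moreover have "Ck_on k (%x. frechet_derivative f (at x) v) S" for v
  by (rule iffD1[OF Ck_on_cong[OF assms] f'(2)[of v]])
   (simp add: frechet_derivative_at[OF f'(1), symmetric])
 ultimately show "Ck_on (Suc k) f S" by simp
qed

lemma Ck_on_SucI:
 assumes "open S" "!!x. x \<in> S ==> (f has_derivative f' x) (at x)" "!!v. Ck_on k (%x. f' x v) S"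
 shows "Ck_on (Suc k) f S"
 unfolding Ck_on_Suc_iff[OF assms(1)] using assms(2,3) by (intro exI[of _ f']) blast

lemma Ck_on_SucE:
 assumes "open S" "Ck_on (Suc k) f S"
 obtains f' where "!!x. x \<in> S ==> (f has_derivative f' x) (at x)" "!!v. Ck_on k (%x. f' x v) S"
 using assms(2) unfolding Ck_on_Suc_iff[OF assms(1)] by (elim exE conjE) blast

lemma Ck_on_Suc_imp: "open S ==> Ck_on (Suc k) f S ==> Ck_on k f S"
proof (induction k arbitrary: f)
 case 0
 then show ?case by (simp add: differentiable_imp_continuous_on)
next
 case (Suc k)
 obtain f' where "!!x. x \<in> S ==> (f has_derivative f' x) (at x)" "!!v. Ck_on (Suc k) (%x. f' x v) S"
  using Ck_on_SucE[OF Suc.prems] by metis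
 then show ?case using Suc by (intro Ck_on_SucI) auto
qed

lemma Ck_on_subset: "Ck_on k f S ==> open S ==> open T ==> T \<subseteq> S ==> Ck_on k f T"
proof (induction k arbitrary: f)
 case (Suc k)
 obtain f' where "!!x. x \<in> S ==> (f has_derivative f' x) (at x)" "!!v. Ck_on k (%x. f' x v) S"
  using Ck_on_SucE[OF Suc.prems(2,1)] by metis
 then show ?case using Suc by (intro Ck_on_SucI) auto
qed (auto intro: continuous_on_subset)

lemma Ck_on_const: "open S ==> Ck_on k (%x. c) S"
proof (induction k arbitrary: c)
 case (Suc k)
 then show ?case by (intro Ck_on_SucI[where f'="%x v. 0"]) auto
qed auto

lemma Ck_on_bounded_linear_comp:
 assumes L: "bounded_linear L"
 shows "open S ==> Ck_on k f S ==> Ck_on k (%x. L (f x)) S"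
proof (induction k arbitrary: f)
 case 0
 then show ?case by (auto intro!: bounded_linear.continuous_on[OF L])
next
 case (Suc k)
 obtain f' where "!!x. x \<in> S ==> (f has_derivative f' x) (at x)" "!!v. Ck_on k (%x. f' x v) S"
  using Ck_on_SucE[OF Suc.prems] by metis
 then show ?case using Suc
  by (intro Ck_on_SucI[where f'="%x v. L (f' x v)"] bounded_linear.has_derivative[OF L]) auto
qed

lemma Ck_on_bounded_linear:
 assumes "bounded_linear L" "open S"
 shows "Ck_on k L S"
proof (cases k)
 case 0
 then show ?thesis using assms by (auto intro: linear_continuous_on)
next
 case (Suc j)
 then show ?thesis using assms
  by (auto intro!: Ck_on_SucI[where f'="%x. L"] Ck_on_const bounded_linear_imp_has_derivative
    simp del: Ck_on.simps)
qed

lemma Ck_on_add: "open S ==> Ck_on k f S ==> Ck_on k g S ==> Ck_on k (%x. f x + g x) S"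
proof (induction k arbitrary: f g)
 case (Suc k)
 obtain f' where "!!x. x \<in> S ==> (f has_derivative f' x) (at x)" "!!v. Ck_on k (%x. f' x v) S"
  using Ck_on_SucE[OF Suc.prems(1,2)] by metis
 moreover obtain g' where "!!x. x \<in> S ==> (g has_derivative g' x) (at x)" "!!v. Ck_on k (%x. g' x v) S"
  using Ck_on_SucE[OF Suc.prems(1,3)] by metis
 ultimately show ?case using Suc
  by (intro Ck_on_SucI[where f'="%x v. f' x v + g' x v"] has_derivative_add) auto
qed (auto intro: continuous_on_add)

lemma Ck_on_sum:
 "open S ==> (!!i. i \<in> I ==> Ck_on k (f i) S) ==> Ck_on k (%x. \<Sum>i\<in>I. f i x) S"
 by (induction I rule: infinite_finite_induct) (auto intro: Ck_on_const Ck_on_add)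

lemma Ck_on_bilinear:
 assumes "bounded_bilinear pr"
 shows "open S ==> Ck_on k f S ==> Ck_on k g S ==> Ck_on k (%x. pr (f x) (g x)) S"
proof (induction k arbitrary: f g)
 case (Suc k)
 obtain f' where "!!x. x \<in> S ==> (f has_derivative f' x) (at x)" "!!v. Ck_on k (%x. f' x v) S"
  using Ck_on_SucE[OF Suc.prems(1,2)] by metis
 moreover obtain g' where "!!x. x \<in> S ==> (g has_derivative g' x) (at x)" "!!v. Ck_on k (%x. g' x v) S"
  using Ck_on_SucE[OF Suc.prems(1,3)] by metis
 moreover have "Ck_on k f S" "Ck_on k g S"
  using Suc.prems Ck_on_Suc_imp by blast+
 ultimately show ?case using Suc.prems(1)
  by (intro Ck_on_SucI[where f'="%x v. pr (f x) (g' x v) + pr (f' x v) (g x)"]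
    bounded_bilinear.FDERIV[OF assms] Ck_on_add Suc.IH)
qed (auto intro: bounded_bilinear.continuous_on[OF assms])

lemma Ck_on_compose:
 fixes f :: "'a::real_normed_vector => 'b::real_normed_vector" and g :: "'b => 'c::real_normed_vector"
 assumes fin: "finite_dim TYPE('b)" and S: "open S" and T: "open T" and im: "f ` S \<subseteq> T"
 shows "Ck_on k f S ==> Ck_on k g T ==> Ck_on k (%x. g (f x)) S"
proof (induction k arbitrary: g)
 case 0
 then show ?case using im by (auto intro!: continuous_on_compose2[of T g S f])
next
 case (Suc k)
 obtain f' where f': "!!x. x \<in> S ==> (f has_derivative f' x) (at x)" "!!v. Ck_on k (%x. f' x v) S"
  using Ck_on_SucE[OF S Suc.prems(1)] by metis
 obtain g' where g': "!!x. x \<in> T ==> (g has_derivative g' x) (at x)" "!!v. Ck_on k (%x. g' x v) T"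
  using Ck_on_SucE[OF T Suc.prems(2)] by metis
 show ?case
 proof (rule Ck_on_SucI[OF S, where f'="%x v. \<Sum>b\<in>model_basis. coord b (f' x v) *\<^sub>R g' (f x) b"])
  fix x assume x: "x \<in> S"
  then have fx: "f x \<in> T" using im by auto
  have "(%v. g' (f x) (f' x v)) = (%v. \<Sum>b\<in>model_basis. coord b (f' x v) *\<^sub>R g' (f x) b)"
   by (rule ext, rule linear_expand[OF fin has_derivative_linear[OF g'(1)[OF fx]]])
  then show "((%x. g (f x)) has_derivative (%v. \<Sum>b\<in>model_basis. coord b (f' x v) *\<^sub>R g' (f x) b)) (at x)"
   using has_derivative_compose[OF f'(1)[OF x] g'(1)[OF fx]] by (simp only:)
 next
  fix v
  show "Ck_on k (%x. \<Sum>b\<in>model_basis. coord b (f' x v) *\<^sub>R g' (f x) b) S"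
   using Ck_on_Suc_imp[OF S Suc.prems(1)]
   by (intro Ck_on_sum S Ck_on_bilinear[OF bounded_bilinear_scaleR] Suc.IH g'
     Ck_on_bounded_linear_comp[OF bounded_linear_coord[OF fin]] f')
 qed
qed

lemma Ck_on_local:
 assumes "open S" "!!x. x \<in> S ==> \<exists>T. open T \<and> x \<in> T \<and> T \<subseteq> S \<and> Ck_on k f T"
 shows "Ck_on k f S"
 using assms(2)
proof (induction k arbitrary: f)
 case 0
 then have "continuous (at x) f" if "x \<in> S" for x
  using that by (metis Ck_on.simps(1) continuous_on_eq_continuous_at)
 then show ?case by (simp add: continuous_at_imp_continuous_on)
next
 case (Suc k)
 have *: "f differentiable (at x)" if "x \<in> S" for x
 proof -
  obtain T where "open T" "x \<in> T" "Ck_on (Suc k) f T" using Suc.prems \<open>x \<in> S\<close> by blast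
  then show ?thesis by (simp add: differentiable_on_eq_differentiable_at)
 qed
 have "Ck_on k (%x. frechet_derivative f (at x) v) S" for v
 proof (rule Suc.IH)
  fix x assume "x \<in> S"
  then obtain T where "open T" "x \<in> T" "T \<subseteq> S" "Ck_on (Suc k) f T" using Suc.prems by blast
  then show "\<exists>T. open T \<and> x \<in> T \<and> T \<subseteq> S \<and> Ck_on k (%x. frechet_derivative f (at x) v) T"
   by (intro exI[of _ T]) simp
 qed
 then show ?case using * by (simp add: differentiable_at_imp_differentiable_on)
qed

lemma smooth_on_cong:
 assumes "open S" "!!x. x \<in> S ==> f x = g x"
 shows "smooth_on f S \<longleftrightarrow> smooth_on g S"
proof -
 have "Ck_on k f S \<longleftrightarrow> Ck_on k g S" for k
  by (rule Ck_on_cong[OF assms])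
 then show ?thesis unfolding smooth_on_def by blast
qed

lemma smooth_on_subset: "smooth_on f S ==> open S ==> open T ==> T \<subseteq> S ==> smooth_on f T"
 by (auto simp: smooth_on_def intro: Ck_on_subset)

lemma smooth_on_const: "open S ==> smooth_on (%x. c) S"
 by (simp add: smooth_on_def Ck_on_const)

lemma smooth_on_bounded_linear: "bounded_linear L ==> open S ==> smooth_on L S"
 by (simp add: smooth_on_def Ck_on_bounded_linear)

lemma smooth_on_add: "open S ==> smooth_on f S ==> smooth_on g S ==> smooth_on (%x. f x + g x) S"
 by (simp add: smooth_on_def Ck_on_add)

lemma smooth_on_sum:
 "open S ==> (!!i. i \<in> I ==> smooth_on (f i) S) ==> smooth_on (%x. \<Sum>i\<in>I. f i x) S"
 by (simp add: smooth_on_def Ck_on_sum)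

lemma smooth_on_bilinear:
 "bounded_bilinear pr ==> open S ==> smooth_on f S ==> smooth_on g S ==> smooth_on (%x. pr (f x) (g x)) S"
 by (simp add: smooth_on_def Ck_on_bilinear)

lemmas smooth_on_mult = smooth_on_bilinear[OF bounded_bilinear_mult]

lemma smooth_on_compose:
 fixes f :: "'a::real_normed_vector => 'b::real_normed_vector" and g :: "'b => 'c::real_normed_vector"
 shows "finite_dim TYPE('b) ==> open S ==> open T ==> f ` S \<subseteq> T ==>
  smooth_on f S ==> smooth_on g T ==> smooth_on (%x. g (f x)) S"
 unfolding smooth_on_def using Ck_on_compose[of S T f] by blast

lemma smooth_on_local:
 assumes "open S" "!!x. x \<in> S ==> \<exists>T. open T \<and> x \<in> T \<and> T \<subseteq> S \<and> smooth_on f T"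
 shows "smooth_on f S"
 unfolding smooth_on_def
proof
 fix k
 show "Ck_on k f S"
 proof (rule Ck_on_local[OF assms(1)])
  fix x assume "x \<in> S"
  then obtain T where "open T" "x \<in> T" "T \<subseteq> S" "smooth_on f T" using assms(2) by blast
  then show "\<exists>T. open T \<and> x \<in> T \<and> T \<subseteq> S \<and> Ck_on k f T"
   by (intro exI[of _ T]) (simp add: smooth_on_def)
 qed
qed

lemma smooth_onE:
 assumes "open S" "smooth_on f S"
 obtains f' where "!!x. x \<in> S ==> (f has_derivative f' x) (at x)" "!!v. smooth_on (%x. f' x v) S"
proof
 have "Ck_on (Suc k) f S" for k using assms by (simp add: smooth_on_def del: Ck_on.simps)
 then have *: "f differentiable_on S" "Ck_on k (%x. frechet_derivative f (at x) v) S" for k v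
  by auto
 show "(f has_derivative frechet_derivative f (at x)) (at x)" if "x \<in> S" for x
  using * that assms(1)
  by (simp add: frechet_derivative_works[symmetric] differentiable_on_eq_differentiable_at)
 show "smooth_on (%x. frechet_derivative f (at x) v) S" for v
  using * by (simp add: smooth_on_def)
qed

lemma smooth_on_derivative:
 assumes "open S" "smooth_on f S"
 shows "x \<in> S ==> (f has_derivative frechet_derivative f (at x)) (at x)"
  and "smooth_on (%x. frechet_derivative f (at x) v) S"
proof -
 obtain f' where f': "!!x. x \<in> S ==> (f has_derivative f' x) (at x)" "!!v. smooth_on (%x. f' x v) S"
  using smooth_onE[OF assms] by metis
 show "(f has_derivative frechet_derivative f (at x)) (at x)" if "x \<in> S"
  using f'(1)[OF that] by (simp add: frechet_derivative_at[OF f'(1)[OF that], symmetric])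
 show "smooth_on (%x. frechet_derivative f (at x) v) S"
  by (rule iffD1[OF smooth_on_cong[OF assms(1)] f'(2)[of v]])
   (simp add: frechet_derivative_at[OF f'(1), symmetric])
qed

lemma smooth_on_continuous: "smooth_on f S ==> continuous_on S f"
 unfolding smooth_on_def by (metis Ck_on.simps(1))

text \<open>Smoothness without formulas for the higher derivatives: it suffices that a family of functions is
 closed under directional derivatives.\<close>

lemma smooth_on_of_family:
 assumes "open S" "f \<in> F"
  and "!!f. f \<in> F ==> \<exists>f'. (\<forall>x\<in>S. (f has_derivative f' x) (at x)) \<and> (\<forall>v. \<exists>g\<in>F. \<forall>x\<in>S. f' x v = g x)"
 shows "smooth_on f S"
proof -
 have "Ck_on k f S" if "f \<in> F" for k f using that
 proof (induction k arbitrary: f)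
  case 0
  then obtain f' where "\<forall>x\<in>S. (f has_derivative f' x) (at x)" using assms(3) by blast
  then show ?case
   by (auto intro!: continuous_at_imp_continuous_on has_derivative_continuous)
 next
  case (Suc k)
  obtain f' where f': "!!x. x \<in> S ==> (f has_derivative f' x) (at x)" "!!v. \<exists>g\<in>F. \<forall>x\<in>S. f' x v = g x"
   using assms(3)[OF Suc.prems] by blast
  have "Ck_on k (%x. f' x v) S" for v
  proof -
   obtain g where "g \<in> F" "\<forall>x\<in>S. f' x v = g x" using f'(2) by blast
   then show ?thesis using Suc.IH[of g]
    Ck_on_cong[OF assms(1), of "%x. f' x v" g k] by blast
  qed
  then show ?case using f'(1) assms(1) by (intro Ck_on_SucI) auto
 qed
 then show ?thesis using assms(2) by (simp add: smooth_on_def)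
qed

lemma smooth_on_exp: "smooth_on (%x::real. exp (c * x)) UNIV"
proof (rule smooth_on_of_family[where F="{%x. a * exp (c * x) | a. True}"])
 show "(%x. exp (c * x)) \<in> {%x. a * exp (c * x) |a. True}"
  by (auto intro: exI[of _ 1])
 fix f assume "f \<in> {%x. a * exp (c * x) |a. True}"
 then obtain a where f: "f = (%x. a * exp (c * x))" by auto
 show "\<exists>f'. (\<forall>x\<in>UNIV. (f has_derivative f' x) (at x)) \<and>
   (\<forall>v. \<exists>g\<in>{%x. a * exp (c * x) |a. True}. \<forall>x\<in>UNIV. f' x v = g x)"
  by (rule exI[of _ "%x v. (a * c * v) * exp (c * x)"])
   (auto simp: f algebra_simps intro!: derivative_eq_intros)
qed auto

lemma smooth_on_powr: "smooth_on (%x::real. x powr r) {0<..}"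
proof (rule smooth_on_of_family[where F="{%x. a * x powr r | a r. True}"])
 show "(%x. x powr r) \<in> {%x. a * x powr r |a r. True}"
  by (force intro: exI[of _ 1])
 fix f assume "f \<in> {%x::real. a * x powr r |a r. True}"
 then obtain a r where f: "f = (%x. a * x powr r)" by auto
 have "((%x. a * x powr r) has_derivative (%v. (a * r * v) * x powr (r - 1))) (at x)" if "x > 0" for x
  using that by (auto intro!: derivative_eq_intros simp: powr_diff field_simps)
 then show "\<exists>f'. (\<forall>x\<in>{0<..}. (f has_derivative f' x) (at x)) \<and>
   (\<forall>v. \<exists>g\<in>{%x. a * x powr r |a r. True}. \<forall>x\<in>{0<..}. f' x v = g x)"
  by (intro exI[of _ "%x v. (a * r * v) * x powr (r - 1)"]) (auto simp: f)
qed auto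

text \<open>The derivatives of \<open>exp (- 1 / x)\<close> are combinations of its quotients by powers of \<open>x\<close>. Taking all
 these quotients together makes the induction over the order of differentiability go through at the origin.\<close>

definition flat :: "nat => real => real" where
 "flat k x = (if x > 0 then exp (- 1 / x) / x ^ k else 0)"

lemma flat_has_derivative:
 "(flat k has_real_derivative (flat (k + 2) x - real k * flat (Suc k) x)) (at x)"
proof -
 consider "x > 0" | "x < 0" | "x = 0" by linarith
 then show ?thesis
 proof cases
  case 1
  have "((%x. exp (- 1 / x) / x ^ k) has_real_derivative (flat (k + 2) x - real k * flat (Suc k) x)) (at x)"
   using 1 by (auto intro!: derivative_eq_intros simp: flat_def divide_simps)
    (cases k; simp add: field_simps)
  then show ?thesis
   by (rule has_field_derivative_transform_within_open[of _ _ _ "{0<..}"])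
    (use 1 in \<open>auto simp: flat_def\<close>)
 next
  case 2
  have "((%x. 0) has_real_derivative (flat (k + 2) x - real k * flat (Suc k) x)) (at x)"
   using 2 by (auto simp: flat_def)
  then show ?thesis
   by (rule has_field_derivative_transform_within_open[of _ _ _ "{..<0}"])
    (use 2 in \<open>auto simp: flat_def\<close>)
 next
  case 3
  have "((%h. exp (- 1 / h) / h ^ Suc k) \<longlongrightarrow> 0) (at_right (0::real))"
   by real_asymp
  then have "((%h. (flat k h - flat k 0) / h) \<longlongrightarrow> 0) (at_right 0)"
   by (rule Lim_transform_eventually)
    (auto simp: flat_def eventually_at_right_less intro!: eventually_mono[OF eventually_at_right_less])
  moreover have "((%h. (flat k h - flat k 0) / h) \<longlongrightarrow> 0) (at_left 0)"
   by (rule Lim_transform_eventually[of "%h. 0"])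
    (auto simp: flat_def eventually_at_filter)
  ultimately have "((%h. (flat k h - flat k 0) / h) \<longlongrightarrow> 0) (at 0)"
   by (simp add: filterlim_split_at)
  then show ?thesis using 3 by (auto simp: DERIV_def flat_def)
 qed
qed

lemma smooth_on_flat: "smooth_on (flat k) UNIV"
proof -
 have "Ck_on j (flat k) UNIV" for j
 proof (induction j arbitrary: k)
  case 0
  show ?case using flat_has_derivative
   by (auto intro!: continuous_at_imp_continuous_on DERIV_isCont)
 next
  case (Suc j)
  have "Ck_on j (%x. v *\<^sub>R flat (k + 2) x + (- real k * v) *\<^sub>R flat (Suc k) x) UNIV" for v
   by (intro Ck_on_add Ck_on_bounded_linear_comp[OF bounded_linear_scaleR_right] Suc) auto
  moreover have "(flat k has_derivative (%v. v *\<^sub>R flat (k + 2) x + (- real k * v) *\<^sub>R flat (Suc k) x)) (at x)" for x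
   using flat_has_derivative[of k x] unfolding has_field_derivative_def
   by (rule back_subst[of "%D. (flat k has_derivative D) (at x)"]) (auto simp: algebra_simps)
  ultimately show ?case by (intro Ck_on_SucI) auto
 qed
 then show ?thesis by (simp add: smooth_on_def)
qed

definition smooth_step :: "real => real" where
 "smooth_step x = flat 0 x * (flat 0 x + flat 0 (1 - x)) powr (-1)"

lemma smooth_step:
 shows smooth_on_smooth_step: "smooth_on smooth_step UNIV"
  and smooth_step_0: "x \<le> 0 ==> smooth_step x = 0"
  and smooth_step_1: "x \<ge> 1 ==> smooth_step x = 1"
  and smooth_step_nonneg: "0 \<le> smooth_step x"
proof -
 have pos: "flat 0 x + flat 0 (1 - x) > 0" for x by (auto simp: flat_def add_pos_nonneg)
 have lin: "smooth_on (%x::real. 1 - x) UNIV"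
  using smooth_on_add[of UNIV "%x. 1::real" "%x. - x"]
  by (simp add: smooth_on_const smooth_on_bounded_linear bounded_linear_minus)
 have 1: "smooth_on (%x. flat 0 (1 - x)) UNIV"
  by (rule smooth_on_compose[OF finite_dim_euclidean open_UNIV open_UNIV subset_UNIV lin smooth_on_flat])
 have 2: "smooth_on (%x. flat 0 x + flat 0 (1 - x)) UNIV"
  by (rule smooth_on_add[OF open_UNIV smooth_on_flat 1])
 have 3: "smooth_on (%x. (flat 0 x + flat 0 (1 - x)) powr (-1)) UNIV"
  by (rule smooth_on_compose[OF finite_dim_euclidean open_UNIV open_greaterThan _ 2 smooth_on_powr[of "-1"]])
   (simp add: image_subset_iff pos)
 show "smooth_on smooth_step UNIV"
  unfolding smooth_step_def[abs_def]
  by (rule smooth_on_mult[OF open_UNIV smooth_on_flat 3])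
 show "x \<le> 0 ==> smooth_step x = 0" "x \<ge> 1 ==> smooth_step x = 1" "0 \<le> smooth_step x"
  by (auto simp: smooth_step_def flat_def powr_minus)
qed

text \<open>The step function is composed with a positive definite quadratic form in the coordinates, because the norm
 of the space need not be differentiable.\<close>

lemma smooth_bump_model:
 fixes x0 :: "'a::real_normed_vector"
 assumes fin: "finite_dim TYPE('a)" and "open V" "x0 \<in> V"
 obtains h :: "'a => real" and K N where "smooth_on h UNIV" "compact K" "K \<subseteq> V" "open N" "x0 \<in> N" "N \<subseteq> K"
  "!!x. x \<notin> K ==> h x = 0" "!!x. x \<in> N ==> h x = 1" "!!x. 0 \<le> h x"
proof -
 let ?q = "%x. \<Sum>b\<in>model_basis. (coord b (x - x0))\<^sup>2"
 obtain r where r: "r > 0" "ball x0 r \<subseteq> V" using assms openE by blast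
 define M where "M = (\<Sum>b\<in>model_basis. norm (b::'a)) + 1"
 have M: "M > 0" by (auto simp: M_def intro!: add_nonneg_pos sum_nonneg)
 define e where "e = (r / M)\<^sup>2"
 have e: "e > 0" using r M by (auto simp: e_def)
 have qs: "\<bar>coord b (x - x0)\<bar> < r / M" if "?q x < e" "b \<in> model_basis" for x b
 proof -
  have "(coord b (x - x0))\<^sup>2 \<le> ?q x"
   by (intro member_le_sum) (use that model_basis(1)[OF fin] in auto)
  then have "(coord b (x - x0))\<^sup>2 < (r / M)\<^sup>2" using that by (simp add: e_def)
  then show ?thesis using r M by (intro power2_less_imp_less[of "\<bar>coord b (x - x0)\<bar>"]) auto
 qed
 have V: "x \<in> V" if "?q x < e" for x
 proof -
  have "norm (x - x0) \<le> (\<Sum>b\<in>model_basis. (r / M) * norm (b::'a))"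
   by (rule order_trans[OF norm_le_coord[OF fin]])
    (intro sum_mono mult_right_mono less_imp_le[OF qs[OF that]] norm_ge_zero)
  also have "... = (r / M) * (M - 1)" by (simp add: M_def sum_distrib_left)
  also have "... < r" using r M by (simp add: field_simps)
  finally show ?thesis using r by (auto simp: dist_norm norm_minus_commute)
 qed
 have cq: "continuous_on UNIV ?q"
  by (intro continuous_intros bounded_linear.continuous_on[OF bounded_linear_coord[OF fin]])
 define K where "K = {x. ?q x \<le> 2/3 * e}"
 define N where "N = {x. ?q x < 1/3 * e}"
 have "compact K"
 proof -
  have "closed K" unfolding K_def
   by (intro closed_Collect_le cq continuous_intros)
  have sub: "K \<subseteq> (%y. x0 + y) ` {x. \<forall>b\<in>model_basis. \<bar>coord b x\<bar> \<le> r / M}"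
  proof
   fix x assume "x \<in> K"
   then have "?q x < e" using e by (simp add: K_def)
   then show "x \<in> (%y. x0 + y) ` {x. \<forall>b\<in>model_basis. \<bar>coord b x\<bar> \<le> r / M}"
    using qs[of x] by (intro image_eqI[of _ _ "x - x0"]) (auto intro: less_imp_le)
  qed
  have "compact ((%y. x0 + y) ` {x. \<forall>b\<in>model_basis. \<bar>coord b x\<bar> \<le> r / M})"
   by (intro compact_continuous_image coord_box_compact[OF fin] continuous_intros)
  from compact_Int_closed[OF this \<open>closed K\<close>] show ?thesis
   unfolding Int_absorb1[OF sub] .
 qed
 define h where "h x = smooth_step (2 - 3 / e * ?q x)" for x
 have sc: "smooth_on (%x. coord b (x - x0)) UNIV" for b :: 'a
 proof -
  have "smooth_on (%x. coord b x + - coord b x0) UNIV"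
   by (intro smooth_on_add smooth_on_const smooth_on_bounded_linear bounded_linear_coord[OF fin]) auto
  then show ?thesis
   by (simp add: linear_diff[OF bounded_linear.linear[OF bounded_linear_coord[OF fin]]])
 qed
 have "smooth_on (%x. 2 + (- 3 / e) * ?q x) UNIV"
  by (intro smooth_on_add smooth_on_const smooth_on_mult smooth_on_sum) (auto simp: power2_eq_square intro!: smooth_on_mult sc)
 then have "smooth_on (%x. smooth_step (2 + (- 3 / e) * ?q x)) UNIV"
  by (rule smooth_on_compose[OF finite_dim_euclidean open_UNIV open_UNIV subset_UNIV _ smooth_on_smooth_step])
 then have "smooth_on h UNIV" by (simp add: h_def[abs_def])
 moreover have "K \<subseteq> V" "N \<subseteq> K" "x0 \<in> N" "open N"
  using V e cq by (auto simp: K_def N_def linear_0 bounded_linear.linear[OF bounded_linear_coord[OF fin]]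
    intro!: open_Collect_less continuous_intros)
 moreover have "h x = 0" if "x \<notin> K" for x
  using that e by (auto simp: h_def K_def field_simps intro!: smooth_step_0)
 moreover have "h x = 1" if "x \<in> N" for x
  using that e by (auto simp: h_def N_def field_simps intro!: smooth_step_1)
 ultimately show ?thesis using that[of h K N] \<open>compact K\<close> smooth_step_nonneg
  by (simp add: h_def)
qed

text \<open>The coordinates are moved one at a time, and each increment is compared with the partial derivative at the
 base point by the mean value theorem.\<close>

lemma has_derivative_of_continuous_partials:
 fixes F :: "'a::real_normed_vector => real"
 assumes fin: "finite_dim TYPE('a)" and S: "open S" "x \<in> S"
  and der: "!!y b. y \<in> S ==> b \<in> model_basis ==>
   ((%s. F (y + s *\<^sub>R b)) has_real_derivative P b y) (at 0)"
  and cont: "!!b. b \<in> model_basis ==> continuous_on S (P b)"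
 shows "(F has_derivative (%v. \<Sum>b\<in>model_basis. coord b v * P b x)) (at x)"
proof -
 note bl = bounded_linear_coord[OF fin]
 define R where "R B h = (\<Sum>b\<in>B. coord b h *\<^sub>R b)" for B and h :: 'a
 have R0: "(R B \<longlongrightarrow> 0) (at 0)" for B
 proof -
  have "((%h. \<Sum>b\<in>B. coord b h *\<^sub>R b) \<longlongrightarrow> (\<Sum>b\<in>B. coord b 0 *\<^sub>R b)) (at (0::'a))"
   by (intro tendsto_intros bounded_linear.tendsto[OF bl])
  then show ?thesis by (simp add: R_def[abs_def] linear_0 bounded_linear.linear[OF bl])
 qed
 have *: "\<forall>\<^sub>F h in at 0. \<bar>F (x + R B h) - F x - (\<Sum>b\<in>B. coord b h * P b x)\<bar> \<le> e * (\<Sum>b\<in>B. \<bar>coord b h\<bar>)"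
  if "finite B" "B \<subseteq> model_basis" "e > 0" for B e
  using that
 proof (induction B)
  case empty
  then show ?case by (simp add: R_def)
 next
  case (insert a B)
  have a: "a \<in> model_basis" using insert by auto
  obtain d1 where d1: "d1 > 0" "ball x d1 \<subseteq> S" using S openE by blast
  have "continuous (at x) (P a)" using cont[OF a] S continuous_on_eq_continuous_at by blast
  then obtain d2 where d2: "d2 > 0" "!!y. dist y x < d2 ==> dist (P a y) (P a x) < e"
   using \<open>e > 0\<close> unfolding continuous_at_eps_delta by blast
  define d where "d = min d1 d2"
  have d: "d > 0" using d1 d2 by (auto simp: d_def)
  have close: "\<forall>\<^sub>F h in at 0. norm (R C h) < d / 2" for C
   using tendstoD[OF R0, of "d/2" C] d by simp
  have "\<forall>\<^sub>F h in at 0. norm (R B h) < d / 2 \<and> norm (R (insert a B) h) < d / 2 \<and>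
   \<bar>F (x + R B h) - F x - (\<Sum>b\<in>B. coord b h * P b x)\<bar> \<le> e * (\<Sum>b\<in>B. \<bar>coord b h\<bar>)"
   using close insert by (intro eventually_conj) auto
  then show ?case
  proof (rule eventually_mono, elim conjE)
   fix h
   assume h: "norm (R B h) < d / 2" "norm (R (insert a B) h) < d / 2"
    and IH: "\<bar>F (x + R B h) - F x - (\<Sum>b\<in>B. coord b h * P b x)\<bar> \<le> e * (\<Sum>b\<in>B. \<bar>coord b h\<bar>)"
   let ?c = "coord a h" and ?y = "x + R B h"
   have Ri: "R (insert a B) h = R B h + ?c *\<^sub>R a" using insert.hyps by (simp add: R_def)
   have near: "dist (?y + (t * ?c) *\<^sub>R a) x < d" if t: "0 \<le> t" "t \<le> 1" for t
   proof -
    have "R B h + (t * ?c) *\<^sub>R a = (1 - t) *\<^sub>R R B h + t *\<^sub>R R (insert a B) h"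
     by (simp add: Ri algebra_simps)
    then have "norm (R B h + (t * ?c) *\<^sub>R a) \<le> (1 - t) * norm (R B h) + t * norm (R (insert a B) h)"
     using norm_triangle_ineq[of "(1 - t) *\<^sub>R R B h" "t *\<^sub>R R (insert a B) h"] t by simp
    also have "... \<le> (1 - t) * (d / 2) + t * (d / 2)"
     by (intro add_mono mult_left_mono) (use t h in auto)
    also have "... = d / 2" by (simp add: field_simps)
    finally show ?thesis using d by (simp add: dist_norm add.assoc)
   qed
   define f where "f t = F (?y + (t * ?c) *\<^sub>R a)" for t
   have df: "(f has_real_derivative ?c * P a (?y + (t * ?c) *\<^sub>R a)) (at t)" if t: "0 \<le> t" "t \<le> 1" for t
   proof -
    let ?z = "?y + (t * ?c) *\<^sub>R a"
    have "?z \<in> S" using near[OF t] d1 by (auto simp: d_def dist_commute)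
    note D = der[OF this a]
    have D': "((%s. F (?z + s *\<^sub>R a)) has_real_derivative P a ?z) (at ((t - t) * ?c))"
     using D by simp
    have "((%t'. (t' - t) * ?c) has_real_derivative ?c) (at t)"
     by (auto intro!: derivative_eq_intros)
    from DERIV_chain2[OF D' this]
    have "((%t'. F (?z + ((t' - t) * ?c) *\<^sub>R a)) has_real_derivative P a ?z * ?c) (at t)" .
    moreover have "(%t'. F (?z + ((t' - t) * ?c) *\<^sub>R a)) = f"
     by (auto simp: f_def algebra_simps)
    ultimately show ?thesis by (simp add: mult.commute)
   qed
   obtain t where t: "0 < t" "t < 1" "f 1 - f 0 = (1 - 0) * (?c * P a (?y + (t * ?c) *\<^sub>R a))"
    using MVT2[of 0 1 f "%t. ?c * P a (?y + (t * ?c) *\<^sub>R a)"] df by auto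
   have "dist (P a (?y + (t * ?c) *\<^sub>R a)) (P a x) < e"
    using near[of t] t d2 by (auto simp: d_def)
   then have "\<bar>?c\<bar> * \<bar>P a (?y + (t * ?c) *\<^sub>R a) - P a x\<bar> \<le> \<bar>?c\<bar> * e"
    by (intro mult_left_mono) (auto simp: dist_real_def)
   moreover have "\<bar>f 1 - f 0 - ?c * P a x\<bar> = \<bar>?c\<bar> * \<bar>P a (?y + (t * ?c) *\<^sub>R a) - P a x\<bar>"
    unfolding t(3) abs_mult[symmetric] by (simp add: algebra_simps)
   ultimately have "\<bar>f 1 - f 0 - ?c * P a x\<bar> \<le> e * \<bar>?c\<bar>" by (simp add: mult.commute)
   moreover have "f 1 = F (x + R (insert a B) h)" "f 0 = F ?y" by (simp_all add: f_def Ri add.assoc)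
   ultimately show "\<bar>F (x + R (insert a B) h) - F x - (\<Sum>b\<in>insert a B. coord b h * P b x)\<bar>
     \<le> e * (\<Sum>b\<in>insert a B. \<bar>coord b h\<bar>)"
    using IH insert.hyps by (simp add: algebra_simps)
  qed
 qed
 let ?D = "%v. \<Sum>b\<in>model_basis. coord b v * P b x"
 have bD: "bounded_linear ?D"
  by (intro bounded_linear_sum bounded_linear_compose[OF bounded_linear_mult_left bl])
 have Rm: "R model_basis h = h" for h using coord_expand[OF fin] by (simp add: R_def)
 obtain C where C: "C > 0" "!!h. (\<Sum>b\<in>model_basis. \<bar>coord b (h::'a)\<bar>) \<le> C * norm h"
 proof -
  have "\<exists>K. \<forall>h. norm (coord b h) \<le> norm h * K" for b :: 'a
   using bounded_linear.bounded[OF bl] by blast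
  then obtain K where K: "!!b h. norm (coord b (h::'a)) \<le> norm h * K b" by metis
  let ?C = "\<bar>\<Sum>b\<in>model_basis. K (b::'a)\<bar> + 1"
  have "(\<Sum>b\<in>model_basis. \<bar>coord b h\<bar>) \<le> ?C * norm h" for h :: 'a
  proof -
   have "(\<Sum>b\<in>model_basis. \<bar>coord b h\<bar>) \<le> (\<Sum>b\<in>model_basis. norm h * K b)"
    by (intro sum_mono) (use K in auto)
   also have "... = (\<Sum>b\<in>model_basis. K b) * norm h"
    by (simp add: sum_distrib_left mult.commute)
   also have "... \<le> ?C * norm h" by (intro mult_right_mono) auto
   finally show ?thesis .
  qed
  then show ?thesis by (intro that[of ?C]) auto
 qed
 show ?thesis
  unfolding has_derivative_at
 proof (intro conjI bD)
  show "((%h. norm (F (x + h) - F x - ?D h) / norm h) \<longlongrightarrow> 0) (at 0)"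
  proof (rule tendstoI)
   fix e :: real assume e: "e > 0"
   then have "\<forall>\<^sub>F h in at 0. \<bar>F (x + h) - F x - ?D h\<bar> \<le> (e / (2 * C)) * (\<Sum>b\<in>model_basis. \<bar>coord b h\<bar>)"
    using *[of model_basis "e / (2 * C)"] model_basis(1)[OF fin] C(1) by (simp add: Rm)
   moreover have "\<forall>\<^sub>F h in at (0::'a). h \<noteq> 0"
    by (simp add: eventually_at_filter)
   ultimately show "\<forall>\<^sub>F h in at 0. dist (norm (F (x + h) - F x - ?D h) / norm h) 0 < e"
   proof eventually_elim
    case (elim h)
    have "\<bar>F (x + h) - F x - ?D h\<bar> \<le> (e / (2 * C)) * (C * norm h)"
     by (rule order_trans[OF elim(1)]) (intro mult_left_mono C, use e C in auto)
    also have "... = e / 2 * norm h" using C by simp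
    also have "... < e * norm h" using e elim(2) by simp
    finally show ?case using elim(2) by (simp add: field_simps)
   qed
  qed
 qed
qed

text \<open>Differentiating under the integral along the ray from \<open>x0\<close> produces an integral of the same shape with
 the exponent \<open>j\<close> increased by one; the general exponent is what makes the induction possible.\<close>

lemma smooth_on_ray_integral:
 fixes k :: "'a::real_normed_vector => real"
 assumes fin: "finite_dim TYPE('a)" and k: "smooth_on k (ball x0 r)"
 shows "smooth_on (%x. integral {0..1} (%t. t ^ j * k (x0 + t *\<^sub>R (x - x0)))) (ball x0 r)"
proof -
 let ?B = "ball x0 r"
 let ?I = "%j k x. integral {0..1} (%t::real. t ^ j * k (x0 + t *\<^sub>R (x - x0)))"
 have inB: "x0 + t *\<^sub>R (x - x0) \<in> ?B" if "x \<in> ?B" "0 \<le> t" "t \<le> 1" for x t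
 proof -
  have "t * norm (x - x0) \<le> norm (x - x0)" using that by (simp add: mult_left_le_one_le)
  then show ?thesis using that by (simp add: dist_norm norm_minus_commute)
 qed
 have cI: "continuous_on (?B \<times> {0..1}) (%(x, t). t ^ j * k (x0 + t *\<^sub>R (x - x0)))"
  if "continuous_on ?B k" for j and k :: "'a => real"
  unfolding split_beta
  by (intro continuous_intros continuous_on_compose2[OF that]) (use inB in auto)
 have cont: "continuous_on ?B (?I j k)" if "continuous_on ?B k" for j and k :: "'a => real"
  using integral_continuous_on_param[of ?B 0 1 "%x t. t ^ j * k (x0 + t *\<^sub>R (x - x0))"] cI[OF that] by simp
 have der: "(?I j k has_derivative (%v. \<Sum>b\<in>model_basis. coord b v * ?I (Suc j) (%y. frechet_derivative k (at y) b) x)) (at x)"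
  if k: "smooth_on k ?B" and x: "x \<in> ?B" for j k x
 proof (rule has_derivative_of_continuous_partials[OF fin open_ball x])
  note dk = smooth_on_derivative[OF open_ball k]
  show "continuous_on ?B (?I (Suc j) (%y. frechet_derivative k (at y) b))" for b
   by (intro cont smooth_on_continuous dk)
  fix y b assume y: "y \<in> ?B" and b: "b \<in> (model_basis :: 'a set)"
  have "open ((%s. y + s *\<^sub>R b) -` ?B)"
   by (rule open_vimage) (auto intro!: continuous_intros)
  moreover have "0 \<in> (%s. y + s *\<^sub>R b) -` ?B" using y by simp
  ultimately obtain d where d: "d > 0" "ball 0 d \<subseteq> (%s. y + s *\<^sub>R b) -` ?B" by (meson openE)
  let ?f = "%s t. t ^ j * k (x0 + t *\<^sub>R (y + s *\<^sub>R b - x0))"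
  let ?f' = "%s t. t ^ Suc j * frechet_derivative k (at (x0 + t *\<^sub>R (y + s *\<^sub>R b - x0))) b"
  have yB: "y + s *\<^sub>R b \<in> ?B" if "s \<in> ball 0 d" for s using d that by blast
  have "((%s. integral (cbox 0 1) (?f s)) has_field_derivative integral (cbox 0 1) (?f' 0)) (at 0 within ball 0 d)"
  proof (rule leibniz_rule_field_derivative)
   fix s t :: real assume st: "s \<in> ball 0 d" "t \<in> cbox 0 1"
   let ?z = "x0 + t *\<^sub>R (y + s *\<^sub>R b - x0)"
   have z: "?z \<in> ?B" using inB[OF yB[OF st(1)]] st(2) by simp
   have "((%s. x0 + t *\<^sub>R (y + s *\<^sub>R b - x0)) has_derivative (%h. (t * h) *\<^sub>R b)) (at s)"
    by (auto intro!: derivative_eq_intros simp: algebra_simps)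
   from has_derivative_compose[OF this dk(1)[OF z]]
   have "((%s. k (x0 + t *\<^sub>R (y + s *\<^sub>R b - x0))) has_derivative
     (%h. frechet_derivative k (at ?z) ((t * h) *\<^sub>R b))) (at s)" .
   then have "((%s. k (x0 + t *\<^sub>R (y + s *\<^sub>R b - x0))) has_derivative
     (%h. (t * frechet_derivative k (at ?z) b) * h)) (at s)"
    by (simp add: linear_scale[OF has_derivative_linear[OF dk(1)[OF z]]] mult_ac)
   then have "((%s. k (x0 + t *\<^sub>R (y + s *\<^sub>R b - x0))) has_field_derivative
     (t * frechet_derivative k (at ?z) b)) (at s)"
    by (simp add: has_field_derivative_def)
   from DERIV_cmult[OF this, of "t ^ j"]
   have "((%s. ?f s t) has_field_derivative ?f' s t) (at s)"
    by (simp add: mult_ac)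
   then show "((%s. ?f s t) has_field_derivative ?f' s t) (at s within ball 0 d)"
    by (rule has_field_derivative_at_within)
  next
   fix s :: real assume s: "s \<in> ball 0 d"
   show "?f s integrable_on cbox 0 1"
    by (rule integrable_continuous)
     (intro continuous_intros continuous_on_compose2[OF smooth_on_continuous[OF k]], use inB[OF yB[OF s]] in auto)
  next
   show "continuous_on (ball 0 d \<times> cbox 0 1) (%(s, t). ?f' s t)"
    unfolding split_beta
    by (intro continuous_intros continuous_on_compose2[OF smooth_on_continuous[OF dk(2)]])
     (use inB[OF yB] in auto)
  qed (use d in auto)
  then show "((%s. ?I j k (y + s *\<^sub>R b)) has_real_derivative ?I (Suc j) (%y. frechet_derivative k (at y) b) y) (at 0)"
   using d(1) by (simp add: at_within_ball)
 qed
 have "Ck_on m (?I j k) ?B" if "smooth_on k ?B" for m j k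
  using that
 proof (induction m arbitrary: j k)
  case 0
  then show ?case using cont[OF smooth_on_continuous] by simp
 next
  case (Suc m)
  show ?case
  proof (rule Ck_on_SucI[OF open_ball der[OF Suc.prems]])
   fix v
   show "Ck_on m (%x. \<Sum>b\<in>model_basis. coord b v * ?I (Suc j) (%y. frechet_derivative k (at y) b) x) ?B"
    by (intro Ck_on_sum open_ball Ck_on_bounded_linear_comp[OF bounded_linear_mult_right] Suc.IH
      smooth_on_derivative Suc.prems)
  qed
 qed
 then show ?thesis using k unfolding smooth_on_def by blast
qed

text \<open>The fundamental theorem of calculus on the segment from \<open>x0\<close> to \<open>x\<close>.\<close>

lemma hadamard_lemma:
 fixes f :: "'a::real_normed_vector => real"
 assumes fin: "finite_dim TYPE('a)" and f: "smooth_on f (ball x0 r)"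
 obtains H where "!!b. smooth_on (H b) (ball x0 r)"
  "!!x. x \<in> ball x0 r ==> f x = f x0 + (\<Sum>b\<in>model_basis. coord b (x - x0) * H b x)"
  "!!b. H b x0 = frechet_derivative f (at x0) b"
proof
 let ?H = "%b x. integral {0..1} (%t::real. t ^ 0 * frechet_derivative f (at (x0 + t *\<^sub>R (x - x0))) b)"
 note df = smooth_on_derivative[OF open_ball f]
 show "smooth_on (?H b) (ball x0 r)" for b
  by (intro smooth_on_ray_integral fin df)
 show "?H b x0 = frechet_derivative f (at x0) b" for b by simp
 fix x assume x: "x \<in> ball x0 r"
 have inB: "x0 + t *\<^sub>R (x - x0) \<in> ball x0 r" if "0 \<le> t" "t \<le> 1" for t
 proof -
  have "t * norm (x - x0) \<le> norm (x - x0)" using that by (simp add: mult_left_le_one_le)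
  then show ?thesis using that x by (simp add: dist_norm norm_minus_commute)
 qed
 have d: "((%t. f (x0 + t *\<^sub>R (x - x0))) has_real_derivative
   (\<Sum>b\<in>model_basis. coord b (x - x0) * frechet_derivative f (at (x0 + t *\<^sub>R (x - x0))) b)) (at t within {0..1})"
  if "0 \<le> t" "t \<le> 1" for t
 proof -
  let ?z = "x0 + t *\<^sub>R (x - x0)"
  have "((%t. x0 + t *\<^sub>R (x - x0)) has_derivative (%h. h *\<^sub>R (x - x0))) (at t)"
   by (auto intro!: derivative_eq_intros)
  from has_derivative_compose[OF this df(1)[OF inB[OF that]]]
  have "((%t. f (x0 + t *\<^sub>R (x - x0))) has_derivative (%h. frechet_derivative f (at ?z) (h *\<^sub>R (x - x0)))) (at t)" .
  moreover have "frechet_derivative f (at ?z) (h *\<^sub>R (x - x0)) =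
   (\<Sum>b\<in>model_basis. coord b (x - x0) * frechet_derivative f (at ?z) b) * h" for h
   using linear_scale[OF has_derivative_linear[OF df(1)[OF inB[OF that]]], of h "x - x0"]
    linear_expand[OF fin has_derivative_linear[OF df(1)[OF inB[OF that]]], of "x - x0"]
   by (simp add: mult.commute)
  ultimately have "((%t. f (x0 + t *\<^sub>R (x - x0))) has_derivative
    (%h. (\<Sum>b\<in>model_basis. coord b (x - x0) * frechet_derivative f (at ?z) b) * h)) (at t)"
   by (simp only:)
  then show ?thesis
   unfolding has_field_derivative_def by (rule has_derivative_at_withinI)
 qed
 have ci: "(%t. frechet_derivative f (at (x0 + t *\<^sub>R (x - x0))) b) integrable_on {0..1}" for b
  by (rule integrable_continuous_real)
   (intro continuous_intros continuous_on_compose2[OF smooth_on_continuous[OF df(2)]], use inB in auto)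
 have "((%t. \<Sum>b\<in>model_basis. coord b (x - x0) * frechet_derivative f (at (x0 + t *\<^sub>R (x - x0))) b)
   has_integral f (x0 + 1 *\<^sub>R (x - x0)) - f (x0 + 0 *\<^sub>R (x - x0))) {0..1}"
  by (rule fundamental_theorem_of_calculus) (use d in \<open>auto simp: has_real_derivative_iff_has_vector_derivative\<close>)
 then have "f x - f x0 = integral {0..1} (%t. \<Sum>b\<in>model_basis. coord b (x - x0) * frechet_derivative f (at (x0 + t *\<^sub>R (x - x0))) b)"
  by (simp add: integral_unique)
 also have "... = (\<Sum>b\<in>model_basis. coord b (x - x0) * ?H b x)"
  using model_basis(1)[OF fin] ci integrable_cmul[OF ci, of "coord b (x - x0)" b for b]
  by (subst integral_sum) auto
 finally show "f x = f x0 + (\<Sum>b\<in>model_basis. coord b (x - x0) * ?H b x)" by simp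
qed

text \<open>Hadamard's lemma, applied twice, writes \<open>f\<close> as a quadratic polynomial in the coordinates with smooth
 coefficients. Its second derivative at the centre is the symmetric form \<open>Q\<close>.\<close>

lemma symmetric_second_derivative:
 fixes f :: "'a::real_normed_vector => real"
 assumes fin: "finite_dim TYPE('a)" and S: "open S" "x0 \<in> S" and f: "smooth_on f S"
 shows "frechet_derivative (%x. frechet_derivative f (at x) v) (at x0) u =
    frechet_derivative (%x. frechet_derivative f (at x) u) (at x0) v"
proof -
 obtain r where r: "r > 0" "ball x0 r \<subseteq> S" using S openE by blast
 let ?B = "ball x0 r"
 have fB: "smooth_on f ?B" by (rule smooth_on_subset[OF f S(1) open_ball r(2)])
 obtain H where H: "!!b. smooth_on (H b) ?B"
  "!!x. x \<in> ?B ==> f x = f x0 + (\<Sum>b\<in>model_basis. coord b (x - x0) * H b x)"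
  using hadamard_lemma[OF fin fB] by metis
 have "\<forall>b. \<exists>G. (\<forall>c. smooth_on (G c) ?B) \<and>
   (\<forall>x\<in>?B. H b x = H b x0 + (\<Sum>c\<in>model_basis. coord c (x - x0) * G c x))"
  using hadamard_lemma[OF fin H(1)] by metis
 then obtain G where G: "!!b c. smooth_on (G b c) ?B"
  "!!b x. x \<in> ?B ==> H b x = H b x0 + (\<Sum>c\<in>model_basis. coord c (x - x0) * G b c x)"
  by metis
 note dG = smooth_on_derivative[OF open_ball G(1)]
 note cl = bounded_linear.linear[OF bounded_linear_coord[OF fin]]
 let ?y = "%b x. coord b (x - x0)"
 have dy: "(?y b has_derivative coord b) (at x)" for b x
 proof -
  have "((%x. x - x0) has_derivative (%h. h)) (at x)" by (auto intro!: derivative_eq_intros)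
  from bounded_linear.has_derivative[OF bounded_linear_coord[OF fin] this] show ?thesis .
 qed
 have fx: "f x = f x0 + ((\<Sum>b\<in>model_basis. ?y b x * H b x0) +
   (\<Sum>b\<in>model_basis. \<Sum>c\<in>model_basis. (?y b x * ?y c x) * G b c x))" if "x \<in> ?B" for x
  unfolding H(2)[OF that] by (subst G(2)[OF that])
   (simp add: distrib_left sum.distrib sum_distrib_left mult.assoc)
 define Q where "Q u v = (\<Sum>b\<in>model_basis. \<Sum>c\<in>model_basis. (coord b v * coord c u + coord b u * coord c v) * G b c x0)" for u v
 have key: "frechet_derivative (%x. frechet_derivative f (at x) v) (at x0) u = Q u v" for u v
 proof -
  let ?D = "%x v. (\<Sum>b\<in>model_basis. coord b v * H b x0) +
   (\<Sum>b\<in>model_basis. \<Sum>c\<in>model_basis. (coord b v * ?y c x + ?y b x * coord c v) * G b c x +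
    (?y b x * ?y c x) * frechet_derivative (G b c) (at x) v)"
  have "(f has_derivative ?D x) (at x)" if x: "x \<in> ?B" for x
  proof (rule has_derivative_transform_within_open[OF _ open_ball x fx[symmetric]])
   show "((%x. f x0 + ((\<Sum>b\<in>model_basis. ?y b x * H b x0) +
    (\<Sum>b\<in>model_basis. \<Sum>c\<in>model_basis. (?y b x * ?y c x) * G b c x))) has_derivative ?D x) (at x)"
    by (rule derivative_eq_intros dy dG(1)[OF x] refl)+ (auto simp: algebra_simps)
  qed
  from frechet_derivative_at[OF this]
  have fD: "frechet_derivative f (at x) v = ?D x v" if "x \<in> ?B" for x
   by (rule fun_cong[OF sym]) (rule that)
  have x0: "x0 \<in> ?B" using r by simp
  note ddG = smooth_on_derivative(1)[OF open_ball dG(2) x0]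
  have D2: "((%x. ?D x v) has_derivative (%u. Q u v)) (at x0)"
   unfolding Q_def
   by (rule derivative_eq_intros dy dG(1)[OF x0] ddG refl)+
    (simp add: linear_0[OF cl])
  have "((%x. frechet_derivative f (at x) v) has_derivative (%u. Q u v)) (at x0)"
   by (rule has_derivative_transform_within_open[OF D2 open_ball x0]) (simp add: fD)
  from fun_cong[OF frechet_derivative_at[OF this], of u] show ?thesis by (rule sym)
 qed
 show ?thesis unfolding key by (simp add: Q_def add.commute mult.commute)
qed

section \<open>Smooth functions on a manifold\<close>

locale manifold =
 fixes A :: "('m, 'e::real_normed_vector) atlas"
 assumes smooth_manifold: "smooth_manifold A"
begin

abbreviation "M \<equiv> pts A"
abbreviation "T \<equiv> atlas_topology A"
abbreviation "C \<equiv> smooth_functions A"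
abbreviation "TM \<equiv> tangent_space A"
abbreviation "ic \<equiv> %c. inv_into (fst c) (snd c)"

lemma fin: "finite_dim TYPE('e)"
 and atlas: "smooth_atlas A"
 and Hausdorff: "Hausdorff_space T"
 using smooth_manifold by (auto simp: smooth_manifold_def finite_dim_def)

lemma chart_inj: "c \<in> A ==> inj_on (snd c) (fst c)"
 using atlas by (auto simp: smooth_atlas_def)

lemma transition:
 assumes "c \<in> A" "d \<in> A"
 shows "open (snd c ` (fst c \<inter> fst d))"
  and "smooth_on (snd d \<circ> ic c) (snd c ` (fst c \<inter> fst d))"
 using assms atlas unfolding smooth_atlas_def by (cases c; cases d; force)+

lemma chart_open: "c \<in> A ==> open (snd c ` fst c)"
 using transition(1)[of c c] by simp

lemma chart_subset: "c \<in> A ==> fst c \<subseteq> M"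
 by (auto simp: pts_def)

lemma chart_at:
 assumes "p \<in> M" obtains c where "c \<in> A" "p \<in> fst c"
 using assms by (auto simp: pts_def)

lemma ic_chart [simp]: "c \<in> A ==> p \<in> fst c ==> ic c (snd c p) = p"
 by (simp add: chart_inj)

lemma chart_ic: "x \<in> snd c ` fst c ==> snd c (ic c x) = x"
 by (rule f_inv_into_f)

lemma ic_in: "x \<in> snd c ` fst c ==> ic c x \<in> fst c"
 by (rule inv_into_into)

lemma openin_iff: "openin T W \<longleftrightarrow> W \<subseteq> M \<and> (\<forall>c\<in>A. open (snd c ` (W \<inter> fst c)))"
 unfolding openin_atlas_topology[OF atlas] by auto

lemma topspace_eq: "topspace T = M"
proof -
 have "openin T M"
  unfolding openin_iff
 proof (intro conjI ballI)
  fix c assume "c \<in> A"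
  then have "M \<inter> fst c = fst c" using chart_subset by blast
  then show "open (snd c ` (M \<inter> fst c))" using chart_open[OF \<open>c \<in> A\<close>] by simp
 qed auto
 moreover have "openin T W ==> W \<subseteq> M" for W by (simp add: openin_iff)
 ultimately show ?thesis by (simp add: openin_subset openin_topspace subset_antisym)
qed

lemma openin_chart: "c \<in> A ==> openin T (fst c)"
 unfolding openin_iff
 by (intro conjI ballI chart_subset) (simp_all add: Int_commute[of "fst c"] transition(1))

lemma chart_image_open: "openin T W ==> c \<in> A ==> open (snd c ` (W \<inter> fst c))"
 by (simp add: openin_iff)

lemma openin_chart_vimage:
 assumes c: "c \<in> A" and V: "open V"
 shows "openin T {p \<in> fst c. snd c p \<in> V}"
 unfolding openin_iff
proof (intro conjI ballI)
 show "{p \<in> fst c. snd c p \<in> V} \<subseteq> M" using chart_subset[OF c] by auto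
 fix d assume d: "d \<in> A"
 let ?S = "snd d ` (fst d \<inter> fst c)"
 have "open (?S \<inter> (snd c \<circ> ic d) -` V)"
  by (rule continuous_open_preimage[OF smooth_on_continuous[OF transition(2)[OF d c]] transition(1)[OF d c] V])
 moreover have "snd d ` ({p \<in> fst c. snd c p \<in> V} \<inter> fst d) = ?S \<inter> (snd c \<circ> ic d) -` V"
  using d by (auto simp: image_iff)
 ultimately show "open (snd d ` ({p \<in> fst c. snd c p \<in> V} \<inter> fst d))" by simp
qed

text \<open>The Hausdorff property enters here: compact subsets of a chart are closed in the whole manifold, so that
 functions supported in them can be extended by zero.\<close>

lemma closedin_ic_compact:
 assumes c: "c \<in> A" and K: "compact K" "K \<subseteq> snd c ` fst c"
 shows "closedin T (ic c ` K)" and "compactin T (ic c ` K)"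
proof -
 have "continuous_map (top_of_set (snd c ` fst c)) T (ic c)"
  unfolding continuous_map_def
 proof (intro conjI allI impI funcsetI)
  fix x assume "x \<in> topspace (top_of_set (snd c ` fst c))"
  then show "ic c x \<in> topspace T"
   using ic_in[of x c] chart_subset[OF c] by (auto simp: topspace_eq)
 next
  fix W assume W: "openin T W"
  have "{x \<in> snd c ` fst c. ic c x \<in> W} = snd c ` (W \<inter> fst c)"
   using c by auto
  then show "openin (top_of_set (snd c ` fst c)) {x \<in> topspace (top_of_set (snd c ` fst c)). ic c x \<in> W}"
   using chart_image_open[OF W c] chart_open[OF c] by (auto simp: openin_open_eq)
 qed
 moreover have "compactin (top_of_set (snd c ` fst c)) K"
  using K by (simp add: compactin_subtopology)
 ultimately show 1: "compactin T (ic c ` K)" by (rule image_compactin[rotated])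
 show "closedin T (ic c ` K)"
  by (rule compactin_imp_closedin[OF Hausdorff 1])
qed

lemma smooth_iff: "f \<in> C \<longleftrightarrow> (\<forall>c\<in>A. smooth_on (%x. f (ic c x)) (snd c ` fst c))"
 unfolding smooth_functions_def smooth_map_def line_atlas_def pts_def
 using chart_open by (auto simp: o_def split_beta)

lemma smooth_in_chart: "f \<in> C ==> c \<in> A ==> smooth_on (%x. f (ic c x)) (snd c ` fst c)"
 by (simp add: smooth_iff)

lemma smooth_local:
 assumes "!!p. p \<in> M ==> \<exists>W h. openin T W \<and> p \<in> W \<and> h \<in> C \<and> (\<forall>q\<in>W. f q = h q)"
 shows "f \<in> C"
 unfolding smooth_iff
proof
 fix c assume c: "c \<in> A"
 show "smooth_on (%x. f (ic c x)) (snd c ` fst c)"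
 proof (rule smooth_on_local[OF chart_open[OF c]])
  fix x assume "x \<in> snd c ` fst c"
  then obtain p where p: "p \<in> fst c" "x = snd c p" by auto
  then have "p \<in> M" using chart_subset[OF c] by auto
  then obtain W h where W: "openin T W" "p \<in> W" "h \<in> C" "\<forall>q\<in>W. f q = h q" using assms by blast
  let ?V = "snd c ` (W \<inter> fst c)"
  have V: "open ?V" "?V \<subseteq> snd c ` fst c" "x \<in> ?V"
   using chart_image_open[OF W(1) c] p W(2) by auto
  have "smooth_on (%x. h (ic c x)) ?V"
   by (rule smooth_on_subset[OF smooth_in_chart[OF W(3) c] chart_open[OF c] V(1,2)])
  moreover have "f (ic c y) = h (ic c y)" if "y \<in> ?V" for y
   using that W(4) c by auto
  ultimately have "smooth_on (%x. f (ic c x)) ?V"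
   using smooth_on_cong[OF V(1), of "%x. f (ic c x)" "%x. h (ic c x)"] by blast
  then show "\<exists>V. open V \<and> x \<in> V \<and> V \<subseteq> snd c ` fst c \<and> smooth_on (%x. f (ic c x)) V"
   using V by blast
 qed
qed

lemma smooth_cong:
 assumes "f \<in> C" "!!p. p \<in> M ==> f p = g p"
 shows "g \<in> C"
proof (rule smooth_local)
 fix p assume "p \<in> M"
 then show "\<exists>W h. openin T W \<and> p \<in> W \<and> h \<in> C \<and> (\<forall>q\<in>W. g q = h q)"
  using assms topspace_eq openin_topspace[of T] by (intro exI[of _ M] exI[of _ f]) auto
qed

lemma smooth_const [simp, intro]: "(%x. c) \<in> C"
 unfolding smooth_iff by (auto intro: smooth_on_const chart_open)

lemma smooth_add: "f \<in> C ==> g \<in> C ==> (%x. f x + g x) \<in> C"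
 unfolding smooth_iff by (auto intro: smooth_on_add chart_open)

lemma smooth_mult: "f \<in> C ==> g \<in> C ==> (%x. f x * g x) \<in> C"
 unfolding smooth_iff by (auto intro: smooth_on_mult chart_open)

lemma smooth_cmult: "f \<in> C ==> (%x. c * f x) \<in> C"
 by (intro smooth_mult smooth_const)

lemma smooth_minus: "f \<in> C ==> (%x. - f x) \<in> C"
 using smooth_cmult[of f "-1"] by simp

lemma smooth_diff: "f \<in> C ==> g \<in> C ==> (%x. f x - g x) \<in> C"
 using smooth_add[OF _ smooth_minus, of f g] by simp

lemma smooth_sum: "(!!i. i \<in> I ==> f i \<in> C) ==> (%x. \<Sum>i\<in>I. f i x) \<in> C"
 by (induction I rule: infinite_finite_induct) (auto intro: smooth_add)

lemma smooth_power: "f \<in> C ==> (%x. f x ^ k) \<in> C"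
 by (induction k) (auto intro: smooth_mult)

lemma smooth_divide: "f \<in> C ==> (%x. f x / c) \<in> C"
 using smooth_cmult[of f "1 / c"] by simp

lemmas smooth_intros = smooth_const smooth_add smooth_mult smooth_minus smooth_diff smooth_sum
 smooth_power smooth_divide

lemma smooth_compose:
 assumes "f \<in> C" "open S" "smooth_on g S" "!!p. p \<in> M ==> f p \<in> S"
 shows "(%x. g (f x)) \<in> C"
 unfolding smooth_iff
proof
 fix c assume c: "c \<in> A"
 have "(%x. f (ic c x)) ` (snd c ` fst c) \<subseteq> S"
  using c chart_subset[OF c] assms(4) by auto
 then show "smooth_on (%x. g (f (ic c x))) (snd c ` fst c)"
  by (rule smooth_on_compose[OF finite_dim_euclidean chart_open[OF c] assms(2) _ smooth_in_chart[OF assms(1) c] assms(3)])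
qed

lemma openin_less:
 assumes "f \<in> C" shows "openin T {p \<in> M. a < f p}"
 unfolding openin_iff
proof (intro conjI ballI)
 fix c assume c: "c \<in> A"
 have "open (snd c ` fst c \<inter> (%x. f (ic c x)) -` {a<..})"
  by (rule continuous_open_preimage[OF smooth_on_continuous[OF smooth_in_chart[OF assms c]] chart_open[OF c]]) simp
 moreover have "snd c ` ({p \<in> M. a < f p} \<inter> fst c) = snd c ` fst c \<inter> (%x. f (ic c x)) -` {a<..}"
  using c chart_subset[OF c] by (auto simp: image_iff)
 ultimately show "open (snd c ` ({p \<in> M. a < f p} \<inter> fst c))" by simp
qed auto

lemma smooth_extend_by_zero:
 assumes c: "c \<in> A" and h: "smooth_on h (snd c ` fst c)"
  and K: "compact K" "K \<subseteq> snd c ` fst c" "!!x. x \<in> snd c ` fst c ==> x \<notin> K ==> h x = 0"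
 shows "(%q. if q \<in> fst c then h (snd c q) else 0) \<in> C" (is "?f \<in> C")
 unfolding smooth_iff
proof
 fix d assume d: "d \<in> A"
 have cl: "closedin T (ic c ` K)" by (rule closedin_ic_compact[OF c K(1,2)])
 show "smooth_on (%x. ?f (ic d x)) (snd d ` fst d)"
 proof (rule smooth_on_local[OF chart_open[OF d]])
  fix x assume "x \<in> snd d ` fst d"
  then obtain p where p: "p \<in> fst d" "x = snd d p" by auto
  show "\<exists>V. open V \<and> x \<in> V \<and> V \<subseteq> snd d ` fst d \<and> smooth_on (%x. ?f (ic d x)) V"
  proof (cases "p \<in> fst c")
   case True
   let ?V = "snd d ` (fst d \<inter> fst c)"
   have "(snd c \<circ> ic d) ` ?V \<subseteq> snd c ` fst c" using d by auto
   from smooth_on_compose[OF fin transition(1)[OF d c] chart_open[OF c] this transition(2)[OF d c] h]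
   have "smooth_on (%x. h (snd c (ic d x))) ?V" by (simp add: o_def)
   moreover have "?f (ic d y) = h (snd c (ic d y))" if "y \<in> ?V" for y using that d by auto
   ultimately have "smooth_on (%x. ?f (ic d x)) ?V"
    using smooth_on_cong[OF transition(1)[OF d c], of "%x. ?f (ic d x)" "%x. h (snd c (ic d x))"] by blast
   then show ?thesis using transition(1)[OF d c] True p by (intro exI[of _ ?V]) auto
  next
   case False
   let ?W = "M - ic c ` K"
   have W: "openin T ?W" using cl by (simp add: closedin_def topspace_eq)
   have "ic c ` K \<subseteq> fst c" using K(2) ic_in[of _ c] by blast
   then have pW: "p \<in> ?W" using False p chart_subset[OF d] by auto
   let ?V = "snd d ` (?W \<inter> fst d)"
   have V: "open ?V" by (rule chart_image_open[OF W d])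
   have "?f (ic d y) = 0" if "y \<in> ?V" for y
   proof -
    obtain q where q: "q \<in> M" "q \<notin> ic c ` K" "q \<in> fst d" "y = snd d q" using \<open>y \<in> ?V\<close> by auto
    have "snd c q \<notin> K" if "q \<in> fst c" using q(2) that c ic_chart[OF c that] by (metis imageI)
    then show ?thesis using q d K(3)[of "snd c q"] by auto
   qed
   then have "smooth_on (%x. ?f (ic d x)) ?V"
    using smooth_on_cong[OF V, of "%x. ?f (ic d x)" "%x. 0"] smooth_on_const[OF V] by blast
   then show ?thesis using V pW p by (intro exI[of _ ?V]) auto
  qed
 qed
qed

text \<open>The cut-off functions of this lemma are the source of everything global: they extend functions,
 vector fields and frames that are only given in a chart.\<close>

lemma chart_cutoff:
 assumes c: "c \<in> A" and W: "openin T W" "p \<in> W" "p \<in> fst c"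
 obtains b N K where "b \<in> C" "openin T N" "p \<in> N" "N \<subseteq> W" "N \<subseteq> fst c" "!!q. q \<in> N ==> b q = 1"
  "compact K" "K \<subseteq> snd c ` (W \<inter> fst c)" "!!q. q \<notin> ic c ` K ==> b q = 0" "!!q. 0 \<le> b q"
  "!!h. smooth_on h (snd c ` fst c) ==> (%q. if q \<in> fst c then b q * h (snd c q) else 0) \<in> C"
proof -
 let ?V = "snd c ` (W \<inter> fst c)"
 have V: "open ?V" "snd c p \<in> ?V" "?V \<subseteq> snd c ` fst c" using chart_image_open[OF W(1) c] W by auto
 obtain k K N where k: "smooth_on k UNIV" "compact K" "K \<subseteq> ?V" "open N" "snd c p \<in> N" "N \<subseteq> K"
  "!!x. x \<notin> K ==> k x = 0" "!!x. x \<in> N ==> k x = (1::real)" "!!x. 0 \<le> k x"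
  by (rule smooth_bump_model[OF fin V(1,2)]) (rule that)
 define b where "b q = (if q \<in> fst c then k (snd c q) else 0)" for q
 have ks: "smooth_on k (snd c ` fst c)"
  by (rule smooth_on_subset[OF k(1)]) (auto simp: chart_open c)
 have Ks: "K \<subseteq> snd c ` fst c" using k(3) V(3) by blast
 show ?thesis
 proof (rule that[of b "{q \<in> fst c. snd c q \<in> N}" K])
  show "b \<in> C" unfolding b_def[abs_def]
   by (rule smooth_extend_by_zero[OF c ks k(2) Ks]) (rule k(7))
  show "openin T {q \<in> fst c. snd c q \<in> N}" by (rule openin_chart_vimage[OF c k(4)])
  show "p \<in> {q \<in> fst c. snd c q \<in> N}" using W k(5) by simp
  show "{q \<in> fst c. snd c q \<in> N} \<subseteq> W"
  proof
   fix q assume q: "q \<in> {q \<in> fst c. snd c q \<in> N}"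
   then have "snd c q \<in> ?V" using k(3,6) by blast
   then obtain q' where "q' \<in> W" "q' \<in> fst c" "snd c q = snd c q'" by auto
   then show "q \<in> W" using inj_onD[OF chart_inj[OF c], of q q'] q by simp
  qed
  show "b q = 0" if "q \<notin> ic c ` K" for q
  proof (cases "q \<in> fst c")
   case True
   then have "snd c q \<notin> K" using that ic_chart[OF c True] by (metis imageI)
   then show ?thesis using k(7) by (simp add: b_def)
  qed (simp add: b_def)
  fix h :: "'e => real" assume h: "smooth_on h (snd c ` fst c)"
  have "(%q. if q \<in> fst c then k (snd c q) * h (snd c q) else 0) \<in> C"
   by (rule smooth_extend_by_zero[OF c smooth_on_mult[OF chart_open[OF c] ks h] k(2) Ks]) (simp add: k(7))
  then show "(%q. if q \<in> fst c then b q * h (snd c q) else 0) \<in> C"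
   by (simp add: b_def cong: if_cong)
 qed (use k in \<open>auto simp: b_def\<close>)
qed

lemma bump:
 assumes W: "openin T W" "p \<in> W"
 obtains b N L where "b \<in> C" "openin T N" "p \<in> N" "N \<subseteq> W" "!!q. q \<in> N ==> b q = 1"
  "closedin T L" "L \<subseteq> W" "!!q. q \<notin> L ==> b q = 0" "!!q. 0 \<le> b q"
proof -
 have "p \<in> M" using W openin_iff by blast
 then obtain c where c: "c \<in> A" "p \<in> fst c" using chart_at by blast
 obtain b N K where b: "b \<in> C" "openin T N" "p \<in> N" "N \<subseteq> W" "N \<subseteq> fst c" "!!q. q \<in> N ==> b q = 1"
  "compact K" "K \<subseteq> snd c ` (W \<inter> fst c)" "!!q. q \<notin> ic c ` K ==> b q = 0" "!!q. 0 \<le> b q"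
  "!!h. smooth_on h (snd c ` fst c) ==> (%q. if q \<in> fst c then b q * h (snd c q) else 0) \<in> C"
  by (rule chart_cutoff[OF c(1) W c(2)]) (rule that)
 have KW: "ic c ` K \<subseteq> W" using b(8) c by auto
 have K: "K \<subseteq> snd c ` fst c" using b(8) by blast
 show ?thesis by (rule that[OF b(1-4,6) closedin_ic_compact(1)[OF c(1) b(7) K] KW b(9,10)])
qed

section \<open>Tangent vectors\<close>

lemma tangentD:
 assumes "v \<in> TM p"
 shows tangent_add: "f \<in> C ==> g \<in> C ==> v (%x. f x + g x) = v f + v g"
  and tangent_cmult: "f \<in> C ==> v (%x. c * f x) = c * v f"
  and tangent_mult: "f \<in> C ==> g \<in> C ==> v (%x. f x * g x) = f p * v g + g p * v f"
  and tangent_nonsmooth: "f \<notin> C ==> v f = 0"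
 using assms unfolding tangent_space_def plus_fun_def times_fun_def by blast+

lemma tangentI:
 assumes "!!f. f \<notin> C ==> v f = 0"
  "!!f g. f \<in> C ==> g \<in> C ==> v (%x. f x + g x) = v f + v g"
  "!!f c. f \<in> C ==> v (%x. c * f x) = c * v f"
  "!!f g. f \<in> C ==> g \<in> C ==> v (%x. f x * g x) = f p * v g + g p * v f"
 shows "v \<in> TM p"
 unfolding tangent_space_def plus_fun_def times_fun_def using assms by blast

lemma tangent_minus: "v \<in> TM p ==> f \<in> C ==> v (%x. - f x) = - v f"
 using tangent_cmult[of v p f "-1"] by simp

lemma tangent_diff: "v \<in> TM p ==> f \<in> C ==> g \<in> C ==> v (%x. f x - g x) = v f - v g"
 using tangent_add[of v p f "%x. - g x"] tangent_minus[of v p g] smooth_minus[of g] by simp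

lemma tangent_const: "v \<in> TM p ==> v (%x. c) = 0"
proof -
 assume v: "v \<in> TM p"
 have "v (%x. 1 * 1) = 1 * v (%x. 1) + 1 * v (%x. 1)" by (rule tangent_mult[OF v]) auto
 then have "v (%x. 1) = 0" by simp
 then show ?thesis using tangent_cmult[OF v, of "%x. 1" c] by simp
qed

lemma tangent_sum:
 assumes v: "v \<in> TM p" and "!!i. i \<in> I ==> f i \<in> C"
 shows "v (%x. \<Sum>i\<in>I. f i x) = (\<Sum>i\<in>I. v (f i))"
 using assms(2)
proof (induction I rule: infinite_finite_induct)
 case (insert i I)
 then show ?case using tangent_add[OF v, of "f i" "%x. \<Sum>i\<in>I. f i x"] smooth_sum[of I f] by simp
qed (auto simp: tangent_const[OF v])

lemma tangent_local:
 assumes v: "v \<in> TM p" and f: "f \<in> C" "g \<in> C"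
  and W: "openin T W" "p \<in> W" "!!q. q \<in> W ==> f q = g q"
 shows "v f = v g"
proof -
 obtain b N L where b: "b \<in> C" "openin T N" "p \<in> N" "N \<subseteq> W" "!!q. q \<in> N ==> b q = 1"
  "closedin T L" "L \<subseteq> W" "!!q. q \<notin> L ==> b q = 0" "!!q. 0 \<le> b q"
  by (rule bump[OF W(1,2)]) (rule that)
 have z: "(%x. (f x - g x) * b x) = (%x. 0)"
 proof
  fix x show "(f x - g x) * b x = 0" using b(7,8) W(3) by (cases "x \<in> L") auto
 qed
 have "v (%x. (f x - g x) * b x) = (f p - g p) * v b + b p * v (%x. f x - g x)"
  by (rule tangent_mult[OF v]) (intro smooth_intros f b)+
 moreover have "v (%x. (f x - g x) * b x) = 0" unfolding z by (rule tangent_const[OF v])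
 ultimately show ?thesis using b(3,5) W(2,3) by (simp add: tangent_diff[OF v f])
qed

lemma tangent_space_0: "0 \<in> TM p"
 by (rule tangentI) auto

lemma tangent_space_add: "u \<in> TM p ==> v \<in> TM p ==> u + v \<in> TM p"
 by (rule tangentI)
  (auto simp: tangent_add tangent_cmult tangent_mult tangent_nonsmooth algebra_simps)

lemma tangent_space_scale: "u \<in> TM p ==> c *\<^sub>t u \<in> TM p"
 by (rule tangentI)
  (auto simp: tscale_def tangent_add tangent_cmult tangent_mult tangent_nonsmooth algebra_simps)

lemma tangent_space_minus: "u \<in> TM p ==> - u \<in> TM p"
 using tangent_space_scale[of u p "-1"] by (simp add: tscale_def fun_Compl_def)

lemma tangent_space_diff: "u \<in> TM p ==> v \<in> TM p ==> u - v \<in> TM p"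
 using tangent_space_add[OF _ tangent_space_minus, of u p v] by simp

lemma tangent_space_sum: "(!!i. i \<in> I ==> u i \<in> TM p) ==> (\<Sum>i\<in>I. u i) \<in> TM p"
 by (induction I rule: infinite_finite_induct) (auto intro: tangent_space_0 tangent_space_add)

text \<open>In a chart, directional derivatives are tangent vectors, and by Hadamard's lemma there are no
 others.\<close>

lemma coord_vec_eq:
 "f \<in> C ==> coord_vec A c p b f = frechet_derivative (%x. f (ic c x)) (at (snd c p)) b"
 by (simp add: coord_vec_def o_def)

lemma chart_derivative:
 assumes "c \<in> A" "p \<in> fst c" "f \<in> C"
 shows "((%x. f (ic c x)) has_derivative (%b. coord_vec A c p b f)) (at (snd c p))"
 using smooth_on_derivative(1)[OF chart_open[OF assms(1)] smooth_in_chart[OF assms(3,1)], of "snd c p"] assms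
 by (simp add: coord_vec_eq)

lemma coord_vecI:
 assumes "c \<in> A" "p \<in> fst c" "f \<in> C" "((%x. f (ic c x)) has_derivative D) (at (snd c p))"
 shows "coord_vec A c p b f = D b"
 by (rule fun_cong[OF has_derivative_unique[OF chart_derivative[OF assms(1-3)] assms(4)]])

lemma coord_vec_tangent:
 assumes c: "c \<in> A" "p \<in> fst c"
 shows "coord_vec A c p b \<in> TM p"
proof (rule tangentI)
 fix f g assume f: "f \<in> C" and g: "g \<in> C"
 note d = chart_derivative[OF c f] chart_derivative[OF c g]
 show "coord_vec A c p b (%x. f x + g x) = coord_vec A c p b f + coord_vec A c p b g"
  by (rule coord_vecI[OF c smooth_add[OF f g]]) (rule has_derivative_add[OF d])
 show "coord_vec A c p b (%x. f x * g x) = f p * coord_vec A c p b g + g p * coord_vec A c p b f"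
  by (rule coord_vecI[OF c smooth_mult[OF f g]])
   (use has_derivative_mult[OF d] c in \<open>simp add: mult.commute\<close>)
next
 fix f k assume f: "f \<in> C"
 show "coord_vec A c p b (%x. k * f x) = k * coord_vec A c p b f"
  by (rule coord_vecI[OF c smooth_cmult[OF f]])
   (rule has_derivative_mult_right[OF chart_derivative[OF c f]])
qed (simp add: coord_vec_def)

lemma coord_vec_linear:
 assumes c: "c \<in> A" "p \<in> fst c"
 shows "coord_vec A c p (a + b) = coord_vec A c p a + coord_vec A c p b"
  and "coord_vec A c p (k *\<^sub>R b) = k *\<^sub>t coord_vec A c p b"
  and "coord_vec A c p 0 = 0"
proof -
 have l: "linear (%b. coord_vec A c p b f)" if "f \<in> C" for f
  by (rule has_derivative_linear[OF chart_derivative[OF c that]])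
 show "coord_vec A c p (a + b) = coord_vec A c p a + coord_vec A c p b"
  using linear_add[OF l] by (auto simp: fun_eq_iff coord_vec_def)
 show "coord_vec A c p (k *\<^sub>R b) = k *\<^sub>t coord_vec A c p b"
  using linear_scale[OF l] by (auto simp: fun_eq_iff coord_vec_def tscale_def)
 show "coord_vec A c p 0 = 0"
  using linear_0[OF l] by (auto simp: fun_eq_iff coord_vec_def)
qed

lemma coord_vec_sum:
 assumes c: "c \<in> A" "p \<in> fst c"
 shows "coord_vec A c p (\<Sum>i\<in>I. a i *\<^sub>R y i) = (\<Sum>i\<in>I. a i *\<^sub>t coord_vec A c p (y i))"
 by (induction I rule: infinite_finite_induct) (simp_all add: coord_vec_linear[OF c])

definition coord_cutoff :: "'m set \<times> ('m => 'e) => ('m => real) => 'e => 'm => real" where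
 "coord_cutoff c \<eta> b q = (if q \<in> fst c then \<eta> q * coord b (snd c q) else 0)"

lemma smooth_on_coord: "open S ==> smooth_on (coord (b::'e)) S"
 by (rule smooth_on_bounded_linear[OF bounded_linear_coord[OF fin]])

text \<open>Hadamard's lemma gives \<open>f = f p + (\<Sum>b. (x\<^sub>b - x\<^sub>b p) * H\<^sub>b)\<close> near \<open>p\<close>. The derivation \<open>v\<close>
 kills the constant, and the product rule at \<open>p\<close> leaves the values \<open>H\<^sub>b p\<close>, which are the partial
 derivatives of \<open>f\<close>.\<close>

lemma tangent_expand:
 assumes c: "c \<in> A" "p \<in> fst c" and v: "v \<in> TM p"
  and \<eta>: "!!b. coord_cutoff c \<eta> b \<in> C" "openin T N" "p \<in> N" "N \<subseteq> fst c" "!!q. q \<in> N ==> \<eta> q = 1"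
 shows "v = coord_vec A c p (\<Sum>b\<in>model_basis. v (coord_cutoff c \<eta> b) *\<^sub>R b)"
proof (rule ext)
 fix f
 show "v f = coord_vec A c p (\<Sum>b\<in>model_basis. v (coord_cutoff c \<eta> b) *\<^sub>R b) f"
 proof (cases "f \<in> C")
  case True
  have oN: "open (snd c ` (N \<inter> fst c))" by (rule chart_image_open[OF \<eta>(2) c(1)])
  have "snd c p \<in> snd c ` (N \<inter> fst c)" using \<eta>(3) c(2) by blast
  from openE[OF oN this] obtain r where r: "r > 0" "ball (snd c p) r \<subseteq> snd c ` (N \<inter> fst c)" .
  have sB: "ball (snd c p) r \<subseteq> snd c ` fst c" using r(2) by blast
  have "smooth_on (%x. f (ic c x)) (ball (snd c p) r)"
   by (rule smooth_on_subset[OF smooth_in_chart[OF True c(1)] chart_open[OF c(1)] open_ball sB])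
  note hl = hadamard_lemma[OF fin this]
  obtain H where H: "!!b. smooth_on (H b) (ball (snd c p) r)"
   "!!x. x \<in> ball (snd c p) r ==> f (ic c x) = f (ic c (snd c p)) +
    (\<Sum>b\<in>model_basis. coord b (x - snd c p) * H b x)"
   "!!b. H b (snd c p) = frechet_derivative (%x. f (ic c x)) (at (snd c p)) b"
   by (rule hl) (rule that)
  have rB: "snd c p \<in> ball (snd c p) r" using r(1) by simp
  \<comment> \<open>cut the factors off inside the ball, so that they become functions on the manifold\<close>
  obtain k K N' where k: "smooth_on k UNIV" "compact K" "K \<subseteq> ball (snd c p) r" "open N'" "snd c p \<in> N'" "N' \<subseteq> K"
   "!!x. x \<notin> K ==> k x = 0" "!!x. x \<in> N' ==> k x = (1::real)" "!!x. 0 \<le> k x"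
   by (rule smooth_bump_model[OF fin open_ball[of "snd c p" r] rB]) (rule that)
  define h where "h b q = (if q \<in> fst c then k (snd c q) * H b (snd c q) else 0)" for b q
  have kH: "smooth_on (%x. k x * H b x) (snd c ` fst c)" for b
  proof (rule smooth_on_local[OF chart_open[OF c(1)]])
   fix x assume x: "x \<in> snd c ` fst c"
   show "\<exists>V. open V \<and> x \<in> V \<and> V \<subseteq> snd c ` fst c \<and> smooth_on (%x. k x * H b x) V"
   proof (cases "x \<in> ball (snd c p) r")
    case True
    have "smooth_on (%x. k x * H b x) (ball (snd c p) r)"
     by (rule smooth_on_mult[OF open_ball smooth_on_subset[OF k(1)] H(1)]) auto
    then show ?thesis using True sB by blast
   next
    case False
    let ?V = "snd c ` fst c - K"
    have V: "open ?V" by (intro open_Diff chart_open c compact_imp_closed k)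
    have "smooth_on (%x. k x * H b x) ?V"
     by (rule iffD2[OF smooth_on_cong[OF V] smooth_on_const[OF V, of 0]]) (simp add: k(7))
    then show ?thesis using False x k(3) V by blast
   qed
  qed
  have hC: "h b \<in> C" for b
   unfolding h_def[abs_def]
   by (rule smooth_extend_by_zero[OF c(1) kH k(2)]) (use k(3,7) sB in auto)
  let ?x = "coord_cutoff c \<eta>"
  let ?g = "%q. f p + (\<Sum>b\<in>model_basis. (?x b q - ?x b p) * h b q)"
  let ?W = "N \<inter> {q \<in> fst c. snd c q \<in> N'}"
  have gC: "?g \<in> C" by (intro smooth_intros \<eta>(1) hC)
  have "v f = v ?g"
  proof (rule tangent_local[OF v True gC])
   show "openin T ?W" by (intro openin_Int \<eta> openin_chart_vimage c k)
   show "p \<in> ?W" using c \<eta> k by auto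
   fix q assume q: "q \<in> ?W"
   then have "snd c q \<in> ball (snd c p) r" using k(3,6) by blast
   from H(2)[OF this] show "f q = ?g q"
    using q c \<eta>(3,5) k(8)
    by (simp add: coord_cutoff_def h_def linear_diff[OF bounded_linear.linear[OF bounded_linear_coord[OF fin]]])
  qed
  also have "... = (\<Sum>b\<in>model_basis. v (%q. (?x b q - ?x b p) * h b q))"
   by (subst tangent_add[OF v]) (simp_all add: tangent_const[OF v] tangent_sum[OF v] smooth_intros \<eta> hC)
  also have "... = (\<Sum>b\<in>model_basis. v (?x b) * frechet_derivative (%x. f (ic c x)) (at (snd c p)) b)"
  proof (rule sum.cong[OF refl])
   fix b :: 'e
   have "v (%q. (?x b q - ?x b p) * h b q) = (?x b p - ?x b p) * v (h b) + h b p * v (%q. ?x b q - ?x b p)"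
    by (rule tangent_mult[OF v]) (intro smooth_intros \<eta> hC)+
   also have "v (%q. ?x b q - ?x b p) = v (?x b)"
    by (simp add: tangent_diff[OF v] \<eta> tangent_const[OF v])
   also have "h b p = frechet_derivative (%x. f (ic c x)) (at (snd c p)) b"
    using c k(5,8) by (simp add: h_def H(3))
   finally show "v (%q. (?x b q - ?x b p) * h b q) = v (?x b) * frechet_derivative (%x. f (ic c x)) (at (snd c p)) b"
    by simp
  qed
  also have "... = coord_vec A c p (\<Sum>b\<in>model_basis. v (?x b) *\<^sub>R b) f"
  proof -
   have l: "linear (%b. coord_vec A c p b f)" by (rule has_derivative_linear[OF chart_derivative[OF c True]])
   show ?thesis
    by (simp add: linear_sum[OF l] linear_scale[OF l]) (simp add: coord_vec_eq[OF True])
  qed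
  finally show ?thesis .
 next
  case False
  then show ?thesis using tangent_nonsmooth[OF v] by (simp add: coord_vec_def)
 qed
qed

lemma coord_vec_coord_cutoff:
 assumes c: "c \<in> A" "p \<in> fst c"
  and \<eta>: "coord_cutoff c \<eta> b \<in> C" "openin T N" "p \<in> N" "!!q. q \<in> N ==> \<eta> q = 1"
 shows "coord_vec A c p x (coord_cutoff c \<eta> b) = coord b x"
proof (rule coord_vecI[OF c \<eta>(1), of "coord b"])
 have "(coord b has_derivative coord b) (at (snd c p))"
  by (rule bounded_linear_imp_has_derivative[OF bounded_linear_coord[OF fin]])
 then show "((%x. coord_cutoff c \<eta> b (ic c x)) has_derivative coord b) (at (snd c p))"
 proof (rule has_derivative_transform_within_open[OF _ chart_image_open[OF \<eta>(2) c(1)]])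
  show "snd c p \<in> snd c ` (N \<inter> fst c)" using c \<eta> by auto
  show "coord b x = coord_cutoff c \<eta> b (ic c x)" if "x \<in> snd c ` (N \<inter> fst c)" for x
   using that c \<eta>(4) by (auto simp: coord_cutoff_def)
 qed
qed

lemma coord_cutoff_at:
 assumes c: "c \<in> A" "p \<in> fst c"
 obtains \<eta> N where "!!b. coord_cutoff c \<eta> b \<in> C" "\<eta> \<in> C" "openin T N" "p \<in> N" "N \<subseteq> fst c" "!!q. q \<in> N ==> \<eta> q = 1"
  "!!h. smooth_on h (snd c ` fst c) ==> (%q. if q \<in> fst c then \<eta> q * h (snd c q) else 0) \<in> C"
proof -
 obtain b N K where b: "b \<in> C" "openin T N" "p \<in> N" "N \<subseteq> fst c" "N \<subseteq> fst c" "!!q. q \<in> N ==> b q = 1"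
  "compact K" "K \<subseteq> snd c ` (fst c \<inter> fst c)" "!!q. q \<notin> ic c ` K ==> b q = 0" "!!q. 0 \<le> b q"
  "!!h. smooth_on h (snd c ` fst c) ==> (%q. if q \<in> fst c then b q * h (snd c q) else 0) \<in> C"
  by (rule chart_cutoff[OF c(1) openin_chart[OF c(1)] c(2) c(2)]) (rule that)
 have "coord_cutoff c b x \<in> C" for x
  unfolding coord_cutoff_def[abs_def] by (rule b(11)[OF smooth_on_coord[OF chart_open[OF c(1)]]])
 then show ?thesis using that[of b N] b by blast
qed

lemma tangent_is_coord_vec:
 assumes c: "c \<in> A" "p \<in> fst c" and v: "v \<in> TM p"
 obtains x where "v = coord_vec A c p x"
proof -
 obtain \<eta> N where \<eta>: "!!b. coord_cutoff c \<eta> b \<in> C" "\<eta> \<in> C" "openin T N" "p \<in> N" "N \<subseteq> fst c" "!!q. q \<in> N ==> \<eta> q = 1"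
  "!!h. smooth_on h (snd c ` fst c) ==> (%q. if q \<in> fst c then \<eta> q * h (snd c q) else 0) \<in> C"
  by (rule coord_cutoff_at[OF c]) (rule that)
 show ?thesis using that[OF tangent_expand[OF c v \<eta>(1,3-6)]] .
qed

lemma coord_vec_inj:
 assumes c: "c \<in> A" "p \<in> fst c" and eq: "coord_vec A c p x = coord_vec A c p y"
 shows "x = y"
proof -
 obtain \<eta> N where \<eta>: "!!b. coord_cutoff c \<eta> b \<in> C" "\<eta> \<in> C" "openin T N" "p \<in> N" "N \<subseteq> fst c" "!!q. q \<in> N ==> \<eta> q = 1"
  "!!h. smooth_on h (snd c ` fst c) ==> (%q. if q \<in> fst c then \<eta> q * h (snd c q) else 0) \<in> C"
  by (rule coord_cutoff_at[OF c]) (rule that)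
 have eq': "coord b x = coord b y" for b
  using coord_vec_coord_cutoff[OF c \<eta>(1,3,4,6), of x b] coord_vec_coord_cutoff[OF c \<eta>(1,3,4,6), of y b] eq
  by simp
 show ?thesis
  by (rule trans[OF trans[OF coord_expand[OF fin, of x, symmetric]] coord_expand[OF fin, of y]])
   (simp only: eq')
qed

end

section \<open>Vector fields\<close>

context manifold
begin

abbreviation "V \<equiv> vfields A"

lemma vfieldD:
 assumes "X \<in> V"
 shows vfield_tangent: "X p \<in> TM p"
  and vfield_outside: "p \<notin> M ==> X p = 0"
  and vfield_smooth: "f \<in> C ==> (%p. X p f) \<in> C"
 using assms tangent_space_0 unfolding vfields_def by (cases "p \<in> M"; force)+

lemma vfieldI:
 assumes "!!p. p \<in> M ==> X p \<in> TM p" "!!p. p \<notin> M ==> X p = 0"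
  "!!f. f \<in> C ==> (%p. X p f) \<in> C"
 shows "X \<in> V"
 using assms unfolding vfields_def by blast

lemma vfield_local:
 assumes "!!p. p \<in> M ==> X p \<in> TM p" "!!p. p \<notin> M ==> X p = 0"
  "!!p. p \<in> M ==> \<exists>W Y. openin T W \<and> p \<in> W \<and> Y \<in> V \<and> (\<forall>q\<in>W. X q = Y q)"
 shows "X \<in> V"
proof (rule vfieldI[OF assms(1,2)])
 fix f assume f: "f \<in> C"
 show "(%p. X p f) \<in> C"
 proof (rule smooth_local)
  fix p assume "p \<in> M"
  then obtain W Y where "openin T W" "p \<in> W" "Y \<in> V" "\<forall>q\<in>W. X q = Y q" using assms(3) by blast
  then show "\<exists>W h. openin T W \<and> p \<in> W \<and> h \<in> C \<and> (\<forall>q\<in>W. X q f = h q)"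
   using vfield_smooth[OF _ f] by (intro exI[of _ W] exI[of _ "%p. Y p f"]) auto
 qed
qed

lemma vfield_0 [simp]: "0 \<in> V"
 by (rule vfieldI) (auto simp: tangent_space_0)

lemma vfield_add: "X \<in> V ==> Y \<in> V ==> X + Y \<in> V"
 by (rule vfieldI) (auto simp: tangent_space_add vfield_tangent vfield_outside smooth_add vfield_smooth)

lemma vfield_fscale: "h \<in> C ==> X \<in> V ==> h *\<^sub>f X \<in> V"
proof (rule vfieldI)
 assume h: "h \<in> C" and X: "X \<in> V"
 show "(h *\<^sub>f X) p \<in> TM p" for p
  unfolding fscale_def by (rule tangent_space_scale[OF vfield_tangent[OF X]])
 show "p \<notin> M ==> (h *\<^sub>f X) p = 0" for p
  by (simp add: fscale_def tscale_def vfield_outside[OF X] fun_eq_iff)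
 show "f \<in> C ==> (%p. (h *\<^sub>f X) p f) \<in> C" for f
  by (simp add: fscale_def tscale_def smooth_mult h vfield_smooth[OF X])
qed

lemma vfield_minus: "X \<in> V ==> - X \<in> V"
 by (rule vfieldI) (auto simp: tangent_space_minus vfield_tangent vfield_outside smooth_minus vfield_smooth)

lemma vfield_diff: "X \<in> V ==> Y \<in> V ==> X - Y \<in> V"
 using vfield_add[OF _ vfield_minus, of X Y] by simp

lemma vfield_sum: "(!!i. i \<in> I ==> X i \<in> V) ==> (\<Sum>i\<in>I. X i) \<in> V"
 by (induction I rule: infinite_finite_induct) (auto intro: vfield_add)

lemma sum_vfield_apply: "(\<Sum>i\<in>I. X i) p f = (\<Sum>i\<in>I. X i p f)" for X :: "'i => 'm vfield"
 by (induction I rule: infinite_finite_induct) auto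

lemma sum_tvec_apply: "(\<Sum>i\<in>I. v i) f = (\<Sum>i\<in>I. v i f)" for v :: "'i => 'm tvec"
 by (induction I rule: infinite_finite_induct) auto

lemma sum_fun_apply: "(\<Sum>i\<in>I. X i) p = (\<Sum>i\<in>I. X i p)" for X :: "'i => 'm vfield"
 by (induction I rule: infinite_finite_induct) auto

lemma vfield_bracket:
 assumes X: "X \<in> V" and Y: "Y \<in> V"
 shows "bracket X Y \<in> V"
proof (rule vfieldI)
 fix p
 note tX = vfield_tangent[OF X] and tY = vfield_tangent[OF Y]
 note sX = vfield_smooth[OF X] and sY = vfield_smooth[OF Y]
 show "bracket X Y p \<in> TM p"
 proof (rule tangentI)
  fix f g assume f: "f \<in> C" and g: "g \<in> C"
  show "bracket X Y p (%x. f x + g x) = bracket X Y p f + bracket X Y p g"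
   by (simp add: bracket_def tangent_add[OF tX] tangent_add[OF tY] f g sX sY)
  show "bracket X Y p (%x. f x * g x) = f p * bracket X Y p g + g p * bracket X Y p f"
   by (simp add: bracket_def tangent_mult[OF tX] tangent_mult[OF tY] tangent_add[OF tX] tangent_add[OF tY]
     f g sX sY smooth_mult algebra_simps)
 next
  fix f c assume f: "f \<in> C"
  show "bracket X Y p (%x. c * f x) = c * bracket X Y p f"
   by (simp add: bracket_def tangent_cmult[OF tX] tangent_cmult[OF tY] f sX sY algebra_simps)
 next
  fix f assume "f \<notin> C"
  then show "bracket X Y p f = 0"
   by (simp add: bracket_def tangent_nonsmooth[OF tX] tangent_nonsmooth[OF tY] tangent_const[OF tX] tangent_const[OF tY])
 qed
 show "p \<notin> M ==> bracket X Y p = 0"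
  by (simp add: bracket_def vfield_outside[OF X] vfield_outside[OF Y] fun_eq_iff)
 show "f \<in> C ==> (%p. bracket X Y p f) \<in> C" for f
  by (simp add: bracket_def smooth_diff sX sY)
qed

lemma bracket_swap: "bracket Y X = - bracket X Y"
 by (simp add: bracket_def fun_eq_iff)

lemma bracket_add:
 assumes "X \<in> V" "Y \<in> V" "Z \<in> V"
 shows "bracket X (Y + Z) = bracket X Y + bracket X Z"
proof (intro ext)
 fix p f
 show "bracket X (Y + Z) p f = (bracket X Y + bracket X Z) p f"
 proof (cases "f \<in> C")
  case True
  then show ?thesis
   unfolding bracket_def plus_fun_apply
    tangent_add[OF vfield_tangent[OF assms(1)] vfield_smooth[OF assms(2) True] vfield_smooth[OF assms(3) True]]
   by (simp add: algebra_simps)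
 next
  case False
  have "bracket X (Y + Z) \<in> V" "bracket X Y + bracket X Z \<in> V"
   by (intro vfield_bracket vfield_add assms)+
  from this[THEN vfield_tangent, THEN tangent_nonsmooth, OF False] show ?thesis by simp
 qed
qed

lemma bracket_fscale:
 assumes "X \<in> V" "Y \<in> V" "h \<in> C"
 shows "bracket X (h *\<^sub>f Y) = (%p. X p h) *\<^sub>f Y + h *\<^sub>f bracket X Y"
proof (intro ext)
 fix p f
 show "bracket X (h *\<^sub>f Y) p f = ((%p. X p h) *\<^sub>f Y + h *\<^sub>f bracket X Y) p f"
 proof (cases "f \<in> C")
  case True
  then show ?thesis
   unfolding bracket_def fscale_def tscale_def plus_fun_apply
    tangent_mult[OF vfield_tangent[OF assms(1)] assms(3) vfield_smooth[OF assms(2) True]]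
   by (simp add: algebra_simps)
 next
  case False
  have "bracket X (h *\<^sub>f Y) \<in> V" "(%p. X p h) *\<^sub>f Y + h *\<^sub>f bracket X Y \<in> V"
   by (intro vfield_bracket vfield_add vfield_fscale vfield_smooth[OF assms(1,3)] assms)+
  from this[THEN vfield_tangent, THEN tangent_nonsmooth, OF False] show ?thesis by simp
 qed
qed

definition coord_field :: "'m set \<times> ('m => 'e) => ('m => real) => 'e => 'm vfield" where
 "coord_field c \<eta> x q = (if q \<in> fst c then \<eta> q *\<^sub>t coord_vec A c q x else 0)"

lemma coord_field:
 assumes c: "c \<in> A"
  and \<eta>: "!!h. smooth_on h (snd c ` fst c) ==> (%q. if q \<in> fst c then \<eta> q * h (snd c q) else 0) \<in> C"
 shows "coord_field c \<eta> x \<in> V"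
proof (rule vfieldI)
 show "coord_field c \<eta> x p \<in> TM p" for p
  using coord_vec_tangent[OF c] by (simp add: coord_field_def tangent_space_0 tangent_space_scale)
 show "p \<notin> M ==> coord_field c \<eta> x p = 0" for p
  using chart_subset[OF c] by (auto simp: coord_field_def)
 fix f assume f: "f \<in> C"
 have "coord_field c \<eta> x p f =
  (if p \<in> fst c then \<eta> p * (%y. frechet_derivative (%x. f (ic c x)) (at y) x) (snd c p) else 0)" for p
  by (simp add: coord_field_def coord_vec_eq[OF f] tscale_def)
 then show "(%p. coord_field c \<eta> x p f) \<in> C"
  using \<eta>[OF smooth_on_derivative(2)[OF chart_open[OF c] smooth_in_chart[OF f c]]] by simp
qed

lemma tangent_extend:
 assumes p: "p \<in> M" and v: "v \<in> TM p"
 obtains X where "X \<in> V" "X p = v"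
proof -
 obtain c where c: "c \<in> A" "p \<in> fst c" using chart_at[OF p] .
 obtain x where x: "v = coord_vec A c p x" using tangent_is_coord_vec[OF c v] .
 obtain \<eta> N where \<eta>: "!!b. coord_cutoff c \<eta> b \<in> C" "\<eta> \<in> C" "openin T N" "p \<in> N" "N \<subseteq> fst c" "!!q. q \<in> N ==> \<eta> q = 1"
  "!!h. smooth_on h (snd c ` fst c) ==> (%q. if q \<in> fst c then \<eta> q * h (snd c q) else 0) \<in> C"
  by (rule coord_cutoff_at[OF c]) (rule that)
 show ?thesis
  by (rule that[OF coord_field[OF c(1) \<eta>(7)], of x]) (use c \<eta>(4,6) in \<open>auto simp: coord_field_def x tscale_def\<close>)
qed

lemma extension:
 assumes "p \<in> M" "v \<in> TM p"
 shows "extension A p v \<in> V" "extension A p v p = v"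
proof -
 obtain X where "X \<in> V" "X p = v" by (rule tangent_extend[OF assms]) (rule that)
 then have "X \<in> V \<and> X p = v" ..
 then have "extension A p v \<in> V \<and> extension A p v p = v"
  unfolding extension_def by (rule someI[of "%X. X \<in> V \<and> X p = v"])
 then show "extension A p v \<in> V" "extension A p v p = v" by auto
qed

end

section \<open>Partitions of unity and global generators\<close>

locale compact_manifold = manifold A for A :: "('m, 'e::real_normed_vector) atlas" +
 assumes compact: "compact_space (atlas_topology A)"
begin

lemma finite_subcover:
 assumes "!!p. p \<in> M ==> openin T (W p) \<and> p \<in> W p"
 obtains F where "finite F" "F \<subseteq> M" "M \<subseteq> (\<Union>p\<in>F. W p)"
proof -
 have "compactin T M" using compact by (simp add: compact_space_def topspace_eq)
 moreover have "\<forall>U\<in>W ` M. openin T U" "M \<subseteq> \<Union>(W ` M)" using assms by auto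
 ultimately obtain \<F> where "finite \<F>" "\<F> \<subseteq> W ` M" "M \<subseteq> \<Union>\<F>"
  unfolding compactin_def by metis
 then obtain F where "finite F" "F \<subseteq> M" "\<F> = W ` F" by (metis finite_subset_image)
 then show ?thesis using \<open>M \<subseteq> \<Union>\<F>\<close> that by auto
qed

lemma smooth_partition:
 assumes W: "!!p. p \<in> M ==> openin T (W p) \<and> p \<in> W p"
 obtains F \<theta> where "finite F" "F \<subseteq> M" "!!p. p \<in> F ==> \<theta> p \<in> C" "!!p q. p \<in> F ==> 0 \<le> \<theta> p q"
  "!!p. p \<in> F ==> T closure_of {q \<in> M. \<theta> p q \<noteq> 0} \<subseteq> W p" "!!p q. p \<in> F ==> q \<notin> W p ==> \<theta> p q = 0"
  "!!q. q \<in> M ==> (\<Sum>p\<in>F. \<theta> p q) = 1"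
proof -
 have "\<forall>p\<in>M. \<exists>b N L. b \<in> C \<and> openin T N \<and> p \<in> N \<and> (\<forall>q\<in>N. b q = 1) \<and> closedin T L \<and> L \<subseteq> W p \<and>
  (\<forall>q. q \<notin> L --> b q = 0) \<and> (\<forall>q. 0 \<le> b q)"
 proof
  fix p assume "p \<in> M"
  then have Wp: "openin T (W p)" "p \<in> W p" using W by auto
  obtain b N L where b: "b \<in> C" "openin T N" "p \<in> N" "N \<subseteq> W p" "!!q. q \<in> N ==> b q = 1"
   "closedin T L" "L \<subseteq> W p" "!!q. q \<notin> L ==> b q = 0" "!!q. 0 \<le> b q"
   by (rule bump[OF Wp]) (rule that)
  then show "\<exists>b N L. b \<in> C \<and> openin T N \<and> p \<in> N \<and> (\<forall>q\<in>N. b q = 1) \<and> closedin T L \<and> L \<subseteq> W p \<and>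
   (\<forall>q. q \<notin> L --> b q = 0) \<and> (\<forall>q. 0 \<le> b q)"
   by (intro exI[of _ b] exI[of _ N] exI[of _ L]) simp
 qed
 then obtain b N L where bb: "\<forall>p\<in>M. b p \<in> C \<and> openin T (N p) \<and> p \<in> N p \<and> (\<forall>q\<in>N p. b p q = 1) \<and>
  closedin T (L p) \<and> L p \<subseteq> W p \<and> (\<forall>q. q \<notin> L p --> b p q = 0) \<and> (\<forall>q. 0 \<le> b p q)"
  unfolding bchoice_iff by (elim exE) (rule that)
 have b: "!!p. p \<in> M ==> b p \<in> C" "!!p. p \<in> M ==> openin T (N p) \<and> p \<in> N p"
  "!!p q. p \<in> M ==> q \<in> N p ==> b p q = (1::real)" "!!p. p \<in> M ==> closedin T (L p)" "!!p. p \<in> M ==> L p \<subseteq> W p"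
  "!!p q. p \<in> M ==> q \<notin> L p ==> b p q = 0" "!!p q. p \<in> M ==> 0 \<le> b p q"
  using bb by blast+
 obtain F where F: "finite F" "F \<subseteq> M" "M \<subseteq> (\<Union>p\<in>F. N p)"
  by (rule finite_subcover[of N]) (rule b(2), assumption, rule that)
 let ?S = "%q. \<Sum>p\<in>F. b p q"
 have S: "?S q > 0" if "q \<in> M" for q
 proof -
  obtain p where p: "p \<in> F" "q \<in> N p" using F(3) \<open>q \<in> M\<close> by blast
  have "0 < b p q" using b(3)[of p q] p F(2) by auto
  also have "... \<le> ?S q" by (rule member_le_sum) (use p F b(7) in auto)
  finally show ?thesis .
 qed
 have SC: "?S \<in> C" by (intro smooth_sum b) (use F in auto)
 have iS: "(%q. ?S q powr (-1)) \<in> C"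
  by (rule smooth_compose[OF SC _ smooth_on_powr[of "-1"]]) (use S in auto)
 let ?t = "%p q. b p q * ?S q powr (-1)"
 show ?thesis
 proof (rule that[of F ?t])
  show "?t p \<in> C" if "p \<in> F" for p
   by (rule smooth_mult[OF b(1) iS]) (use that F in auto)
  show "0 \<le> ?t p q" if "p \<in> F" for p q using b(7) F that by auto
  show "T closure_of {q \<in> M. ?t p q \<noteq> 0} \<subseteq> W p" if "p \<in> F" for p
  proof -
   have pM: "p \<in> M" using that F by auto
   have "T closure_of {q \<in> M. ?t p q \<noteq> 0} \<subseteq> L p"
    by (rule closure_of_minimal[OF _ b(4)[OF pM]]) (use b(6)[OF pM] in auto)
   then show ?thesis using b(5)[OF pM] by blast
  qed
  show "?t p q = 0" if "p \<in> F" "q \<notin> W p" for p q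
  proof -
   have pM: "p \<in> M" using that F by auto
   have "q \<notin> L p" using b(5)[OF pM] that by blast
   then show ?thesis by (simp add: b(6)[OF pM])
  qed
  show "(\<Sum>p\<in>F. ?t p q) = 1" if "q \<in> M" for q
   using S[OF that] by (simp add: sum_distrib_right[symmetric] powr_minus)
 qed (use F in auto)
qed

text \<open>Finitely many global vector fields together with functions that serve as their dual
 frame. The module of vector fields is projective but in general not free; with this replacement for a
 frame, traces of endomorphisms can still be written down globally. Each of the generators is a multiple of
 a coordinate field of one chart with a factor supported where the cut-off \<open>\<eta>\<close> of the field is
 constantly 1, which is the form needed for integration.\<close>

definition localized :: "'m vfield => bool" where
 "localized Y \<longleftrightarrow> (\<exists>c \<eta> N b \<theta>. c \<in> A \<and> \<theta> \<in> C \<and> (\<forall>x. coord_field c \<eta> x \<in> V) \<and> openin T N \<and> N \<subseteq> fst c \<and>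
  (\<forall>q\<in>N. \<eta> q = 1) \<and> T closure_of {q \<in> M. \<theta> q \<noteq> 0} \<subseteq> N \<and> Y = \<theta> *\<^sub>f coord_field c \<eta> b)"

lemma generators_exist:
 "\<exists>(I :: ('m \<times> 'e) set) E \<beta>. finite I \<and> (\<forall>k\<in>I. E k \<in> V \<and> \<beta> k \<in> C \<and> localized (E k)) \<and>
  (\<forall>q\<in>M. \<forall>v\<in>TM q. v = (\<Sum>k\<in>I. v (\<beta> k) *\<^sub>t E k q))"
proof -
 have "\<forall>p\<in>M. \<exists>c \<eta> N. c \<in> A \<and> (\<forall>b. coord_cutoff c \<eta> b \<in> C) \<and> openin T N \<and> p \<in> N \<and> N \<subseteq> fst c \<and>
  (\<forall>q\<in>N. \<eta> q = 1) \<and> (\<forall>x. coord_field c \<eta> x \<in> V)"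
 proof
  fix p assume "p \<in> M"
  then obtain c where c: "c \<in> A" "p \<in> fst c" using chart_at by blast
  obtain \<eta> N where \<eta>: "!!b. coord_cutoff c \<eta> b \<in> C" "\<eta> \<in> C" "openin T N" "p \<in> N" "N \<subseteq> fst c" "!!q. q \<in> N ==> \<eta> q = 1"
   "!!h. smooth_on h (snd c ` fst c) ==> (%q. if q \<in> fst c then \<eta> q * h (snd c q) else 0) \<in> C"
   by (rule coord_cutoff_at[OF c]) (rule that)
  have "coord_field c \<eta> x \<in> V" for x by (rule coord_field[OF c(1) \<eta>(7)])
  then show "\<exists>c \<eta> N. c \<in> A \<and> (\<forall>b. coord_cutoff c \<eta> b \<in> C) \<and> openin T N \<and> p \<in> N \<and> N \<subseteq> fst c \<and>
   (\<forall>q\<in>N. \<eta> q = 1) \<and> (\<forall>x. coord_field c \<eta> x \<in> V)"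
   using c \<eta> by (intro exI[of _ c] exI[of _ \<eta>] exI[of _ N]) simp
 qed
 then obtain c \<eta> N where cc: "\<forall>p\<in>M. c p \<in> A \<and> (\<forall>b. coord_cutoff (c p) (\<eta> p) b \<in> C) \<and> openin T (N p) \<and>
  p \<in> N p \<and> N p \<subseteq> fst (c p) \<and> (\<forall>q\<in>N p. \<eta> p q = 1) \<and> (\<forall>x. coord_field (c p) (\<eta> p) x \<in> V)"
  unfolding bchoice_iff by (elim exE) (rule that)
 have c: "!!p. p \<in> M ==> c p \<in> A" "!!p b. p \<in> M ==> coord_cutoff (c p) (\<eta> p) b \<in> C"
  "!!p. p \<in> M ==> openin T (N p) \<and> p \<in> N p" "!!p. p \<in> M ==> N p \<subseteq> fst (c p)"
  "!!p q. p \<in> M ==> q \<in> N p ==> \<eta> p q = 1" "!!p x. p \<in> M ==> coord_field (c p) (\<eta> p) x \<in> V"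
  using cc by blast+
 obtain F \<theta> where F: "finite F" "F \<subseteq> M" "!!p. p \<in> F ==> \<theta> p \<in> C" "!!p q. p \<in> F ==> 0 \<le> \<theta> p q"
  "!!p. p \<in> F ==> T closure_of {q \<in> M. \<theta> p q \<noteq> 0} \<subseteq> N p" "!!p q. p \<in> F ==> q \<notin> N p ==> \<theta> p q = 0"
  "!!q. q \<in> M ==> (\<Sum>p\<in>F. \<theta> p q) = 1"
  by (rule smooth_partition[of N]) (rule c(3), assumption, rule that)
 let ?I = "F \<times> (model_basis :: 'e set)"
 let ?E = "%(p, b). \<theta> p *\<^sub>f coord_field (c p) (\<eta> p) b"
 let ?\<beta> = "%(p, b). coord_cutoff (c p) (\<eta> p) b"
 have "v = (\<Sum>k\<in>?I. v (?\<beta> k) *\<^sub>t ?E k q)" if q: "q \<in> M" and v: "v \<in> TM q" for q v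
 proof -
  have loc: "(\<Sum>b\<in>model_basis. v (coord_cutoff (c p) (\<eta> p) b) *\<^sub>t (\<theta> p *\<^sub>f coord_field (c p) (\<eta> p) b) q) = \<theta> p q *\<^sub>t v"
   if p: "p \<in> F" for p
  proof (cases "q \<in> N p")
   case True
   have pM: "p \<in> M" using p F by auto
   have qc: "q \<in> fst (c p)" using True c(4)[OF pM] by auto
   have "v = coord_vec A (c p) q (\<Sum>b\<in>model_basis. v (coord_cutoff (c p) (\<eta> p) b) *\<^sub>R b)"
    by (rule tangent_expand[OF c(1)[OF pM] qc v c(2)[OF pM] _ True c(4)[OF pM] c(5)[OF pM]]) (simp add: c(3) pM)
   then have ve: "v = (\<Sum>b\<in>model_basis. v (coord_cutoff (c p) (\<eta> p) b) *\<^sub>t coord_vec A (c p) q b)"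
    by (simp only: coord_vec_sum[OF c(1)[OF pM] qc])
   have "(\<Sum>b\<in>model_basis. v (coord_cutoff (c p) (\<eta> p) b) *\<^sub>t (\<theta> p *\<^sub>f coord_field (c p) (\<eta> p) b) q) f = \<theta> p q * v f" for f
   proof -
    have "v f = (\<Sum>b\<in>model_basis. v (coord_cutoff (c p) (\<eta> p) b) * coord_vec A (c p) q b f)"
     using fun_cong[OF ve, of f] by (simp only: sum_tvec_apply tscale_def)
    then have "\<theta> p q * v f = \<theta> p q * (\<Sum>b\<in>model_basis. v (coord_cutoff (c p) (\<eta> p) b) * coord_vec A (c p) q b f)"
     by (rule arg_cong)
    then show ?thesis
     by (simp add: sum_tvec_apply tscale_def fscale_def coord_field_def qc c(5)[OF pM True] sum_distrib_left mult_ac)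
   qed
   then show ?thesis by (auto simp: tscale_def)
  next
   case False
   then show ?thesis using F(6)[OF p] by (simp add: fscale_def tscale_def fun_eq_iff sum_tvec_apply)
  qed
  have "(\<Sum>k\<in>?I. v (?\<beta> k) *\<^sub>t ?E k q) =
   (\<Sum>p\<in>F. \<Sum>b\<in>model_basis. v (coord_cutoff (c p) (\<eta> p) b) *\<^sub>t (\<theta> p *\<^sub>f coord_field (c p) (\<eta> p) b) q)"
   unfolding sum.cartesian_product by (rule sum.cong) auto
  also have "... = (\<Sum>p\<in>F. \<theta> p q *\<^sub>t v)" by (rule sum.cong[OF refl loc])
  also have "... = v"
   by (rule ext) (simp add: sum_tvec_apply tscale_def sum_distrib_right[symmetric] F(7)[OF q])
  finally show ?thesis by simp
 qed
 moreover have "finite ?I" using F(1) model_basis(1)[OF fin] by simp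
 moreover have "\<forall>k\<in>?I. ?E k \<in> V \<and> ?\<beta> k \<in> C \<and> localized (?E k)"
 proof
  fix k assume "k \<in> ?I"
  then obtain p b where k: "k = (p, b)" "p \<in> F" "p \<in> M" using F(2) by auto
  have "localized (?E k)"
   unfolding localized_def k(1) prod.case
   by (rule exI[of _ "c p"], rule exI[of _ "\<eta> p"], rule exI[of _ "N p"], rule exI[of _ b], rule exI[of _ "\<theta> p"])
    (use k c F(3,5) in simp)
  then show "?E k \<in> V \<and> ?\<beta> k \<in> C \<and> localized (?E k)" using k F(3) c(2,6) by (simp add: vfield_fscale)
 qed
 ultimately show ?thesis by blast
qed

definition generators :: "('m \<times> 'e) set \<times> ('m \<times> 'e => 'm vfield) \<times> ('m \<times> 'e => 'm => real)" where
 "generators = (SOME (I, E, \<beta>). finite I \<and> (\<forall>k\<in>I. E k \<in> V \<and> \<beta> k \<in> C \<and> localized (E k)) \<and>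
  (\<forall>q\<in>M. \<forall>v\<in>TM q. v = (\<Sum>k\<in>I. v (\<beta> k) *\<^sub>t E k q)))"

definition "gen_index = fst generators"
definition "E = fst (snd generators)"
definition "\<beta> = snd (snd generators)"

lemma gen_finite: "finite gen_index"
 and gen_field: "k \<in> gen_index ==> E k \<in> V"
 and gen_fun: "k \<in> gen_index ==> \<beta> k \<in> C"
 and gen_localized: "k \<in> gen_index ==> localized (E k)"
 and tangent_gen: "q \<in> M ==> v \<in> TM q ==> v = (\<Sum>k\<in>gen_index. v (\<beta> k) *\<^sub>t E k q)"
proof -
 have "case generators of (I, e, b) => finite I \<and> (\<forall>k\<in>I. e k \<in> V \<and> b k \<in> C \<and> localized (e k)) \<and>
  (\<forall>q\<in>M. \<forall>v\<in>TM q. v = (\<Sum>k\<in>I. v (b k) *\<^sub>t e k q))"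
  unfolding generators_def by (rule someI_ex) (use generators_exist in simp)
 then have *: "finite gen_index \<and> (\<forall>k\<in>gen_index. E k \<in> V \<and> \<beta> k \<in> C \<and> localized (E k)) \<and>
  (\<forall>q\<in>M. \<forall>v\<in>TM q. v = (\<Sum>k\<in>gen_index. v (\<beta> k) *\<^sub>t E k q))"
  by (simp add: gen_index_def E_def \<beta>_def split_beta)
 show "finite gen_index" "k \<in> gen_index ==> E k \<in> V" "k \<in> gen_index ==> \<beta> k \<in> C" "k \<in> gen_index ==> localized (E k)"
  "q \<in> M ==> v \<in> TM q ==> v = (\<Sum>k\<in>gen_index. v (\<beta> k) *\<^sub>t E k q)"
  using * by blast+
qed

lemma field_gen: "X \<in> V ==> X = (\<Sum>k\<in>gen_index. (%p. X p (\<beta> k)) *\<^sub>f E k)"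
proof (intro ext)
 fix p f assume X: "X \<in> V"
 show "X p f = (\<Sum>k\<in>gen_index. (%p. X p (\<beta> k)) *\<^sub>f E k) p f"
 proof (cases "p \<in> M")
  case True
  have "X p f = (\<Sum>k\<in>gen_index. X p (\<beta> k) *\<^sub>t E k p) f"
   using tangent_gen[OF True vfield_tangent[OF X]] by (rule fun_cong)
  then show ?thesis by (simp add: sum_vfield_apply sum_tvec_apply fscale_def)
 next
  case False
  then show ?thesis by (simp add: sum_vfield_apply vfield_outside[OF X] fscale_def tscale_def)
 qed
qed

lemma field_gen_fun: "X \<in> V ==> X p f = (\<Sum>k\<in>gen_index. X p (\<beta> k) * E k p f)"
 using fun_cong[OF fun_cong[OF field_gen], of X p f] by (simp add: sum_vfield_apply fscale_def tscale_def)

end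

section \<open>Derivations in the two variables of a function on a product\<close>

definition jointly_smooth ::
 "('k, 'h::real_normed_vector) atlas => ('m, 'e::real_normed_vector) atlas => ('k => 'm => real) => bool" where
 "jointly_smooth B A F \<longleftrightarrow> (\<forall>c\<in>B. \<forall>d\<in>A.
  smooth_on (%z. F (inv_into (fst c) (snd c) (fst z)) (inv_into (fst d) (snd d) (snd z)))
   (snd c ` fst c \<times> snd d ` fst d))"

locale manifold_pair = L: manifold B + R: manifold A
 for B :: "('k, 'h::real_normed_vector) atlas" and A :: "('m, 'e::real_normed_vector) atlas"
begin

lemma jointly_smooth_swap: "jointly_smooth B A F ==> jointly_smooth A B (%q a. F a q)"
 unfolding jointly_smooth_def
proof (intro ballI)
 fix d c assume F: "\<forall>c\<in>B. \<forall>d\<in>A. smooth_on (%z. F (L.ic c (fst z)) (R.ic d (snd z))) (snd c ` fst c \<times> snd d ` fst d)"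
  and d: "d \<in> A" and c: "c \<in> B"
 have sw: "smooth_on (prod.swap :: 'e \<times> 'h => 'h \<times> 'e) (snd d ` fst d \<times> snd c ` fst c)"
  by (rule smooth_on_bounded_linear)
   (auto simp: prod.swap_def[abs_def] intro!: bounded_linear_Pair bounded_linear_fst bounded_linear_snd open_Times L.chart_open R.chart_open c d)
 have "smooth_on (%z. (%z. F (L.ic c (fst z)) (R.ic d (snd z))) (prod.swap z)) (snd d ` fst d \<times> snd c ` fst c)"
  by (rule smooth_on_compose[OF finite_dim_prod[OF L.fin R.fin] _ _ _ sw F[rule_format, OF c d]])
   (auto intro!: open_Times L.chart_open R.chart_open c d)
 then show "smooth_on (%z. F (L.ic c (snd z)) (R.ic d (fst z))) (snd d ` fst d \<times> snd c ` fst c)"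
  by simp
qed

lemma jointly_smooth_right:
 assumes F: "jointly_smooth B A F" and a: "a \<in> pts B"
 shows "F a \<in> smooth_functions A"
 unfolding R.smooth_iff
proof
 fix d assume d: "d \<in> A"
 obtain c where c: "c \<in> B" "a \<in> fst c" using L.chart_at[OF a] .
 have "smooth_on (%y. (snd c a, 0) + (0, y)) (snd d ` fst d)"
  by (intro smooth_on_add smooth_on_const smooth_on_bounded_linear bounded_linear_Pair
    bounded_linear_zero bounded_linear_ident R.chart_open d)
 then have s: "smooth_on (%y. (snd c a, y)) (snd d ` fst d)" by simp
 have "smooth_on (%y. (%z. F (L.ic c (fst z)) (R.ic d (snd z))) (snd c a, y)) (snd d ` fst d)"
  by (rule smooth_on_compose[OF finite_dim_prod[OF L.fin R.fin] R.chart_open[OF d] _ _ s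
     F[unfolded jointly_smooth_def, rule_format, OF c(1) d]])
   (use c in \<open>auto intro!: open_Times L.chart_open R.chart_open d\<close>)
 then show "smooth_on (%y. F a (R.ic d y)) (snd d ` fst d)" using c by simp
qed

lemma derivation_right_smooth:
 assumes F: "jointly_smooth B A F" and q: "q \<in> pts A" and v: "v \<in> tangent_space A q"
 shows "(%a. v (F a)) \<in> smooth_functions B"
  and "!!c d y. c \<in> B ==> d \<in> A ==> q \<in> fst d ==> v = coord_vec A d q y ==> a \<in> fst c ==>
   v (F a) = frechet_derivative (%z. F (L.ic c (fst z)) (R.ic d (snd z))) (at (snd c a, snd d q)) (0, y)"
proof -
 show val: "v (F a) = frechet_derivative (%z. F (L.ic c (fst z)) (R.ic d (snd z))) (at (snd c a, snd d q)) (0, y)"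
  if c: "c \<in> B" and d: "d \<in> A" "q \<in> fst d" and v: "v = coord_vec A d q y" and a: "a \<in> fst c" for c d y a
 proof -
  have aB: "a \<in> pts B" using a L.chart_subset[OF c] by blast
  let ?S = "snd c ` fst c \<times> snd d ` fst d"
  have oS: "open ?S" by (intro open_Times L.chart_open R.chart_open c d)
  have zS: "(snd c a, snd d q) \<in> ?S" using a d by auto
  note D = smooth_on_derivative(1)[OF oS F[unfolded jointly_smooth_def, rule_format, OF c d(1)] zS]
  have "((%y. (snd c a, y)) has_derivative (%y. (0, y))) (at (snd d q))"
   by (auto intro!: derivative_eq_intros)
  from has_derivative_compose[OF this D]
  show ?thesis unfolding v
   by (intro R.coord_vecI[OF d jointly_smooth_right[OF F aB]]) (simp add: c a)
 qed
 obtain d where d: "d \<in> A" "q \<in> fst d" using R.chart_at[OF q] .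
 obtain y where y: "v = coord_vec A d q y" using R.tangent_is_coord_vec[OF d v] .
 show "(%a. v (F a)) \<in> smooth_functions B"
  unfolding L.smooth_iff
 proof
  fix c assume c: "c \<in> B"
  let ?S = "snd c ` fst c \<times> snd d ` fst d"
  let ?D = "%z. frechet_derivative (%z. F (L.ic c (fst z)) (R.ic d (snd z))) (at z) (0, y)"
  have oS: "open ?S" by (intro open_Times L.chart_open R.chart_open c d)
  have "smooth_on (%x. (0, snd d q) + (x, 0)) (snd c ` fst c)"
   by (intro smooth_on_add smooth_on_const smooth_on_bounded_linear bounded_linear_Pair
     bounded_linear_zero bounded_linear_ident L.chart_open c)
  then have s: "smooth_on (%x. (x, snd d q)) (snd c ` fst c)" by simp
  have "smooth_on (%x. ?D (x, snd d q)) (snd c ` fst c)"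
   by (rule smooth_on_compose[OF finite_dim_prod[OF L.fin R.fin] L.chart_open[OF c] oS _ s
      smooth_on_derivative(2)[OF oS F[unfolded jointly_smooth_def, rule_format, OF c d(1)]]])
    (use d in auto)
  moreover have "v (F (L.ic c x)) = ?D (x, snd d q)" if "x \<in> snd c ` fst c" for x
   using val[OF c d y L.ic_in[OF that]] L.chart_ic[OF that] by simp
  ultimately show "smooth_on (%x. v (F (L.ic c x))) (snd c ` fst c)"
   using smooth_on_cong[OF L.chart_open[OF c], of "%x. v (F (L.ic c x))" "%x. ?D (x, snd d q)"] by blast
 qed
qed

lemma derivation_left_value:
 assumes F: "jointly_smooth B A F" and a: "c \<in> B" "a \<in> fst c"
  and \<xi>: "\<xi> = coord_vec B c a x" and d: "d \<in> A" "q \<in> fst d"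
 shows "\<xi> (%a. F a q) = frechet_derivative (%z. F (L.ic c (fst z)) (R.ic d (snd z))) (at (snd c a, snd d q)) (x, 0)"
proof -
 interpret S: manifold_pair A B ..
 have qA: "q \<in> pts A" using d R.chart_subset by blast
 let ?S = "snd c ` fst c \<times> snd d ` fst d"
 have oS: "open ?S" by (intro open_Times L.chart_open R.chart_open a d)
 have zS: "(snd c a, snd d q) \<in> ?S" using a d by auto
 note D = smooth_on_derivative(1)[OF oS F[unfolded jointly_smooth_def, rule_format, OF a(1) d(1)] zS]
 have "((%x. (x, snd d q)) has_derivative (%x. (x, 0))) (at (snd c a))"
  by (auto intro!: derivative_eq_intros)
 from has_derivative_compose[OF this D]
 show ?thesis unfolding \<xi>
  by (intro L.coord_vecI[OF a S.jointly_smooth_right[OF jointly_smooth_swap[OF F] qA]]) (simp add: d)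
qed

text \<open>In a product of charts both sides are mixed second derivatives of the same function.\<close>

lemma derivations_commute:
 assumes F: "jointly_smooth B A F" and q: "q \<in> pts A" and v: "v \<in> tangent_space A q"
  and a: "a \<in> pts B" and \<xi>: "\<xi> \<in> tangent_space B a"
 shows "\<xi> (%a. v (F a)) = v (%q. \<xi> (%a. F a q))"
proof -
 interpret S: manifold_pair A B ..
 obtain d where d: "d \<in> A" "q \<in> fst d" using R.chart_at[OF q] .
 obtain y where y: "v = coord_vec A d q y" using R.tangent_is_coord_vec[OF d v] .
 obtain c where c: "c \<in> B" "a \<in> fst c" using L.chart_at[OF a] .
 obtain x where x: "\<xi> = coord_vec B c a x" using L.tangent_is_coord_vec[OF c \<xi>] .
 let ?F = "%z. F (L.ic c (fst z)) (R.ic d (snd z))"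
 let ?S = "snd c ` fst c \<times> snd d ` fst d" and ?z = "(snd c a, snd d q)"
 have oS: "open ?S" by (intro open_Times L.chart_open R.chart_open c d)
 have zS: "?z \<in> ?S" using c d by auto
 have sF: "smooth_on ?F ?S" by (rule F[unfolded jointly_smooth_def, rule_format, OF c(1) d(1)])
 note fP = finite_dim_prod[OF L.fin R.fin]
 have 1: "\<xi> (%a. v (F a)) = frechet_derivative (%z. frechet_derivative ?F (at z) (0, y)) (at ?z) (x, 0)"
  unfolding x
 proof (rule L.coord_vecI[OF c derivation_right_smooth(1)[OF F q v]])
  have "((%x. (x, snd d q)) has_derivative (%x. (x, 0))) (at (snd c a))"
   by (auto intro!: derivative_eq_intros)
  from has_derivative_compose[OF this, of "%z. frechet_derivative ?F (at z) (0, y)",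
    OF smooth_on_derivative(1)[OF oS smooth_on_derivative(2)[OF oS sF] zS]]
  show "((%x. v (F (L.ic c x))) has_derivative
   (%x. frechet_derivative (%z. frechet_derivative ?F (at z) (0, y)) (at ?z) (x, 0))) (at (snd c a))"
  proof (rule has_derivative_transform_within_open[OF _ L.chart_open[OF c(1)]])
   show "snd c a \<in> snd c ` fst c" using c by auto
   show "frechet_derivative ?F (at (x, snd d q)) (0, y) = v (F (L.ic c x))" if "x \<in> snd c ` fst c" for x
    using derivation_right_smooth(2)[OF F q v c(1) d y L.ic_in[OF that]] L.chart_ic[OF that] by simp
  qed
 qed
 have 2: "v (%q. \<xi> (%a. F a q)) = frechet_derivative (%z. frechet_derivative ?F (at z) (x, 0)) (at ?z) (0, y)"
  unfolding y
 proof (rule R.coord_vecI[OF d S.derivation_right_smooth(1)[OF jointly_smooth_swap[OF F] a \<xi>]])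
  have "((%y. (snd c a, y)) has_derivative (%y. (0, y))) (at (snd d q))"
   by (auto intro!: derivative_eq_intros)
  from has_derivative_compose[OF this, of "%z. frechet_derivative ?F (at z) (x, 0)",
    OF smooth_on_derivative(1)[OF oS smooth_on_derivative(2)[OF oS sF] zS]]
  show "((%y. \<xi> (%a. F a (R.ic d y))) has_derivative
   (%y. frechet_derivative (%z. frechet_derivative ?F (at z) (x, 0)) (at ?z) (0, y))) (at (snd d q))"
  proof (rule has_derivative_transform_within_open[OF _ R.chart_open[OF d(1)]])
   show "snd d q \<in> snd d ` fst d" using d by auto
   show "frechet_derivative ?F (at (snd c a, y)) (x, 0) = \<xi> (%a. F a (R.ic d y))" if "y \<in> snd d ` fst d" for y
    using derivation_left_value[OF F c x d(1) R.ic_in[OF that]] R.chart_ic[OF that] by simp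
  qed
 qed
 show ?thesis unfolding 1 2
  by (rule symmetric_second_derivative[OF fP oS zS sF])
qed

lemma jointly_smooth_action:
 assumes act: "smooth_map (prod_atlas B A) A (%(a, p). act a p)" and w: "w \<in> smooth_functions A"
 shows "jointly_smooth B A (%a p. w (act a p))"
 unfolding jointly_smooth_def
proof (intro ballI)
 fix c d assume c: "c \<in> B" and d: "d \<in> A"
 let ?S = "snd c ` fst c \<times> snd d ` fst d"
 have oS: "open ?S" by (intro open_Times L.chart_open R.chart_open c d)
 let ?P = "map_prod (snd c) (snd d)"
 have P: "(fst c \<times> fst d, ?P) \<in> prod_atlas B A"
  using c d unfolding prod_atlas_def by (cases c; cases d) auto
 have inj: "inj_on ?P (fst c \<times> fst d)"
  using L.chart_inj[OF c] R.chart_inj[OF d] by (auto simp: inj_on_def)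
 have inv': "inv_into (fst c \<times> fst d) ?P (snd c a, snd d p) = (a, p)" if "a \<in> fst c" "p \<in> fst d" for a p
  using inv_into_f_f[OF inj, of "(a, p)"] that by simp
 have inv: "inv_into (fst c \<times> fst d) ?P z = (L.ic c (fst z), R.ic d (snd z))" if "z \<in> ?S" for z
 proof (rule inv_into_f_eq[OF inj])
  show "(L.ic c (fst z), R.ic d (snd z)) \<in> fst c \<times> fst d"
   using that L.ic_in[of "fst z" c] R.ic_in[of "snd z" d] by (simp add: mem_Times_iff)
  show "?P (L.ic c (fst z), R.ic d (snd z)) = z"
   using that L.chart_ic[of "fst z" c] R.chart_ic[of "snd z" d] by (simp add: mem_Times_iff)
 qed
 show "smooth_on (%z. w (act (L.ic c (fst z)) (R.ic d (snd z)))) ?S"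
 proof (rule smooth_on_local[OF oS])
  fix z assume z: "z \<in> ?S"
  then obtain a p where ap: "a \<in> fst c" "p \<in> fst d" "z = (snd c a, snd d p)" by auto
  have "(a, p) \<in> pts (prod_atlas B A)" using P ap by (force simp: pts_def)
  then have "act a p \<in> pts A" using act unfolding smooth_map_def by auto
  then obtain e where e: "e \<in> A" "act a p \<in> fst e" using R.chart_at by blast
  let ?F = "%(a, p). act a p"
  let ?W = "?P ` ((fst c \<times> fst d) \<inter> ?F -` fst e)"
  have W: "open ?W \<and> smooth_on (snd e \<circ> ?F \<circ> inv_into (fst c \<times> fst d) ?P) ?W"
   using act P e(1) unfolding smooth_map_def by (cases e) fastforce
  have WS: "?W \<subseteq> ?S" by auto
  have zW: "z \<in> ?W" using ap e by force
  have im: "(snd e \<circ> ?F \<circ> inv_into (fst c \<times> fst d) ?P) ` ?W \<subseteq> snd e ` fst e"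
   by (auto simp: inv')
  have 1: "smooth_on (%x. w (R.ic e ((snd e \<circ> ?F \<circ> inv_into (fst c \<times> fst d) ?P) x))) ?W"
   by (rule smooth_on_compose[OF R.fin _ R.chart_open[OF e(1)] im _ R.smooth_in_chart[OF w e(1)]])
    (use W in auto)
  have 2: "w (R.ic e ((snd e \<circ> ?F \<circ> inv_into (fst c \<times> fst d) ?P) x)) = w (act (L.ic c (fst x)) (R.ic d (snd x)))"
   if x: "x \<in> ?W" for x
  proof -
   have i: "inv_into (fst c \<times> fst d) ?P x = (L.ic c (fst x), R.ic d (snd x))"
    by (rule inv) (use WS x in blast)
   have "inv_into (fst c \<times> fst d) ?P x \<in> ?F -` fst e" using x by (auto simp: inv')
   then have "act (L.ic c (fst x)) (R.ic d (snd x)) \<in> fst e" by (simp add: i)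
   then show ?thesis by (simp add: i e)
  qed
  have "smooth_on (%z. w (act (L.ic c (fst z)) (R.ic d (snd z)))) ?W"
   by (rule iffD1[OF smooth_on_cong 1]) (use W 2 in auto)
  then show "\<exists>Z. open Z \<and> z \<in> Z \<and> Z \<subseteq> ?S \<and> smooth_on (%z. w (act (L.ic c (fst z)) (R.ic d (snd z)))) Z"
   using W WS zW by blast
 qed
qed

end

section \<open>Tensors and traces\<close>

context compact_manifold
begin

lemma der_add: "X \<in> V ==> f \<in> C ==> g \<in> C ==> X p (%x. f x + g x) = X p f + X p g"
 by (rule tangent_add[OF vfield_tangent])

lemma der_mult: "X \<in> V ==> f \<in> C ==> g \<in> C ==> X p (%x. f x * g x) = f p * X p g + g p * X p f"
 by (rule tangent_mult[OF vfield_tangent])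

lemma der_minus: "X \<in> V ==> f \<in> C ==> X p (%x. - f x) = - X p f"
 by (rule tangent_minus[OF vfield_tangent])

lemma der_sum: "X \<in> V ==> (!!i. i \<in> I ==> f i \<in> C) ==> X p (%x. \<Sum>i\<in>I. f i x) = (\<Sum>i\<in>I. X p (f i))"
 by (rule tangent_sum[OF vfield_tangent])

lemma tangent_cong:
 assumes "p \<in> M" "v \<in> TM p" "f \<in> C" "g \<in> C" "!!q. q \<in> M ==> f q = g q"
 shows "v f = v g"
 by (rule tangent_local[OF assms(2-4), of M]) (use assms openin_topspace[of T] topspace_eq in auto)

definition tensor_endo :: "('m vfield => 'm vfield) => bool" where
 "tensor_endo S \<longleftrightarrow> (\<forall>X\<in>V. S X \<in> V) \<and> (\<forall>X\<in>V. \<forall>Y\<in>V. S (X + Y) = S X + S Y) \<and>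
  (\<forall>X\<in>V. \<forall>h\<in>C. S (h *\<^sub>f X) = h *\<^sub>f S X)"

lemma tensor_endoD:
 assumes "tensor_endo S"
 shows tensor_endo_field: "X \<in> V ==> S X \<in> V"
  and tensor_endo_add: "X \<in> V ==> Y \<in> V ==> S (X + Y) = S X + S Y"
  and tensor_endo_fscale: "X \<in> V ==> h \<in> C ==> S (h *\<^sub>f X) = h *\<^sub>f S X"
 using assms unfolding tensor_endo_def by blast+

lemma tensor_endoI:
 assumes "!!X. X \<in> V ==> S X \<in> V" "!!X Y. X \<in> V ==> Y \<in> V ==> S (X + Y) = S X + S Y"
  "!!X h. X \<in> V ==> h \<in> C ==> S (h *\<^sub>f X) = h *\<^sub>f S X"
 shows "tensor_endo S"
 using assms unfolding tensor_endo_def by blast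

lemma fscale_simps:
 "(h *\<^sub>f X) p = h p *\<^sub>t X p" "(h *\<^sub>f X) p f = h p * X p f" "(c *\<^sub>t v) f = c * v f"
 by (simp_all add: fscale_def tscale_def)

lemma fscale_diff: "h *\<^sub>f (X - Y) = h *\<^sub>f X - h *\<^sub>f Y"
 by (simp add: fun_eq_iff fscale_simps algebra_simps)

lemma fscale_minus1: "(%p. -1) *\<^sub>f X = - X"
 by (simp add: fun_eq_iff fscale_simps)

lemma tensor_endo_minus: "tensor_endo S ==> X \<in> V ==> S (- X) = - S X"
 using tensor_endo_fscale[of S X "%p. -1"] by (simp add: fscale_minus1)

lemma tensor_endo_diff: "tensor_endo S ==> X \<in> V ==> Y \<in> V ==> S (X - Y) = S X - S Y"
 using tensor_endo_add[of S X "- Y"] tensor_endo_minus[of S Y] vfield_minus[of Y] by simp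

lemma tensor_endo_0: "tensor_endo S ==> S 0 = 0"
 using tensor_endo_diff[of S 0 0] by simp

lemma tensor_endo_sum:
 assumes S: "tensor_endo S" and "!!i. i \<in> I ==> X i \<in> V"
 shows "S (\<Sum>i\<in>I. X i) = (\<Sum>i\<in>I. S (X i))"
 using assms(2)
proof (induction I rule: infinite_finite_induct)
 case (insert i I)
 have "X i \<in> V" "(\<Sum>i\<in>I. X i) \<in> V" by (auto intro!: vfield_sum insert.prems)
 from tensor_endo_add[OF S this] insert show ?case
  by (simp only: sum.insert insert_iff simp_thms)
qed (simp_all add: tensor_endo_0[OF S])

lemma tensor_endo_gen:
 assumes S: "tensor_endo S" and X: "X \<in> V"
 shows "S X p f = (\<Sum>k\<in>gen_index. X p (\<beta> k) * S (E k) p f)"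
proof -
 have "S X = S (\<Sum>k\<in>gen_index. (%p. X p (\<beta> k)) *\<^sub>f E k)"
  using field_gen[OF X] by (rule arg_cong)
 also have "... = (\<Sum>k\<in>gen_index. S ((%p. X p (\<beta> k)) *\<^sub>f E k))"
  by (rule tensor_endo_sum[OF S]) (intro vfield_fscale vfield_smooth[OF X] gen_fun gen_field)
 also have "... = (\<Sum>k\<in>gen_index. (%p. X p (\<beta> k)) *\<^sub>f S (E k))"
  by (rule sum.cong[OF refl]) (intro tensor_endo_fscale[OF S] vfield_smooth[OF X] gen_fun gen_field)
 finally show ?thesis by (simp add: sum_vfield_apply fscale_simps)
qed

lemma tensor_endo_at:
 assumes "tensor_endo S" "X \<in> V" "Y \<in> V" "X p = Y p"
 shows "S X p = S Y p"
 by (rule ext) (simp add: tensor_endo_gen[OF assms(1,2)] tensor_endo_gen[OF assms(1,3)] assms(4))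

text \<open>The generators and their dual functions do not form a basis with its dual basis, but the sum below is the
 usual trace in every basis; no frame has to exist globally.\<close>

definition trace :: "('m vfield => 'm vfield) => 'm => real" where
 "trace S p = (\<Sum>k\<in>gen_index. S (E k) p (\<beta> k))"

lemma trace_smooth: "tensor_endo S ==> trace S \<in> C"
 unfolding trace_def[abs_def]
 by (rule smooth_sum) (rule vfield_smooth[OF tensor_endo_field[OF _ gen_field] gen_fun])

lemma trace_cong: "(!!X. X \<in> V ==> S X p = S' X p) ==> trace S p = trace S' p"
 unfolding trace_def by (rule sum.cong[OF refl]) (simp add: gen_field)

lemma trace_add: "trace (%X. S X + S' X) p = trace S p + trace S' p"
 by (simp add: trace_def sum.distrib)

lemma trace_diff: "trace (%X. S X - S' X) p = trace S p - trace S' p"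
 by (simp add: trace_def sum_subtractf)

lemma trace_minus: "trace (%X. - S X) p = - trace S p"
 by (simp add: trace_def sum_negf)

lemma trace_fscale: "trace (%X. h *\<^sub>f S X) p = h p * trace S p"
 by (simp add: trace_def sum_distrib_left fscale_simps)

lemma trace_commute:
 assumes S: "tensor_endo S" and S': "tensor_endo S'"
 shows "trace (%X. S (S' X)) p = trace (%X. S' (S X)) p"
proof -
 have "trace (%X. S (S' X)) p = (\<Sum>k\<in>gen_index. \<Sum>l\<in>gen_index. S' (E k) p (\<beta> l) * S (E l) p (\<beta> k))"
  unfolding trace_def
  by (rule sum.cong[OF refl]) (rule tensor_endo_gen[OF S tensor_endo_field[OF S' gen_field]])
 also have "... = (\<Sum>k\<in>gen_index. \<Sum>l\<in>gen_index. S' (E l) p (\<beta> k) * S (E k) p (\<beta> l))"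
  by (rule sum.swap)
 also have "... = (\<Sum>k\<in>gen_index. \<Sum>l\<in>gen_index. S (E k) p (\<beta> l) * S' (E l) p (\<beta> k))"
  by (simp add: mult.commute)
 also have "... = trace (%X. S' (S X)) p"
  unfolding trace_def
  by (rule sum.cong[OF refl]) (rule tensor_endo_gen[OF S' tensor_endo_field[OF S gen_field], symmetric])
 finally show ?thesis .
qed

text \<open>Bilinear tensors, cut off outside the manifold so that they are bilinear as functions.\<close>

definition pair :: "'m form2 => 'm vfield => 'm vfield => 'm => real" where
 "pair g X Y p = (if p \<in> M then g p (X p) (Y p) else 0)"

lemma bilinear_tensorD:
 assumes "bilinear_tensor A g" "p \<in> M" "u \<in> TM p" "v \<in> TM p" "w \<in> TM p"
 shows "g p (u + v) w = g p u w + g p v w" "g p w (u + v) = g p w u + g p w v"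
  "g p (c *\<^sub>t u) w = c * g p u w" "g p u (c *\<^sub>t w) = c * g p u w"
 using assms unfolding bilinear_tensor_def by blast+

lemma bilinear_minus:
 assumes "bilinear_tensor A g" "p \<in> M" "u \<in> TM p" "w \<in> TM p"
 shows "g p (- u) w = - g p u w" "g p u (- w) = - g p u w"
proof -
 have m: "- v = (-1) *\<^sub>t v" for v :: "'m tvec" by (simp add: tscale_def fun_eq_iff)
 show "g p (- u) w = - g p u w" "g p u (- w) = - g p u w"
  unfolding m using bilinear_tensorD(3)[OF assms(1-3,3,4), of "-1"] bilinear_tensorD(4)[OF assms(1-3,3,4), of "-1"] by simp_all
qed

lemma bilinear_0:
 assumes "bilinear_tensor A g" "p \<in> M" "w \<in> TM p"
 shows "g p 0 w = 0" "g p w 0 = 0"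
proof -
 have z: "(0 :: 'm tvec) = 0 *\<^sub>t 0" by (simp add: tscale_def fun_eq_iff)
 show "g p 0 w = 0" "g p w 0 = 0"
  using bilinear_tensorD(3)[OF assms(1,2) tangent_space_0 tangent_space_0 assms(3), of 0]
   bilinear_tensorD(4)[OF assms(1,2,3,3) tangent_space_0, of 0] z by simp_all
qed

lemma bilinear_sum:
 assumes g: "bilinear_tensor A g" "p \<in> M" and w: "w \<in> TM p"
  and u: "!!i. i \<in> I ==> u i \<in> TM p"
 shows "g p (\<Sum>i\<in>I. c i *\<^sub>t u i) w = (\<Sum>i\<in>I. c i * g p (u i) w)"
  and "g p w (\<Sum>i\<in>I. c i *\<^sub>t u i) = (\<Sum>i\<in>I. c i * g p w (u i))"
proof -
 have t: "(\<Sum>i\<in>J. c i *\<^sub>t u i) \<in> TM p" if "J \<subseteq> I" for J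
  by (intro tangent_space_sum tangent_space_scale u) (use that in auto)
 have "g p (\<Sum>i\<in>J. c i *\<^sub>t u i) w = (\<Sum>i\<in>J. c i * g p (u i) w) \<and>
  g p w (\<Sum>i\<in>J. c i *\<^sub>t u i) = (\<Sum>i\<in>J. c i * g p w (u i))" if "J \<subseteq> I" for J
  using that
 proof (induction J rule: infinite_finite_induct)
  case (insert i J)
  have "u i \<in> TM p" using u insert by auto
  then show ?case
   using insert t[of J] bilinear_tensorD[OF g tangent_space_scale _ w, of "u i" "\<Sum>i\<in>J. c i *\<^sub>t u i" "c i"]
    bilinear_tensorD(3)[OF g, of "u i" "u i" w "c i"] bilinear_tensorD(4)[OF g, of w w "u i" "c i"] w
   by (simp del: plus_fun_apply)
 qed (simp_all add: bilinear_0[OF g w])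
 then show "g p (\<Sum>i\<in>I. c i *\<^sub>t u i) w = (\<Sum>i\<in>I. c i * g p (u i) w)"
  "g p w (\<Sum>i\<in>I. c i *\<^sub>t u i) = (\<Sum>i\<in>I. c i * g p w (u i))" by blast+
qed

lemma pair_smooth: "bilinear_tensor A g ==> X \<in> V ==> Y \<in> V ==> pair g X Y \<in> C"
 by (rule smooth_cong[of "%p. g p (X p) (Y p)"]) (auto simp: pair_def bilinear_tensor_def)

lemma pair_simps:
 assumes g: "bilinear_tensor A g" and X: "X \<in> V" and Y: "Y \<in> V"
 shows "Z \<in> V ==> pair g (X + Y) Z = (%p. pair g X Z p + pair g Y Z p)"
  "Z \<in> V ==> pair g Z (X + Y) = (%p. pair g Z X p + pair g Z Y p)"
  "Z \<in> V ==> pair g (X - Y) Z = (%p. pair g X Z p - pair g Y Z p)"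
  "Z \<in> V ==> pair g Z (X - Y) = (%p. pair g Z X p - pair g Z Y p)"
  "pair g (h *\<^sub>f X) Y = (%p. h p * pair g X Y p)"
  "pair g X (h *\<^sub>f Y) = (%p. h p * pair g X Y p)"
  "pair g (- X) Y = (%p. - pair g X Y p)"
  "pair g X (- Y) = (%p. - pair g X Y p)"
proof -
 have d: "X - Y = X + - Y" by simp
 note t = vfield_tangent
 show "Z \<in> V ==> pair g (X + Y) Z = (%p. pair g X Z p + pair g Y Z p)"
  "Z \<in> V ==> pair g Z (X + Y) = (%p. pair g Z X p + pair g Z Y p)"
  "pair g (h *\<^sub>f X) Y = (%p. h p * pair g X Y p)"
  "pair g X (h *\<^sub>f Y) = (%p. h p * pair g X Y p)"
  "pair g (- X) Y = (%p. - pair g X Y p)"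
  "pair g X (- Y) = (%p. - pair g X Y p)"
  by (rule ext, simp add: pair_def fscale_simps bilinear_tensorD(1,2)[OF g _ t[OF X] t[OF Y] t] bilinear_minus[OF g _ t[OF X] t[OF Y]]
    bilinear_tensorD(3,4)[OF g _ t[OF X] t[OF X] t[OF Y]])+
 show "Z \<in> V ==> pair g (X - Y) Z = (%p. pair g X Z p - pair g Y Z p)"
  unfolding d
  by (rule ext, simp add: pair_def bilinear_tensorD(1)[OF g _ t[OF X] t[OF vfield_minus[OF Y]] t, simplified] bilinear_minus[OF g _ t[OF Y] t])
 show "Z \<in> V ==> pair g Z (X - Y) = (%p. pair g Z X p - pair g Z Y p)"
  unfolding d
  by (rule ext, simp add: pair_def bilinear_tensorD(2)[OF g _ t[OF X] t[OF vfield_minus[OF Y]] t, simplified] bilinear_minus[OF g _ t t[OF Y]])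
qed

end

section \<open>Orthonormal bases and adapted frames\<close>

locale metric = compact_manifold A for A :: "('m, 'e::euclidean_space) atlas" +
 fixes g :: "'m form2"
 assumes metric: "riemannian_metric A g"
begin

lemma g_tensor: "bilinear_tensor A g"
 and g_sym: "p \<in> M ==> u \<in> TM p ==> v \<in> TM p ==> g p u v = g p v u"
 and g_pos: "p \<in> M ==> u \<in> TM p ==> u \<noteq> 0 ==> g p u u > 0"
 using metric unfolding riemannian_metric_def by blast+

lemmas g_lin = bilinear_tensorD[OF g_tensor] bilinear_minus[OF g_tensor] bilinear_0[OF g_tensor]
lemmas g_sum = bilinear_sum[OF g_tensor]

lemma g_nonneg: "p \<in> M ==> u \<in> TM p ==> g p u u \<ge> 0"
 using g_pos[of p u] g_lin(7)[of p 0] tangent_space_0 by (cases "u = 0") (auto simp: less_imp_le)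

lemma nondegenerate:
 assumes p: "p \<in> M" and "u \<in> TM p" "v \<in> TM p"
  and eq: "!!w. w \<in> TM p ==> g p u w = g p v w"
 shows "u = v"
proof -
 have t: "u - v \<in> TM p" using assms tangent_space_diff by blast
 have "g p (u + - v) (u - v) = g p u (u - v) + g p (- v) (u - v)"
  by (rule g_lin(1)[OF p]) (use assms t tangent_space_minus in auto)
 also have "... = 0" using eq[OF t] g_lin(5)[OF p assms(3) t] by simp
 finally have "g p (u - v) (u - v) = 0" by simp
 then show ?thesis using g_pos[OF p t] by force
qed

lemma field_eqI:
 assumes X: "X \<in> V" and Y: "Y \<in> V" and eq: "!!Z p. Z \<in> V ==> p \<in> M ==> pair g X Z p = pair g Y Z p"
 shows "X = Y"
proof
 fix p
 show "X p = Y p"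
 proof (cases "p \<in> M")
  case True
  show ?thesis
  proof (rule nondegenerate[OF True vfield_tangent[OF X] vfield_tangent[OF Y]])
   fix w assume "w \<in> TM p"
   then obtain Z where "Z \<in> V" "Z p = w" by (rule tangent_extend[OF True]) (rule that)
   then show "g p (X p) w = g p (Y p) w" using eq[of Z p] True by (simp add: pair_def)
  qed
 qed (simp add: vfield_outside X Y)
qed

definition orthonormal :: "'m => nat => (nat => 'm tvec) => bool" where
 "orthonormal p k u \<longleftrightarrow> (\<forall>i<k. u i \<in> TM p) \<and>
  (\<forall>i<k. \<forall>j<k. g p (u i) (u j) = (if i = j then 1 else 0))"

lemma orthonormal_coeff:
 assumes p: "p \<in> M" and u: "orthonormal p k u" and j: "j < k"
 shows "g p (\<Sum>i<k. c i *\<^sub>t u i) (u j) = c j"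
proof -
 have "g p (\<Sum>i<k. c i *\<^sub>t u i) (u j) = (\<Sum>i<k. c i * g p (u i) (u j))"
  by (rule g_sum(1)[OF p]) (use u j in \<open>auto simp: orthonormal_def\<close>)
 also have "... = (\<Sum>i<k. if i = j then c i else 0)"
  by (rule sum.cong) (use u j in \<open>auto simp: orthonormal_def\<close>)
 finally show ?thesis using j by simp
qed

lemma orthonormal_independent:
 assumes p: "p \<in> M" and u: "orthonormal p k u" and c: "c \<in> A" "p \<in> fst c"
  and y: "!!i. i < k ==> u i = coord_vec A c p (y i)"
 shows "inj_on y {..<k}" and "independent (y ` {..<k})"
proof -
 show inj: "inj_on y {..<k}"
 proof (rule inj_onI)
  fix i j assume ij: "i \<in> {..<k}" "j \<in> {..<k}" "y i = y j"
  then have "u i = u j" using y by simp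
  then have "g p (u i) (u j) = g p (u i) (u i)" by simp
  then show "i = j" using u ij unfolding orthonormal_def by (metis lessThan_iff zero_neq_one)
 qed
 show "independent (y ` {..<k})"
 proof (rule independent_if_scalars_zero)
  fix f x assume s: "(\<Sum>x\<in>y ` {..<k}. f x *\<^sub>R x) = 0" and x: "x \<in> y ` {..<k}"
  then obtain j where j: "j < k" "x = y j" by auto
  have "(\<Sum>i<k. f (y i) *\<^sub>R y i) = 0" using s by (simp add: sum.reindex[OF inj])
  then have "(\<Sum>i<k. f (y i) *\<^sub>t u i) = 0"
   using coord_vec_sum[OF c, of "%i. f (y i)" y "{..<k}"] y coord_vec_linear(3)[OF c] by simp
  then have "f (y j) = g p 0 (u j)" using orthonormal_coeff[OF p u j(1), of "%i. f (y i)"] by simp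
  also have "... = 0" by (rule g_lin(7)[OF p]) (use u j in \<open>auto simp: orthonormal_def\<close>)
  finally show "f x = 0" using j by simp
 qed simp
qed

lemma orthonormal_expand:
 assumes p: "p \<in> M" and u: "orthonormal p DIM('e) u" and v: "v \<in> TM p"
 shows "v = (\<Sum>i<DIM('e). g p v (u i) *\<^sub>t u i)"
proof -
 obtain c where c: "c \<in> A" "p \<in> fst c" using chart_at[OF p] .
 have "\<forall>i<DIM('e). \<exists>y. u i = coord_vec A c p y"
 proof (intro allI impI)
  fix i assume "i < DIM('e)"
  then have "u i \<in> TM p" using u by (simp add: orthonormal_def)
  then obtain y where "u i = coord_vec A c p y" by (rule tangent_is_coord_vec[OF c])
  then show "\<exists>y. u i = coord_vec A c p y" ..
 qed
 then obtain y where y: "!!i. i < DIM('e) ==> u i = coord_vec A c p (y i)" by metis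
 note ind = orthonormal_independent[OF p u c y]
 have "card (y ` {..<DIM('e)}) = DIM('e)" by (simp add: card_image ind(1))
 then have sp: "span (y ` {..<DIM('e)}) = UNIV"
  using card_ge_dim_independent[of "y ` {..<DIM('e)}" UNIV] ind(2) by auto
 obtain z where z: "v = coord_vec A c p z" using tangent_is_coord_vec[OF c v] .
 have "z \<in> span (y ` {..<DIM('e)})" using sp by simp
 then obtain f where "z = (\<Sum>x\<in>y ` {..<DIM('e)}. f x *\<^sub>R x)"
  using span_finite[of "y ` {..<DIM('e)}"] by auto
 then have "z = (\<Sum>i<DIM('e). f (y i) *\<^sub>R y i)" by (simp add: sum.reindex[OF ind(1)])
 then have ve: "v = (\<Sum>i<DIM('e). f (y i) *\<^sub>t u i)"
  unfolding z using coord_vec_sum[OF c, of "%i. f (y i)" y "{..<DIM('e)}"] y by simp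
 have "g p v (u j) = f (y j)" if "j < DIM('e)" for j
  unfolding ve by (rule orthonormal_coeff[OF p u that])
 then show ?thesis by (subst ve) (rule sum.cong, auto)
qed

lemma orthonormal_extend:
 assumes p: "p \<in> M" and u: "orthonormal p k u" and k: "k < DIM('e)"
 obtains x where "x \<in> TM p" "x \<noteq> 0" "!!i. i < k ==> g p x (u i) = 0"
proof -
 obtain c where c: "c \<in> A" "p \<in> fst c" using chart_at[OF p] .
 have "\<forall>i<k. \<exists>y. u i = coord_vec A c p y"
 proof (intro allI impI)
  fix i assume "i < k"
  then have "u i \<in> TM p" using u by (simp add: orthonormal_def)
  then obtain y where "u i = coord_vec A c p y" by (rule tangent_is_coord_vec[OF c])
  then show "\<exists>y. u i = coord_vec A c p y" ..
 qed
 then obtain y where y: "!!i. i < k ==> u i = coord_vec A c p (y i)" by metis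
 have "dim (span (y ` {..<k})) \<le> k"
  by (metis card_image_le card_lessThan dim_le_card finite_imageI finite_lessThan order_trans span_superset dim_span)
 then have "span (y ` {..<k}) \<noteq> UNIV" using k by (metis dim_UNIV not_le)
 then obtain z where z: "z \<notin> span (y ` {..<k})" by blast
 let ?v = "coord_vec A c p z"
 let ?x = "?v - (\<Sum>i<k. g p ?v (u i) *\<^sub>t u i)"
 have ut: "u i \<in> TM p" if "i < k" for i using u that by (simp add: orthonormal_def)
 have v: "?v \<in> TM p" by (rule coord_vec_tangent[OF c])
 have s: "(\<Sum>i<k. g p ?v (u i) *\<^sub>t u i) \<in> TM p"
  by (intro tangent_space_sum tangent_space_scale ut) simp
 show ?thesis
 proof (rule that[of ?x])
  show "?x \<in> TM p" by (rule tangent_space_diff[OF v s])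
  show "?x \<noteq> 0"
  proof
   assume "?x = 0"
   then have "?v = (\<Sum>i<k. g p ?v (u i) *\<^sub>t u i)" by simp
   also have "... = coord_vec A c p (\<Sum>i<k. g p ?v (u i) *\<^sub>R y i)"
    unfolding coord_vec_sum[OF c] by (rule sum.cong) (simp_all add: y)
   finally have "z = (\<Sum>i<k. g p ?v (u i) *\<^sub>R y i)" by (rule coord_vec_inj[OF c])
   also have "... \<in> span (y ` {..<k})" by (intro span_sum span_scale span_base) auto
   finally show False using z by simp
  qed
  fix i assume i: "i < k"
  have "g p (?v + - (\<Sum>i<k. g p ?v (u i) *\<^sub>t u i)) (u i) = g p ?v (u i) + g p (- (\<Sum>i<k. g p ?v (u i) *\<^sub>t u i)) (u i)"
   by (rule g_lin(1)[OF p v tangent_space_minus[OF s] ut[OF i]])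
  also have "... = 0" using g_lin(5)[OF p s ut[OF i]] orthonormal_coeff[OF p u i] by simp
  finally show "g p ?x (u i) = 0" by simp
 qed
qed

lemma trace_orthonormal:
 assumes S: "tensor_endo S" and p: "p \<in> M" and e: "!!i. i < DIM('e) ==> e i \<in> V"
  and u: "orthonormal p DIM('e) (%i. e i p)"
 shows "trace S p = (\<Sum>i<DIM('e). g p (S (e i) p) (e i p))"
proof -
 have St: "S X p \<in> TM p" if "X \<in> V" for X by (rule vfield_tangent[OF tensor_endo_field[OF S that]])
 have et: "e i p \<in> TM p" if "i < DIM('e)" for i by (rule vfield_tangent[OF e[OF that]])
 have "g p (S (e i) p) (e i p) = (\<Sum>k\<in>gen_index. e i p (\<beta> k) * g p (S (E k) p) (e i p))" if i: "i < DIM('e)" for i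
 proof -
  have "S (e i) p = (\<Sum>k\<in>gen_index. e i p (\<beta> k) *\<^sub>t S (E k) p)"
   by (rule ext) (simp add: tensor_endo_gen[OF S e[OF i]] sum_tvec_apply fscale_simps)
  then show ?thesis using g_sum(1)[OF p et[OF i] St[OF gen_field]] by simp
 qed
 then have "(\<Sum>i<DIM('e). g p (S (e i) p) (e i p)) = (\<Sum>i<DIM('e). \<Sum>k\<in>gen_index. e i p (\<beta> k) * g p (S (E k) p) (e i p))"
  by simp
 also have "... = (\<Sum>k\<in>gen_index. \<Sum>i<DIM('e). g p (S (E k) p) (e i p) * e i p (\<beta> k))"
  by (subst sum.swap) (simp add: mult.commute)
 also have "... = (\<Sum>k\<in>gen_index. S (E k) p (\<beta> k))"
 proof (rule sum.cong[OF refl])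
  fix k assume k: "k \<in> gen_index"
  show "(\<Sum>i<DIM('e). g p (S (E k) p) (e i p) * e i p (\<beta> k)) = S (E k) p (\<beta> k)"
   using fun_cong[OF orthonormal_expand[OF p u St[OF gen_field[OF k]]], of "\<beta> k"]
   by (simp add: sum_tvec_apply fscale_simps)
 qed
 finally show ?thesis by (simp add: trace_def)
qed

end

locale hermitian = metric A g for A :: "('m, 'e::euclidean_space) atlas" and g +
 fixes J :: "'m endo" and n :: nat
 assumes J: "almost_complex A J"
  and g_J: "p \<in> M ==> u \<in> TM p ==> v \<in> TM p ==> g p (J p u) (J p v) = g p u v"
  and dim: "DIM('e) = 2 * n"
begin

lemma J_tangent: "p \<in> M ==> u \<in> TM p ==> J p u \<in> TM p"
 and J_add: "p \<in> M ==> u \<in> TM p ==> v \<in> TM p ==> J p (u + v) = J p u + J p v"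
 and J_scale: "p \<in> M ==> u \<in> TM p ==> J p (c *\<^sub>t u) = c *\<^sub>t J p u"
 and J_J: "p \<in> M ==> u \<in> TM p ==> J p (J p u) = - u"
 using J unfolding almost_complex_def by blast+

abbreviation "JJ \<equiv> endo_apply A J"

lemma JJ_field: "X \<in> V ==> JJ X \<in> V"
 using J unfolding almost_complex_def by blast

lemma JJ_at: "p \<in> M ==> JJ X p = J p (X p)"
 by (simp add: endo_apply_def)

lemma JJ_endo: "tensor_endo JJ"
proof (rule tensor_endoI[OF JJ_field])
 show "JJ (X + Y) = JJ X + JJ Y" if "X \<in> V" "Y \<in> V" for X Y
  by (rule ext) (simp add: endo_apply_def J_add vfield_tangent that)
 show "JJ (h *\<^sub>f X) = h *\<^sub>f JJ X" if "X \<in> V" for X h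
 proof
  fix p show "JJ (h *\<^sub>f X) p = (h *\<^sub>f JJ X) p"
  proof (cases "p \<in> M")
   case True
   then show ?thesis by (simp only: endo_apply_def fscale_def if_True J_scale[OF True vfield_tangent[OF that]])
  qed (simp add: endo_apply_def fscale_def tscale_def fun_eq_iff)
 qed
qed

lemma JJ_JJ: "X \<in> V ==> JJ (JJ X) = - X"
 by (rule ext) (auto simp: endo_apply_def J_J vfield_tangent vfield_outside)

lemma g_J_skew: 
 assumes "p \<in> M" "u \<in> TM p" "v \<in> TM p"
 shows "g p u (J p v) = - g p (J p u) v"
 using g_J[OF assms(1,2) J_tangent[OF assms(1,3)]] J_J[OF assms(1,3)]
  g_lin(6)[OF assms(1) J_tangent[OF assms(1,2)] assms(3)] by simp

lemma g_J_self:
 assumes "p \<in> M" "u \<in> TM p"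
 shows "g p u (J p u) = 0" "g p (J p u) u = 0"
 using g_J_skew[OF assms(1,2,2)] g_sym[OF assms(1,2) J_tangent[OF assms]] by auto

text \<open>Gram-Schmidt for one more pair: a vector that is orthogonal to the frame at \<open>p\<close> is extended to a field,
 projected off the frame near \<open>p\<close> and normalised. Together with its image under \<open>J\<close> it completes the frame,
 because the span of the previous pairs is \<open>J\<close>-invariant.\<close>

lemma partial_frame:
 assumes p: "p \<in> M" and "m \<le> n"
 shows "\<exists>e W. (\<forall>i<2 * m. e i \<in> V) \<and> openin T W \<and> p \<in> W \<and>
  (\<forall>q\<in>W. orthonormal q (2 * m) (%i. e i q) \<and> (\<forall>i<m. e (2 * i + 1) q = J q (e (2 * i) q)))"
 using assms(2)
proof (induction m)
 case 0
 then show ?case using p openin_topspace[of T]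
  by (intro exI[of _ "%_. 0"] exI[of _ M]) (auto simp: orthonormal_def topspace_eq)
next
 case (Suc m)
 have "m \<le> n" using Suc.prems by simp
 from Suc.IH[OF this] obtain e W where ew: "\<forall>i<2 * m. e i \<in> V" and W: "openin T W" "p \<in> W"
  and ew': "\<forall>q\<in>W. orthonormal q (2 * m) (%i. e i q) \<and> (\<forall>i<m. e (2 * i + 1) q = J q (e (2 * i) q))"
  by (elim exE conjE) (rule that)
 have e: "!!i. i < 2 * m ==> e i \<in> V"
  and on: "!!q. q \<in> W ==> orthonormal q (2 * m) (%i. e i q)"
  and eJ: "!!q i. q \<in> W ==> i < m ==> e (2 * i + 1) q = J q (e (2 * i) q)"
  using ew ew' by blast+
 have WM: "W \<subseteq> M" using W openin_iff by blast
 have km: "2 * m < DIM('e)" using Suc.prems dim by simp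
 obtain x where x: "x \<in> TM p" "x \<noteq> 0" "!!i. i < 2 * m ==> g p x (e i p) = 0"
  by (rule orthonormal_extend[OF p on[OF W(2)] km]) (rule that)
 obtain X where X: "X \<in> V" "X p = x" by (rule tangent_extend[OF p x(1)]) (rule that)
 define Y where "Y = X - (\<Sum>i<2 * m. pair g X (e i) *\<^sub>f e i)"
 have Y: "Y \<in> V" unfolding Y_def
  by (intro vfield_diff X vfield_sum vfield_fscale pair_smooth[OF g_tensor] e) simp_all
 have Yq: "Y q = X q - (\<Sum>i<2 * m. g q (X q) (e i q) *\<^sub>t e i q)" if "q \<in> M" for q
  using that by (simp add: Y_def sum_fun_apply fscale_def pair_def)
 have Yo: "g q (Y q) (e i q) = 0" if q: "q \<in> W" and i: "i < 2 * m" for q i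
 proof -
  have qM: "q \<in> M" using q WM by blast
  let ?s = "\<Sum>i<2 * m. g q (X q) (e i q) *\<^sub>t e i q"
  have s: "?s \<in> TM q"
   by (intro tangent_space_sum tangent_space_scale vfield_tangent e) simp
  have "g q (X q + - ?s) (e i q) = g q (X q) (e i q) + g q (- ?s) (e i q)"
   by (rule g_lin(1)[OF qM vfield_tangent[OF X(1)] tangent_space_minus[OF s] vfield_tangent[OF e[OF i]]])
  also have "... = 0"
   using g_lin(5)[OF qM s vfield_tangent[OF e[OF i]]] orthonormal_coeff[OF qM on[OF q] i] by simp
  finally show ?thesis using Yq[OF qM] by simp
 qed
 have Yp: "Y p = x"
 proof -
  have "(\<Sum>i<2 * m. g p x (e i p) *\<^sub>t e i p) = (\<Sum>i<2 * m. 0)"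
   by (rule sum.cong) (simp_all add: x(3) tscale_def fun_eq_iff)
  then show ?thesis using Yq[OF p] X(2) by simp
 qed
 let ?G = "pair g Y Y"
 have G: "?G \<in> C" by (rule pair_smooth[OF g_tensor Y Y])
 have G0: "?G q \<ge> 0" for q using g_nonneg[of q "Y q"] vfield_tangent[OF Y] by (simp add: pair_def)
 have "p \<in> {q \<in> M. 0 < ?G q}" using p g_pos[OF p x(1,2)] Yp by (simp add: pair_def)
 then obtain b N L where b: "b \<in> C" "openin T N" "p \<in> N" "N \<subseteq> {q \<in> M. 0 < ?G q}" "!!q. q \<in> N ==> b q = (1::real)"
  "closedin T L" "L \<subseteq> {q \<in> M. 0 < ?G q}" "!!q. q \<notin> L ==> b q = 0" "!!q. 0 \<le> b q"
  by (rule bump[OF openin_less[OF G]]) (rule that)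
 \<comment> \<open>a globally positive function that equals the squared length of \<open>Y\<close> near \<open>p\<close>\<close>
 define H where "H q = ?G q + (1 - b q)\<^sup>2" for q
 have H: "H \<in> C" unfolding H_def[abs_def] by (intro smooth_intros G b)
 have Hpos: "H q > 0" for q
 proof (cases "q \<in> L")
  case True
  then have "?G q > 0" using b(7) by auto
  then show ?thesis by (simp add: H_def add_pos_nonneg)
 next
  case False
  then show ?thesis using b(8)[OF False] G0[of q] by (simp add: H_def)
 qed
 define r where "r q = H q powr (- 1 / 2)" for q
 have r: "r \<in> C" unfolding r_def[abs_def]
  by (rule smooth_compose[OF H _ smooth_on_powr]) (use Hpos in auto)
 have rG: "r q * (r q * ?G q) = 1" if "q \<in> N" for q
 proof -
  have "H q = ?G q" using b(5)[OF that] by (simp add: H_def)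
  moreover have "r q * r q = H q powr (-1)" by (simp add: r_def powr_add[symmetric])
  ultimately show ?thesis using Hpos[of q] by (simp add: mult.assoc[symmetric] powr_minus)
 qed
 define Z where "Z = r *\<^sub>f Y"
 have Z: "Z \<in> V" unfolding Z_def by (rule vfield_fscale[OF r Y])
 define e' where "e' = e(2 * m := Z, 2 * m + 1 := JJ Z)"
 let ?W = "W \<inter> N"
 have "orthonormal q (2 * Suc m) (%i. e' i q)" if q: "q \<in> ?W" for q
 proof -
  have qM: "q \<in> M" and qW: "q \<in> W" and qN: "q \<in> N" using q WM by auto
  note zt = vfield_tangent[OF Z, of q]
  note Jt = J_tangent[OF qM zt]
  have zz: "g q (Z q) (Z q) = 1"
  proof -
   have "g q (Z q) (Z q) = pair g Z Z q" by (simp add: pair_def qM)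
   also have "... = r q * (r q * ?G q)"
    by (simp add: Z_def pair_simps[OF g_tensor Y vfield_fscale[OF r Y]] pair_simps[OF g_tensor Y Y])
   finally show ?thesis using rG[OF qN] by simp
  qed
  have ze: "g q (Z q) (e i q) = 0" if "i < 2 * m" for i
   using g_lin(3)[OF qM vfield_tangent[OF Y] vfield_tangent[OF Y] vfield_tangent[OF e[OF that]]] Yo[OF qW that]
   by (simp add: Z_def fscale_simps)
  have Je: "g q (J q (Z q)) (e i q) = 0" if i: "i < 2 * m" for i
  proof -
   note et = vfield_tangent[OF e[OF i], of q]
   have "g q (J q (Z q)) (e i q) = - g q (Z q) (J q (e i q))" using g_J_skew[OF qM zt et] by simp
   also have "g q (Z q) (J q (e i q)) = 0"
   proof (cases "even i")
    case True
    then obtain j where j: "i = 2 * j" by blast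
    then show ?thesis using eJ[OF qW, of j] ze[of "2 * j + 1"] i by simp
   next
    case False
    then obtain j where j: "i = 2 * j + 1" by (metis oddE)
    have j2: "2 * j < 2 * m" using i j by simp
    have "J q (e i q) = - e (2 * j) q"
     using eJ[OF qW, of j] i j J_J[OF qM vfield_tangent[OF e[OF j2]]] by simp
    then show ?thesis using g_lin(6)[OF qM zt vfield_tangent[OF e[OF j2]]] ze[OF j2] by simp
   qed
   finally show ?thesis by simp
  qed
  have cases: "i < 2 * m \<or> i = 2 * m \<or> i = Suc (2 * m)" if "i < 2 * Suc m" for i using that by auto
  have sym: "g q (e i q) w = g q w (e i q)" if "i < 2 * m" "w \<in> TM q" for i w
   by (rule g_sym[OF qM vfield_tangent[OF e[OF that(1)]] that(2)])
  have ee: "g q (e i q) (e j q) = (if i = j then 1 else 0)" if "i < 2 * m" "j < 2 * m" for i j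
   using on[OF qW] that by (simp add: orthonormal_def)
  have t: "\<forall>i<2 * Suc m. e' i q \<in> TM q"
  proof (intro allI impI)
   fix i assume "i < 2 * Suc m"
   from cases[OF this] show "e' i q \<in> TM q"
    by (elim disjE) (simp_all add: e'_def zt Jt JJ_at qM vfield_tangent e)
  qed
  have "g q (e' i q) (e' j q) = (if i = j then 1 else 0)" if i: "i < 2 * Suc m" and j: "j < 2 * Suc m" for i j
   using cases[OF i] cases[OF j]
   by (elim disjE) (simp_all add: e'_def JJ_at qM zz ze Je sym zt Jt ee g_J g_J_self)
  with t show ?thesis by (simp add: orthonormal_def)
 qed
 moreover have "e' (2 * i + 1) q = J q (e' (2 * i) q)" if q: "q \<in> ?W" and i: "i < Suc m" for q i
 proof (cases "i = m")
  case True
  then show ?thesis using q WM by (auto simp: e'_def JJ_at)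
 next
  case False
  then have "i < m" using i by simp
  moreover from this have "2 * i \<noteq> Suc (2 * m)" "Suc (2 * i) \<noteq> 2 * m" by presburger+
  ultimately show ?thesis using q eJ[of q i] by (simp add: e'_def)
 qed
 moreover have "\<forall>i<2 * Suc m. e' i \<in> V" by (auto simp: e'_def Z JJ_field e)
 moreover have "openin T ?W" "p \<in> ?W" using W b by (auto intro: openin_Int)
 ultimately show ?case by blast
qed

lemma adapted_frame_exists:
 assumes "p \<in> M" shows "\<exists>e. adapted_frame A g J p e"
proof -
 obtain e W where e: "\<forall>i<2 * n. e i \<in> V" "openin T W" "p \<in> W"
  "\<forall>q\<in>W. orthonormal q (2 * n) (%i. e i q) \<and> (\<forall>i<n. e (2 * i + 1) q = J q (e (2 * i) q))"
  using partial_frame[OF assms order_refl] by blast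
 then have "adapted_frame A g J p e"
  unfolding adapted_frame_def dim by (intro conjI exI[of _ W]) (auto simp: orthonormal_def)
 then show ?thesis by (rule exI[of "adapted_frame A g J p" e])
qed

lemma some_frame:
 assumes p: "p \<in> M"
 shows some_frame_field: "i < DIM('e) ==> some_frame A g J p i \<in> V"
  and some_frame_near: "\<exists>W. openin T W \<and> p \<in> W \<and> (\<forall>q\<in>W. orthonormal q DIM('e) (%i. some_frame A g J p i q))"
  and some_frame_orthonormal: "orthonormal p DIM('e) (%i. some_frame A g J p i p)"
  and some_frame_J: "2 * i + 1 < DIM('e) ==> some_frame A g J p (2 * i + 1) p = J p (some_frame A g J p (2 * i) p)"
proof -
 have ad: "adapted_frame A g J p (some_frame A g J p)"
  unfolding some_frame_def by (rule someI_ex[OF adapted_frame_exists[OF p]])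
 show f: "i < DIM('e) ==> some_frame A g J p i \<in> V" for i
  using conjunct1[OF ad[unfolded adapted_frame_def]] by simp
 obtain W where W: "openin T W" "p \<in> W"
  "\<forall>q\<in>W. (\<forall>i < DIM('e). \<forall>j < DIM('e). g q (some_frame A g J p i q) (some_frame A g J p j q) = (if i = j then 1 else 0)) \<and>
     (\<forall>i. 2 * i + 1 < DIM('e) --> some_frame A g J p (2 * i + 1) q = J q (some_frame A g J p (2 * i) q))"
  using ad unfolding adapted_frame_def by (elim conjE exE) (rule that)
 have on: "orthonormal q DIM('e) (%i. some_frame A g J p i q)" if "q \<in> W" for q
  unfolding orthonormal_def using bspec[OF W(3) that] vfield_tangent[OF f] by simp
 show "\<exists>W. openin T W \<and> p \<in> W \<and> (\<forall>q\<in>W. orthonormal q DIM('e) (%i. some_frame A g J p i q))"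
  by (intro exI[of _ W] conjI ballI W on)
 show "orthonormal p DIM('e) (%i. some_frame A g J p i p)" by (rule on[OF W(2)])
 show "2 * i + 1 < DIM('e) ==> some_frame A g J p (2 * i + 1) p = J p (some_frame A g J p (2 * i) p)"
  using bspec[OF W(3,2)] by simp
qed

end

section \<open>The Levi-Civita connection\<close>

context compact_manifold
begin

lemma bracket_add1: "X \<in> V ==> Y \<in> V ==> Z \<in> V ==> bracket (X + Y) Z = bracket X Z + bracket Y Z"
 using bracket_add[of Z X Y] bracket_swap[of "X + Y" Z] bracket_swap[of X Z] bracket_swap[of Y Z] by simp

lemma bracket_fscale1: "X \<in> V ==> Y \<in> V ==> h \<in> C ==>
  bracket (h *\<^sub>f X) Y = h *\<^sub>f bracket X Y - (%p. Y p h) *\<^sub>f X"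
 using bracket_fscale[of Y X h] bracket_swap[of "h *\<^sub>f X" Y] bracket_swap[of X Y]
 by (simp add: fun_eq_iff fscale_simps)

lemma connectionD:
 assumes "connection A D"
 shows con_field: "X \<in> V ==> Y \<in> V ==> D X Y \<in> V"
  and con_add1: "X \<in> V ==> Y \<in> V ==> Z \<in> V ==> D (X + Y) Z = D X Z + D Y Z"
  and con_fscale1: "X \<in> V ==> Y \<in> V ==> h \<in> C ==> D (h *\<^sub>f X) Y = h *\<^sub>f D X Y"
  and con_add2: "X \<in> V ==> Y \<in> V ==> Z \<in> V ==> D X (Y + Z) = D X Y + D X Z"
  and con_fscale2: "X \<in> V ==> Y \<in> V ==> h \<in> C ==>
   D X (h *\<^sub>f Y) = (%p. X p h) *\<^sub>f Y + h *\<^sub>f D X Y"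
proof -
 note c = assms[unfolded connection_def, rule_format]
 show "X \<in> V ==> Y \<in> V ==> D X Y \<in> V" using c[of X Y 0 "%_. 0"] by simp
 show "X \<in> V ==> Y \<in> V ==> Z \<in> V ==> D (X + Y) Z = D X Z + D Y Z"
  "X \<in> V ==> Y \<in> V ==> Z \<in> V ==> D X (Y + Z) = D X Y + D X Z"
  using c[of X Y Z "%_. 0"] by (simp_all only: smooth_const simp_thms)
 show "X \<in> V ==> Y \<in> V ==> h \<in> C ==> D (h *\<^sub>f X) Y = h *\<^sub>f D X Y"
  "X \<in> V ==> Y \<in> V ==> h \<in> C ==> D X (h *\<^sub>f Y) = (%p. X p h) *\<^sub>f Y + h *\<^sub>f D X Y"
  using c[of X Y 0 h] by (simp_all only: vfield_0 simp_thms)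
qed

lemma connectionI:
 assumes "!!X Y. X \<in> V ==> Y \<in> V ==> D X Y \<in> V"
  "!!X Y Z. X \<in> V ==> Y \<in> V ==> Z \<in> V ==> D (X + Y) Z = D X Z + D Y Z"
  "!!X Y h. X \<in> V ==> Y \<in> V ==> h \<in> C ==> D (h *\<^sub>f X) Y = h *\<^sub>f D X Y"
  "!!X Y Z. X \<in> V ==> Y \<in> V ==> Z \<in> V ==> D X (Y + Z) = D X Y + D X Z"
  "!!X Y h. X \<in> V ==> Y \<in> V ==> h \<in> C ==>
   D X (h *\<^sub>f Y) = (%p. X p h) *\<^sub>f Y + h *\<^sub>f D X Y"
 shows "connection A D"
 unfolding connection_def by (intro ballI conjI assms)

lemma con_minus2: "connection A D ==> X \<in> V ==> Y \<in> V ==> D X (- Y) = - D X Y"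
 using con_fscale2[of D X Y "%p. -1"] tangent_const[OF vfield_tangent, of X _ "-1"]
 by (simp add: fscale_minus1 fun_eq_iff fscale_simps)

lemma con_minus1: "connection A D ==> X \<in> V ==> Y \<in> V ==> D (- X) Y = - D X Y"
 using con_fscale1[of D X Y "%p. -1"] by (simp add: fscale_minus1)

lemma con_diff1: "connection A D ==> X \<in> V ==> Y \<in> V ==> Z \<in> V ==> D (X - Y) Z = D X Z - D Y Z"
 using con_add1[of D X "- Y" Z] con_minus1[of D Y Z] vfield_minus[of Y] by simp

lemma con_diff2: "connection A D ==> X \<in> V ==> Y \<in> V ==> Z \<in> V ==> D X (Y - Z) = D X Y - D X Z"
 using con_add2[of D X Y "- Z"] con_minus2[of D X Z] vfield_minus[of Z] by simp

lemma con_endo1: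
 assumes D: "connection A D" and Y: "Y \<in> V"
 shows "tensor_endo (%X. D X Y)"
 by (intro tensor_endoI con_field[OF D] con_add1[OF D] con_fscale1[OF D] Y)

lemma con_sum2:
 assumes D: "connection A D" "X \<in> V" and "!!i. i \<in> I ==> Y i \<in> V"
 shows "D X (\<Sum>i\<in>I. Y i) = (\<Sum>i\<in>I. D X (Y i))"
 using assms(3)
proof (induction I rule: infinite_finite_induct)
 case (insert i I)
 have "Y i \<in> V" "(\<Sum>i\<in>I. Y i) \<in> V" by (auto intro!: vfield_sum insert.prems)
 from con_add2[OF D this] insert show ?case
  by (simp only: sum.insert insert_iff simp_thms)
qed (use con_diff2[OF D vfield_0 vfield_0] in simp_all)

end

context compact_manifold
begin

definition tensor_form :: "('m vfield => 'm => real) => bool" where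
 "tensor_form \<alpha> \<longleftrightarrow> (\<forall>X\<in>V. \<alpha> X \<in> C) \<and> (\<forall>X\<in>V. \<forall>Y\<in>V. \<forall>p\<in>M. \<alpha> (X + Y) p = \<alpha> X p + \<alpha> Y p) \<and>
  (\<forall>X\<in>V. \<forall>h\<in>C. \<forall>p\<in>M. \<alpha> (h *\<^sub>f X) p = h p * \<alpha> X p)"

lemma tensor_form_gen:
 assumes \<alpha>: "tensor_form \<alpha>" and X: "X \<in> V" and p: "p \<in> M"
 shows "\<alpha> X p = (\<Sum>k\<in>gen_index. X p (\<beta> k) * \<alpha> (E k) p)"
proof -
 let ?Y = "%k. (%p. X p (\<beta> k)) *\<^sub>f E k"
 have Y: "?Y k \<in> V" if "k \<in> gen_index" for k
  by (intro vfield_fscale vfield_smooth[OF X] gen_fun gen_field that)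
 have z: "\<alpha> 0 p = 0"
 proof -
  have "\<alpha> ((%p. 0) *\<^sub>f 0) p = 0 * \<alpha> 0 p"
   using \<alpha> p unfolding tensor_form_def by (metis smooth_const vfield_0)
  moreover have "(%p. 0) *\<^sub>f 0 = (0 :: 'm vfield)" by (simp add: fun_eq_iff fscale_simps)
  ultimately show ?thesis by simp
 qed
 have "\<alpha> (\<Sum>k\<in>I. ?Y k) p = (\<Sum>k\<in>I. X p (\<beta> k) * \<alpha> (E k) p)" if "finite I" "I \<subseteq> gen_index" for I
  using that
 proof (induction I)
  case (insert k I)
  have k: "k \<in> gen_index" and s: "(\<Sum>k\<in>I. ?Y k) \<in> V" using insert by (auto intro!: vfield_sum Y)
  have "\<alpha> (?Y k + (\<Sum>k\<in>I. ?Y k)) p = \<alpha> (?Y k) p + \<alpha> (\<Sum>k\<in>I. ?Y k) p"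
   using \<alpha> p Y[OF k] s unfolding tensor_form_def by blast
  moreover have "\<alpha> (?Y k) p = X p (\<beta> k) * \<alpha> (E k) p"
   using \<alpha> p gen_field[OF k] vfield_smooth[OF X gen_fun[OF k]] unfolding tensor_form_def by blast
  ultimately show ?case using insert by (simp only: sum.insert insert_subset simp_thms)
 qed (simp add: z)
 from this[OF gen_finite order_refl] show ?thesis by (simp only: field_gen[OF X, symmetric])
qed

lemma tensor_form_at:
 "tensor_form \<alpha> ==> X \<in> V ==> Y \<in> V ==> p \<in> M ==> X p = Y p ==> \<alpha> X p = \<alpha> Y p"
 by (simp add: tensor_form_gen)

end

context hermitian
begin

text \<open>The dual vector at a point is written in an orthonormal frame chosen at that point. Since the dual vector is
 unique, it agrees near a point with the one written in the frame of this point, which is smooth.\<close>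

lemma riesz:
 assumes \<alpha>: "tensor_form \<alpha>"
 obtains X where "X \<in> V" "!!Z p. Z \<in> V ==> p \<in> M ==> pair g X Z p = \<alpha> Z p"
proof -
 define e where "e = some_frame A g J"
 define X where "X p = (if p \<in> M then \<Sum>i<DIM('e). \<alpha> (e p i) p *\<^sub>t e p i p else 0)" for p
 have t: "X p \<in> TM p" if "p \<in> M" for p
 proof -
  have "(\<Sum>i<DIM('e). \<alpha> (e p i) p *\<^sub>t e p i p) \<in> TM p"
   by (intro tangent_space_sum tangent_space_scale)
    (simp add: e_def vfield_tangent[OF some_frame_field[OF that]])
  then show ?thesis using that by (simp add: X_def)
 qed
 have dual: "g q (\<Sum>i<DIM('e). \<alpha> (Y i) q *\<^sub>t Y i q) (Z q) = \<alpha> Z q"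
  if q: "q \<in> M" and Y: "!!i. i < DIM('e) ==> Y i \<in> V" and on: "orthonormal q DIM('e) (%i. Y i q)" and Z: "Z \<in> V" for q Y Z
 proof -
  let ?Z = "\<Sum>i<DIM('e). pair g Z (Y i) *\<^sub>f Y i"
  have ps: "pair g Z (Y i) \<in> C" if "i < DIM('e)" for i by (rule pair_smooth[OF g_tensor Z Y[OF that]])
  have ZV: "?Z \<in> V" by (intro vfield_sum vfield_fscale ps Y) simp_all
  have "Z q = ?Z q"
   using orthonormal_expand[OF q on vfield_tangent[OF Z]] q
   by (simp add: sum_fun_apply fscale_def pair_def)
  then have "\<alpha> Z q = \<alpha> ?Z q" by (rule tensor_form_at[OF \<alpha> Z ZV q])
  also have "... = (\<Sum>k\<in>gen_index. ?Z q (\<beta> k) * \<alpha> (E k) q)" by (rule tensor_form_gen[OF \<alpha> ZV q])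
  also have "... = (\<Sum>k\<in>gen_index. \<Sum>i<DIM('e). pair g Z (Y i) q * (Y i q (\<beta> k) * \<alpha> (E k) q))"
   by (simp add: sum_vfield_apply fscale_simps sum_distrib_right mult.assoc)
  also have "... = (\<Sum>i<DIM('e). pair g Z (Y i) q * \<alpha> (Y i) q)"
   by (subst sum.swap) (simp add: sum_distrib_left[symmetric] tensor_form_gen[OF \<alpha> Y q, symmetric])
  also have "... = (\<Sum>i<DIM('e). \<alpha> (Y i) q * g q (Y i q) (Z q))"
   using q g_sym[OF q vfield_tangent[OF Z] vfield_tangent[OF Y]] by (simp add: pair_def mult.commute)
  also have "... = g q (\<Sum>i<DIM('e). \<alpha> (Y i) q *\<^sub>t Y i q) (Z q)"
   by (rule g_sum(1)[OF q vfield_tangent[OF Z], symmetric]) (use vfield_tangent[OF Y] in auto)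
  finally show ?thesis by simp
 qed
 have Xd: "g q (X q) (Z q) = \<alpha> Z q" if q: "q \<in> M" and Z: "Z \<in> V" for q Z
  using dual[OF q _ _ Z, of "e q"] some_frame_field[OF q] some_frame_orthonormal[OF q] q by (simp add: X_def e_def)
 have "X \<in> V"
 proof (rule vfield_local[OF t])
  show "p \<notin> M ==> X p = 0" for p by (simp add: X_def)
  fix p assume p: "p \<in> M"
  obtain W where W: "openin T W" "p \<in> W" "\<forall>q\<in>W. orthonormal q DIM('e) (%i. e p i q)"
   using some_frame_near[OF p] unfolding e_def by blast
  have WM: "W \<subseteq> M" using W openin_iff by blast
  let ?Y = "\<Sum>i<DIM('e). \<alpha> (e p i) *\<^sub>f e p i"
  have ep: "e p i \<in> V" if "i < DIM('e)" for i unfolding e_def by (rule some_frame_field[OF p that])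
  have Y: "?Y \<in> V" using \<alpha> ep by (intro vfield_sum vfield_fscale) (auto simp: tensor_form_def)
  have "X q = ?Y q" if q: "q \<in> W" for q
  proof (rule nondegenerate)
   show qM: "q \<in> M" using q WM by blast
   show "X q \<in> TM q" by (rule t[OF qM])
   show "?Y q \<in> TM q" by (rule vfield_tangent[OF Y])
   fix w assume "w \<in> TM q"
   then obtain Z where Z: "Z \<in> V" "Z q = w" by (rule tangent_extend[OF qM]) (rule that)
   have "g q (?Y q) (Z q) = \<alpha> Z q"
    using dual[OF qM ep _ Z(1)] W(3) q by (simp add: sum_fun_apply fscale_def)
   then show "g q (X q) w = g q (?Y q) w" using Xd[OF qM Z(1)] Z(2) by simp
  qed
  then show "\<exists>W Y. openin T W \<and> p \<in> W \<and> Y \<in> V \<and> (\<forall>q\<in>W. X q = Y q)" using W Y by blast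
 qed
 then show ?thesis using that Xd by (simp add: pair_def)
qed

abbreviation "gp \<equiv> pair g"

lemmas gp_simps = pair_simps[OF g_tensor]
lemmas gp_smooth = pair_smooth[OF g_tensor]

lemma gp_sym: "X \<in> V ==> Y \<in> V ==> gp X Y = gp Y X"
 by (rule ext) (simp add: pair_def g_sym[OF _ vfield_tangent vfield_tangent])

definition koszul :: "'m vfield => 'm vfield => 'm vfield => 'm => real" where
 "koszul X Y Z p = (X p (gp Y Z) + Y p (gp X Z) - Z p (gp X Y)
  + gp (bracket X Y) Z p - gp (bracket X Z) Y p - gp (bracket Y Z) X p) / 2"

lemma koszul_tensor:
 assumes X: "X \<in> V" and Y: "Y \<in> V"
 shows "tensor_form (koszul X Y)"
 unfolding tensor_form_def
proof (intro conjI ballI)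
 fix Z assume Z: "Z \<in> V"
 show "koszul X Y Z \<in> C" unfolding koszul_def[abs_def]
  by (intro smooth_divide smooth_add smooth_diff vfield_smooth[OF X] vfield_smooth[OF Y] vfield_smooth[OF Z]
    gp_smooth vfield_bracket X Y Z)
next
 fix Z Z' p assume Z: "Z \<in> V" and Z': "Z' \<in> V"
 show "koszul X Y (Z + Z') p = koszul X Y Z p + koszul X Y Z' p"
  by (simp add: koszul_def gp_simps gp_smooth X Y Z Z' der_add bracket_add vfield_bracket add_divide_distrib diff_divide_distrib)
next
 fix Z h p assume Z: "Z \<in> V" and h: "h \<in> C"
 note s = vfield_smooth[OF X h] vfield_smooth[OF Y h]
 show "koszul X Y (h *\<^sub>f Z) p = h p * koszul X Y Z p"
  by (simp add: koszul_def gp_simps gp_smooth X Y Z h s der_mult bracket_fscale vfield_bracket vfield_fscale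
    fscale_simps gp_sym[OF Z Y] gp_sym[OF Z X] add_divide_distrib diff_divide_distrib algebra_simps)
qed

text \<open>By the Riesz lemma Koszul's formula defines \<open>D X Y\<close>; the axioms are checked by pairing with a third field.\<close>

lemma levi_civita_exists:
 "\<exists>D. metric_connection A g D \<and> (\<forall>X\<in>V. \<forall>Y\<in>V. D X Y - D Y X = bracket X Y)"
proof -
 have "\<forall>X\<in>V. \<forall>Y\<in>V. \<exists>U. U \<in> V \<and> (\<forall>Z\<in>V. \<forall>p\<in>M. gp U Z p = koszul X Y Z p)"
 proof (intro ballI)
  fix X Y assume X: "X \<in> V" and Y: "Y \<in> V"
  obtain U where "U \<in> V" "!!Z p. Z \<in> V ==> p \<in> M ==> gp U Z p = koszul X Y Z p"
   by (rule riesz[OF koszul_tensor[OF X Y]]) (rule that)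
  then show "\<exists>U. U \<in> V \<and> (\<forall>Z\<in>V. \<forall>p\<in>M. gp U Z p = koszul X Y Z p)" by blast
 qed
 then obtain D where D': "\<forall>X\<in>V. \<forall>Y\<in>V. D X Y \<in> V \<and> (\<forall>Z\<in>V. \<forall>p\<in>M. gp (D X Y) Z p = koszul X Y Z p)"
  unfolding bchoice_iff by (elim exE) (rule that)
 have D: "!!X Y. X \<in> V ==> Y \<in> V ==> D X Y \<in> V"
  and K: "!!X Y Z p. X \<in> V ==> Y \<in> V ==> Z \<in> V ==> p \<in> M ==> gp (D X Y) Z p = koszul X Y Z p"
  using D' by blast+
 have con: "connection A D"
 proof (rule connectionI[OF D])
  fix X Y Z assume X: "X \<in> V" and Y: "Y \<in> V" and Z: "Z \<in> V"
  show "D (X + Y) Z = D X Z + D Y Z"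
  proof (rule field_eqI)
   fix U p assume U: "U \<in> V" and p: "p \<in> M"
   show "gp (D (X + Y) Z) U p = gp (D X Z + D Y Z) U p"
    by (simp add: K U p X Y Z D vfield_add gp_simps koszul_def gp_smooth der_add bracket_add bracket_add1 vfield_bracket
      add_divide_distrib diff_divide_distrib)
  qed (intro D vfield_add X Y Z)+
  show "D X (Y + Z) = D X Y + D X Z"
  proof (rule field_eqI)
   fix U p assume U: "U \<in> V" and p: "p \<in> M"
   show "gp (D X (Y + Z)) U p = gp (D X Y + D X Z) U p"
    by (simp add: K U p X Y Z D vfield_add gp_simps koszul_def gp_smooth der_add bracket_add bracket_add1 vfield_bracket
      add_divide_distrib diff_divide_distrib)
  qed (intro D vfield_add X Y Z)+
 next
  fix X Y h assume X: "X \<in> V" and Y: "Y \<in> V" and h: "h \<in> C"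
  note s = vfield_smooth[OF X h] vfield_smooth[OF Y h]
  show "D (h *\<^sub>f X) Y = h *\<^sub>f D X Y"
  proof (rule field_eqI)
   fix U p assume U: "U \<in> V" and p: "p \<in> M"
   note s' = vfield_smooth[OF U h]
   show "gp (D (h *\<^sub>f X) Y) U p = gp (h *\<^sub>f D X Y) U p"
    by (simp add: K U p X Y h s s' D vfield_fscale gp_simps koszul_def gp_smooth der_mult bracket_fscale bracket_fscale1 vfield_bracket
      fscale_simps gp_sym[OF U Y] gp_sym[OF U X] gp_sym[OF Y X] add_divide_distrib diff_divide_distrib algebra_simps)
  qed (intro D vfield_fscale X Y h)+
  show "D X (h *\<^sub>f Y) = (%p. X p h) *\<^sub>f Y + h *\<^sub>f D X Y"
  proof (rule field_eqI)
   fix U p assume U: "U \<in> V" and p: "p \<in> M"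
   note s' = vfield_smooth[OF U h]
   show "gp (D X (h *\<^sub>f Y)) U p = gp ((%p. X p h) *\<^sub>f Y + h *\<^sub>f D X Y) U p"
    by (simp add: K U p X Y h s s' D vfield_fscale gp_simps koszul_def gp_smooth der_mult bracket_fscale bracket_fscale1 vfield_bracket
      fscale_simps gp_sym[OF U Y] gp_sym[OF U X] gp_sym[OF Y X] add_divide_distrib diff_divide_distrib algebra_simps)
  qed (intro D vfield_add vfield_fscale X Y h s)+
 qed
 have met: "X p (%q. g q (Y q) (Z q)) = g p (D X Y p) (Z p) + g p (Y p) (D X Z p)"
  if X: "X \<in> V" and Y: "Y \<in> V" and Z: "Z \<in> V" and p: "p \<in> M" for X Y Z p
 proof -
  have "(%q. g q (Y q) (Z q)) \<in> C"
   using g_tensor Y Z unfolding bilinear_tensor_def by blast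
  then have "X p (%q. g q (Y q) (Z q)) = X p (gp Y Z)"
   by (rule tangent_cong[OF p vfield_tangent[OF X]]) (simp_all add: gp_smooth Y Z, simp add: pair_def)
  also have "... = koszul X Y Z p + koszul X Z Y p"
   by (simp add: koszul_def gp_sym[OF Z Y] bracket_swap[of Y Z] gp_simps vfield_bracket X Y Z
    field_simps)
  also have "... = gp (D X Y) Z p + gp (D X Z) Y p" by (simp add: K X Y Z p)
  finally show ?thesis
   using p g_sym[OF p vfield_tangent[OF Y] vfield_tangent[OF D[OF X Z]]] by (simp add: pair_def)
 qed
 have tor: "D X Y - D Y X = bracket X Y" if X: "X \<in> V" and Y: "Y \<in> V" for X Y
 proof (rule field_eqI)
  fix U p assume U: "U \<in> V" and p: "p \<in> M"
  show "gp (D X Y - D Y X) U p = gp (bracket X Y) U p"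
   by (simp add: K U p X Y D gp_simps koszul_def bracket_swap[of Y X] vfield_bracket gp_sym[OF Y X] field_simps)
 qed (intro vfield_diff vfield_bracket D X Y)+
 show ?thesis
  unfolding metric_connection_def using con met tor by blast
qed

abbreviation "LC \<equiv> levi_civita A g"

lemma levi_civita: "metric_connection A g LC" "X \<in> V ==> Y \<in> V ==> LC X Y - LC Y X = bracket X Y"
 using someI_ex[OF levi_civita_exists] unfolding levi_civita_def[symmetric] by blast+

lemma LC: "connection A LC"
 using levi_civita(1) by (simp add: metric_connection_def)

lemma metric_connection_pair:
 assumes D: "metric_connection A g D" and X: "X \<in> V" and Y: "Y \<in> V" and Z: "Z \<in> V" and p: "p \<in> M"
 shows "X p (gp Y Z) = gp (D X Y) Z p + gp Y (D X Z) p"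
proof -
 have "(%q. g q (Y q) (Z q)) \<in> C"
  using g_tensor Y Z unfolding bilinear_tensor_def by blast
 then have "X p (%q. g q (Y q) (Z q)) = X p (gp Y Z)"
  by (rule tangent_cong[OF p vfield_tangent[OF X]]) (simp_all add: gp_smooth Y Z, simp add: pair_def)
 then show ?thesis using D X Y Z p unfolding metric_connection_def by (simp add: pair_def)
qed

end

section \<open>Curvature traces and their transgression\<close>

context compact_manifold
begin

text \<open>Both terms are derivations along \<open>W\<close>, so the derivatives of the coefficient functions cancel.\<close>

lemma lie_difference_endo:
 assumes D: "connection A D" and W: "W \<in> V"
 shows "tensor_endo (%Y. D W Y - bracket W Y)"
proof (rule tensor_endoI)
 note f = con_field[OF D] W
 show "Y \<in> V ==> D W Y - bracket W Y \<in> V" for Y by (intro vfield_diff f vfield_bracket)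
 show "D W (X + Y) - bracket W (X + Y) = D W X - bracket W X + (D W Y - bracket W Y)" if "X \<in> V" "Y \<in> V" for X Y
  by (simp add: con_add2[OF D] bracket_add f that)
 show "D W (h *\<^sub>f X) - bracket W (h *\<^sub>f X) = h *\<^sub>f (D W X - bracket W X)" if "X \<in> V" "h \<in> C" for X h
  by (simp add: con_fscale2[OF D] bracket_fscale f that fscale_diff)
qed

lemma connection_difference_endo:
 assumes D: "connection A D" and D': "connection A D'" and X: "X \<in> V"
 shows "tensor_endo (%Z. D' X Z - D X Z)"
proof (rule tensor_endoI)
 show "Z \<in> V ==> D' X Z - D X Z \<in> V" for Z by (intro vfield_diff con_field[OF D] con_field[OF D'] X)
 show "Z \<in> V ==> Z' \<in> V ==> D' X (Z + Z') - D X (Z + Z') = D' X Z - D X Z + (D' X Z' - D X Z')" for Z Z'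
  by (simp add: con_add2[OF D X] con_add2[OF D' X])
 show "D' X (h *\<^sub>f Z) - D X (h *\<^sub>f Z) = h *\<^sub>f (D' X Z - D X Z)" if "Z \<in> V" "h \<in> C" for Z h
  unfolding con_fscale2[OF D X that] con_fscale2[OF D' X that]
  by (simp add: fun_eq_iff fscale_simps algebra_simps)
qed

lemma curvature_field:
 assumes D: "connection A D" and X: "X \<in> V" and Y: "Y \<in> V" and Z: "Z \<in> V"
 shows "curvature D X Y Z \<in> V"
 unfolding curvature_def by (intro vfield_diff con_field[OF D] vfield_bracket X Y Z)

lemma curvature_endo:
 assumes D: "connection A D" and X: "X \<in> V" and Y: "Y \<in> V"
 shows "tensor_endo (curvature D X Y)"
proof (rule tensor_endoI)
 note f = con_field[OF D] vfield_bracket vfield_fscale vfield_add X Y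
 show "Z \<in> V ==> curvature D X Y Z \<in> V" for Z by (rule curvature_field[OF D X Y])
 show "curvature D X Y (Z + Z') = curvature D X Y Z + curvature D X Y Z'" if Z: "Z \<in> V" "Z' \<in> V" for Z Z'
  unfolding curvature_def by (simp add: con_add2[OF D] f Z)
 show "curvature D X Y (h *\<^sub>f Z) = h *\<^sub>f curvature D X Y Z" if Z: "Z \<in> V" and h: "h \<in> C" for Z h
 proof -
  note s = vfield_smooth[OF X h] vfield_smooth[OF Y h]
  have 1: "D X (D Y (h *\<^sub>f Z)) = (%p. X p (%p. Y p h)) *\<^sub>f Z + (%p. Y p h) *\<^sub>f D X Z
    + ((%p. X p h) *\<^sub>f D Y Z + h *\<^sub>f D X (D Y Z))"
   by (simp only: con_fscale2[OF D Y Z h] con_fscale2[OF D X Z s(2)] con_fscale2[OF D X con_field[OF D Y Z] h]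
    con_add2[OF D X vfield_fscale[OF s(2) Z] vfield_fscale[OF h con_field[OF D Y Z]]])
  have 2: "D Y (D X (h *\<^sub>f Z)) = (%p. Y p (%p. X p h)) *\<^sub>f Z + (%p. X p h) *\<^sub>f D Y Z
    + ((%p. Y p h) *\<^sub>f D X Z + h *\<^sub>f D Y (D X Z))"
   by (simp only: con_fscale2[OF D X Z h] con_fscale2[OF D Y Z s(1)] con_fscale2[OF D Y con_field[OF D X Z] h]
    con_add2[OF D Y vfield_fscale[OF s(1) Z] vfield_fscale[OF h con_field[OF D X Z]]])
  show ?thesis
   unfolding curvature_def 1 2 con_fscale2[OF D vfield_bracket[OF X Y] Z h]
   by (simp add: fun_eq_iff fscale_simps bracket_def algebra_simps)
 qed
qed

lemma curvature_swap:
 assumes "connection A D" "X \<in> V" "Y \<in> V" "Z \<in> V"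
 shows "curvature D Y X Z = - curvature D X Y Z"
 unfolding curvature_def bracket_swap[of Y X] con_minus1[OF assms(1) vfield_bracket[OF assms(2,3)] assms(4)]
 by (simp add: fun_eq_iff)

lemma curvature_endo1:
 assumes D: "connection A D" and Y: "Y \<in> V" and Z: "Z \<in> V"
 shows "tensor_endo (%X. curvature D X Y Z)"
proof (rule tensor_endoI)
 note f = con_field[OF D] vfield_bracket vfield_fscale vfield_add Y Z
 show "X \<in> V ==> curvature D X Y Z \<in> V" for X by (rule curvature_field[OF D _ Y Z])
 show "curvature D (X + X') Y Z = curvature D X Y Z + curvature D X' Y Z" if X: "X \<in> V" "X' \<in> V" for X X'
  unfolding curvature_def by (simp add: bracket_add1 con_add1[OF D] con_add2[OF D] f X)
 show "curvature D (h *\<^sub>f X) Y Z = h *\<^sub>f curvature D X Y Z" if X: "X \<in> V" and h: "h \<in> C" for X h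
 proof -
  note s = vfield_smooth[OF Y h]
  have 1: "D (bracket (h *\<^sub>f X) Y) Z = h *\<^sub>f D (bracket X Y) Z - (%p. Y p h) *\<^sub>f D X Z"
   unfolding bracket_fscale1[OF X Y h]
   by (simp only: con_diff1[OF D vfield_fscale[OF h vfield_bracket[OF X Y]] vfield_fscale[OF s X] Z]
     con_fscale1[OF D vfield_bracket[OF X Y] Z h] con_fscale1[OF D X Z s])
  show ?thesis
   unfolding curvature_def 1 con_fscale1[OF D X Z h] con_fscale1[OF D X con_field[OF D Y Z] h]
    con_fscale2[OF D Y con_field[OF D X Z] h]
   by (simp add: fun_eq_iff fscale_simps algebra_simps)
 qed
qed

lemma curvature_at:
 assumes D: "connection A D" and V: "X \<in> V" "Y \<in> V" "X' \<in> V" "Y' \<in> V" "Z \<in> V"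
  and eq: "X p = X' p" "Y p = Y' p"
 shows "curvature D X Y Z p = curvature D X' Y' Z p"
proof -
 have "curvature D X Y Z p = curvature D X' Y Z p"
  by (rule tensor_endo_at[OF curvature_endo1[OF D V(2,5)] V(1,3) eq(1)])
 also have "... = - curvature D Y X' Z p"
  by (simp add: curvature_swap[OF D V(2,3,5)])
 also have "curvature D Y X' Z p = curvature D Y' X' Z p"
  by (rule tensor_endo_at[OF curvature_endo1[OF D V(3,5)] V(2,4) eq(2)])
 also have "- curvature D Y' X' Z p = curvature D X' Y' Z p"
  by (simp add: curvature_swap[OF D V(4,3,5)])
 finally show ?thesis .
qed

definition endo_der :: "'m conn => 'm vfield => ('m vfield => 'm vfield) => 'm vfield => 'm vfield" where
 "endo_der D X S Y = D X (S Y) - S (D X Y)"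

lemma endo_der_endo:
 assumes D: "connection A D" and X: "X \<in> V" and S: "tensor_endo S"
 shows "tensor_endo (endo_der D X S)"
proof (rule tensor_endoI)
 note f = con_field[OF D X] tensor_endo_field[OF S]
 show "Y \<in> V ==> endo_der D X S Y \<in> V" for Y unfolding endo_der_def by (intro vfield_diff f)
 show "endo_der D X S (Y + Z) = endo_der D X S Y + endo_der D X S Z" if "Y \<in> V" "Z \<in> V" for Y Z
  unfolding endo_der_def by (simp add: tensor_endo_add[OF S] con_add2[OF D X] f that)
 show "endo_der D X S (h *\<^sub>f Y) = h *\<^sub>f endo_der D X S Y" if Y: "Y \<in> V" and h: "h \<in> C" for Y h
  unfolding endo_der_def tensor_endo_fscale[OF S Y h] con_fscale2[OF D X f(2)[OF Y] h] con_fscale2[OF D X Y h]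
   tensor_endo_add[OF S vfield_fscale[OF vfield_smooth[OF X h] Y] vfield_fscale[OF h f(1)[OF Y]]]
   tensor_endo_fscale[OF S Y vfield_smooth[OF X h]] tensor_endo_fscale[OF S f(1)[OF Y] h]
  by (simp add: fun_eq_iff fscale_simps algebra_simps)
qed

text \<open>The trace is parallel for every connection. In a frame this is the product rule; with
 generators, the matrix \<open>e\<close> of the pairings is only idempotent, and the extra term
 \<open>tr (t X(e))\<close> vanishes because of \<open>X(e) = X(e) e + e X(e)\<close> and \<open>t = t e = e t\<close>.\<close>

lemma trace_endo_der:
 assumes D: "connection A D" and X: "X \<in> V" and S: "tensor_endo S"
 shows "trace (endo_der D X S) p = X p (trace S)"
proof -
 let ?I = gen_index
 define t where "t l k q = S (E k) q (\<beta> l)" for l k q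
 define e where "e l k q = E k q (\<beta> l)" for l k q
 define d where "d l k = D X (E k) p (\<beta> l)" for l k
 have SE: "S (E k) \<in> V" if "k \<in> ?I" for k by (rule tensor_endo_field[OF S gen_field[OF that]])
 have tC: "t l k \<in> C" if "l \<in> ?I" "k \<in> ?I" for l k
  unfolding t_def[abs_def] by (rule vfield_smooth[OF SE gen_fun]) (rule that)+
 have eC: "e l k \<in> C" if "l \<in> ?I" "k \<in> ?I" for l k
  unfolding e_def[abs_def] by (rule vfield_smooth[OF gen_field gen_fun]) (rule that)+
 have te: "(\<Sum>l\<in>?I. t l k q * e m l q) = t m k q" if "k \<in> ?I" for k m q
  using field_gen_fun[OF SE[OF that], of q "\<beta> m"] by (simp add: t_def e_def)
 have et: "(\<Sum>k\<in>?I. t l k q * e k m q) = t l m q" if "m \<in> ?I" for l m q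
  using tensor_endo_gen[OF S gen_field[OF that], of q "\<beta> l"] by (simp add: t_def e_def mult.commute)
 have ee: "e k l q = (\<Sum>m\<in>?I. e m l q * e k m q)" if "l \<in> ?I" for k l q
  using field_gen_fun[OF gen_field[OF that], of q "\<beta> k"] by (simp add: e_def)
 have D1: "D X (S (E k)) p (\<beta> k) = (\<Sum>l\<in>?I. X p (t l k) * e k l p + t l k p * d k l)" if k: "k \<in> ?I" for k
 proof -
  have "S (E k) = (\<Sum>l\<in>?I. t l k *\<^sub>f E l)"
   using field_gen[OF SE[OF k]] by (simp only: t_def[abs_def])
  then have "D X (S (E k)) = D X (\<Sum>l\<in>?I. t l k *\<^sub>f E l)" by (rule arg_cong)
  also have "... = (\<Sum>l\<in>?I. D X (t l k *\<^sub>f E l))"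
   by (rule con_sum2[OF D X]) (intro vfield_fscale tC gen_field k)
  also have "... = (\<Sum>l\<in>?I. (%p. X p (t l k)) *\<^sub>f E l + t l k *\<^sub>f D X (E l))"
   by (rule sum.cong[OF refl]) (rule con_fscale2[OF D X gen_field tC[OF _ k]])
  finally show ?thesis
   by (simp add: sum_vfield_apply fscale_simps e_def d_def)
 qed
 have D2: "S (D X (E k)) p (\<beta> k) = (\<Sum>l\<in>?I. d l k * t k l p)" if k: "k \<in> ?I" for k
  using tensor_endo_gen[OF S con_field[OF D X gen_field[OF k]], of p "\<beta> k"] by (simp add: d_def t_def)
 have "trace (endo_der D X S) p = (\<Sum>k\<in>?I. (\<Sum>l\<in>?I. X p (t l k) * e k l p + t l k p * d k l) - (\<Sum>l\<in>?I. d l k * t k l p))"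
  unfolding trace_def endo_der_def by (rule sum.cong[OF refl]) (simp add: D1 D2)
 also have "... = (\<Sum>k\<in>?I. \<Sum>l\<in>?I. X p (t l k) * e k l p) + (\<Sum>k\<in>?I. \<Sum>l\<in>?I. t l k p * d k l)
   - (\<Sum>k\<in>?I. \<Sum>l\<in>?I. d l k * t k l p)"
  by (simp add: sum.distrib sum_subtractf)
 also have "(\<Sum>k\<in>?I. \<Sum>l\<in>?I. d l k * t k l p) = (\<Sum>k\<in>?I. \<Sum>l\<in>?I. t l k p * d k l)"
  by (subst sum.swap) (simp add: mult.commute)
 finally have L: "trace (endo_der D X S) p = (\<Sum>k\<in>?I. \<Sum>l\<in>?I. X p (t l k) * e k l p)" by simp
 have Q0: "(\<Sum>k\<in>?I. \<Sum>l\<in>?I. t l k p * X p (e k l)) = 0" (is "?Q = 0")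
 proof -
  have Xe: "X p (e k l) = (\<Sum>m\<in>?I. e m l p * X p (e k m) + e k m p * X p (e m l))" if k: "k \<in> ?I" and l: "l \<in> ?I" for k l
  proof -
   have "e k l = (%q. \<Sum>m\<in>?I. e m l q * e k m q)" using ee[OF l] by (rule ext)
   then have "X p (e k l) = X p (%q. \<Sum>m\<in>?I. e m l q * e k m q)" by (rule arg_cong)
   also have "... = (\<Sum>m\<in>?I. X p (%q. e m l q * e k m q))"
    by (rule der_sum[OF X]) (intro smooth_mult eC k l)
   also have "... = (\<Sum>m\<in>?I. e m l p * X p (e k m) + e k m p * X p (e m l))"
    by (rule sum.cong[OF refl]) (intro der_mult X eC k l)
   finally show ?thesis .
  qed
  have "?Q = (\<Sum>k\<in>?I. \<Sum>l\<in>?I. \<Sum>m\<in>?I. t l k p * e m l p * X p (e k m) + t l k p * e k m p * X p (e m l))"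
  proof (intro sum.cong refl)
   fix k l assume k: "k \<in> ?I" and l: "l \<in> ?I"
   show "t l k p * X p (e k l) = (\<Sum>m\<in>?I. t l k p * e m l p * X p (e k m) + t l k p * e k m p * X p (e m l))"
    by (subst Xe[OF k l]) (simp add: sum_distrib_left distrib_left mult.assoc)
  qed
  also have "... = (\<Sum>k\<in>?I. \<Sum>l\<in>?I. \<Sum>m\<in>?I. t l k p * e m l p * X p (e k m))
    + (\<Sum>k\<in>?I. \<Sum>l\<in>?I. \<Sum>m\<in>?I. t l k p * e k m p * X p (e m l))"
   by (simp add: sum.distrib)
  also have "(\<Sum>k\<in>?I. \<Sum>l\<in>?I. \<Sum>m\<in>?I. t l k p * e m l p * X p (e k m)) = ?Q"
  proof (rule sum.cong[OF refl])
   fix k assume k: "k \<in> ?I"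
   have "(\<Sum>l\<in>?I. \<Sum>m\<in>?I. t l k p * e m l p * X p (e k m)) = (\<Sum>m\<in>?I. (\<Sum>l\<in>?I. t l k p * e m l p) * X p (e k m))"
    by (subst sum.swap) (simp add: sum_distrib_right)
   then show "(\<Sum>l\<in>?I. \<Sum>m\<in>?I. t l k p * e m l p * X p (e k m)) = (\<Sum>l\<in>?I. t l k p * X p (e k l))"
    by (simp add: te[OF k])
  qed
  also have "(\<Sum>k\<in>?I. \<Sum>l\<in>?I. \<Sum>m\<in>?I. t l k p * e k m p * X p (e m l))
    = (\<Sum>l\<in>?I. \<Sum>m\<in>?I. \<Sum>k\<in>?I. t l k p * e k m p * X p (e m l))"
   by (subst sum.swap) (rule sum.cong[OF refl], rule sum.swap)
  also have "... = (\<Sum>l\<in>?I. \<Sum>m\<in>?I. t l m p * X p (e m l))"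
   by (intro sum.cong refl) (simp add: sum_distrib_right[symmetric] et)
  also have "... = ?Q" by (rule sum.swap)
  finally show ?thesis by simp
 qed
 have "trace S = (%q. \<Sum>k\<in>?I. \<Sum>l\<in>?I. t l k q * e k l q)"
  unfolding trace_def[abs_def] by (rule ext, rule sum.cong[OF refl]) (simp add: te, simp add: t_def)
 then have "X p (trace S) = X p (%q. \<Sum>k\<in>?I. \<Sum>l\<in>?I. t l k q * e k l q)" by (rule arg_cong)
 also have "... = (\<Sum>k\<in>?I. X p (%q. \<Sum>l\<in>?I. t l k q * e k l q))"
  by (rule der_sum[OF X]) (intro smooth_sum smooth_mult tC eC)
 also have "... = (\<Sum>k\<in>?I. \<Sum>l\<in>?I. X p (%q. t l k q * e k l q))"
  by (rule sum.cong[OF refl], rule der_sum[OF X]) (intro smooth_mult tC eC)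
 also have "... = (\<Sum>k\<in>?I. \<Sum>l\<in>?I. t l k p * X p (e k l) + e k l p * X p (t l k))"
  by (intro sum.cong refl der_mult X tC eC)
 also have "... = (\<Sum>k\<in>?I. \<Sum>l\<in>?I. X p (t l k) * e k l p)"
  using Q0 by (simp add: sum.distrib mult.commute)
 finally show ?thesis using L by simp
qed

definition d1 :: "('m vfield => 'm => real) => 'm vfield => 'm vfield => 'm => real" where
 "d1 \<theta> X Y p = X p (\<theta> Y) - Y p (\<theta> X) - \<theta> (bracket X Y) p"

text \<open>For \<open>D' = D + a\<close> the curvatures differ by terms linear in \<open>a\<close>, which make up the exterior derivative of \<open>\<theta>\<close>
 because the trace is parallel, and by a commutator of \<open>a X\<close> and \<open>a Y\<close>, whose product with \<open>K\<close> has trace 0 as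
 \<open>a\<close> commutes with \<open>K\<close>.\<close>

lemma transgression:
 assumes D: "connection A D" and D': "connection A D'" and K: "tensor_endo K"
  and DK: "!!X Y. X \<in> V ==> Y \<in> V ==> D X (K Y) = K (D X Y)"
  and D'K: "!!X Y. X \<in> V ==> Y \<in> V ==> D' X (K Y) = K (D' X Y)"
  and X: "X \<in> V" and Y: "Y \<in> V"
 defines "\<theta> \<equiv> %X. trace (%Z. K (D' X Z - D X Z))"
 shows "trace (%Z. K (curvature D' X Y Z)) p = trace (%Z. K (curvature D X Y Z)) p - d1 \<theta> X Y p"
proof -
 define a where "a X Z = D' X Z - D X Z" for X Z
 note f = con_field[OF D] con_field[OF D']
 have aV: "a X Z \<in> V" if "X \<in> V" "Z \<in> V" for X Z
  unfolding a_def by (intro vfield_diff f that)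
 have aE: "tensor_endo (a X)" if X: "X \<in> V" for X
  unfolding a_def[abs_def] by (rule connection_difference_endo[OF D D' X])
 have D'a: "D' X Z = D X Z + a X Z" for X Z by (simp add: a_def)
 have aK: "a X (K Z) = K (a X Z)" if "X \<in> V" "Z \<in> V" for X Z
  unfolding a_def DK[OF that] D'K[OF that]
  by (rule tensor_endo_diff[OF K f(2,1), symmetric]) (rule that)+
 have KE: "tensor_endo (%Z. K (S Z))" if S: "tensor_endo S" for S
  by (rule tensor_endoI) (simp_all add: tensor_endo_field[OF K] tensor_endo_field[OF S] tensor_endo_add[OF K]
    tensor_endo_add[OF S] tensor_endo_fscale[OF K] tensor_endo_fscale[OF S] del: plus_fun_apply)
 have cur: "curvature D' X Y Z = curvature D X Y Z + a (bracket X Y) Z - endo_der D X (a Y) Z + endo_der D Y (a X) Z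
   - (a X (a Y Z) - a Y (a X Z))" if Z: "Z \<in> V" for Z
  unfolding curvature_def endo_der_def D'a
  by (simp add: con_add2[OF D] f aV X Y Z tensor_endo_add[OF aE] algebra_simps)
 have "trace (%Z. K (curvature D' X Y Z)) p = trace (%Z. K (curvature D X Y Z) + K (a (bracket X Y) Z)
   - K (endo_der D X (a Y) Z) + K (endo_der D Y (a X) Z) - (K (a X (a Y Z)) - K (a Y (a X Z)))) p"
 proof (rule trace_cong)
  fix Z assume Z: "Z \<in> V"
  note v = curvature_field[OF D X Y Z] aV[OF vfield_bracket[OF X Y] Z] tensor_endo_field[OF endo_der_endo[OF D X aE[OF Y]] Z]
   tensor_endo_field[OF endo_der_endo[OF D Y aE[OF X]] Z] aV[OF X aV[OF Y Z]] aV[OF Y aV[OF X Z]]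
  show "K (curvature D' X Y Z) p = (K (curvature D X Y Z) + K (a (bracket X Y) Z)
   - K (endo_der D X (a Y) Z) + K (endo_der D Y (a X) Z) - (K (a X (a Y Z)) - K (a Y (a X Z)))) p"
   unfolding cur[OF Z]
   by (simp only: tensor_endo_add[OF K] tensor_endo_diff[OF K] vfield_add vfield_diff v)
 qed
 also have "... = trace (%Z. K (curvature D X Y Z)) p + trace (%Z. K (a (bracket X Y) Z)) p
   - trace (%Z. K (endo_der D X (a Y) Z)) p + trace (%Z. K (endo_der D Y (a X) Z)) p
   - (trace (%Z. K (a X (a Y Z))) p - trace (%Z. K (a Y (a X Z))) p)"
  by (simp only: trace_add trace_diff)
 finally have 1: "trace (%Z. K (curvature D' X Y Z)) p = ..." .
 have "trace (%Z. K (a X (a Y Z))) p = trace (%Z. a Y (K (a X Z))) p"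
  by (rule trace_commute[OF KE[OF aE[OF X]] aE[OF Y]])
 also have "... = trace (%Z. K (a Y (a X Z))) p"
  by (rule trace_cong) (simp add: aK aV X Y)
 finally have 2: "trace (%Z. K (a X (a Y Z))) p = trace (%Z. K (a Y (a X Z))) p" .
 have 3: "trace (%Z. K (endo_der D X (a Y) Z)) p = X p (trace (%Z. K (a Y Z)))"
 proof -
  have "trace (%Z. K (endo_der D X (a Y) Z)) p = trace (endo_der D X (%Z. K (a Y Z))) p"
   by (rule trace_cong) (simp add: endo_der_def DK aV f X Y tensor_endo_diff[OF K] del: minus_apply)
  then show ?thesis using trace_endo_der[OF D X KE[OF aE[OF Y]]] by simp
 qed
 have 4: "trace (%Z. K (endo_der D Y (a X) Z)) p = Y p (trace (%Z. K (a X Z)))"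
 proof -
  have "trace (%Z. K (endo_der D Y (a X) Z)) p = trace (endo_der D Y (%Z. K (a X Z))) p"
   by (rule trace_cong) (simp add: endo_der_def DK aV f X Y tensor_endo_diff[OF K] del: minus_apply)
  then show ?thesis using trace_endo_der[OF D Y KE[OF aE[OF X]]] by simp
 qed
 show ?thesis
  unfolding 1 2 3 4 d1_def \<theta>_def a_def[symmetric] by simp
qed

end

section \<open>Hermitian connections\<close>

context hermitian
begin

lemma gp_JJ: "X \<in> V ==> Y \<in> V ==> gp (JJ X) (JJ Y) p = gp X Y p"
 by (simp add: pair_def JJ_at g_J vfield_tangent)

lemma gp_JJ_skew: "X \<in> V ==> Y \<in> V ==> gp X (JJ Y) p = - gp (JJ X) Y p"
 by (simp add: pair_def JJ_at g_J_skew vfield_tangent)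

lemma JJ_simps:
 "X \<in> V ==> Y \<in> V ==> JJ (X + Y) = JJ X + JJ Y" "X \<in> V ==> Y \<in> V ==> JJ (X - Y) = JJ X - JJ Y"
 "X \<in> V ==> JJ (- X) = - JJ X" "X \<in> V ==> h \<in> C ==> JJ (h *\<^sub>f X) = h *\<^sub>f JJ X"
 by (simp_all only: tensor_endo_add[OF JJ_endo] tensor_endo_diff[OF JJ_endo] tensor_endo_minus[OF JJ_endo] tensor_endo_fscale[OF JJ_endo])

lemma trace_frame:
 assumes S: "tensor_endo S" and p: "p \<in> M"
 shows "trace S p = (\<Sum>i<DIM('e). g p (S (some_frame A g J p i) p) (some_frame A g J p i p))"
 by (rule trace_orthonormal[OF S p some_frame_field[OF p] some_frame_orthonormal[OF p]])

lemma ricci_form_trace: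
 assumes D: "connection A D" and X: "X \<in> V" and Y: "Y \<in> V" and p: "p \<in> M"
 shows "ricci_form A g J D p (X p) (Y p) = - 1 / 2 * trace (%Z. JJ (curvature D X Y Z)) p"
proof -
 let ?e = "some_frame A g J p"
 note e = some_frame_field[OF p]
 note x = extension[OF p vfield_tangent[OF X]] and y = extension[OF p vfield_tangent[OF Y]]
 have "g p (curvature D (extension A p (X p)) (extension A p (Y p)) (?e i) p) (J p (?e i p))
   = - g p (JJ (curvature D X Y (?e i)) p) (?e i p)" if i: "i < DIM('e)" for i
  using curvature_at[OF D x(1) y(1) X Y e[OF i] x(2) y(2)]
   g_J_skew[OF p vfield_tangent[OF curvature_field[OF D X Y e[OF i]]] vfield_tangent[OF e[OF i]]]
  by (simp add: JJ_at p)
 moreover have "tensor_endo (%Z. JJ (curvature D X Y Z))"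
  using curvature_endo[OF D X Y] JJ_endo unfolding tensor_endo_def by simp
 ultimately show ?thesis
  by (simp add: ricci_form_def trace_frame[OF _ p] sum_negf)
qed

abbreviation "CC \<equiv> canonical_connection A g J"

lemma CC_eq: 
 assumes X: "X \<in> V" and Y: "Y \<in> V"
 shows "CC X Y = (%p. 1 / 2) *\<^sub>f (LC X Y - JJ (LC X (JJ Y)))"
proof -
 note f = con_field[OF LC] X Y JJ_field
 show ?thesis
  by (simp add: canonical_connection_def Let_def JJ_simps JJ_JJ f) (simp add: fun_eq_iff fscale_simps algebra_simps)
qed

lemma CC_connection: "connection A CC"
proof (rule connectionI)
 note f = con_field[OF LC] JJ_field
 fix X Y assume X: "X \<in> V" and Y: "Y \<in> V"
 note cc = CC_eq[OF X Y]
 show "CC X Y \<in> V" unfolding cc by (intro vfield_fscale vfield_diff f X Y smooth_const)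
 show "CC (X + Z) Y = CC X Y + CC Z Y" if Z: "Z \<in> V" for Z
  unfolding cc CC_eq[OF Z Y] CC_eq[OF vfield_add[OF X Z] Y]
  by (simp add: con_add1[OF LC] JJ_simps f X Y Z) (simp add: fun_eq_iff fscale_simps algebra_simps)
 show "CC X (Y + Z) = CC X Y + CC X Z" if Z: "Z \<in> V" for Z
  unfolding cc CC_eq[OF X Z] CC_eq[OF X vfield_add[OF Y Z]]
  by (simp add: con_add2[OF LC] JJ_simps f X Y Z) (simp add: fun_eq_iff fscale_simps algebra_simps)
 fix h assume h: "h \<in> C"
 show "CC (h *\<^sub>f X) Y = h *\<^sub>f CC X Y"
  unfolding cc CC_eq[OF vfield_fscale[OF h X] Y]
  by (simp add: con_fscale1[OF LC] JJ_simps f X Y h) (simp add: fun_eq_iff fscale_simps algebra_simps)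
 show "CC X (h *\<^sub>f Y) = (%p. X p h) *\<^sub>f Y + h *\<^sub>f CC X Y"
  unfolding cc CC_eq[OF X vfield_fscale[OF h Y]]
  by (simp add: con_fscale2[OF LC] JJ_simps JJ_JJ f X Y h vfield_fscale vfield_smooth[OF X h])
   (simp add: fun_eq_iff fscale_simps algebra_simps)
qed

text \<open>The correction term in the canonical connection is designed for this: it removes the \<open>J\<close>-antilinear part of
 the Levi-Civita derivative.\<close>

lemma CC_JJ:
 assumes X: "X \<in> V" and Y: "Y \<in> V"
 shows "CC X (JJ Y) = JJ (CC X Y)"
proof -
 note f = con_field[OF LC] JJ_field X Y
 show ?thesis
  unfolding CC_eq[OF X Y] CC_eq[OF X JJ_field[OF Y]]
  by (simp add: JJ_simps JJ_JJ f vfield_diff con_minus2[OF LC]) (simp add: fun_eq_iff fscale_simps algebra_simps)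
qed

lemma CC_hermitian: "hermitian_connection A g J CC"
proof -
 have "X p (%q. g q (Y q) (Z q)) = g p (CC X Y p) (Z p) + g p (Y p) (CC X Z p)"
  if X: "X \<in> V" and Y: "Y \<in> V" and Z: "Z \<in> V" and p: "p \<in> M" for X Y Z p
 proof -
  note f = con_field[OF LC] JJ_field X Y Z
  note m = metric_connection_pair[OF levi_civita(1) X]
  have "(%q. g q (Y q) (Z q)) \<in> C"
   using g_tensor Y Z unfolding bilinear_tensor_def by blast
  then have "X p (%q. g q (Y q) (Z q)) = X p (gp Y Z)"
   by (rule tangent_cong[OF p vfield_tangent[OF X]]) (simp_all add: gp_smooth Y Z, simp add: pair_def)
  also have "... = (X p (gp Y Z) + X p (gp (JJ Y) (JJ Z))) / 2"
  proof -
   have "gp (JJ Y) (JJ Z) = gp Y Z" by (rule ext) (rule gp_JJ[OF Y Z])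
   then show ?thesis by simp
  qed
  also have "... = gp (CC X Y) Z p + gp Y (CC X Z) p"
   unfolding m[OF Y Z p] m[OF JJ_field[OF Y] JJ_field[OF Z] p] CC_eq[OF X Y] CC_eq[OF X Z]
   using gp_JJ_skew[OF con_field[OF LC X JJ_field[OF Y]] Z, of p] gp_JJ_skew[OF Y con_field[OF LC X JJ_field[OF Z]], of p]
   by (simp add: gp_simps f vfield_diff field_simps)
  finally show ?thesis using p by (simp add: pair_def)
 qed
 then show ?thesis
  unfolding hermitian_connection_def metric_connection_def using CC_connection CC_JJ by blast
qed

end

section \<open>Almost-Kaehler structures\<close>

context hermitian
begin

lemma J_minus:
 assumes p: "p \<in> M" and u: "u \<in> TM p"
 shows "J p (- u) = - J p u"
proof -
 have m: "- w = (-1) *\<^sub>t w" for w :: "'m tvec" by (simp add: fun_eq_iff tscale_def)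
 show ?thesis unfolding m by (rule J_scale[OF p u])
qed

lemma J_diff:
 assumes p: "p \<in> M" and u: "u \<in> TM p" and v: "v \<in> TM p"
 shows "J p (u - v) = J p u - J p v"
proof -
 have m: "a - b = a + - b" for a b :: "'m tvec" by simp
 show ?thesis unfolding m J_add[OF p u tangent_space_minus[OF v]] J_minus[OF p v] ..
qed

end

locale symplectic = compact_manifold A for A :: "('m, 'e::euclidean_space) atlas" +
 fixes n :: nat and \<omega> :: "'m form2"
 assumes symplectic: "symplectic_manifold A n \<omega>"
begin

lemma dim_2n: "DIM('e) = 2 * n" and n_pos: "n \<ge> 1"
 and \<omega>_closed: "closed_form2 A \<omega>" and \<omega>_tensor: "bilinear_tensor A \<omega>"
proof -
 show d: "DIM('e) = 2 * n" and c: "closed_form2 A \<omega>" using symplectic by (simp_all only: symplectic_manifold_def)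
 show "bilinear_tensor A \<omega>" using c by (simp only: closed_form2_def is_form2_def)
 show "n \<ge> 1" using d DIM_positive[where 'a='e] by linarith
qed

lemma \<omega>_skew:
 assumes "p \<in> M" "u \<in> TM p" "v \<in> TM p"
 shows "\<omega> p u v = - \<omega> p v u"
proof -
 have "\<forall>p\<in>M. \<forall>u\<in>TM p. \<forall>v\<in>TM p. \<omega> p v u = - \<omega> p u v"
  using \<omega>_closed unfolding closed_form2_def is_form2_def by (elim conjE) assumption
 from this[rule_format, OF assms(1,3,2)] show ?thesis .
qed

lemma AK_hermitian: "J \<in> AK A \<omega> ==> hermitian A (induced_metric \<omega> J) J n"
proof (unfold_locales)
 assume J: "J \<in> AK A \<omega>"
 show "riemannian_metric A (induced_metric \<omega> J)" and ac: "almost_complex A J"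
  using J by (auto simp: AK_def)
 show "DIM('e) = 2 * n" by (rule dim_2n)
 fix p u v assume p: "p \<in> M" and u: "u \<in> TM p" and v: "v \<in> TM p"
 have "J p v \<in> TM p" using ac p v unfolding almost_complex_def by blast
 then show "induced_metric \<omega> J p (J p u) (J p v) = induced_metric \<omega> J p u v"
  using J p u v unfolding AK_def induced_metric_def by blast
qed

abbreviation "om \<equiv> pair \<omega>"

end

locale almost_kaehler = symplectic A n \<omega> for A :: "('m, 'e::euclidean_space) atlas" and n \<omega> +
 fixes J :: "'m endo"
 assumes J_AK: "J \<in> AK A \<omega>"

sublocale almost_kaehler \<subseteq> hermitian A "induced_metric \<omega> J" J n
 by (rule AK_hermitian[OF J_AK])

context almost_kaehler
begin

abbreviation "g \<equiv> induced_metric \<omega> J"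

lemma om_gp: "X \<in> V ==> Y \<in> V ==> om X Y = gp (JJ X) Y"
proof
 fix p assume X: "X \<in> V" and Y: "Y \<in> V"
 show "om X Y p = gp (JJ X) Y p"
  using J_AK vfield_tangent[OF X, of p] vfield_tangent[OF Y, of p]
  by (simp add: pair_def induced_metric_def JJ_at AK_def)
qed

abbreviation "DJ \<equiv> %X. endo_der LC X JJ"

lemma LC_pair: "X \<in> V ==> Y \<in> V ==> Z \<in> V ==> p \<in> M ==> X p (gp Y Z) = gp (LC X Y) Z p + gp Y (LC X Z) p"
 by (rule metric_connection_pair[OF levi_civita(1)])

lemma bracket_LC: "X \<in> V ==> Y \<in> V ==> bracket X Y = LC X Y - LC Y X"
 by (simp add: levi_civita(2))

lemma DJ_skew:
 assumes X: "X \<in> V" and Y: "Y \<in> V" and Z: "Z \<in> V" and p: "p \<in> M"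
 shows "gp (DJ X Y) Z p = - gp Y (DJ X Z) p"
proof -
 note f = con_field[OF LC] JJ_field X Y Z
 have "gp (JJ Y) Z = (%q. - gp Y (JJ Z) q)" by (rule ext) (simp add: gp_JJ_skew Y Z)
 then have "X p (gp (JJ Y) Z) = X p (%q. - gp Y (JJ Z) q)" by (rule arg_cong)
 also have "... = - X p (gp Y (JJ Z))" by (rule der_minus[OF X gp_smooth]) (intro f)+
 finally have "X p (gp (JJ Y) Z) = - X p (gp Y (JJ Z))" .
 then have "gp (LC X (JJ Y)) Z p + gp (JJ Y) (LC X Z) p = - (gp (LC X Y) (JJ Z) p + gp Y (LC X (JJ Z)) p)"
  by (simp only: LC_pair[OF X JJ_field[OF Y] Z p] LC_pair[OF X Y JJ_field[OF Z] p])
 then show ?thesis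
  using gp_JJ_skew[OF Y con_field[OF LC X Z], of p] gp_JJ_skew[OF con_field[OF LC X Y] Z, of p]
  by (simp add: endo_der_def gp_simps f)
qed

text \<open>Closedness of \<open>\<omega>\<close>, with all derivatives of \<open>\<omega>(X, Y) = g(JX, Y)\<close> expressed by the Levi-Civita connection.
 The brackets turn into covariant derivatives, and only those of \<open>J\<close> survive.\<close>

lemma DJ_cyclic:
 assumes X: "X \<in> V" and Y: "Y \<in> V" and Z: "Z \<in> V" and p: "p \<in> M"
 shows "gp (DJ X Y) Z p - gp (DJ Y X) Z p + gp (DJ Z X) Y p = 0"
proof -
 note f = con_field[OF LC] JJ_field X Y Z
 have \<omega>D: "U p (%q. \<omega> q (U1 q) (U2 q)) = gp (LC U (JJ U1)) U2 p - gp (JJ (LC U U2)) U1 p"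
  if U: "U \<in> V" "U1 \<in> V" "U2 \<in> V" for U U1 U2
 proof -
  have "(%q. \<omega> q (U1 q) (U2 q)) \<in> C"
   using \<omega>_tensor U unfolding bilinear_tensor_def by blast
  then have "U p (%q. \<omega> q (U1 q) (U2 q)) = U p (om U1 U2)"
   by (rule tangent_cong[OF p vfield_tangent[OF U(1)]]) (simp_all add: pair_smooth[OF \<omega>_tensor] U, simp add: pair_def)
  also have "... = U p (gp (JJ U1) U2)" by (simp add: om_gp U)
  also have "... = gp (LC U (JJ U1)) U2 p + gp (JJ U1) (LC U U2) p"
   by (rule LC_pair[OF U(1) JJ_field[OF U(2)] U(3) p])
  finally show ?thesis
   using gp_JJ_skew[OF U(2) con_field[OF LC U(1,3)], of p] gp_sym[OF U(2) JJ_field[OF con_field[OF LC U(1,3)]]]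
   by simp
 qed
 have \<omega>B: "\<omega> p (bracket U1 U2 p) (U p) = gp (JJ (LC U1 U2)) U p - gp (JJ (LC U2 U1)) U p"
  if U: "U \<in> V" "U1 \<in> V" "U2 \<in> V" for U U1 U2
 proof -
  have "\<omega> p (bracket U1 U2 p) (U p) = om (bracket U1 U2) U p" by (simp add: pair_def p)
  also have "... = gp (JJ (bracket U1 U2)) U p" by (simp add: om_gp U vfield_bracket)
  finally show ?thesis
   by (simp add: bracket_LC U JJ_simps f gp_simps)
 qed
 have "d_form2 \<omega> X Y Z p = 0"
  using \<omega>_closed X Y Z p unfolding closed_form2_def by blast
 then show ?thesis
  unfolding d_form2_def \<omega>D[OF X Y Z] \<omega>D[OF Y X Z] \<omega>D[OF Z X Y] \<omega>B[OF Z X Y] \<omega>B[OF Y X Z] \<omega>B[OF X Y Z]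
  by (simp add: endo_der_def gp_simps f)
qed

lemma JJ_comp_endo: "tensor_endo S ==> tensor_endo (%X. JJ (S X))"
 using JJ_endo unfolding tensor_endo_def by simp

lemma comp_JJ_endo: "tensor_endo S ==> tensor_endo (%X. S (JJ X))"
 using JJ_endo unfolding tensor_endo_def by simp

lemma trace_JJ_DJ:
 assumes X: "X \<in> V"
 shows "trace (%Y. JJ (DJ X Y)) p = 0"
proof -
 note DE = endo_der_endo[OF LC X JJ_endo]
 have "trace (%Y. JJ (DJ X Y)) p = trace (%Y. DJ X (JJ Y)) p"
  by (rule trace_commute[OF JJ_endo DE])
 also have "... = trace (%Y. - JJ (DJ X Y)) p"
 proof (rule trace_cong)
  fix Y assume Y: "Y \<in> V"
  note f = con_field[OF LC] JJ_field X Y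
  show "DJ X (JJ Y) p = (- JJ (DJ X Y)) p"
   unfolding endo_der_def by (simp add: JJ_simps JJ_JJ f con_minus2[OF LC])
 qed
 finally show ?thesis by (simp add: trace_minus)
qed

text \<open>The codifferential of an almost-Kaehler form vanishes: in an orthonormal frame this is the trace of the
 cyclic identity for the derivative of \<open>J\<close>. It allows the divergence to be computed after twisting by \<open>J\<close>.\<close>

lemma balanced:
 assumes W: "W \<in> V" and p: "p \<in> M"
 shows "trace (%Y. JJ (LC Y (JJ W))) p = - trace (%Y. LC Y W) p"
proof -
 define S where "S Y = DJ Y W" for Y
 have SE: "tensor_endo S"
 proof -
  have "tensor_endo (%Y. LC Y (JJ W) - JJ (LC Y W))"
  proof (rule tensor_endoI)
   note f = con_field[OF LC] JJ_field W
   show "X \<in> V ==> LC X (JJ W) - JJ (LC X W) \<in> V" for X by (intro vfield_diff f)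
   show "LC (X + Y) (JJ W) - JJ (LC (X + Y) W) = LC X (JJ W) - JJ (LC X W) + (LC Y (JJ W) - JJ (LC Y W))"
    if "X \<in> V" "Y \<in> V" for X Y
    by (simp add: con_add1[OF LC] JJ_simps f that)
   show "LC (h *\<^sub>f X) (JJ W) - JJ (LC (h *\<^sub>f X) W) = h *\<^sub>f (LC X (JJ W) - JJ (LC X W))"
    if "X \<in> V" "h \<in> C" for X h
    by (simp add: con_fscale1[OF LC] JJ_simps f that fscale_diff)
  qed
  then show ?thesis by (simp add: S_def[abs_def] endo_der_def)
 qed
 let ?e = "some_frame A g J p"
 note e = some_frame_field[OF p]
 have "gp (S (?e i)) (JJ (?e i)) p - gp (DJ W (?e i)) (JJ (?e i)) p + gp (DJ (JJ (?e i)) (?e i)) W p = 0"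
  if i: "i < DIM('e)" for i
  using DJ_cyclic[OF e[OF i] W JJ_field[OF e[OF i]] p] by (simp add: S_def)
 moreover have "gp (S (?e i)) (JJ (?e i)) p = - gp (JJ (S (?e i))) (?e i) p" if i: "i < DIM('e)" for i
  by (rule gp_JJ_skew[OF tensor_endo_field[OF SE e[OF i]] e[OF i]])
 moreover have "gp (DJ W (?e i)) (JJ (?e i)) p = - gp (JJ (DJ W (?e i))) (?e i) p" if i: "i < DIM('e)" for i
  by (rule gp_JJ_skew[OF tensor_endo_field[OF endo_der_endo[OF LC W JJ_endo] e[OF i]] e[OF i]])
 moreover have "gp (DJ (JJ (?e i)) (?e i)) W p = - gp (S (JJ (?e i))) (?e i) p" if i: "i < DIM('e)" for i
  using DJ_skew[OF JJ_field[OF e[OF i]] e[OF i] W p] gp_sym[OF e[OF i] tensor_endo_field[OF SE JJ_field[OF e[OF i]]]]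
  by (simp add: S_def)
 ultimately have "(\<Sum>i<DIM('e). - gp (JJ (S (?e i))) (?e i) p + gp (JJ (DJ W (?e i))) (?e i) p - gp (S (JJ (?e i))) (?e i) p) = 0"
  by (intro sum.neutral) simp
 then have "- trace (%Y. JJ (S Y)) p + trace (%Y. JJ (DJ W Y)) p - trace (%Y. S (JJ Y)) p = 0"
  unfolding trace_frame[OF JJ_comp_endo[OF SE] p] trace_frame[OF comp_JJ_endo[OF SE] p]
   trace_frame[OF JJ_comp_endo[OF endo_der_endo[OF LC W JJ_endo]] p]
  by (simp add: pair_def p sum.distrib sum_subtractf sum_negf)
 moreover have "trace (%Y. S (JJ Y)) p = trace (%Y. JJ (S Y)) p"
  by (rule trace_commute[OF SE JJ_endo])
 ultimately have "trace (%Y. JJ (S Y)) p = 0" using trace_JJ_DJ[OF W, of p] by simp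
 moreover have "trace (%Y. JJ (S Y)) p = trace (%Y. JJ (LC Y (JJ W)) + LC Y W) p"
 proof (rule trace_cong)
  fix Y assume Y: "Y \<in> V"
  note f = con_field[OF LC] JJ_field W Y
  show "JJ (S Y) p = (JJ (LC Y (JJ W)) + LC Y W) p"
   unfolding S_def endo_der_def by (simp add: JJ_simps JJ_JJ f)
 qed
 ultimately show ?thesis by (simp add: trace_add)
qed

lemma trace_JJ: "p \<in> M ==> trace JJ p = 0"
 by (simp add: trace_frame[OF JJ_endo] JJ_at g_J_self[OF _ vfield_tangent[OF some_frame_field]])

text \<open>Contracting \<open>d(\<omega>(W, \<cdot>))\<close> with \<open>\<omega>\<close> gives a trace of the covariant derivative of \<open>J W\<close> twisted by \<open>J\<close>;
 balancedness identifies it with a divergence. This is why contractions of exact forms integrate to 0.\<close>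

lemma contraction_d1:
 assumes W: "W \<in> V" and \<theta>: "!!Z q. Z \<in> V ==> q \<in> M ==> \<theta> Z q = om W Z q" and \<theta>C: "!!Z. Z \<in> V ==> \<theta> Z \<in> C" and p: "p \<in> M"
 shows "(\<Sum>i<DIM('e). d1 \<theta> (some_frame A g J p i) (JJ (some_frame A g J p i)) p) = 2 * trace (%X. LC X W) p"
proof -
 let ?e = "some_frame A g J p"
 note e = some_frame_field[OF p]
 define L where "L X = LC X (JJ W)" for X
 have LE: "tensor_endo L" unfolding L_def[abs_def] by (rule con_endo1[OF LC JJ_field[OF W]])
 have d: "d1 \<theta> X Y p = gp (L X) Y p - gp (L Y) X p" if X: "X \<in> V" and Y: "Y \<in> V" for X Y
 proof -
  have D: "U p (\<theta> Z) = gp (L U) Z p + gp (JJ W) (LC U Z) p" if U: "U \<in> V" "Z \<in> V" for U Z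
  proof -
   have "U p (\<theta> Z) = U p (om W Z)"
    by (rule tangent_cong[OF p vfield_tangent[OF U(1)] \<theta>C[OF U(2)] pair_smooth[OF \<omega>_tensor W U(2)] \<theta>[OF U(2)]])
   then show ?thesis by (simp add: om_gp W U LC_pair JJ_field p L_def)
  qed
  have "\<theta> (bracket X Y) p = gp (JJ W) (LC X Y) p - gp (JJ W) (LC Y X) p"
   using \<theta>[OF vfield_bracket[OF X Y] p]
   by (simp add: om_gp W vfield_bracket X Y) (simp add: bracket_LC X Y gp_simps con_field[OF LC] JJ_field W)
  then show ?thesis
   by (simp add: d1_def D X Y)
 qed
 have "(\<Sum>i<DIM('e). d1 \<theta> (?e i) (JJ (?e i)) p) = (\<Sum>i<DIM('e). - gp (JJ (L (?e i))) (?e i) p - gp (L (JJ (?e i))) (?e i) p)"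
 proof (rule sum.cong[OF refl])
  fix i assume "i \<in> {..<DIM('e)}"
  then have i: "?e i \<in> V" using e by simp
  show "d1 \<theta> (?e i) (JJ (?e i)) p = - gp (JJ (L (?e i))) (?e i) p - gp (L (JJ (?e i))) (?e i) p"
   using gp_JJ_skew[OF tensor_endo_field[OF LE i] i, of p] by (simp add: d i JJ_field)
 qed
 also have "... = - trace (%X. JJ (L X)) p - trace (%X. L (JJ X)) p"
  unfolding trace_frame[OF JJ_comp_endo[OF LE] p] trace_frame[OF comp_JJ_endo[OF LE] p]
  by (simp add: pair_def p sum_subtractf sum_negf)
 also have "trace (%X. L (JJ X)) p = trace (%X. JJ (L X)) p" by (rule trace_commute[OF LE JJ_endo])
 also have "trace (%X. JJ (L X)) p = - trace (%X. LC X W) p" unfolding L_def by (rule balanced[OF W p])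
 finally show ?thesis by simp
qed

lemma differential_tensor: "f \<in> C ==> tensor_form (%X p. X p f)"
 unfolding tensor_form_def by (auto simp: vfield_smooth fscale_simps)

definition grad :: "('m => real) => 'm vfield" where
 "grad f = (SOME G. G \<in> V \<and> (\<forall>Z\<in>V. \<forall>p\<in>M. gp G Z p = Z p f))"

lemma grad:
 assumes f: "f \<in> C"
 shows grad_field: "grad f \<in> V" and gp_grad: "Z \<in> V ==> p \<in> M ==> gp (grad f) Z p = Z p f"
proof -
 obtain G where "G \<in> V" "!!Z p. Z \<in> V ==> p \<in> M ==> gp G Z p = Z p f"
  by (rule riesz[OF differential_tensor[OF f]]) (rule that)
 then have "\<exists>G. G \<in> V \<and> (\<forall>Z\<in>V. \<forall>p\<in>M. gp G Z p = Z p f)" by blast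
 from someI_ex[OF this] show "grad f \<in> V" "Z \<in> V ==> p \<in> M ==> gp (grad f) Z p = Z p f"
  unfolding grad_def[symmetric] by blast+
qed

lemma laplacian_trace:
 assumes f: "f \<in> C" and p: "p \<in> M"
 shows "laplacian A g J f p = - trace (%X. LC X (grad f)) p"
proof -
 let ?e = "some_frame A g J p"
 note e = some_frame_field[OF p] and G = grad_field[OF f]
 have "?e i p (%q. ?e i q f) - LC (?e i) (?e i) p f = g p (LC (?e i) (grad f) p) (?e i p)" if "i < DIM('e)" for i
 proof -
  note ei = e[OF that]
  have 1: "?e i p (%q. ?e i q f) = ?e i p (gp (grad f) (?e i))"
   by (rule tangent_cong[OF p vfield_tangent[OF ei] vfield_smooth[OF ei f] gp_smooth[OF G ei]]) (simp add: gp_grad[OF f ei])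
  have 2: "?e i p (gp (grad f) (?e i)) = gp (LC (?e i) (grad f)) (?e i) p + gp (grad f) (LC (?e i) (?e i)) p"
   by (rule LC_pair[OF ei G ei p])
  have 3: "gp (grad f) (LC (?e i) (?e i)) p = LC (?e i) (?e i) p f"
   by (rule gp_grad[OF f con_field[OF LC ei ei] p])
  have 4: "gp (LC (?e i) (grad f)) (?e i) p = g p (LC (?e i) (grad f) p) (?e i p)"
   using p by (simp only: pair_def if_True)
  show ?thesis unfolding 1 2 3 4 by (rule add_diff_cancel_right')
 qed
 then have "(\<Sum>i<DIM('e). ?e i p (%q. ?e i q f) - LC (?e i) (?e i) p f) = trace (%X. LC X (grad f)) p"
  unfolding trace_frame[OF con_endo1[OF LC G] p] by (intro sum.cong refl) (simp only: lessThan_iff)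
 then show ?thesis unfolding laplacian_def codifferential_def Let_def by (rule arg_cong)
qed

lemma norm_df_sq_grad:
 assumes f: "f \<in> C" and p: "p \<in> M"
 shows "norm_df_sq A g J f p = gp (grad f) (grad f) p"
proof -
 let ?e = "some_frame A g J p" and ?G = "grad f p"
 note e = some_frame_field[OF p] and G = vfield_tangent[OF grad_field[OF f], of p]
 have c: "g p ?G (?e i p) = ?e i p f" if "i < DIM('e)" for i
  using gp_grad[OF f e[OF that] p] by (simp add: pair_def p)
 have "g p ?G ?G = g p (\<Sum>i<DIM('e). g p ?G (?e i p) *\<^sub>t ?e i p) ?G"
  by (rule arg_cong[where f="%u. g p u ?G"]) (rule orthonormal_expand[OF p some_frame_orthonormal[OF p] G])
 also have "... = (\<Sum>i<DIM('e). g p ?G (?e i p) * g p (?e i p) ?G)"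
  by (rule g_sum(1)[OF p G]) (rule vfield_tangent[OF e], simp)
 also have "... = (\<Sum>i<DIM('e). (?e i p f)\<^sup>2)"
  by (rule sum.cong[OF refl]) (simp add: c g_sym[OF p vfield_tangent[OF e] G] power2_eq_square)
 finally show ?thesis by (simp add: norm_df_sq_def pair_def p)
qed

lemma potential_grad:
 assumes \<xi>: "!!p. p \<in> M ==> \<xi> p \<in> TM p" "!!p. p \<notin> M ==> \<xi> p = 0" and f: "potential A \<omega> \<xi> f"
 shows "\<xi> = JJ (grad f)"
proof
 fix p
 have fC: "f \<in> C" using f by (simp add: potential_def)
 note G = grad_field[OF fC]
 show "\<xi> p = JJ (grad f) p"
 proof (cases "p \<in> M")
  case True
  note t = \<xi>(1)[OF True] vfield_tangent[OF JJ_field[OF G], of p]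
  show ?thesis
  proof (rule nondegenerate[OF True t])
   fix w assume w: "w \<in> TM p"
   obtain Z where Z: "Z \<in> V" "Z p = w" by (rule tangent_extend[OF True w]) (rule that)
   have "g p (\<xi> p) w = - J p w f"
    using f True J_tangent[OF True w] by (simp add: induced_metric_def potential_def)
   also have "J p w f = gp (grad f) (JJ Z) p"
    using gp_grad[OF fC JJ_field[OF Z(1)] True] Z True by (simp add: JJ_at)
   also have "... = - gp (JJ (grad f)) Z p" by (rule gp_JJ_skew[OF G Z(1)])
   finally show "g p (\<xi> p) w = g p (JJ (grad f) p) w" using True Z by (simp add: pair_def)
  qed
 qed (simp add: \<xi>(2) vfield_outside[OF JJ_field[OF G]])
qed

text \<open>The trace on the left is the value of the equivariant Chern-Ricci form on \<open>\<xi>\<close>, so the Laplacian is a moment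
 map for the Chern-Ricci form. Up to a multiple of the derivative of \<open>J\<close>, which is trace-free because the
 trace of \<open>J\<close> is 0, the endomorphism is \<open>J\<close> times the covariant derivative of \<open>\<xi>\<close>, and balancedness applies.\<close>

lemma moment_laplacian:
 assumes f: "f \<in> C" and p: "p \<in> M"
 defines "\<xi> \<equiv> JJ (grad f)"
 shows "trace (%Y. JJ (CC \<xi> Y - bracket \<xi> Y)) p = laplacian A g J f p"
proof -
 note G = grad_field[OF f]
 have \<xi>: "\<xi> \<in> V" unfolding \<xi>_def by (rule JJ_field[OF G])
 have "trace (%Y. JJ (CC \<xi> Y - bracket \<xi> Y)) p = trace (%Y. (%p. 1 / 2) *\<^sub>f DJ \<xi> Y + JJ (LC Y \<xi>)) p"
 proof (rule trace_cong)
  fix Y assume Y: "Y \<in> V"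
  note f = con_field[OF LC] JJ_field \<xi> Y
  show "JJ (CC \<xi> Y - bracket \<xi> Y) p = ((%p. 1 / 2) *\<^sub>f DJ \<xi> Y + JJ (LC Y \<xi>)) p"
   unfolding CC_eq[OF \<xi> Y] bracket_LC[OF \<xi> Y] endo_der_def
   by (simp add: JJ_simps JJ_JJ f vfield_diff vfield_fscale) (simp add: fun_eq_iff fscale_simps algebra_simps)
 qed
 also have "... = 1 / 2 * trace (DJ \<xi>) p + trace (%Y. JJ (LC Y \<xi>)) p"
  unfolding trace_add trace_fscale ..
 also have "trace (DJ \<xi>) p = \<xi> p (trace JJ)" by (rule trace_endo_der[OF LC \<xi> JJ_endo])
 also have "... = \<xi> p (%q. 0)"
  by (rule tangent_cong[OF p vfield_tangent[OF \<xi>] trace_smooth[OF JJ_endo] smooth_const]) (simp add: trace_JJ)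
 also have "... = 0" by (rule tangent_const[OF vfield_tangent[OF \<xi>]])
 also have "trace (%Y. JJ (LC Y \<xi>)) p = - trace (%Y. LC Y (grad f)) p"
  unfolding \<xi>_def by (rule balanced[OF G p])
 finally show ?thesis by (simp only: laplacian_trace[OF f p] mult_zero_right add_0_left)
qed

end

section \<open>Comparison of two almost-Kaehler structures\<close>

locale two_structures = K: almost_kaehler A n \<omega> J + K0: almost_kaehler A n \<omega> J0
 for A :: "('m, 'e::euclidean_space) atlas" and n \<omega> J J0
begin

abbreviation "\<J> \<equiv> endo_apply A J"
abbreviation "\<J>0 \<equiv> endo_apply A J0"

text \<open>An explicit isomorphism of the complex vector bundles \<open>(TM, J)\<close> and \<open>(TM, J0)\<close>, natural in
 both structures. It is injective because its pairing with the identity is the mean of the two metrics.\<close>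

definition \<Phi> :: "'m vfield => 'm vfield" where
 "\<Phi> X = (%p. 1 / 2) *\<^sub>f (X - \<J>0 (\<J> X))"

definition \<phi> :: "'m => 'm tvec => 'm tvec" where
 "\<phi> p u = (1 / 2) *\<^sub>t (u - J0 p (J p u))"

lemma \<Phi>_at: "p \<in> K.M ==> \<Phi> X p = \<phi> p (X p)"
 by (simp add: \<Phi>_def \<phi>_def fscale_def endo_apply_def)

lemma \<phi>_tangent: "p \<in> K.M ==> u \<in> K.TM p ==> \<phi> p u \<in> K.TM p"
 unfolding \<phi>_def by (intro K.tangent_space_scale K.tangent_space_diff K0.J_tangent K.J_tangent)

lemma \<phi>_lin:
 assumes p: "p \<in> K.M" and u: "u \<in> K.TM p"
 shows "v \<in> K.TM p ==> \<phi> p (u + v) = \<phi> p u + \<phi> p v" "\<phi> p (c *\<^sub>t u) = c *\<^sub>t \<phi> p u"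
  "\<phi> p (J p u) = J0 p (\<phi> p u)"
proof -
 note t = K.J_tangent[OF p] K0.J_tangent[OF p]
 show "\<phi> p (u + v) = \<phi> p u + \<phi> p v" if v: "v \<in> K.TM p"
  unfolding \<phi>_def K.J_add[OF p u v] K0.J_add[OF p t(1)[OF u] t(1)[OF v]]
  by (simp add: fun_eq_iff tscale_def algebra_simps)
 show "\<phi> p (c *\<^sub>t u) = c *\<^sub>t \<phi> p u"
  unfolding \<phi>_def K.J_scale[OF p u] K0.J_scale[OF p t(1)[OF u]]
  by (simp add: fun_eq_iff tscale_def algebra_simps)
 note w = t(2)[OF t(1)[OF u]]
 show "\<phi> p (J p u) = J0 p (\<phi> p u)"
  unfolding \<phi>_def K0.J_scale[OF p K.tangent_space_diff[OF u w]] K0.J_diff[OF p u w] K0.J_J[OF p t(1)[OF u]]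
   K.J_J[OF p u] K0.J_minus[OF p u]
  by (simp add: fun_eq_iff tscale_def algebra_simps)
qed

lemma \<phi>_pairing:
 assumes p: "p \<in> K.M" and u: "u \<in> K.TM p" and v: "v \<in> K.TM p"
 shows "K0.g p (\<phi> p u) v = (K0.g p u v + K.g p u v) / 2"
proof -
 note t = K.J_tangent[OF p] K0.J_tangent[OF p]
 have 1: "K0.g p (J0 p (J p u)) v = \<omega> p (J p u) v"
  using K0.J_AK t(1)[OF u] p v unfolding AK_def induced_metric_def by blast
 have 2: "K.g p u v = - \<omega> p (J p u) v"
  using K.g_J_skew[OF p u v] K.J_AK p t(1) u v K.J_J[OF p v] K.bilinear_minus(2)[OF K.\<omega>_tensor p t(1)[OF u] v]
   K.g_J[OF p u v]
  by (simp add: induced_metric_def)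
 have "K0.g p (\<phi> p u) v = 1 / 2 * K0.g p (u + - J0 p (J p u)) v"
  unfolding \<phi>_def using K0.g_lin(3)[OF p K.tangent_space_diff[OF u t(2)[OF t(1)[OF u]]] u v, of "1 / 2"] by simp
 also have "... = 1 / 2 * (K0.g p u v - K0.g p (J0 p (J p u)) v)"
  using K0.g_lin(1)[OF p u K.tangent_space_minus[OF t(2)[OF t(1)[OF u]]] v] K0.g_lin(5)[OF p t(2)[OF t(1)[OF u]] v] by simp
 finally show ?thesis using 1 2 by simp
qed

lemma \<phi>_inj:
 assumes p: "p \<in> K.M" and u: "u \<in> K.TM p" and z: "\<phi> p u = 0"
 shows "u = 0"
proof (rule ccontr)
 assume "u \<noteq> 0"
 then have "0 < (K0.g p u u + K.g p u u) / 2" using K.g_pos[OF p u] K0.g_pos[OF p u] by simp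
 also have "... = K0.g p (\<phi> p u) u" by (rule \<phi>_pairing[OF p u u, symmetric])
 also have "... = 0" unfolding z by (rule K0.g_lin(7)[OF p u])
 finally show False by simp
qed

lemma \<phi>_adjoint:
 assumes p: "p \<in> K.M" and u: "u \<in> K.TM p" and v: "v \<in> K.TM p"
 shows "K0.g p (\<phi> p u) v = K0.g p u (\<phi> p v)"
 using \<phi>_pairing[OF p u v] \<phi>_pairing[OF p v u] K.g_sym[OF p u v] K0.g_sym[OF p u v]
  K0.g_sym[OF p u \<phi>_tangent[OF p v]] by simp

lemma \<Phi>_endo: "K.tensor_endo \<Phi>"
proof (rule K.tensor_endoI)
 note f = K.JJ_field K0.JJ_field
 show "X \<in> K.V ==> \<Phi> X \<in> K.V" for X unfolding \<Phi>_def by (intro K.vfield_fscale K.smooth_const K.vfield_diff f)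
 show "\<Phi> (X + Y) = \<Phi> X + \<Phi> Y" if "X \<in> K.V" "Y \<in> K.V" for X Y
  unfolding \<Phi>_def by (simp add: K.JJ_simps K0.JJ_simps f that) (simp add: fun_eq_iff K.fscale_simps algebra_simps)
 show "\<Phi> (h *\<^sub>f X) = h *\<^sub>f \<Phi> X" if "X \<in> K.V" "h \<in> K.C" for X h
  unfolding \<Phi>_def by (simp add: K.JJ_simps K0.JJ_simps f that) (simp add: fun_eq_iff K.fscale_simps algebra_simps)
qed

lemma \<Phi>_J: "X \<in> K.V ==> \<Phi> (\<J> X) = \<J>0 (\<Phi> X)"
proof
 fix p assume X: "X \<in> K.V"
 show "\<Phi> (\<J> X) p = \<J>0 (\<Phi> X) p"
 proof (cases "p \<in> K.M")
  case True
  then show ?thesis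
   using \<phi>_lin(3)[OF True K.vfield_tangent[OF X]] by (simp add: \<Phi>_at K.JJ_at K0.JJ_at)
 next
  case False
  then show ?thesis by (simp add: \<Phi>_def fscale_def tscale_def endo_apply_def fun_eq_iff)
 qed
qed

text \<open>The metric pulled back along \<open>\<Phi>\<close>. Its Riesz lemma produces a smooth inverse of \<open>\<Phi>\<close>.\<close>

definition h :: "'m form2" where
 "h p u v = K0.g p (\<phi> p u) (\<phi> p v)"

lemma h_hermitian: "hermitian A h J n"
proof (unfold_locales)
 show "almost_complex A J" by (rule K.J)
 show "DIM('e) = 2 * n" by (rule K.dim_2n)
 fix p u v assume p: "p \<in> K.M" and u: "u \<in> K.TM p" and v: "v \<in> K.TM p"
 show "h p (J p u) (J p v) = h p u v"
  unfolding h_def \<phi>_lin(3)[OF p u] \<phi>_lin(3)[OF p v] by (rule K0.g_J[OF p \<phi>_tangent[OF p u] \<phi>_tangent[OF p v]])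
next
 show "riemannian_metric A h"
  unfolding riemannian_metric_def
 proof (intro conjI ballI impI)
  fix p u assume p: "p \<in> K.M" and u: "u \<in> K.TM p"
  show "h p u v = h p v u" if v: "v \<in> K.TM p" for v
   unfolding h_def by (rule K0.g_sym[OF p \<phi>_tangent[OF p u] \<phi>_tangent[OF p v]])
  show "u \<noteq> 0 ==> h p u u > 0"
   unfolding h_def using K0.g_pos[OF p \<phi>_tangent[OF p u]] \<phi>_inj[OF p u] by blast
 next
  show "bilinear_tensor A h"
   unfolding bilinear_tensor_def
  proof (rule conjI; intro ballI allI)
   fix p u v w c assume p: "p \<in> K.M" and t: "u \<in> K.TM p" "v \<in> K.TM p" "w \<in> K.TM p"
   note \<phi>t = \<phi>_tangent[OF p]
   show "h p (u + v) w = h p u w + h p v w \<and> h p w (u + v) = h p w u + h p w v \<and>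
    h p (c *\<^sub>t u) w = c * h p u w \<and> h p u (c *\<^sub>t w) = c * h p u w"
    unfolding h_def \<phi>_lin(1)[OF p t(1,2)] \<phi>_lin(2)[OF p t(1)] \<phi>_lin(2)[OF p t(3)]
    using K.bilinear_tensorD[OF K0.g_tensor p \<phi>t[OF t(1)] \<phi>t[OF t(2)] \<phi>t[OF t(3)]]
     K.bilinear_tensorD[OF K0.g_tensor p \<phi>t[OF t(1)] \<phi>t[OF t(1)] \<phi>t[OF t(3)]] by simp
  next
   fix X Y assume X: "X \<in> K.V" and Y: "Y \<in> K.V"
   have "K0.gp (\<Phi> X) (\<Phi> Y) \<in> K.C"
    by (rule K0.gp_smooth[OF K.tensor_endo_field[OF \<Phi>_endo X] K.tensor_endo_field[OF \<Phi>_endo Y]])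
   then show "(%p. h p (X p) (Y p)) \<in> K.C"
    by (rule K.smooth_cong) (simp add: K.pair_def h_def \<Phi>_at)
  qed
 qed
qed

lemma \<Phi>_inverse:
 obtains \<Psi> where "K.tensor_endo \<Psi>" "!!X. X \<in> K.V ==> \<Phi> (\<Psi> X) = X" "!!X. X \<in> K.V ==> \<Psi> (\<Phi> X) = X"
proof -
 interpret H: hermitian A h J n by (rule h_hermitian)
 note \<Phi>V = K.tensor_endo_field[OF \<Phi>_endo]
 have inj: "X = Y" if "X \<in> K.V" "Y \<in> K.V" "\<Phi> X = \<Phi> Y" for X Y
 proof -
  have V: "X - Y \<in> K.V" using that K.vfield_diff by blast
  have z: "\<Phi> (X - Y) = 0" using K.tensor_endo_diff[OF \<Phi>_endo that(1,2)] that(3) by simp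
  have "(X - Y) p = 0" for p
  proof (cases "p \<in> K.M")
   case True
   show ?thesis by (rule \<phi>_inj[OF True K.vfield_tangent[OF V]]) (use \<Phi>_at[OF True, of "X - Y"] z in simp)
  qed (rule K.vfield_outside[OF V])
  then have "X - Y = 0" by (intro ext) (metis zero_fun_apply)
  then show ?thesis by simp
 qed
 have "\<forall>X\<in>K.V. \<exists>U. U \<in> K.V \<and> \<Phi> U = X"
 proof
  fix X assume X: "X \<in> K.V"
  have "K.tensor_form (%Z. K0.gp X (\<Phi> Z))"
   unfolding K.tensor_form_def
   by (auto simp: K0.gp_smooth X \<Phi>V K.tensor_endo_add[OF \<Phi>_endo] K.tensor_endo_fscale[OF \<Phi>_endo] K0.gp_simps simp del: plus_fun_apply)
  then obtain U where U: "U \<in> K.V" "!!Z p. Z \<in> K.V ==> p \<in> K.M ==> H.gp U Z p = K0.gp X (\<Phi> Z) p"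
   by (rule H.riesz) (rule that)
  have "\<Phi> (\<Phi> U) = \<Phi> X"
  proof (rule K0.field_eqI[OF \<Phi>V[OF \<Phi>V[OF U(1)]] \<Phi>V[OF X]])
   fix Z p assume Z: "Z \<in> K.V" and p: "p \<in> K.M"
   note t = K.vfield_tangent[of _ p]
   show "K0.gp (\<Phi> (\<Phi> U)) Z p = K0.gp (\<Phi> X) Z p"
    using U(2)[OF Z p] \<phi>_adjoint[OF p t[OF \<Phi>V[OF U(1)]] t[OF Z]] \<phi>_adjoint[OF p t[OF X] t[OF Z]]
    by (simp add: K.pair_def p h_def \<Phi>_at)
  qed
  then have "\<Phi> U = X" by (rule inj[OF \<Phi>V[OF U(1)] X])
  then show "\<exists>U. U \<in> K.V \<and> \<Phi> U = X" using U by blast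
 qed
 then obtain \<Psi> where \<Psi>': "\<forall>X\<in>K.V. \<Psi> X \<in> K.V \<and> \<Phi> (\<Psi> X) = X"
  unfolding bchoice_iff by (elim exE) (rule that)
 have \<Psi>: "!!X. X \<in> K.V ==> \<Psi> X \<in> K.V" "!!X. X \<in> K.V ==> \<Phi> (\<Psi> X) = X" using \<Psi>' by blast+
 show ?thesis
 proof (rule that[of \<Psi>])
  show "X \<in> K.V ==> \<Phi> (\<Psi> X) = X" for X by (rule \<Psi>(2))
  show "X \<in> K.V ==> \<Psi> (\<Phi> X) = X" for X
   by (rule inj) (simp_all add: \<Psi> \<Phi>V)
  show "K.tensor_endo \<Psi>"
  proof (rule K.tensor_endoI[OF \<Psi>(1)])
   show "\<Psi> (X + Y) = \<Psi> X + \<Psi> Y" if "X \<in> K.V" "Y \<in> K.V" for X Y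
    by (rule inj) (simp_all add: \<Psi> that K.vfield_add K.tensor_endo_add[OF \<Phi>_endo] del: plus_fun_apply)
   show "\<Psi> (h *\<^sub>f X) = h *\<^sub>f \<Psi> X" if "X \<in> K.V" "h \<in> K.C" for X h
    by (rule inj) (simp_all add: \<Psi> that K.vfield_fscale K.tensor_endo_fscale[OF \<Phi>_endo])
  qed
 qed
qed

text \<open>The connection \<open>D0\<close> is transported along \<open>\<Phi>\<close> to a connection that commutes with \<open>J\<close> and whose curvature has
 the same trace form, so that the transgression of the trace applies. The primitive obtained in this way is
 natural: an infinitesimal automorphism \<open>\<xi>\<close> of both structures commutes with \<open>\<Phi>\<close>, and the Lie derivative along
 \<open>\<xi>\<close> can be subtracted from both connections, which separates the two structures.\<close>

lemma chern_ricci_transgression: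
 assumes D: "hermitian_connection A K.g J D" and D0: "hermitian_connection A K0.g J0 D0"
 obtains \<theta> where "K.tensor_form \<theta>"
  "!!X Y p. X \<in> K.V ==> Y \<in> K.V ==> p \<in> K.M ==>
   ricci_form A K0.g J0 D0 p (X p) (Y p) - ricci_form A K.g J D p (X p) (Y p) = 1 / 2 * K.d1 \<theta> X Y p"
  "!!\<xi> p. \<xi> \<in> K.V ==> (!!Y. Y \<in> K.V ==> bracket \<xi> (\<J> Y) = \<J> (bracket \<xi> Y)) ==>
   (!!Y. Y \<in> K.V ==> bracket \<xi> (\<J>0 Y) = \<J>0 (bracket \<xi> Y)) ==>
   \<theta> \<xi> p = K.trace (%Y. \<J>0 (D0 \<xi> Y - bracket \<xi> Y)) p - K.trace (%Y. \<J> (D \<xi> Y - bracket \<xi> Y)) p"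
proof -
 obtain \<Psi> where \<Psi>: "K.tensor_endo \<Psi>" "!!X. X \<in> K.V ==> \<Phi> (\<Psi> X) = X" "!!X. X \<in> K.V ==> \<Psi> (\<Phi> X) = X"
  by (rule \<Phi>_inverse) (rule that)
 have cD: "connection A D" and cD0: "connection A D0"
  and DJ: "!!X Y. X \<in> K.V ==> Y \<in> K.V ==> D X (\<J> Y) = \<J> (D X Y)"
  and D0J: "!!X Y. X \<in> K.V ==> Y \<in> K.V ==> D0 X (\<J>0 Y) = \<J>0 (D0 X Y)"
  using D D0 unfolding hermitian_connection_def metric_connection_def by blast+
 note \<Phi>V = K.tensor_endo_field[OF \<Phi>_endo] and \<Psi>V = K.tensor_endo_field[OF \<Psi>(1)]
 note \<Phi>l = K.tensor_endo_add[OF \<Phi>_endo] K.tensor_endo_diff[OF \<Phi>_endo] K.tensor_endo_fscale[OF \<Phi>_endo]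
 note \<Psi>l = K.tensor_endo_add[OF \<Psi>(1)] K.tensor_endo_diff[OF \<Psi>(1)] K.tensor_endo_fscale[OF \<Psi>(1)]
 note f0 = K.con_field[OF cD0] and f = K.con_field[OF cD]
 have \<Psi>J: "\<Psi> (\<J>0 X) = \<J> (\<Psi> X)" if X: "X \<in> K.V" for X
 proof -
  have "\<Psi> (\<J>0 X) = \<Psi> (\<J>0 (\<Phi> (\<Psi> X)))" by (simp add: \<Psi> X)
  also have "... = \<Psi> (\<Phi> (\<J> (\<Psi> X)))" by (simp add: \<Phi>_J \<Psi>V X)
  also have "... = \<J> (\<Psi> X)" by (simp add: \<Psi> \<Psi>V X K.JJ_field)
  finally show ?thesis .
 qed
 define D' where "D' X Y = \<Psi> (D0 X (\<Phi> Y))" for X Y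
 have cD': "connection A D'"
 proof (rule K.connectionI)
  fix X Y Z assume X: "X \<in> K.V" and Y: "Y \<in> K.V" and Z: "Z \<in> K.V"
  show "D' (X + Y) Z = D' X Z + D' Y Z"
   unfolding D'_def by (simp only: K.con_add1[OF cD0 X Y \<Phi>V[OF Z]] \<Psi>l(1)[OF f0[OF X \<Phi>V[OF Z]] f0[OF Y \<Phi>V[OF Z]]])
  show "D' X (Y + Z) = D' X Y + D' X Z"
   unfolding D'_def by (simp only: \<Phi>l(1)[OF Y Z] K.con_add2[OF cD0 X \<Phi>V[OF Y] \<Phi>V[OF Z]]
     \<Psi>l(1)[OF f0[OF X \<Phi>V[OF Y]] f0[OF X \<Phi>V[OF Z]]])
 next
  fix X Y assume X: "X \<in> K.V" and Y: "Y \<in> K.V"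
  show "D' X Y \<in> K.V" unfolding D'_def by (intro \<Psi>V f0 \<Phi>V X Y)
  fix h assume h: "h \<in> K.C"
  show "D' (h *\<^sub>f X) Y = h *\<^sub>f D' X Y"
   unfolding D'_def by (simp only: K.con_fscale1[OF cD0 X \<Phi>V[OF Y] h] \<Psi>l(3)[OF f0[OF X \<Phi>V[OF Y]] h])
  show "D' X (h *\<^sub>f Y) = (%p. X p h) *\<^sub>f Y + h *\<^sub>f D' X Y"
   unfolding D'_def by (simp only: \<Phi>l(3)[OF Y h] K.con_fscale2[OF cD0 X \<Phi>V[OF Y] h]
     \<Psi>l(1)[OF K.vfield_fscale[OF K.vfield_smooth[OF X h] \<Phi>V[OF Y]] K.vfield_fscale[OF h f0[OF X \<Phi>V[OF Y]]]]
     \<Psi>l(3)[OF f0[OF X \<Phi>V[OF Y]] h] \<Psi>l(3)[OF \<Phi>V[OF Y] K.vfield_smooth[OF X h]] \<Psi>(3)[OF Y])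
 qed
 have D'J: "D' X (\<J> Y) = \<J> (D' X Y)" if X: "X \<in> K.V" and Y: "Y \<in> K.V" for X Y
  unfolding D'_def by (simp only: \<Phi>_J[OF Y] D0J[OF X \<Phi>V[OF Y]] \<Psi>J[OF f0[OF X \<Phi>V[OF Y]]])
 have curv: "curvature D' X Y Z = \<Psi> (curvature D0 X Y (\<Phi> Z))" if X: "X \<in> K.V" and Y: "Y \<in> K.V" and Z: "Z \<in> K.V" for X Y Z
  unfolding curvature_def D'_def
  by (simp add: \<Psi> \<Psi>l f0 \<Phi>V X Y Z K.vfield_bracket K.vfield_diff)
 have conj: "K.trace (%Z. \<J> (\<Psi> (S (\<Phi> Z)))) p = K.trace (%Z. \<J>0 (S Z)) p" if S: "K.tensor_endo S" for S p
 proof -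
  note SV = K.tensor_endo_field[OF S]
  have E: "K.tensor_endo (%Z. \<J>0 (S (\<Phi> Z)))"
   by (rule K.tensor_endoI) (simp_all add: K0.JJ_field SV \<Phi>V \<Phi>l K.tensor_endo_add[OF S] K.tensor_endo_fscale[OF S] K0.JJ_simps del: plus_fun_apply)
  have "K.trace (%Z. \<J> (\<Psi> (S (\<Phi> Z)))) p = K.trace (%Z. \<Psi> (\<J>0 (S (\<Phi> Z)))) p"
   by (rule K.trace_cong) (simp add: \<Psi>J SV \<Phi>V)
  also have "... = K.trace (%Z. \<J>0 (S (\<Phi> (\<Psi> Z)))) p" by (rule K.trace_commute[OF \<Psi>(1) E])
  also have "... = K.trace (%Z. \<J>0 (S Z)) p" by (rule K.trace_cong) (simp add: \<Psi>)
  finally show ?thesis .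
 qed
 define \<theta> where "\<theta> X = K.trace (%Z. \<J> (D' X Z - D X Z))" for X
 have \<theta>_abs: "\<theta> = (%X. K.trace (%Z. \<J> (D' X Z - D X Z)))" by (rule ext) (rule \<theta>_def)
 have f': "!!X Y. X \<in> K.V ==> Y \<in> K.V ==> D' X Y \<in> K.V" by (rule K.con_field[OF cD'])
 have aE: "K.tensor_endo (%Z. \<J> (D' X Z - D X Z))" if X: "X \<in> K.V" for X
  by (rule K.JJ_comp_endo[OF K.connection_difference_endo[OF cD cD' X]])
 show ?thesis
 proof (rule that[of \<theta>])
  show "K.tensor_form \<theta>"
   unfolding K.tensor_form_def
  proof (intro conjI ballI)
   fix X assume X: "X \<in> K.V"
   show "\<theta> X \<in> K.C" unfolding \<theta>_def by (rule K.trace_smooth[OF aE[OF X]])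
   show "\<theta> (X + Y) p = \<theta> X p + \<theta> Y p" if Y: "Y \<in> K.V" for Y p
   proof -
    have "\<theta> (X + Y) p = K.trace (%Z. \<J> (D' X Z - D X Z) + \<J> (D' Y Z - D Y Z)) p"
     unfolding \<theta>_def
    proof (rule K.trace_cong)
     fix Z assume Z: "Z \<in> K.V"
     have "D' (X + Y) Z - D (X + Y) Z = (D' X Z - D X Z) + (D' Y Z - D Y Z)"
      by (simp add: K.con_add1[OF cD' X Y Z] K.con_add1[OF cD X Y Z])
     then show "\<J> (D' (X + Y) Z - D (X + Y) Z) p = (\<J> (D' X Z - D X Z) + \<J> (D' Y Z - D Y Z)) p"
      by (simp only: K.JJ_simps(1)[OF K.vfield_diff[OF f'[OF X Z] f[OF X Z]] K.vfield_diff[OF f'[OF Y Z] f[OF Y Z]]])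
    qed
    then show ?thesis by (simp only: K.trace_add \<theta>_def)
   qed
   show "\<theta> (h *\<^sub>f X) p = h p * \<theta> X p" if h: "h \<in> K.C" for h p
   proof -
    have "\<theta> (h *\<^sub>f X) p = K.trace (%Z. h *\<^sub>f \<J> (D' X Z - D X Z)) p"
     unfolding \<theta>_def
    proof (rule K.trace_cong)
     fix Z assume Z: "Z \<in> K.V"
     have "D' (h *\<^sub>f X) Z - D (h *\<^sub>f X) Z = h *\<^sub>f (D' X Z - D X Z)"
      by (simp add: K.con_fscale1[OF cD' X Z h] K.con_fscale1[OF cD X Z h] K.fscale_diff)
     then show "\<J> (D' (h *\<^sub>f X) Z - D (h *\<^sub>f X) Z) p = (h *\<^sub>f \<J> (D' X Z - D X Z)) p"
      by (simp only: K.JJ_simps(4)[OF K.vfield_diff[OF f'[OF X Z] f[OF X Z]] h])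
    qed
    then show ?thesis by (simp only: K.trace_fscale \<theta>_def)
   qed
  qed
 next
  fix X Y p assume X: "X \<in> K.V" and Y: "Y \<in> K.V" and p: "p \<in> K.M"
  have "K.trace (%Z. \<J> (curvature D' X Y Z)) p = K.trace (%Z. \<J>0 (curvature D0 X Y Z)) p"
  proof -
   have "K.trace (%Z. \<J> (curvature D' X Y Z)) p = K.trace (%Z. \<J> (\<Psi> (curvature D0 X Y (\<Phi> Z)))) p"
    by (rule K.trace_cong) (simp only: curv[OF X Y])
   then show ?thesis by (simp only: conj[OF K.curvature_endo[OF cD0 X Y]])
  qed
  moreover have "K.trace (%Z. \<J> (curvature D' X Y Z)) p = K.trace (%Z. \<J> (curvature D X Y Z)) p - K.d1 \<theta> X Y p"
   unfolding \<theta>_abs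
   by (rule K.transgression[where D = D and D' = D' and K = \<J> and X = X and Y = Y and p = p])
    (fact cD cD' K.JJ_endo X Y | rule DJ D'J, assumption, assumption)+
  ultimately show "ricci_form A K0.g J0 D0 p (X p) (Y p) - ricci_form A K.g J D p (X p) (Y p) = 1 / 2 * K.d1 \<theta> X Y p"
   unfolding K.ricci_form_trace[OF cD X Y p] K0.ricci_form_trace[OF cD0 X Y p] by simp
 next
  fix \<xi> p assume \<xi>: "\<xi> \<in> K.V" and inv: "!!Y. Y \<in> K.V ==> bracket \<xi> (\<J> Y) = \<J> (bracket \<xi> Y)"
   and inv0: "!!Y. Y \<in> K.V ==> bracket \<xi> (\<J>0 Y) = \<J>0 (bracket \<xi> Y)"
  define S where "S Y = D0 \<xi> Y - bracket \<xi> Y" for Y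
  have SE: "K.tensor_endo S" unfolding S_def[abs_def] by (rule K.lie_difference_endo[OF cD0 \<xi>])
  have br: "bracket \<xi> (\<Phi> Y) = \<Phi> (bracket \<xi> Y)" if Y: "Y \<in> K.V" for Y
  proof -
   have "bracket \<xi> (\<J>0 (\<J> Y)) = \<J>0 (\<J> (bracket \<xi> Y))"
    by (simp only: inv0[OF K.JJ_field[OF Y]] inv[OF Y])
   moreover have "bracket \<xi> (Y - \<J>0 (\<J> Y)) = bracket \<xi> Y - bracket \<xi> (\<J>0 (\<J> Y))"
    using K.bracket_add[OF \<xi> Y K.vfield_minus[OF K0.JJ_field[OF K.JJ_field[OF Y]]]]
     K.bracket_fscale[OF \<xi> K0.JJ_field[OF K.JJ_field[OF Y]] K.smooth_const, of "-1"]
    by (simp add: K.fscale_minus1 fun_eq_iff K.fscale_simps K.tangent_const[OF K.vfield_tangent[OF \<xi>]])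
   ultimately show ?thesis
    unfolding \<Phi>_def K.bracket_fscale[OF \<xi> K.vfield_diff[OF Y K0.JJ_field[OF K.JJ_field[OF Y]]] K.smooth_const]
    by (simp add: fun_eq_iff K.fscale_simps K.tangent_const[OF K.vfield_tangent[OF \<xi>]])
  qed
  have "\<theta> \<xi> p = K.trace (%Y. \<J> (\<Psi> (S (\<Phi> Y))) - \<J> (D \<xi> Y - bracket \<xi> Y)) p"
   unfolding \<theta>_def
  proof (rule K.trace_cong)
   fix Y assume Y: "Y \<in> K.V"
   have b: "bracket \<xi> Y \<in> K.V" by (rule K.vfield_bracket[OF \<xi> Y])
   have "\<Psi> (S (\<Phi> Y)) = D' \<xi> Y - bracket \<xi> Y"
    unfolding S_def D'_def br[OF Y] by (simp only: \<Psi>l(2)[OF f0[OF \<xi> \<Phi>V[OF Y]] \<Phi>V[OF b]] \<Psi>(3)[OF b])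
   then have "\<J> (\<Psi> (S (\<Phi> Y))) - \<J> (D \<xi> Y - bracket \<xi> Y) = \<J> ((D' \<xi> Y - bracket \<xi> Y) - (D \<xi> Y - bracket \<xi> Y))"
    by (simp only: K.JJ_simps(2)[OF K.vfield_diff[OF f'[OF \<xi> Y] b] K.vfield_diff[OF f[OF \<xi> Y] b]])
   then show "\<J> (D' \<xi> Y - D \<xi> Y) p = (\<J> (\<Psi> (S (\<Phi> Y))) - \<J> (D \<xi> Y - bracket \<xi> Y)) p" by simp
  qed
  then show "\<theta> \<xi> p = K.trace (%Y. \<J>0 (D0 \<xi> Y - bracket \<xi> Y)) p - K.trace (%Y. \<J> (D \<xi> Y - bracket \<xi> Y)) p"
   unfolding K.trace_diff conj[OF SE] unfolding S_def .
 qed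
qed

end

section \<open>Alternating forms\<close>

lemma wedge2_eq: "wedge 2 (2 * m) (seq2 \<beta>) \<eta> v =
 (\<Sum>\<sigma> | \<sigma> permutes {..<2 * Suc m}. of_int (sign \<sigma>) * \<beta> (v (\<sigma> 0)) (v (\<sigma> 1)) * \<eta> (%i. v (\<sigma> (2 + i))))
 / (2 * fact (2 * m))"
 by (simp add: wedge_def seq2_def)

lemma wedge_permute:
 assumes \<tau>: "\<tau> permutes {..<k + l}"
 shows "wedge k l \<alpha> \<beta> (v \<circ> \<tau>) = of_int (sign \<tau>) * wedge k l \<alpha> \<beta> v"
proof -
 let ?P = "{\<sigma>. \<sigma> permutes {..<k + l}}"
 have perm: "permutation \<sigma>" if "\<sigma> permutes {..<k + l}" for \<sigma>
  using that permutes_imp_permutation by blast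
 let ?f = "%\<sigma>. of_int (sign \<sigma>) * \<alpha> (%i. v (\<sigma> i)) * \<beta> (%i. v (\<sigma> (k + i)))"
 have "(\<Sum>\<sigma>\<in>?P. ?f \<sigma>) = (\<Sum>\<sigma>\<in>?P. ?f (\<tau> \<circ> \<sigma>))"
  by (rule setum_permutations_compose_left[OF \<tau>])
 also have "... = (\<Sum>\<sigma>\<in>?P. of_int (sign \<tau>) * (of_int (sign \<sigma>) * \<alpha> (%i. (v \<circ> \<tau>) (\<sigma> i)) * \<beta> (%i. (v \<circ> \<tau>) (\<sigma> (k + i)))))"
  by (rule sum.cong[OF refl]) (simp add: sign_compose[OF perm[OF \<tau>] perm] mult.assoc)
 finally have "of_int (sign \<tau>) * (\<Sum>\<sigma>\<in>?P. ?f \<sigma>) =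
   (\<Sum>\<sigma>\<in>?P. of_int (sign \<sigma>) * \<alpha> (%i. (v \<circ> \<tau>) (\<sigma> i)) * \<beta> (%i. (v \<circ> \<tau>) (\<sigma> (k + i))))"
  by (simp add: sum_distrib_left mult.assoc[symmetric] of_int_mult[symmetric] del: of_int_mult)
 then show ?thesis by (simp add: wedge_def mult.commute)
qed

lemma wedge_power_permute:
 assumes "\<tau> permutes {..<2 * m}"
 shows "wedge_power \<beta> m (v \<circ> \<tau>) = of_int (sign \<tau>) * wedge_power \<beta> m v"
proof (cases m)
 case 0
 then have "\<tau> = id" using assms by simp
 then show ?thesis by simp
next
 case (Suc k)
 then show ?thesis using wedge_permute[of \<tau> 2 "2 * k"] assms by simp
qed

lemma permutes_lessThan: "\<sigma> permutes {..<N} ==> i < N ==> \<sigma> i < (N :: nat)"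
 using permutes_in_image[of \<sigma> "{..<N}" i] by simp

lemma wedge_power_cong:
 "(!!i j. i < 2 * m ==> j < 2 * m ==> \<beta> (v i) (v j) = \<beta>' (v' i) (v' j)) ==>
 wedge_power \<beta> m v = wedge_power \<beta>' m v'"
proof (induction m arbitrary: v v')
 case (Suc m)
 have "wedge_power \<beta> m (%i. v (\<sigma> (2 + i))) = wedge_power \<beta>' m (%i. v' (\<sigma> (2 + i)))"
  if \<sigma>: "\<sigma> permutes {..<2 * Suc m}" for \<sigma>
  by (rule Suc.IH) (intro Suc.prems permutes_lessThan[OF \<sigma>], simp_all)
 moreover have "\<beta> (v (\<sigma> 0)) (v (\<sigma> 1)) = \<beta>' (v' (\<sigma> 0)) (v' (\<sigma> 1))" if \<sigma>: "\<sigma> permutes {..<2 * Suc m}" for \<sigma>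
  by (intro Suc.prems permutes_lessThan[OF \<sigma>]) simp_all
 ultimately show ?case
  unfolding wedge_power.simps wedge2_eq by simp
qed simp

lemma slot_shift:
 assumes \<sigma>: "\<sigma> permutes (S :: nat set)" and i: "\<sigma> (2 + i) = j"
 shows "(%k. (v(j := x)) (\<sigma> (2 + k))) = (%k. v (\<sigma> (2 + k)))(i := x)"
 using i permutes_inj[OF \<sigma>] by (auto simp: fun_eq_iff inj_eq)

text \<open>Linearity at the particular argument \<open>x = (\<Sum>k\<in>K. c k * u k)\<close>, phrased by values of the form only, so that
 indices can take the place of vectors.\<close>

definition slot_linear :: "('v => 'v => real) => 'v set => 'v => 'k set => ('k => real) => ('k => 'v) => bool" where
 "slot_linear \<beta> S x K c u \<longleftrightarrow>
  (\<forall>w\<in>S. \<beta> x w = (\<Sum>k\<in>K. c k * \<beta> (u k) w) \<and> \<beta> w x = (\<Sum>k\<in>K. c k * \<beta> w (u k)))"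

lemma wedge2_linear:
 assumes \<beta>: "slot_linear \<beta> S x K c u" and v: "!!i. i < 2 * Suc m ==> i \<noteq> j ==> v i \<in> S" and j: "j < 2 * Suc m"
  and \<eta>: "!!v i. (!!k. k < 2 * m ==> k \<noteq> i ==> v k \<in> S) ==> i < 2 * m ==> \<eta> (v(i := x)) = (\<Sum>k\<in>K. c k * \<eta> (v(i := u k)))"
  and \<eta>_cong: "!!v v'. (!!k. k < 2 * m ==> v k = v' k) ==> \<eta> v = \<eta> v'"
 shows "wedge 2 (2 * m) (seq2 \<beta>) \<eta> (v(j := x)) = (\<Sum>k\<in>K. c k * wedge 2 (2 * m) (seq2 \<beta>) \<eta> (v(j := u k)))"
proof -
 let ?P = "{\<sigma>. \<sigma> permutes {..<2 * Suc m}}"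
 let ?f = "%v \<sigma>. of_int (sign \<sigma>) * \<beta> (v (\<sigma> 0)) (v (\<sigma> 1)) * \<eta> (%i. v (\<sigma> (2 + i)))"
 have "?f (v(j := x)) \<sigma> = (\<Sum>k\<in>K. c k * ?f (v(j := u k)) \<sigma>)" if \<sigma>: "\<sigma> permutes {..<2 * Suc m}" for \<sigma>
 proof -
  have inj: "\<sigma> a = \<sigma> b \<longleftrightarrow> a = b" for a b using permutes_inj[OF \<sigma>] by (auto simp: inj_eq)
  have lt: "a < 2 * Suc m ==> \<sigma> a < 2 * Suc m" for a by (rule permutes_lessThan[OF \<sigma>])
  obtain i where i: "i < 2 * Suc m" "\<sigma> i = j"
   using permutes_image[OF \<sigma>] j by (metis imageE lessThan_iff)
  have "i = 0 \<or> i = 1 \<or> (\<exists>k. i = 2 + k \<and> k < 2 * m)" using i(1) by presburger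
  then consider "i = 0" | "i = 1" | k where "i = 2 + k" "k < 2 * m" by blast
  then show ?thesis
  proof cases
   case 1
   have \<eta>': "\<eta> (%k. (v(j := z)) (\<sigma> (2 + k))) = \<eta> (%k. v (\<sigma> (2 + k)))" for z
    by (rule \<eta>_cong) (use i(2) 1 inj in auto)
   have "\<sigma> 1 \<noteq> j" using i(2) 1 inj[of 0 1] by auto
   then show ?thesis unfolding \<eta>' using 1 i(2) \<beta> v[OF lt[of 1]] unfolding slot_linear_def
    by (simp add: sum_distrib_left sum_distrib_right mult_ac)
  next
   case 2
   have \<eta>': "\<eta> (%k. (v(j := z)) (\<sigma> (2 + k))) = \<eta> (%k. v (\<sigma> (2 + k)))" for z
    by (rule \<eta>_cong) (use i(2) 2 inj in auto)
   have "\<sigma> 0 \<noteq> j" using i(2) 2 inj[of 0 1] by auto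
   then show ?thesis unfolding \<eta>' using 2 i(2) \<beta> v[OF lt[of 0]] unfolding slot_linear_def
    by (simp add: sum_distrib_left sum_distrib_right mult_ac)
  next
   case (3 k)
   have s: "(%i. (v(j := z)) (\<sigma> (2 + i))) = (%i. v (\<sigma> (2 + i)))(k := z)" for z
    by (rule slot_shift[OF \<sigma>]) (use 3 i in simp)
   have ne: "\<sigma> 0 \<noteq> j" "\<sigma> 1 \<noteq> j" using i(2) 3 inj[of 0 i] inj[of 1 i] by auto
   have "\<eta> ((%i. v (\<sigma> (2 + i)))(k := x)) = (\<Sum>l\<in>K. c l * \<eta> ((%i. v (\<sigma> (2 + i)))(k := u l)))"
   proof (rule \<eta>[OF _ 3(2)])
    fix a assume "a < 2 * m" "a \<noteq> k"
    then show "v (\<sigma> (2 + a)) \<in> S" using i 3 inj[of "2 + a" i] by (intro v lt) auto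
   qed
   then show ?thesis using ne unfolding s by (simp add: sum_distrib_left mult_ac)
  qed
 qed
 then have "(\<Sum>\<sigma>\<in>?P. ?f (v(j := x)) \<sigma>) = (\<Sum>\<sigma>\<in>?P. \<Sum>k\<in>K. c k * ?f (v(j := u k)) \<sigma>)"
  by (intro sum.cong refl) (simp only: mem_Collect_eq)
 also have "... = (\<Sum>k\<in>K. \<Sum>\<sigma>\<in>?P. c k * ?f (v(j := u k)) \<sigma>)" by (rule sum.swap)
 also have "... = (\<Sum>k\<in>K. c k * (\<Sum>\<sigma>\<in>?P. ?f (v(j := u k)) \<sigma>))" by (simp only: sum_distrib_left)
 finally show ?thesis
  unfolding wedge2_eq times_divide_eq_right sum_divide_distrib[symmetric] by (rule arg_cong)
qed

lemma wedge_power_linear: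
 assumes \<beta>: "slot_linear \<beta> S x K c u" 
 shows "(!!i. i < 2 * m ==> i \<noteq> j ==> v i \<in> S) ==> j < 2 * m ==>
  wedge_power \<beta> m (v(j := x)) = (\<Sum>k\<in>K. c k * wedge_power \<beta> m (v(j := u k)))"
proof (induction m arbitrary: v j)
 case (Suc m)
 show ?case
  unfolding wedge_power.simps
 proof (rule wedge2_linear[OF \<beta> Suc.prems])
  show "wedge_power \<beta> m v = wedge_power \<beta> m v'" if "!!k. k < 2 * m ==> v k = v' k" for v v'
   by (rule wedge_power_cong) (simp add: that)
  show "wedge_power \<beta> m (v(i := x)) = (\<Sum>k\<in>K. c k * wedge_power \<beta> m (v(i := u k)))"
   if "!!k. k < 2 * m ==> k \<noteq> i ==> v k \<in> S" "i < 2 * m" for v i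
   by (rule Suc.IH[OF that])
 qed
qed simp

lemma wedge_power_isolated:
 assumes "i < 2 * m" "!!k. k < 2 * m ==> \<beta> (v i) (v k) = 0 \<and> \<beta> (v k) (v i) = 0"
 shows "wedge_power \<beta> m v = 0"
proof -
 have "slot_linear \<beta> (v ` {..<2 * m}) (v i) ({} :: nat set) (%_. 0) (%_. v i)"
  using assms by (auto simp: slot_linear_def)
 from wedge_power_linear[OF this, of m i v] assms(1) show ?thesis by simp
qed

text \<open>The matrix of \<open>\<omega>\<close> in a basis of the shape \<open>e\<^sub>0, J e\<^sub>0, e\<^sub>2, J e\<^sub>2, ...\<close>.\<close>

definition standard :: "nat => (nat => nat => real) => bool" where
 "standard n B \<longleftrightarrow> (\<forall>a<2 * n. \<forall>b<2 * n.
  B a b = (if even a \<and> b = a + 1 then 1 else if odd a \<and> b + 1 = a then -1 else 0))"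

text \<open>Up to normalisation, the coefficient of the entry of \<open>\<beta>\<close> at \<open>(a, b)\<close> when \<open>\<beta> \<and> B\<^sup>m\<close> is evaluated on the basis.\<close>

definition minor :: "(nat => nat => real) => nat => nat => nat => real" where
 "minor B m a b = (\<Sum>\<sigma> | \<sigma> permutes {..<2 * Suc m} \<and> \<sigma> 0 = a \<and> \<sigma> 1 = b.
  of_int (sign \<sigma>) * wedge_power B m (%i. \<sigma> (2 + i)))"

lemma minor_0_1: "minor B m 0 1 = fact (2 * m) * wedge_power B m (%i. 2 + i)"
proof -
 let ?A = "{..<2 * m}" and ?B = "{2..<2 * Suc m}" and ?s = "map_permutation {..<2 * m} (%i. 2 + i :: nat)"
 let ?w = "%\<sigma>. of_int (sign \<sigma>) * wedge_power B m (%i. \<sigma> (2 + i))"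
 have bij: "bij_betw (%i. 2 + i) ?A ?B"
  by (rule bij_betw_byWitness[where f' = "%i. i - 2"]) auto
 have inj: "inj_on (%i. 2 + i :: nat) ?A" by (simp add: inj_on_def)
 have "\<sigma> permutes ?B \<longleftrightarrow> \<sigma> permutes {..<2 * Suc m} \<and> \<sigma> 0 = 0 \<and> \<sigma> 1 = 1" for \<sigma>
 proof safe
  show "\<sigma> permutes {..<2 * Suc m}" if "\<sigma> permutes ?B" by (rule permutes_subset[OF that]) auto
  show "\<sigma> permutes ?B" if "\<sigma> permutes {..<2 * Suc m}" "\<sigma> 0 = 0" "\<sigma> 1 = 1"
   by (rule permutes_superset[OF that(1)]) (use that in \<open>auto simp: not_le less_2_cases_iff\<close>)
 qed (auto simp: permutes_not_in)
 then have "minor B m 0 1 = (\<Sum>\<sigma> | \<sigma> permutes ?B. ?w \<sigma>)" by (simp add: minor_def)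
 also have "... = (\<Sum>\<tau> | \<tau> permutes ?A. ?w (?s \<tau>))"
 proof (rule sum.reindex_bij_betw[symmetric])
  have "?s = (%\<pi> x. if x \<in> ?B then 2 + \<pi> (inv_into ?A (%i. 2 + i) x) else x)"
   by (simp only: fun_eq_iff map_permutation_def restrict_id_def bij_betw_imp_surj_on[OF bij] o_def) simp
  then show "bij_betw ?s {\<tau>. \<tau> permutes ?A} {\<sigma>. \<sigma> permutes ?B}" using bij_betw_permutations[OF bij] by (simp only:)
 qed
 also have "... = (\<Sum>\<tau> | \<tau> permutes ?A. wedge_power B m (%i. 2 + i))"
 proof (rule sum.cong[OF refl])
  fix \<tau> assume "\<tau> \<in> {\<tau>. \<tau> permutes ?A}"
  then have \<tau>: "\<tau> permutes ?A" by simp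
  have "wedge_power B m (%i. ?s \<tau> (2 + i)) = wedge_power B m ((%i. 2 + i) \<circ> \<tau>)"
   by (rule wedge_power_cong) (simp only: map_permutation_apply[OF inj] lessThan_iff o_apply)
  then show "?w (?s \<tau>) = wedge_power B m (%i. 2 + i)"
   using sign_map_permutation[OF inj \<tau>]
   by (simp add: wedge_power_permute[OF \<tau>] mult.assoc[symmetric] of_int_mult[symmetric] del: of_int_mult)
 qed
 finally show ?thesis by (simp add: card_permutations[of "{..<2 * m}" "2 * m"])
qed

lemma minor_swap: "minor B m b a = - minor B m a b"
proof -
 let ?t = "Transposition.transpose 0 (1::nat)"
 have t: "?t permutes {..<2 * Suc m}" by (rule permutes_swap_id) auto
 have perm: "permutation \<sigma>" if "\<sigma> permutes {..<2 * Suc m}" for \<sigma>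
  using that permutes_imp_permutation by blast
 have "minor B m b a = (\<Sum>\<sigma> | \<sigma> permutes {..<2 * Suc m} \<and> \<sigma> 0 = a \<and> \<sigma> 1 = b.
  - (of_int (sign \<sigma>) * wedge_power B m (%i. \<sigma> (2 + i))))"
  unfolding minor_def
 proof (rule sum.reindex_bij_witness[of _ "%\<sigma>. \<sigma> \<circ> ?t" "%\<sigma>. \<sigma> \<circ> ?t"])
  fix \<sigma> assume "\<sigma> \<in> {\<sigma>. \<sigma> permutes {..<2 * Suc m} \<and> \<sigma> 0 = b \<and> \<sigma> 1 = a}"
  then show "- (of_int (sign (\<sigma> \<circ> ?t)) * wedge_power B m (%i. (\<sigma> \<circ> ?t) (2 + i))) = of_int (sign \<sigma>) * wedge_power B m (%i. \<sigma> (2 + i))"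
   using perm by (simp add: sign_compose permutation_swap_id sign_swap_id)
 qed (use t in \<open>auto simp: o_assoc[symmetric] intro: permutes_compose\<close>)
 then show ?thesis by (simp add: minor_def sum_negf)
qed

lemma minor_conjugate:
 assumes q: "q permutes {..<2 * Suc m}" and B: "!!a b. a < 2 * Suc m ==> b < 2 * Suc m ==> B (q a) (q b) = B a b"
 shows "minor B m (q a) (q b) = of_int (sign q) * minor B m a b"
proof -
 have perm: "permutation \<sigma>" if "\<sigma> permutes {..<2 * Suc m}" for \<sigma>
  using that permutes_imp_permutation by blast
 have qi: "inv q (q x) = x" "q (inv q x) = x" for x using permutes_inverses[OF q] by simp_all
 have "minor B m (q a) (q b) = (\<Sum>\<sigma> | \<sigma> permutes {..<2 * Suc m} \<and> \<sigma> 0 = a \<and> \<sigma> 1 = b.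
  of_int (sign q) * (of_int (sign \<sigma>) * wedge_power B m (%i. \<sigma> (2 + i))))"
  unfolding minor_def
 proof (rule sum.reindex_bij_witness[of _ "%\<sigma>. q \<circ> \<sigma>" "%\<sigma>. inv q \<circ> \<sigma>"])
  fix \<sigma> assume s: "\<sigma> \<in> {\<sigma>. \<sigma> permutes {..<2 * Suc m} \<and> \<sigma> 0 = q a \<and> \<sigma> 1 = q b}"
  define \<tau> where "\<tau> = inv q \<circ> \<sigma>"
  have \<tau>: "\<tau> permutes {..<2 * Suc m}" unfolding \<tau>_def using s permutes_inv[OF q] by (auto intro: permutes_compose)
  have \<sigma>\<tau>: "\<sigma> = q \<circ> \<tau>" by (simp add: \<tau>_def fun_eq_iff qi)
  have "wedge_power B m (%i. \<sigma> (2 + i)) = wedge_power B m (%i. \<tau> (2 + i))"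
   unfolding \<sigma>\<tau> o_apply by (rule wedge_power_cong) (intro B permutes_lessThan[OF \<tau>]; simp)
  moreover have "sign \<sigma> = sign q * sign \<tau>" unfolding \<sigma>\<tau> by (rule sign_compose[OF perm[OF q] perm[OF \<tau>]])
  ultimately show "of_int (sign q) * (of_int (sign (inv q \<circ> \<sigma>)) * wedge_power B m (%i. (inv q \<circ> \<sigma>) (2 + i))) =
    of_int (sign \<sigma>) * wedge_power B m (%i. \<sigma> (2 + i))"
   by (simp add: \<tau>_def[symmetric])
 qed (use q permutes_inv[OF q] in \<open>auto simp: fun_eq_iff qi intro: permutes_compose\<close>)
 then show ?thesis by (simp add: minor_def sum_distrib_left)
qed

text \<open>The permutation that exchanges the pair \<open>j\<close> with the pair 0 is even and preserves the standard matrix.\<close>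

lemma minor_pair:
 assumes B: "standard (Suc m) B" and j: "j < Suc m"
 shows "minor B m (2 * j) (2 * j + 1) = minor B m 0 1"
proof (cases "j = 0")
 case False
 let ?q = "Transposition.transpose 0 (2 * j) \<circ> Transposition.transpose 1 (2 * j + 1)"
 have q: "?q permutes {..<2 * Suc m}"
  by (intro permutes_compose permutes_swap_id) (use j in auto)
 have qv: "?q 0 = 2 * j" "?q 1 = 2 * j + 1" "?q (2 * j) = 0" "?q (2 * j + 1) = 1"
  "x \<notin> {0, 1, 2 * j, 2 * j + 1} ==> ?q x = x" for x
  using False by (auto simp: Transposition.transpose_def)
 have qe: "even (?q x) = even x" for x
  using qv(1-4) qv(5)[of x] by (cases "x \<in> {0, 1, 2 * j, 2 * j + 1}") auto
 have qs: "?q (x + 1) = ?q x + 1" if "even x" for x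
 proof (cases "x \<in> {0, 2 * j}")
  case True
  then show ?thesis using qv by auto
 next
  case F: False
  then have "x \<notin> {0, 1, 2 * j, 2 * j + 1}" "x + 1 \<notin> {0, 1, 2 * j, 2 * j + 1}" using that by auto
  then show ?thesis using qv(5) by simp
 qed
 have inj: "?q x = ?q y \<longleftrightarrow> x = y" for x y using permutes_inj[OF q] by (simp only: inj_eq)
 have "B (?q a) (?q b) = B a b" if a: "a < 2 * Suc m" and b: "b < 2 * Suc m" for a b
 proof -
  have 1: "?q b = ?q a + 1 \<longleftrightarrow> b = a + 1" if "even a" using qs[OF that] inj[of b "a + 1"] by simp
  have 2: "?q b + 1 = ?q a \<longleftrightarrow> b + 1 = a" if "odd a"
  proof (cases "even b")
   case True
   then show ?thesis using qs[OF True] inj[of "b + 1" a] by simp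
  next
   case F: False
   have "odd (?q b)" using qe[of b] F by (simp only: simp_thms)
   then have "even (?q b + 1)" by simp
   moreover have "odd (?q a)" using qe[of a] that by (simp only: simp_thms)
   ultimately have "?q b + 1 \<noteq> ?q a" by metis
   moreover have "b + 1 \<noteq> a" using F that by auto
   ultimately show ?thesis by blast
  qed
  have lt: "?q a < 2 * Suc m" "?q b < 2 * Suc m" using permutes_lessThan[OF q] a b by blast+
  show ?thesis
   using B a b lt qe[of a] 1 2 unfolding standard_def by (cases "even a") auto
 qed
 from minor_conjugate[where B=B and q="?q" and a=0 and b=1, OF q this]
 have "minor B m (?q 0) (?q 1) = of_int (sign ?q) * minor B m 0 1" by simp
 moreover have "sign ?q = 1"
  using False by (simp add: sign_compose permutation_swap_id sign_swap_id)
 ultimately show ?thesis using qv by simp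
qed simp

text \<open>If \<open>a\<close> and \<open>b\<close> are distinct and do not form a pair, the partner of \<open>a\<close> is among the remaining indices and is orthogonal
 to all of them.\<close>

lemma minor_zero:
 assumes B: "standard (Suc m) B" and a: "a < 2 * Suc m" and b: "b < 2 * Suc m"
  and n1: "\<not> (even a \<and> b = a + 1)" and n2: "\<not> (even b \<and> a = b + 1)"
 shows "minor B m a b = 0"
proof (cases "a = b")
 case True
 have "{\<sigma>. \<sigma> permutes {..<2 * Suc m} \<and> \<sigma> 0 = a \<and> \<sigma> 1 = b} = {}"
  using permutes_inj True by (auto simp: inj_def)
 then show ?thesis unfolding minor_def by (simp only: sum.empty)
next
 case False
 define a' where "a' = (if even a then a + 1 else a - 1)"
 have a': "a' < 2 * Suc m" "a' \<noteq> a" "a' \<noteq> b"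
 proof -
  show "a' < 2 * Suc m" using a unfolding a'_def by presburger
  show "a' \<noteq> a" unfolding a'_def by (auto elim!: oddE)
  show "a' \<noteq> b" using n1 n2 unfolding a'_def by presburger
 qed
 have "wedge_power B m (%i. \<sigma> (2 + i)) = 0" if \<sigma>: "\<sigma> permutes {..<2 * Suc m}" "\<sigma> 0 = a" "\<sigma> 1 = b" for \<sigma>
 proof -
  have inj: "\<sigma> x = \<sigma> y \<longleftrightarrow> x = y" for x y using permutes_inj[OF \<sigma>(1)] by (auto simp: inj_eq)
  obtain i where i: "i < 2 * Suc m" "\<sigma> i = a'"
   using permutes_image[OF \<sigma>(1)] a'(1) by (metis imageE lessThan_iff)
  have "i \<noteq> 0" using i(2) \<sigma>(2) a'(2) by (intro notI) simp
  moreover have "i \<noteq> 1" using i(2) \<sigma>(3) a'(3) by (intro notI) simp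
  ultimately obtain k where k: "i = 2 + k" by (metis One_nat_def add_2_eq_Suc not0_implies_Suc)
  show ?thesis
  proof (rule wedge_power_isolated[where i=k])
   show "k < 2 * m" using i k by simp
   fix l assume l: "l < 2 * m"
   let ?c = "\<sigma> (2 + l)"
   have c: "?c < 2 * Suc m" "?c \<noteq> a" using permutes_lessThan[OF \<sigma>(1), of "2 + l"] l inj[of "2 + l" 0] \<sigma>(2) by auto
   have ac: "\<not> (even a' \<and> ?c = a' + 1)" "\<not> (odd a' \<and> ?c + 1 = a')" "\<not> (even ?c \<and> a' = ?c + 1)" "\<not> (odd ?c \<and> a' + 1 = ?c)"
    using c(2) unfolding a'_def by presburger+
   have "B a' ?c = 0" "B ?c a' = 0"
    using B a'(1) c(1) ac unfolding standard_def by (simp_all only: if_False simp_thms)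
   then show "B (\<sigma> (2 + k)) ?c = 0 \<and> B ?c (\<sigma> (2 + k)) = 0" using i k by simp
  qed
 qed
 then show ?thesis unfolding minor_def by (intro sum.neutral) auto
qed

lemma sum_pairs: "(\<Sum>a<2 * n. f a) = (\<Sum>j<n. f (2 * j) + f (2 * j + 1))" for f :: "nat => real"
 by (induction n) (auto simp: algebra_simps)

text \<open>Only the minors at pairs contribute, and these all agree.\<close>

lemma wedge2_standard:
 assumes B: "standard (Suc m) B" and \<beta>: "!!a b. a < 2 * Suc m ==> b < 2 * Suc m ==> \<beta> b a = - \<beta> a b"
 shows "wedge 2 (2 * m) (seq2 \<beta>) (wedge_power B m) id = (\<Sum>j<Suc m. \<beta> (2 * j) (2 * j + 1)) * (minor B m 0 1 / fact (2 * m))"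
proof -
 let ?N = "2 * Suc m" and ?P = "{\<sigma>. \<sigma> permutes {..<2 * Suc m}}"
 let ?k = "minor B m 0 1"
 let ?f = "%\<sigma>. of_int (sign \<sigma>) * \<beta> (\<sigma> 0) (\<sigma> 1) * wedge_power B m (%i. \<sigma> (2 + i))"
 have finP: "finite ?P" by (simp add: finite_permutations)
 have img: "(%\<sigma>. (\<sigma> 0, \<sigma> 1)) ` ?P \<subseteq> {..<?N} \<times> {..<?N}"
  using permutes_lessThan[of _ ?N] by auto
 have "(\<Sum>\<sigma>\<in>?P. ?f \<sigma>) = (\<Sum>y\<in>{..<?N} \<times> {..<?N}. \<Sum>\<sigma> | \<sigma> \<in> ?P \<and> (\<sigma> 0, \<sigma> 1) = y. ?f \<sigma>)"
  by (rule sum.group[symmetric, OF finP _ img]) simp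
 also have "... = (\<Sum>(a, b)\<in>{..<?N} \<times> {..<?N}. \<beta> a b * minor B m a b)"
  unfolding minor_def by (intro sum.cong refl) (auto simp: sum_distrib_left mult_ac intro!: sum.cong)
 also have "... = (\<Sum>a<?N. \<Sum>b<?N. \<beta> a b * minor B m a b)"
  by (rule sum.cartesian_product[symmetric])
 also have "... = (\<Sum>a<?N. if even a then \<beta> a (a + 1) * ?k else \<beta> (a - 1) a * ?k)"
 proof (rule sum.cong[OF refl])
  fix a assume "a \<in> {..<?N}"
  then have a: "a < ?N" by simp
  show "(\<Sum>b<?N. \<beta> a b * minor B m a b) = (if even a then \<beta> a (a + 1) * ?k else \<beta> (a - 1) a * ?k)"
  proof (cases "even a")
   case True
   then obtain j where j: "a = 2 * j" by blast
   have a1: "a + 1 < ?N" using a True by presburger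
   have "(\<Sum>b<?N. \<beta> a b * minor B m a b) = (\<Sum>b\<in>{a + 1}. \<beta> a b * minor B m a b)"
   proof (rule sum.mono_neutral_right)
    show "\<forall>b\<in>{..<?N} - {a + 1}. \<beta> a b * minor B m a b = 0"
     using minor_zero[OF B a] True by (metis DiffD1 DiffD2 even_plus_one_iff lessThan_iff mult_zero_right singletonI)
   qed (use a1 in auto)
   also have "... = \<beta> a (a + 1) * ?k" using minor_pair[OF B, of j] j a by simp
   finally show ?thesis using True by simp
  next
   case False
   then obtain j where j: "a = 2 * j + 1" by (metis oddE)
   have "(\<Sum>b<?N. \<beta> a b * minor B m a b) = (\<Sum>b\<in>{a - 1}. \<beta> a b * minor B m a b)"
   proof (rule sum.mono_neutral_right)
    show "\<forall>b\<in>{..<?N} - {a - 1}. \<beta> a b * minor B m a b = 0"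
    proof
     fix b assume "b \<in> {..<?N} - {a - 1}"
     then have b: "b < ?N" "\<not> (even b \<and> a = b + 1)" by auto
     have "\<not> (even a \<and> b = a + 1)" using False by simp
     then show "\<beta> a b * minor B m a b = 0" using minor_zero[OF B a b(1) _ b(2)] by simp
    qed
   qed (use a in auto)
   also have "... = \<beta> (a - 1) a * ?k"
    using minor_pair[OF B, of j] minor_swap[of B m "2 * j + 1" "2 * j"] \<beta>[of "2 * j" "2 * j + 1"] j a by simp
   finally show ?thesis using False by simp
  qed
 qed
 also have "... = 2 * (\<Sum>j<Suc m. \<beta> (2 * j) (2 * j + 1)) * ?k"
 proof -
  have "(\<Sum>a<?N. if even a then \<beta> a (a + 1) * ?k else \<beta> (a - 1) a * ?k) =
    (\<Sum>j<Suc m. 2 * \<beta> (2 * j) (2 * j + 1) * ?k)"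
   unfolding sum_pairs by (rule sum.cong[OF refl]) simp
  then show ?thesis by (simp only: sum_distrib_left sum_distrib_right)
 qed
 finally show ?thesis unfolding wedge2_eq by (simp only: divide_simps) simp
qed

lemma wedge_power_standard: "standard n B ==> wedge_power B n id = fact n"
proof (induction n arbitrary: B)
 case (Suc m)
 have sk: "!!a b. a < 2 * Suc m ==> b < 2 * Suc m ==> B b a = - B a b"
  using Suc.prems unfolding standard_def by auto
 have "wedge_power B m (%i. 2 + i) = wedge_power (%i j. B (2 + i) (2 + j)) m id"
  by (rule wedge_power_cong) simp
 also have "... = fact m"
  by (rule Suc.IH) (use Suc.prems in \<open>auto simp: standard_def\<close>)
 finally have w: "wedge_power B m (%i. 2 + i) = fact m" .
 have "minor B m 0 1 / fact (2 * m) = fact m" unfolding minor_0_1 w by simp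
 moreover have "(\<Sum>j<Suc m. B (2 * j) (2 * j + 1)) = real (Suc m)"
 proof -
  have "(\<Sum>j<Suc m. B (2 * j) (2 * j + 1)) = (\<Sum>j<Suc m. 1)"
   by (rule sum.cong[OF refl]) (use Suc.prems in \<open>auto simp: standard_def\<close>)
  then show ?thesis by simp
 qed
 ultimately have "wedge 2 (2 * m) (seq2 B) (wedge_power B m) id = real (Suc m) * fact m"
  using wedge2_standard[where B = B and \<beta> = B and m = m, OF Suc.prems sk] by (simp only:)
 then show ?case by (simp only: wedge_power.simps fact_Suc)
qed simp

text \<open>On an adapted basis each pair contributes to \<open>\<beta> \<and> \<omega>\<^sup>m\<close> the value of \<open>\<beta>\<close> on it with the same weight \<open>m!\<close>, so
 this top form is a multiple of \<open>\<omega>\<^sup>m\<^sup>+\<^sup>1\<close> by the contraction of \<open>\<beta>\<close>.\<close>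

lemma wedge2_adapted:
 assumes e: "standard (Suc m) (%i j. \<omega> (e i) (e j))"
  and \<beta>: "!!a b. a < 2 * Suc m ==> b < 2 * Suc m ==> \<beta> (e b) (e a) = - \<beta> (e a) (e b)"
 shows "real (Suc m) * wedge 2 (2 * m) (seq2 \<beta>) (wedge_power \<omega> m) e =
   (\<Sum>j<Suc m. \<beta> (e (2 * j)) (e (2 * j + 1))) * wedge_power \<omega> (Suc m) e"
  and "wedge_power \<omega> (Suc m) e = fact (Suc m)"
proof -
 let ?B = "%i j. \<omega> (e i) (e j)" and ?\<beta> = "%i j. \<beta> (e i) (e j)"
 have c: "wedge_power \<omega> k (%i. e (s i)) = wedge_power ?B k s" for k s
  by (rule wedge_power_cong) simp
 have "wedge 2 (2 * m) (seq2 \<beta>) (wedge_power \<omega> m) e = wedge 2 (2 * m) (seq2 ?\<beta>) (wedge_power ?B m) id"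
  unfolding wedge2_eq by (simp add: c)
 also have "... = (\<Sum>j<Suc m. \<beta> (e (2 * j)) (e (2 * j + 1))) * (minor ?B m 0 1 / fact (2 * m))"
  by (rule wedge2_standard[OF e \<beta>])
 also have "minor ?B m 0 1 / fact (2 * m) = fact m"
 proof -
  have "wedge_power ?B m (%i. 2 + i) = wedge_power (%i j. ?B (2 + i) (2 + j)) m id"
   by (rule wedge_power_cong) simp
  also have "... = fact m"
   by (rule wedge_power_standard) (use e in \<open>auto simp: standard_def\<close>)
  finally have w: "wedge_power ?B m (%i. 2 + i) = fact m" .
  show ?thesis unfolding minor_0_1 w by simp
 qed
 finally have 1: "wedge 2 (2 * m) (seq2 \<beta>) (wedge_power \<omega> m) e = (\<Sum>j<Suc m. \<beta> (e (2 * j)) (e (2 * j + 1))) * fact m" .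
 have "wedge_power \<omega> (Suc m) e = wedge_power ?B (Suc m) id" using c[of "Suc m" id] by simp
 also have "... = fact (Suc m)" by (rule wedge_power_standard[OF e])
 finally show 2: "wedge_power \<omega> (Suc m) e = fact (Suc m)" .
 show "real (Suc m) * wedge 2 (2 * m) (seq2 \<beta>) (wedge_power \<omega> m) e =
   (\<Sum>j<Suc m. \<beta> (e (2 * j)) (e (2 * j + 1))) * wedge_power \<omega> (Suc m) e"
  unfolding 1 2 by simp
qed

text \<open>Alternating multilinear functions of \<open>N\<close> vectors. An argument is a sequence of which only the first \<open>N\<close>
 entries count; the vectors belong to a tangent space \<open>S\<close>, on which alone multilinearity can be expected.\<close>

definition top_form :: "nat => 'm tvec set => ((nat => 'm tvec) => real) => bool" where
 "top_form N S \<eta> \<longleftrightarrow>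
  (\<forall>v v'. (\<forall>i<N. v i = v' i) --> \<eta> v = \<eta> v') \<and>
  (\<forall>v \<tau>. \<tau> permutes {..<N} --> \<eta> (v \<circ> \<tau>) = of_int (sign \<tau>) * \<eta> v) \<and>
  (\<forall>v j K c u. (\<forall>i<N. i \<noteq> j --> v i \<in> S) --> j < N --> finite (K :: nat set) --> (\<forall>k\<in>K. u k \<in> S) -->
    \<eta> (v(j := (\<Sum>k\<in>K. c k *\<^sub>t u k))) = (\<Sum>k\<in>K. c k * \<eta> (v(j := u k))))"

lemma
 assumes "top_form N S \<eta>"
 shows top_form_cong: "(!!i. i < N ==> v i = v' i) ==> \<eta> v = \<eta> v'"
  and top_form_permute: "\<tau> permutes {..<N} ==> \<eta> (v \<circ> \<tau>) = of_int (sign \<tau>) * \<eta> v"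
  and top_form_linear: "(!!i. i < N ==> i \<noteq> j ==> v i \<in> S) ==> j < N ==> finite (K :: nat set) ==>
   (!!k. k \<in> K ==> u k \<in> S) ==> \<eta> (v(j := (\<Sum>k\<in>K. c k *\<^sub>t u k))) = (\<Sum>k\<in>K. c k * \<eta> (v(j := u k)))"
 using assms unfolding top_form_def by (elim conjE, simp)+

lemma top_form_repeat:
 assumes \<eta>: "top_form N S \<eta>" and ij: "i < N" "j < N" "i \<noteq> j" "v i = v j"
 shows "\<eta> v = 0"
proof -
 have "v \<circ> Transposition.transpose i j = v" using ij(4) by (auto simp: fun_eq_iff Transposition.transpose_def)
 moreover have "Transposition.transpose i j permutes {..<N}" by (rule permutes_swap_id) (use ij in auto)
 ultimately show ?thesis using top_form_permute[OF \<eta>, of "Transposition.transpose i j" v] ij(3)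
  by (simp add: sign_swap_id)
qed

lemma top_form_expand_partial:
 assumes \<eta>: "top_form N S \<eta>" and e: "!!k. k < N ==> e k \<in> S" and I: "finite I" "I \<subseteq> {..<N}"
  and w: "!!i. i < N ==> w i \<in> S" and X: "!!i. i < N ==> X i = (\<Sum>k<N. a i k *\<^sub>t e k) \<and> X i \<in> S"
 shows "\<eta> (%i. if i \<in> I then X i else w i) =
  (\<Sum>f\<in>I \<rightarrow>\<^sub>E {..<N}. (\<Prod>i\<in>I. a i (f i)) * \<eta> (%i. if i \<in> I then e (f i) else w i))"
 using I w
proof (induction I arbitrary: w)
 case empty
 then show ?case by simp
next
 case (insert x I)
 have x: "x < N" "I \<subseteq> {..<N}" using insert.prems by auto
 have upd: "(%i. if i \<in> I then e (f i) else (w(x := z)) i) = (%i. if i \<in> I then e (f i) else w i)(x := z)" for f z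
  using insert.hyps(2) by (auto simp: fun_eq_iff)
 have lin: "\<eta> ((%i. if i \<in> I then e (f i) else w i)(x := X x)) =
   (\<Sum>k<N. a x k * \<eta> ((%i. if i \<in> I then e (f i) else w i)(x := e k)))" if f: "f \<in> I \<rightarrow>\<^sub>E {..<N}" for f
  unfolding conjunct1[OF X[OF x(1)]]
 proof (rule top_form_linear[OF \<eta> _ x(1)])
  fix i assume "i < N"
  then show "(if i \<in> I then e (f i) else w i) \<in> S" using e insert.prems(2) f by auto
 qed (use e in auto)
 have inj: "inj_on (%(k, f). f(x := k)) ({..<N} \<times> (I \<rightarrow>\<^sub>E {..<N}))"
  by (rule inj_combinator[OF insert.hyps(2)])
 define F where "F k f = (\<Prod>i\<in>I. a i (f i)) * (a x k * \<eta> ((%i. if i \<in> I then e (f i) else w i)(x := e k)))" for k f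
 have 1: "(%i. if i \<in> insert x I then X i else w i) = (%i. if i \<in> I then X i else (w(x := X x)) i)"
  using insert.hyps(2) by (auto simp: fun_eq_iff)
 have "\<eta> (%i. if i \<in> I then X i else (w(x := X x)) i) = (\<Sum>f\<in>I \<rightarrow>\<^sub>E {..<N}. (\<Prod>i\<in>I. a i (f i)) * \<eta> (%i. if i \<in> I then e (f i) else (w(x := X x)) i))"
  by (rule insert.IH[OF x(2)]) (use conjunct2[OF X] x(1) insert.prems(2) in simp)
 also have "... = (\<Sum>f\<in>I \<rightarrow>\<^sub>E {..<N}. \<Sum>k<N. F k f)"
  by (rule sum.cong[OF refl]) (simp only: upd lin F_def sum_distrib_left)
 also have "... = (\<Sum>(k, f)\<in>{..<N} \<times> (I \<rightarrow>\<^sub>E {..<N}). F k f)"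
  by (subst sum.swap) (rule sum.cartesian_product)
 also have "... = (\<Sum>f\<in>insert x I \<rightarrow>\<^sub>E {..<N}. (\<Prod>i\<in>insert x I. a i (f i)) * \<eta> (%i. if i \<in> insert x I then e (f i) else w i))"
  unfolding PiE_insert_eq
 proof (subst sum.reindex[OF inj], rule sum.cong[OF refl])
  fix z assume "z \<in> {..<N} \<times> (I \<rightarrow>\<^sub>E {..<N})"
  obtain k f where z: "z = (k, f)" by (cases z)
  have "(\<Prod>i\<in>I. a i ((f(x := k)) i)) = (\<Prod>i\<in>I. a i (f i))"
   using insert.hyps(2) by (intro prod.cong) auto
  moreover have "(%i. if i \<in> insert x I then e ((f(x := k)) i) else w i) = (%i. if i \<in> I then e (f i) else w i)(x := e k)"
   using insert.hyps(2) by (auto simp: fun_eq_iff)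
  ultimately have "F k f = (\<Prod>i\<in>insert x I. a i ((f(x := k)) i)) * \<eta> (%i. if i \<in> insert x I then e ((f(x := k)) i) else w i)"
   unfolding F_def prod.insert[OF insert.hyps] by simp
  then show "(case z of (k, f) => F k f) = ((%f. (\<Prod>i\<in>insert x I. a i (f i)) * \<eta> (%i. if i \<in> insert x I then e (f i) else w i)) \<circ> (%(k, f). f(x := k))) z"
   by (simp only: z o_apply prod.case)
 qed
 finally show ?case unfolding 1 .
qed

text \<open>Expanding every slot gives a sum over all maps from indices to indices; by alternation only the permutations contribute.\<close>

lemma top_form_expand:
 assumes \<eta>: "top_form N S \<eta>" and e: "!!k. k < N ==> e k \<in> S"
  and X: "!!i. i < N ==> X i = (\<Sum>k<N. a i k *\<^sub>t e k) \<and> X i \<in> S"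
 shows "\<eta> X = (\<Sum>\<sigma> | \<sigma> permutes {..<N}. of_int (sign \<sigma>) * (\<Prod>i<N. a i (\<sigma> i))) * \<eta> e"
proof -
 let ?E = "{..<N} \<rightarrow>\<^sub>E {..<N}" and ?P = "{\<sigma>. \<sigma> permutes {..<N}}"
 let ?F = "%f. (\<Prod>i<N. a i (f i)) * \<eta> (%i. if i < N then e (f i) else e i)"
 have "\<eta> X = \<eta> (%i. if i \<in> {..<N} then X i else e i)" by (rule top_form_cong[OF \<eta>]) simp
 also have "... = (\<Sum>f\<in>?E. ?F f)"
  by (subst top_form_expand_partial[OF \<eta> e _ _ e X]) simp_all
 also have "... = (\<Sum>f\<in>(%\<sigma>. restrict \<sigma> {..<N}) ` ?P. ?F f)"
 proof (rule sum.mono_neutral_right)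
  show "finite ?E" by (simp add: finite_PiE)
  show "(%\<sigma>. restrict \<sigma> {..<N}) ` ?P \<subseteq> ?E" by (auto simp: permutes_lessThan restrict_def PiE_def extensional_def)
  show "\<forall>f\<in>?E - (%\<sigma>. restrict \<sigma> {..<N}) ` ?P. ?F f = 0"
  proof
   fix f assume f: "f \<in> ?E - (%\<sigma>. restrict \<sigma> {..<N}) ` ?P"
   have "\<not> inj_on f {..<N}"
   proof
    assume inj: "inj_on f {..<N}"
    have im: "f ` {..<N} \<subseteq> {..<N}" using f by (auto simp: PiE_def)
    have bij: "bij_betw f {..<N} {..<N}"
     unfolding bij_betw_def using endo_inj_surj[OF finite_lessThan im inj] inj by blast
    have cong: "bij_betw f {..<N} {..<N} = bij_betw (%i. if i < N then f i else i) {..<N} {..<N}"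
     by (rule bij_betw_cong) simp
    have "(%i. if i < N then f i else i) permutes {..<N}"
    proof (rule bij_imp_permutes)
     show "bij_betw (%i. if i < N then f i else i) {..<N} {..<N}"
      using bij unfolding cong .
    qed simp
    moreover have "f = restrict (%i. if i < N then f i else i) {..<N}"
     using f by (auto simp: fun_eq_iff restrict_def PiE_def extensional_def)
    ultimately show False using f by blast
   qed
   then obtain i j where ij: "i < N" "j < N" "i \<noteq> j" "f i = f j" by (auto simp: inj_on_def)
   show "?F f = 0" by (subst top_form_repeat[OF \<eta> ij(1-3)]) (use ij in auto)
  qed
 qed
 also have "... = (\<Sum>\<sigma>\<in>?P. ?F (restrict \<sigma> {..<N}))"
 proof (rule sum.reindex_cong[OF _ refl refl])
  show "inj_on (%\<sigma>. restrict \<sigma> {..<N}) ?P"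
  proof (rule inj_onI)
   fix \<sigma> \<tau> assume s: "\<sigma> \<in> ?P" "\<tau> \<in> ?P" and eq: "restrict \<sigma> {..<N} = restrict \<tau> {..<N}"
   show "\<sigma> = \<tau>"
   proof
    fix i show "\<sigma> i = \<tau> i"
     using s fun_cong[OF eq, of i] by (cases "i < N") (auto simp: permutes_not_in)
   qed
  qed
 qed
 also have "... = (\<Sum>\<sigma>\<in>?P. of_int (sign \<sigma>) * (\<Prod>i<N. a i (\<sigma> i)) * \<eta> e)"
 proof (rule sum.cong[OF refl])
  fix \<sigma> assume "\<sigma> \<in> ?P"
  moreover have "\<eta> (%i. if i < N then e (restrict \<sigma> {..<N} i) else e i) = \<eta> (e \<circ> \<sigma>)"
   by (rule top_form_cong[OF \<eta>]) simp
  ultimately show "?F (restrict \<sigma> {..<N}) = of_int (sign \<sigma>) * (\<Prod>i<N. a i (\<sigma> i)) * \<eta> e"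
   using top_form_permute[OF \<eta>, of \<sigma> e] by simp
 qed
 finally show ?thesis by (simp add: sum_distrib_right)
qed

lemma top_form_det:
 fixes b :: "nat => 'k::finite" and a :: "real ^ 'k ^ 'k"
 assumes \<eta>: "top_form N S \<eta>" and e: "!!k. k < N ==> e k \<in> S" and b: "bij_betw b {..<N} UNIV"
  and X: "!!i. i < N ==> X i = (\<Sum>k<N. a $ b i $ b k *\<^sub>t e k) \<and> X i \<in> S"
 shows "\<eta> X = det a * \<eta> e"
proof -
 have inj: "inj_on b {..<N}" using b by (simp add: bij_betw_def)
 have "det a = (\<Sum>\<sigma> | \<sigma> permutes {..<N}. of_int (sign \<sigma>) * (\<Prod>i<N. a $ b i $ b (\<sigma> i)))"
  unfolding det_def
 proof (rule sum.reindex_bij_betw[THEN sym, THEN trans])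
  show "bij_betw (map_permutation {..<N} b) {\<sigma>. \<sigma> permutes {..<N}} {p. p permutes UNIV}"
   using bij_betw_permutations[OF b] bij_betw_imp_surj_on[OF b]
   by (simp add: map_permutation_def[abs_def] restrict_id_def o_def)
  show "(\<Sum>\<sigma> | \<sigma> permutes {..<N}. of_int (sign (map_permutation {..<N} b \<sigma>)) * (\<Prod>i\<in>UNIV. a $ i $ map_permutation {..<N} b \<sigma> i)) =
   (\<Sum>\<sigma> | \<sigma> permutes {..<N}. of_int (sign \<sigma>) * (\<Prod>i<N. a $ b i $ b (\<sigma> i)))"
  proof (rule sum.cong[OF refl])
   fix \<sigma> assume "\<sigma> \<in> {\<sigma>. \<sigma> permutes {..<N}}"
   then have \<sigma>: "\<sigma> permutes {..<N}" by simp
   have "(\<Prod>i\<in>UNIV. a $ i $ map_permutation {..<N} b \<sigma> i) = (\<Prod>i<N. a $ b i $ map_permutation {..<N} b \<sigma> (b i))"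
    by (rule prod.reindex_bij_betw[OF b, symmetric])
   also have "... = (\<Prod>i<N. a $ b i $ b (\<sigma> i))"
    by (rule prod.cong[OF refl]) (simp add: map_permutation_apply[OF inj])
   finally show "of_int (sign (map_permutation {..<N} b \<sigma>)) * (\<Prod>i\<in>UNIV. a $ i $ map_permutation {..<N} b \<sigma> i) =
    of_int (sign \<sigma>) * (\<Prod>i<N. a $ b i $ b (\<sigma> i))"
    using sign_map_permutation[OF inj \<sigma>] by simp
  qed
 qed
 then show ?thesis using top_form_expand[OF \<eta> e X] by simp
qed


context compact_manifold
begin

lemma tangent_space_sum: "p \<in> M ==> (!!k. k \<in> K ==> u k \<in> TM p) ==> (\<Sum>k\<in>K. c k *\<^sub>t u k) \<in> TM p"
 by (induction K rule: infinite_finite_induct) (auto intro: tangent_space_0 tangent_space_add tangent_space_scale)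

lemma slot_linear_bilinear:
 assumes h: "bilinear_tensor A h" and p: "p \<in> M" and u: "!!k. k \<in> K ==> u k \<in> TM p"
 shows "slot_linear (h p) (TM p) (\<Sum>k\<in>K. c k *\<^sub>t u k) K c u"
 unfolding slot_linear_def by (intro ballI conjI; rule bilinear_sum[OF h p _ u]; assumption)

lemma wedge_power_top_form:
 assumes h: "bilinear_tensor A h" and p: "p \<in> M"
 shows "top_form (2 * m) (TM p) (wedge_power (h p) m)"
 unfolding top_form_def
proof (intro conjI allI impI)
 fix v v' :: "nat => 'm tvec" assume "\<forall>i<2 * m. v i = v' i"
 then show "wedge_power (h p) m v = wedge_power (h p) m v'" by (intro wedge_power_cong) simp
next
 fix v j c u and K :: "nat set"
 assume "\<forall>i<2 * m. i \<noteq> j --> v i \<in> TM p" "j < 2 * m" "finite K" "\<forall>k\<in>K. u k \<in> TM p"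
 then show "wedge_power (h p) m (v(j := (\<Sum>k\<in>K. c k *\<^sub>t u k))) = (\<Sum>k\<in>K. c k * wedge_power (h p) m (v(j := u k)))"
  by (intro wedge_power_linear[OF slot_linear_bilinear[OF h p]]) auto
qed (rule wedge_power_permute)

lemma wedge2_top_form:
 assumes \<alpha>: "!!K c u. finite (K :: nat set) ==> (!!k. k \<in> K ==> u k \<in> TM p) ==>
   slot_linear \<alpha> (TM p) (\<Sum>k\<in>K. c k *\<^sub>t u k) K c u"
  and h: "bilinear_tensor A h" and p: "p \<in> M"
 shows "top_form (2 * Suc m) (TM p) (wedge 2 (2 * m) (seq2 \<alpha>) (wedge_power (h p) m))"
 unfolding top_form_def
proof (intro conjI allI impI)
 fix v v' :: "nat => 'm tvec" assume "\<forall>i<2 * Suc m. v i = v' i"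
 then have eq: "v (\<sigma> i) = v' (\<sigma> i)" if "\<sigma> permutes {..<2 * Suc m}" "i < 2 * Suc m" for \<sigma> i
  using permutes_lessThan[OF that] by blast
 have "wedge_power (h p) m (%i. v (\<sigma> (2 + i))) = wedge_power (h p) m (%i. v' (\<sigma> (2 + i)))"
  if \<sigma>: "\<sigma> permutes {..<2 * Suc m}" for \<sigma> by (rule wedge_power_cong) (simp add: eq[OF \<sigma>] del: add_2_eq_Suc)
 then show "wedge 2 (2 * m) (seq2 \<alpha>) (wedge_power (h p) m) v = wedge 2 (2 * m) (seq2 \<alpha>) (wedge_power (h p) m) v'"
  unfolding wedge2_eq using eq[of _ 0] eq[of _ 1] by (intro arg_cong2[where f="(/)"] sum.cong refl) simp
next
 fix v :: "nat => 'm tvec" and \<tau> assume "\<tau> permutes {..<2 * Suc m}"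
 then show "wedge 2 (2 * m) (seq2 \<alpha>) (wedge_power (h p) m) (v \<circ> \<tau>) =
   of_int (sign \<tau>) * wedge 2 (2 * m) (seq2 \<alpha>) (wedge_power (h p) m) v"
  by (intro wedge_permute) simp
next
 fix v j c u and K :: "nat set"
 assume *: "\<forall>i<2 * Suc m. i \<noteq> j --> v i \<in> TM p" "j < 2 * Suc m" "finite K" "\<forall>k\<in>K. u k \<in> TM p"
 show "wedge 2 (2 * m) (seq2 \<alpha>) (wedge_power (h p) m) (v(j := (\<Sum>k\<in>K. c k *\<^sub>t u k))) =
   (\<Sum>k\<in>K. c k * wedge 2 (2 * m) (seq2 \<alpha>) (wedge_power (h p) m) (v(j := u k)))"
 proof (rule wedge2_linear[where S = "TM p"])
  show "slot_linear \<alpha> (TM p) (\<Sum>k\<in>K. c k *\<^sub>t u k) K c u" by (rule \<alpha>) (use * in auto)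
  fix v :: "nat => 'm tvec" and i assume v: "!!k. k < 2 * m ==> k \<noteq> i ==> v k \<in> TM p" "i < 2 * m"
  show "wedge_power (h p) m (v(i := (\<Sum>k\<in>K. c k *\<^sub>t u k))) = (\<Sum>k\<in>K. c k * wedge_power (h p) m (v(i := u k)))"
   by (rule top_form_linear[OF wedge_power_top_form[OF h p]]) (use v * in auto)
 next
  show "!!v v'. (!!k. k < 2 * m ==> v k = v' k) ==> wedge_power (h p) m v = wedge_power (h p) m v'"
   by (rule wedge_power_cong) simp
 qed (use * in auto)
qed

end

section \<open>The Chern scalar curvature as a contraction\<close>

context symplectic
begin

text \<open>The Chern scalar curvature depends on \<open>J\<close> through the Chern-Ricci form only. Separating this form from the
 contraction makes it possible to contract the forms of two structures in one frame.\<close>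

definition contraction :: "('m tvec => 'm tvec => real) => 'm => real" where
 "contraction \<alpha> p = (THE s. \<forall>v. (\<forall>i<2 * n. v i \<in> TM p) -->
  s * wedge_power (\<omega> p) n v = real n * wedge 2 (2 * (n - 1)) (seq2 \<alpha>) (wedge_power (\<omega> p) (n - 1)) v)"

lemma chern_scalar_contraction: "chern_scalar A n \<omega> J p = contraction (chern_ricci_form A \<omega> J p) p"
 by (simp only: chern_scalar_def contraction_def)

definition pointwise_form :: "'m => ('m tvec => 'm tvec => real) => bool" where
 "pointwise_form p \<alpha> \<longleftrightarrow>
  (\<forall>u\<in>TM p. \<forall>w\<in>TM p. \<alpha> w u = - \<alpha> u w) \<and>
  (\<forall>(K :: nat set) c u. (\<forall>k\<in>K. u k \<in> TM p) -->
    slot_linear \<alpha> (TM p) (\<Sum>k\<in>K. c k *\<^sub>t u k) K c u)"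

lemma pointwise_formD:
 assumes "pointwise_form p \<alpha>"
 shows "u \<in> TM p ==> w \<in> TM p ==> \<alpha> w u = - \<alpha> u w"
  and "(!!k. k \<in> K ==> u' k \<in> TM p) ==>
   slot_linear \<alpha> (TM p) (\<Sum>k\<in>K. c k *\<^sub>t u' k) (K :: nat set) c u'"
 by (rule assms[unfolded pointwise_form_def, THEN conjunct1, rule_format], assumption+,
  rule assms[unfolded pointwise_form_def, THEN conjunct2, rule_format])

lemma \<omega>_pointwise_form: "p \<in> M ==> pointwise_form p (\<omega> p)"
 unfolding pointwise_form_def by (intro conjI ballI allI impI slot_linear_bilinear[OF \<omega>_tensor] \<omega>_skew) auto

end

context almost_kaehler
begin

lemma frame_standard:
 assumes p: "p \<in> M"
 shows "standard n (%i j. \<omega> p (some_frame A g J p i p) (some_frame A g J p j p))"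
 unfolding standard_def
proof (intro allI impI)
 fix a b assume ab: "a < 2 * n" "b < 2 * n"
 let ?e = "%i. some_frame A g J p i p"
 note e = vfield_tangent[OF some_frame_field[OF p]]
 have on: "g p (?e i) (?e j) = (if i = j then 1 else 0)" if "i < 2 * n" "j < 2 * n" for i j
  using some_frame_orthonormal[OF p] that by (simp add: orthonormal_def dim_2n)
 have gJ: "\<omega> p u (J p v) = g p u v" for u v by (simp add: induced_metric_def)
 have 1: "\<omega> p (?e i) (?e (2 * j + 1)) = (if i = 2 * j then 1 else 0)" if "i < 2 * n" "j < n" for i j
  using some_frame_J[OF p, of j] on[of i "2 * j"] that by (simp add: gJ dim_2n)
 have 2: "\<omega> p (?e i) (?e (2 * j)) = (if i = 2 * j + 1 then - 1 else 0)" if "i < 2 * n" "j < n" for i j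
 proof -
  have "?e (2 * j) = - J p (?e (2 * j + 1))" 
   using some_frame_J[OF p, of j] J_J[OF p e[of "2 * j"]] that by (simp add: dim_2n)
  then have "\<omega> p (?e i) (?e (2 * j)) = - g p (?e i) (?e (2 * j + 1))"
   using that e[of i] e[of "2 * j + 1"] J_tangent[OF p e[of "2 * j + 1"]] bilinear_minus[OF \<omega>_tensor p]
   by (simp add: gJ dim_2n p)
  then show ?thesis using on[of i "2 * j + 1"] that by auto
 qed
 show "\<omega> p (?e a) (?e b) = (if even a \<and> b = a + 1 then 1 else if odd a \<and> b + 1 = a then - 1 else 0)"
 proof (cases "even b")
  case True
  then obtain j where j: "b = 2 * j" by blast
  have "\<not> (even a \<and> b = a + 1)" "odd a \<and> b + 1 = a \<longleftrightarrow> a = 2 * j + 1" using j by presburger+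
  then show ?thesis using 2[of a j] ab unfolding j by simp
 next
  case False
  then obtain j where j: "b = 2 * j + 1" by (rule oddE)
  have "\<not> (odd a \<and> b + 1 = a)" "even a \<and> b = a + 1 \<longleftrightarrow> a = 2 * j" using j by presburger+
  then show ?thesis using 1[of a j] ab unfolding j by simp
 qed
qed

lemma ricci_tensor:
 assumes D: "connection A D" and p: "p \<in> M" and u: "u \<in> TM p" and w: "w \<in> TM p"
 shows "ricci_form A g J D p u w = (\<Sum>k\<in>gen_index. u (\<beta> k) * ricci_form A g J D p (E k p) w)"
  and "ricci_form A g J D p w u = - ricci_form A g J D p u w"
proof -
 obtain X where X: "X \<in> V" "X p = u" by (rule tangent_extend[OF p u]) (rule that)
 obtain Y where Y: "Y \<in> V" "Y p = w" by (rule tangent_extend[OF p w]) (rule that)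
 define \<alpha> where "\<alpha> X q = trace (%Z. JJ (curvature D X Y Z)) q" for X q
 have t: "tensor_endo (%Z. JJ (curvature D X Y Z))" if "X \<in> V" for X
  by (rule JJ_comp_endo[OF curvature_endo[OF D that Y(1)]])
 have e1: "tensor_endo (%X. JJ (curvature D X Y Z))" if "Z \<in> V" for Z
  by (rule JJ_comp_endo[OF curvature_endo1[OF D Y(1) that]])
 have "tensor_form \<alpha>"
  unfolding tensor_form_def \<alpha>_def[abs_def]
 proof (intro conjI ballI)
  fix X assume "X \<in> V" then show "trace (%Z. JJ (curvature D X Y Z)) \<in> C" by (rule trace_smooth[OF t])
 next
  fix X X' q assume X: "X \<in> V" "X' \<in> V" and q: "q \<in> M"
  show "trace (%Z. JJ (curvature D (X + X') Y Z)) q = trace (%Z. JJ (curvature D X Y Z)) q + trace (%Z. JJ (curvature D X' Y Z)) q"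
   unfolding trace_def sum.distrib[symmetric]
   by (rule sum.cong[OF refl]) (simp add: tensor_endo_add[OF e1[OF gen_field] X])
 next
  fix X h q assume X: "X \<in> V" and h: "h \<in> C" and q: "q \<in> M"
  show "trace (%Z. JJ (curvature D (h *\<^sub>f X) Y Z)) q = h q * trace (%Z. JJ (curvature D X Y Z)) q"
   unfolding trace_def sum_distrib_left
   by (rule sum.cong[OF refl]) (simp add: tensor_endo_fscale[OF e1[OF gen_field] X h] fscale_simps)
 qed
 from tensor_form_gen[OF this X(1) p] have "\<alpha> X p = (\<Sum>k\<in>gen_index. u (\<beta> k) * \<alpha> (E k) p)" by (simp add: X)
 then show "ricci_form A g J D p u w = (\<Sum>k\<in>gen_index. u (\<beta> k) * ricci_form A g J D p (E k p) w)"
  using ricci_form_trace[OF D X(1) Y(1) p] ricci_form_trace[OF D gen_field Y(1) p]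
  by (simp add: X Y \<alpha>_def sum_distrib_left algebra_simps)
 have "trace (%Z. JJ (curvature D Y X Z)) p = - trace (%Z. JJ (curvature D X Y Z)) p"
  unfolding trace_def sum_negf[symmetric]
  by (rule sum.cong[OF refl]) (simp add: curvature_swap[OF D X(1) Y(1) gen_field] JJ_simps curvature_field[OF D X(1) Y(1) gen_field])
 then show "ricci_form A g J D p w u = - ricci_form A g J D p u w"
  using ricci_form_trace[OF D X(1) Y(1) p] ricci_form_trace[OF D Y(1) X(1) p] by (simp add: X Y)
qed

lemma ricci_slot_linear:
 assumes D: "connection A D" and p: "p \<in> M" and u: "!!k. k \<in> K ==> u k \<in> TM p"
 shows "slot_linear (ricci_form A g J D p) (TM p) (\<Sum>k\<in>K. c k *\<^sub>t u k) K c u"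
proof -
 let ?r = "ricci_form A g J D p" and ?x = "\<Sum>k\<in>K. c k *\<^sub>t u k"
 have x: "?x \<in> TM p" by (rule tangent_space_sum[OF p u])
 have ev: "?x f = (\<Sum>k\<in>K. c k * u k f)" for f
  by (induction K rule: infinite_finite_induct) (simp_all add: tscale_def)
 have 1: "?r ?x w = (\<Sum>k\<in>K. c k * ?r (u k) w)" if w: "w \<in> TM p" for w
 proof -
  have "?r ?x w = (\<Sum>l\<in>gen_index. (\<Sum>k\<in>K. c k * u k (\<beta> l)) * ?r (E l p) w)"
   unfolding ricci_tensor(1)[OF D p x w] ev ..
  also have "... = (\<Sum>k\<in>K. c k * (\<Sum>l\<in>gen_index. u k (\<beta> l) * ?r (E l p) w))"
   unfolding sum_distrib_left sum_distrib_right by (subst sum.swap) (simp only: mult.assoc)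
  also have "... = (\<Sum>k\<in>K. c k * ?r (u k) w)"
   by (rule sum.cong[OF refl]) (simp only: ricci_tensor(1)[OF D p u w, symmetric])
  finally show ?thesis .
 qed
 then have 2: "?r w ?x = (\<Sum>k\<in>K. c k * ?r w (u k))" if w: "w \<in> TM p" for w
  unfolding ricci_tensor(2)[OF D p x w] using ricci_tensor(2)[OF D p u w] by (simp add: w sum_negf)
 show ?thesis unfolding slot_linear_def using 1 2 by blast
qed

lemma ricci_pointwise_form: "connection A D ==> p \<in> M ==> pointwise_form p (ricci_form A g J D p)"
 unfolding pointwise_form_def by (intro conjI ballI allI impI ricci_tensor(2) ricci_slot_linear) auto

text \<open>The left-hand side does not refer to the almost-complex structure, so the adapted frame of any compatible one
 may be used on the right.\<close>

lemma contraction_frame: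
 assumes p: "p \<in> M" and \<alpha>: "pointwise_form p \<alpha>"
 shows "contraction \<alpha> p = 1 / 2 * (\<Sum>i<2 * n. \<alpha> (some_frame A g J p i p) (J p (some_frame A g J p i p)))"
proof -
 let ?e = "%i. some_frame A g J p i p"
 note e = vfield_tangent[OF some_frame_field[OF p]]
 obtain m where m: "n = Suc m" using n_pos by (cases n) auto
 have st: "standard (Suc m) (%i j. \<omega> p (?e i) (?e j))" using frame_standard[OF p] m by simp
 have skew: "\<alpha> (?e b) (?e a) = - \<alpha> (?e a) (?e b)" if "a < 2 * Suc m" "b < 2 * Suc m" for a b
  by (rule pointwise_formD(1)[OF \<alpha>]) (use e that m dim_2n in auto)
 define s where "s = (\<Sum>j<n. \<alpha> (?e (2 * j)) (?e (2 * j + 1)))"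
 let ?\<eta> = "%v. wedge 2 (2 * m) (seq2 \<alpha>) (wedge_power (\<omega> p) m) v"
 have ad: "real n * ?\<eta> ?e = s * wedge_power (\<omega> p) (Suc m) ?e" and ad2: "wedge_power (\<omega> p) (Suc m) ?e = fact (Suc m)"
  unfolding s_def m by (rule wedge2_adapted(1)[where \<omega> = "\<omega> p" and e = "?e", OF st], rule skew, assumption+, rule wedge2_adapted(2)[where \<omega> = "\<omega> p" and e = "?e" and \<beta> = "\<alpha>", OF st], rule skew)
 have tf1: "top_form (2 * Suc m) (TM p) (wedge_power (\<omega> p) (Suc m))"
  by (rule wedge_power_top_form[OF \<omega>_tensor p])
 have tf2: "top_form (2 * Suc m) (TM p) ?\<eta>"
  by (rule wedge2_top_form[OF _ \<omega>_tensor p]) (rule pointwise_formD(2)[OF \<alpha>])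
 have eq: "real n * ?\<eta> v = s * wedge_power (\<omega> p) n v" if v: "!!i. i < 2 * n ==> v i \<in> TM p" for v
 proof -
  have X: "v i = (\<Sum>k<2 * Suc m. g p (v i) (?e k) *\<^sub>t ?e k) \<and> v i \<in> TM p" if "i < 2 * Suc m" for i
   using orthonormal_expand[OF p some_frame_orthonormal[OF p] v[of i]] v[of i] that m unfolding dim_2n by simp
  have ek: "k < 2 * Suc m ==> ?e k \<in> TM p" for k using e m dim_2n by simp
  define d where "d = (\<Sum>\<sigma> | \<sigma> permutes {..<2 * Suc m}. of_int (sign \<sigma>) * (\<Prod>i<2 * Suc m. g p (v i) (?e (\<sigma> i))))"
  have d: "wedge_power (\<omega> p) (Suc m) v = d * wedge_power (\<omega> p) (Suc m) ?e" "?\<eta> v = d * ?\<eta> ?e"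
   unfolding d_def by (rule top_form_expand[OF tf1 ek X], assumption+, rule top_form_expand[OF tf2 ek X])
  show ?thesis using ad unfolding d m by simp
 qed
 have "contraction \<alpha> p = s"
  unfolding contraction_def
 proof (rule the_equality)
  show "\<forall>v. (\<forall>i<2 * n. v i \<in> TM p) --> s * wedge_power (\<omega> p) n v =
    real n * wedge 2 (2 * (n - 1)) (seq2 \<alpha>) (wedge_power (\<omega> p) (n - 1)) v"
   using eq m by simp
  fix s' assume "\<forall>v. (\<forall>i<2 * n. v i \<in> TM p) --> s' * wedge_power (\<omega> p) n v =
    real n * wedge 2 (2 * (n - 1)) (seq2 \<alpha>) (wedge_power (\<omega> p) (n - 1)) v"
  then have "s' * wedge_power (\<omega> p) n ?e = real n * ?\<eta> ?e" using e m dim_2n by simp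
  also have "... = s * wedge_power (\<omega> p) n ?e" by (rule eq) (use e dim_2n in simp)
  finally show "s' = s" using ad2 m by simp
 qed
 also have "s = 1 / 2 * (\<Sum>i<2 * n. \<alpha> (?e i) (J p (?e i)))"
 proof -
  have "\<alpha> (?e (2 * j)) (J p (?e (2 * j))) + \<alpha> (?e (2 * j + 1)) (J p (?e (2 * j + 1))) = 2 * \<alpha> (?e (2 * j)) (?e (2 * j + 1))"
   if j: "j < n" for j
  proof -
   have J: "?e (2 * j + 1) = J p (?e (2 * j))" by (rule some_frame_J[OF p]) (use j dim_2n in simp)
   have t: "?e (2 * j) \<in> TM p" "?e (2 * j + 1) \<in> TM p" using e j dim_2n by auto
   have "J p (?e (2 * j + 1)) = (\<Sum>k\<in>{0 :: nat}. (-1) *\<^sub>t ?e (2 * j))"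
    unfolding J J_J[OF p t(1)] by (simp add: tscale_def fun_eq_iff)
   then have "\<alpha> (?e (2 * j + 1)) (J p (?e (2 * j + 1))) = - \<alpha> (?e (2 * j + 1)) (?e (2 * j))"
    using pointwise_formD(2)[OF \<alpha>, of "{0}" "%_. ?e (2 * j)" "%_. -1"] t unfolding slot_linear_def by simp
   then show ?thesis using pointwise_formD(1)[OF \<alpha> t] J by simp
  qed
  then show ?thesis unfolding s_def sum_pairs by (simp add: sum_distrib_left[symmetric])
 qed
 finally show ?thesis .
qed

end

section \<open>Integration in a Euclidean space\<close>

text \<open>The change of variables formula for Lebesgue integrals concerns vectors indexed by a well-ordered finite
 type. Turning the basis vectors of a Euclidean space into such a type transfers the formula.\<close>

typedef (overloaded) ('e::euclidean_space) basis_index = "Basis :: 'e set"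
 using nonempty_Basis by blast

lemma bij_Rep_basis_index: "bij_betw Rep_basis_index UNIV (Basis :: 'e::euclidean_space set)"
 unfolding bij_betw_def using type_definition.Rep_range[OF type_definition_basis_index]
 by (simp add: inj_on_def Rep_basis_index_inject)

instance basis_index :: (euclidean_space) finite
 by standard (rule bij_betw_finite[THEN iffD2, OF bij_Rep_basis_index finite_Basis])

lemma basis_enum: "bij_betw (basis_enum :: nat => 'e::euclidean_space) {..<DIM('e)} Basis"
proof -
 obtain h :: "nat => 'e" where "bij_betw h {0..<DIM('e)} Basis"
  using ex_bij_betw_nat_finite[OF finite_Basis] by blast
 then have "\<exists>b :: nat => 'e. bij_betw b {..<DIM('e)} Basis" by (auto simp: lessThan_atLeast0)
 then show ?thesis unfolding basis_enum_def by (rule someI_ex)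
qed

definition basis_rank :: "'e::euclidean_space basis_index => nat" where
 "basis_rank i = inv_into {..<DIM('e)} basis_enum (Rep_basis_index i)"

lemma basis_rank_inj: "basis_rank i = basis_rank j ==> i = j"
 unfolding basis_rank_def
 using inv_into_injective[of "{..<DIM('a)}" basis_enum "Rep_basis_index i" "Rep_basis_index j"]
  bij_betw_imp_surj_on[OF basis_enum[where 'e='a]] Rep_basis_index[of i] Rep_basis_index[of j] Rep_basis_index_inject[of i j]
 by auto

instantiation basis_index :: (euclidean_space) wellorder
begin

definition less_eq_basis_index :: "'a basis_index => 'a basis_index => bool" where
 "less_eq_basis_index i j \<longleftrightarrow> basis_rank i \<le> basis_rank j"

definition less_basis_index :: "'a basis_index => 'a basis_index => bool" where
 "less_basis_index i j \<longleftrightarrow> basis_rank i < basis_rank j"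

instance
proof
 show "P a" if "!!x :: 'a basis_index. (!!y. y < x ==> P y) ==> P x" for P and a :: "'a basis_index"
  using that unfolding less_basis_index_def by (induction a rule: measure_induct_rule[of basis_rank]) blast
qed (auto simp: less_eq_basis_index_def less_basis_index_def intro: basis_rank_inj)

end

definition of_coords :: "real ^ ('e::euclidean_space) basis_index => 'e" where
 "of_coords v = (\<Sum>i\<in>UNIV. v $ i *\<^sub>R Rep_basis_index i)"

definition to_coords :: "'e::euclidean_space => real ^ 'e basis_index" where
 "to_coords x = (\<chi> i. x \<bullet> Rep_basis_index i)"

lemma of_to_coords [simp]: "of_coords (to_coords x) = x"
 unfolding of_coords_def to_coords_def
 using sum.reindex_bij_betw[OF bij_Rep_basis_index, of "%b. (x \<bullet> b) *\<^sub>R b"] by (simp add: euclidean_representation)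

lemma to_coords_nth [simp]: "to_coords x $ i = x \<bullet> Rep_basis_index i"
 by (simp add: to_coords_def)

lemma of_coords_inner: "of_coords v \<bullet> Rep_basis_index i = v $ i"
proof -
 have "of_coords v \<bullet> Rep_basis_index i = (\<Sum>j\<in>UNIV. if j = i then v $ j else 0)"
  unfolding of_coords_def inner_sum_left
  by (intro sum.cong refl) (simp add: inner_Basis[OF Rep_basis_index Rep_basis_index] Rep_basis_index_inject)
 then show ?thesis by simp
qed

lemma to_of_coords [simp]: "to_coords (of_coords v) = v"
 by (simp add: vec_eq_iff of_coords_inner)

lemma linear_coords: "linear (to_coords :: 'e::euclidean_space => _)" "linear (of_coords :: _ => 'e)"
 unfolding to_coords_def of_coords_def
 by (auto intro!: linearI simp: vec_eq_iff inner_add_left algebra_simps sum.distrib scaleR_sum_right)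

lemma continuous_coords: "continuous_on S to_coords" "continuous_on S' of_coords"
 using linear_coords by (auto intro: linear_continuous_on simp: linear_conv_bounded_linear)

lemma borel_coords: "of_coords \<in> borel_measurable borel" "to_coords \<in> borel_measurable borel"
 using continuous_coords by (auto intro!: borel_measurable_continuous_onI)

lemma lborel_coords: "distr lborel borel (of_coords :: _ => 'e::euclidean_space) = lborel"
proof (rule lborel_eqI[symmetric])
 fix l u :: 'e assume lu: "!!b. b \<in> Basis ==> l \<bullet> b \<le> u \<bullet> b"
 have b: "(!!b. b \<in> Basis ==> to_coords l \<bullet> b \<le> to_coords u \<bullet> b)"
  using lu[OF Rep_basis_index] by (auto simp: Basis_vec_def inner_axis)
 have "of_coords -` box l u = box (to_coords l) (to_coords u)"
 proof -
  have "(\<forall>b\<in>Basis. l \<bullet> b < of_coords v \<bullet> b \<and> of_coords v \<bullet> b < u \<bullet> b) \<longleftrightarrow>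
    (\<forall>i. l \<bullet> Rep_basis_index i < v $ i \<and> v $ i < u \<bullet> Rep_basis_index i)" for v
   using bij_betw_imp_surj_on[OF bij_Rep_basis_index[where 'e='e]] of_coords_inner[of v]
   by (metis rangeI image_iff)
  then show ?thesis by (auto simp: mem_box Basis_vec_def inner_axis)
 qed
 then have "emeasure (distr lborel borel of_coords) (box l u) = emeasure lborel (box (to_coords l) (to_coords u))"
  using borel_coords(1) by (subst emeasure_distr) (auto simp: )
 also have "... = (\<Prod>b\<in>Basis. (to_coords u - to_coords l) \<bullet> b)"
  by (rule emeasure_lborel_box[OF b])
 also have "(\<Prod>b\<in>Basis. (to_coords u - to_coords l) \<bullet> b) = (\<Prod>i\<in>UNIV. (u - l) \<bullet> Rep_basis_index i)"
 proof (rule prod.reindex_bij_betw[of "%i. axis i 1", THEN sym, THEN trans])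
  show "bij_betw (%i. axis i 1) UNIV (Basis :: (real ^ 'e basis_index) set)"
   unfolding bij_betw_def Basis_vec_def by (auto simp: inj_on_def axis_eq_axis)
 qed (simp add: inner_axis inner_diff_left)
 also have "... = (\<Prod>b\<in>Basis. (u - l) \<bullet> b)"
  by (rule prod.reindex_bij_betw[OF bij_Rep_basis_index])
 finally show "emeasure (distr lborel borel of_coords) (box l u) = (\<Prod>b\<in>Basis. (u - l) \<bullet> b)" .
qed simp

lemma integrable_compact_support:
 fixes f :: "'e::euclidean_space => real"
 assumes f: "continuous_on UNIV f" and K: "compact K" "!!x. x \<notin> K ==> f x = 0"
 shows "integrable lborel f"
proof -
 have "integrable lborel (%x. indicator K x *\<^sub>R f x)"
  by (rule borel_integrable_compact[OF K(1) continuous_on_subset[OF f subset_UNIV]])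
 moreover have "(%x. indicator K x *\<^sub>R f x) = f" using K(2) by (auto simp: fun_eq_iff indicator_def)
 ultimately show ?thesis by simp
qed

text \<open>By translation invariance the difference quotients of \<open>f\<close> have integral 0, and they converge dominatedly.\<close>

lemma integral_partial_derivative:
 fixes f :: "'e::euclidean_space => real"
 assumes f: "!!x. (f has_derivative f' x) (at x)" and cont: "continuous_on UNIV (%x. f' x b)"
  and K: "compact K" "!!x. x \<notin> K ==> f x = 0"
 shows "(LINT x|lborel. f' x b) = 0"
proof -
 have cf: "continuous_on UNIV f" using f by (meson continuous_at_imp_continuous_on has_derivative_continuous)
 have zero: "f' x b = 0" if "x \<notin> K" for x
 proof -
  have "open (- K)" using K(1) by (simp add: compact_imp_closed open_Compl)
  then have "((%x. 0) has_derivative f' x) (at x)"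
   using has_derivative_transform_within_open[OF f[of x], of "- K" "%_. 0"] that K(2) by simp
  then have "f' x = (%_. 0)" using has_derivative_unique has_derivative_const by blast
  then show ?thesis by simp
 qed
 have int: "integrable lborel (%x. f' x b)" by (rule integrable_compact_support[OF cont K(1) zero])
 have line: "((%s. f (x + s *\<^sub>R b)) has_real_derivative f' (x + t *\<^sub>R b) b) (at t)" for x t
 proof -
  have "((%s. x + s *\<^sub>R b) has_derivative (%s. s *\<^sub>R b)) (at t)" by (auto intro!: derivative_eq_intros)
  from has_derivative_compose[OF this f] have "((%s. f (x + s *\<^sub>R b)) has_derivative (%s. f' (x + t *\<^sub>R b) (s *\<^sub>R b))) (at t)" .
  moreover have "f' (x + t *\<^sub>R b) (s *\<^sub>R b) = f' (x + t *\<^sub>R b) b * s" for s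
   using has_derivative_bounded_linear[OF f[of "x + t *\<^sub>R b"]] by (simp add: linear_simps mult.commute)
  ultimately show ?thesis by (simp add: has_field_derivative_def)
 qed
 have "bounded ((%x. f' x b) ` K)"
  using compact_continuous_image[OF continuous_on_subset[OF cont subset_UNIV] K(1)] compact_imp_bounded by blast
 then obtain B where "\<forall>y\<in>(%x. f' x b) ` K. norm y \<le> B" by (auto simp: bounded_iff)
 then have B: "\<bar>f' x b\<bar> \<le> max B 0" for x using zero[of x] by (cases "x \<in> K") (auto simp: le_max_iff_disj)
 let ?t = "%n. inverse (real (Suc n))"
 let ?q = "%n x. (f (x + ?t n *\<^sub>R b) - f x) / ?t n"
 define L where "L = (%(x, s). x - s *\<^sub>R b) ` (K \<times> {0..1})"
 have L: "compact L" unfolding L_def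
  by (intro compact_continuous_image compact_Times K) (auto simp: case_prod_unfold intro!: continuous_intros)
 have bound: "\<bar>?q n x\<bar> \<le> indicator L x * max B 0" for n x
 proof -
  have t: "?t n > 0" "?t n \<le> 1" by (auto simp: field_simps)
  obtain s where s: "0 < s" "s < ?t n" "f (x + ?t n *\<^sub>R b) - f (x + 0 *\<^sub>R b) = (?t n - 0) * f' (x + s *\<^sub>R b) b"
   using MVT2[of 0 "?t n" "%s. f (x + s *\<^sub>R b)" "%s. f' (x + s *\<^sub>R b) b"] t line by blast
  then have q: "?q n x = f' (x + s *\<^sub>R b) b" using t by simp
  show ?thesis
  proof (cases "x + s *\<^sub>R b \<in> K")
   case True
   have "(%(x, s). x - s *\<^sub>R b) (x + s *\<^sub>R b, s) \<in> L"
    unfolding L_def by (rule imageI) (use True s t in auto)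
   then show ?thesis unfolding q using B by simp
  next
   case False
   then show ?thesis unfolding q using zero by (simp add: indicator_def)
  qed
 qed
 have dom: "(%n. LINT x|lborel. ?q n x) \<longlonglongrightarrow> (LINT x|lborel. f' x b)"
 proof (rule integral_dominated_convergence)
  show "integrable lborel (%x. indicator L x * max B 0)"
   using borel_integrable_compact[OF L, of "%_. max B 0"] by simp
  show "AE x in lborel. (%n. ?q n x) \<longlonglongrightarrow> f' x b"
  proof (rule AE_I2)
   fix x
   have "((%h. (f (x + (0 + h) *\<^sub>R b) - f (x + 0 *\<^sub>R b)) / h) \<longlongrightarrow> f' (x + 0 *\<^sub>R b) b) (at 0)"
    using line[of x 0] unfolding DERIV_def .
   moreover have "filterlim ?t (at 0) sequentially"
    unfolding filterlim_at using LIMSEQ_inverse_real_of_nat by simp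
   ultimately have "(%n. (f (x + (0 + ?t n) *\<^sub>R b) - f (x + 0 *\<^sub>R b)) / ?t n) \<longlonglongrightarrow> f' (x + 0 *\<^sub>R b) b"
    by (rule filterlim_compose)
   then show "(%n. ?q n x) \<longlonglongrightarrow> f' x b" by simp
  qed
  show "AE x in lborel. norm (?q n x) \<le> indicator L x * max B 0" for n using bound by simp
  show "?q n \<in> borel_measurable lborel" for n
  proof -
   have "(%x. f (x + ?t n *\<^sub>R b)) \<in> borel_measurable borel" "f \<in> borel_measurable borel"
    by (auto intro!: borel_measurable_continuous_onI continuous_on_compose2[OF cf] cf continuous_intros)
   then show ?thesis by simp
  qed
  show "(%x. f' x b) \<in> borel_measurable lborel" using borel_measurable_integrable[OF int] .
 qed
 have f_int: "integrable lborel f" by (rule integrable_compact_support[OF cf K])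
 have shift: "integrable lborel (%x. f (x + c))" "(LINT x|lborel. f (x + c)) = (LINT x|lborel. f x)" for c
  using integrable_distr_eq[of "(+) c" lborel borel f] integral_distr[of "(+) c" lborel borel f] f_int
   borel_measurable_continuous_onI[OF cf] lborel_distr_plus[of c] by (simp_all add: add.commute)
 have q0: "(LINT x|lborel. ?q n x) = 0" for n
  using shift[of "?t n *\<^sub>R b"] f_int by (simp add: Bochner_Integration.integral_diff)
 then show "(LINT x|lborel. f' x b) = 0" using dom unfolding q0 by (simp only: LIMSEQ_const_iff)
qed


lemma continuous_nonneg_integral_0:
 fixes f :: "'e::euclidean_space => real"
 assumes f: "continuous_on UNIV f" "!!x. f x \<ge> 0" and int: "integrable lborel f" "(LINT x|lborel. f x) = 0"
 shows "f x = 0"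
proof -
 have "(f has_integral 0) UNIV" using has_integral_integral_lborel[OF int(1)] int(2) by simp
 then have "integral (cbox (x - One) (x + One)) f \<le> 0"
  using integral_subset_le[of "cbox (x - One) (x + One)" UNIV f] f integrable_continuous[OF continuous_on_subset[OF f(1)]]
  by (auto simp: has_integral_iff)
 moreover have "integral (cbox (x - One) (x + One)) f \<ge> 0" by (rule integral_nonneg) (auto intro: integrable_continuous continuous_on_subset[OF f(1)] f(2))
 ultimately have "(f has_integral 0) (cbox (x - One) (x + One))"
  using integrable_continuous[OF continuous_on_subset[OF f(1) subset_UNIV]] by (auto simp: has_integral_iff)
 moreover have "x \<in> box (x - One) (x + One)" by (simp add: mem_box inner_diff_left inner_add_left)
 moreover from this have "x \<in> cbox (x - One) (x + One)" using box_subset_cbox by blast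
 ultimately show ?thesis
  using has_integral_0_cbox_imp_0[OF continuous_on_subset[OF f(1) subset_UNIV] f(2), of "x - One" "x + One" x] by blast
qed

definition jacobian :: "('e => 'e::euclidean_space) => real" where
 "jacobian L = det (\<chi> i j. L (Rep_basis_index i) \<bullet> Rep_basis_index j)"

lemma jacobian_matrix:
 assumes "linear L"
 shows "jacobian L = det (matrix (to_coords \<circ> L \<circ> of_coords))"
proof -
 have of_axis: "of_coords (axis i 1) = Rep_basis_index i" for i :: "'a basis_index"
  unfolding of_coords_def by (subst sum.remove[of _ i]) (auto simp: axis_def)
 have "(\<chi> i j. L (Rep_basis_index i) \<bullet> Rep_basis_index j) = transpose (matrix (to_coords \<circ> L \<circ> of_coords))"
  by (simp add: vec_eq_iff transpose_def matrix_def of_axis)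
 then show ?thesis by (simp add: jacobian_def det_transpose)
qed

lemma set_integral_coords:
 fixes F :: "'e::euclidean_space => real"
 assumes F: "set_integrable lborel S F"
 shows "(%v. F (of_coords v)) absolutely_integrable_on to_coords ` S"
  and "integral (to_coords ` S) (%v. F (of_coords v)) = (LINT x:S|lborel. F x)"
proof -
 let ?G = "%x. indicator S x *\<^sub>R F x"
 have ind: "indicator S (of_coords v) = (indicator (to_coords ` S) v :: real)" for v
  by (auto simp: indicator_def image_iff)
 have G: "integrable lborel ?G" "?G \<in> borel_measurable borel"
  using F borel_measurable_integrable[of lborel ?G] by (simp_all add: set_integrable_def)
 have "integrable lborel (%v. ?G (of_coords v))"
  using integrable_distr_eq[of of_coords lborel borel ?G] G borel_coords(1) by (simp add: lborel_coords)
 then have int: "set_integrable lborel (to_coords ` S) (%v. F (of_coords v))"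
  by (simp add: set_integrable_def ind)
 then show "(%v. F (of_coords v)) absolutely_integrable_on to_coords ` S"
  unfolding set_integrable_def by (intro integrable_completion[THEN iffD2]) (auto dest: borel_measurable_integrable)
 have "(LINT x:S|lborel. F x) = (LINT v|lborel. ?G (of_coords v))"
  using integral_distr[of of_coords lborel borel ?G] G(2) borel_coords(1) by (simp add: lborel_coords set_lebesgue_integral_def)
 also have "... = (LINT v:to_coords ` S|lborel. F (of_coords v))"
  by (simp only: set_lebesgue_integral_def ind)
 finally show "integral (to_coords ` S) (%v. F (of_coords v)) = (LINT x:S|lborel. F x)"
  using set_borel_integral_eq_integral(2)[OF int] by simp
qed

lemma change_of_variables:
 fixes f :: "'e::euclidean_space => real"
 assumes \<phi>: "!!x. x \<in> S ==> (\<phi> has_derivative \<phi>' x) (at x)" "!!x. x \<in> S ==> \<phi> x \<in> T \<and> \<psi> (\<phi> x) = x"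
  and \<psi>: "!!y. y \<in> T ==> (\<psi> has_derivative \<psi>' y) (at y)" "!!y. y \<in> T ==> \<psi> y \<in> S \<and> \<phi> (\<psi> y) = y"
  and S: "open T" and f: "set_integrable lborel T f"
  and f': "set_integrable lborel S (%x. \<bar>jacobian (\<phi>' x)\<bar> * f (\<phi> x))"
 shows "(LINT y:T|lborel. f y) = (LINT x:S|lborel. \<bar>jacobian (\<phi>' x)\<bar> * f (\<phi> x))"
proof -
 let ?g = "%v. to_coords (\<phi> (of_coords v))" and ?h = "%v. to_coords (\<psi> (of_coords v))"
 let ?g' = "%v. to_coords \<circ> \<phi>' (of_coords v) \<circ> of_coords" and ?h' = "%v. to_coords \<circ> \<psi>' (of_coords v) \<circ> of_coords"
 have bl: "bounded_linear (to_coords :: 'e => _)" "bounded_linear (of_coords :: _ => 'e)"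
  using linear_coords by (simp_all add: linear_conv_bounded_linear)
 have der: "((%v. to_coords (k (of_coords v))) has_derivative (to_coords \<circ> D \<circ> of_coords)) (at v within X)"
  if "(k has_derivative D) (at (of_coords v))" for k :: "'e => 'e" and D v X
 proof -
  have "((%v. k (of_coords v)) has_derivative (%w. D (of_coords w))) (at v)"
   by (rule has_derivative_compose[OF bounded_linear_imp_has_derivative[OF bl(2)] that])
  from bounded_linear.has_derivative[OF bl(1) this] show ?thesis
   by (simp add: o_def has_derivative_at_withinI)
 qed
 have id: "\<phi>' (\<psi> y) (\<psi>' y w) = w" if y: "y \<in> T" for y w
 proof -
  have "((%z. \<phi> (\<psi> z)) has_derivative (%w. \<phi>' (\<psi> y) (\<psi>' y w))) (at y)"
   by (rule has_derivative_compose[OF \<psi>(1)[OF y] \<phi>(1)]) (use \<psi>(2)[OF y] in simp)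
  then have "((%z. z) has_derivative (%w. \<phi>' (\<psi> y) (\<psi>' y w))) (at y)"
   by (rule has_derivative_transform_within_open[OF _ S y]) (use \<psi>(2) in simp)
  from has_derivative_unique[OF this has_derivative_ident] show ?thesis by (rule fun_cong)
 qed
 have id': "\<psi>' y (\<phi>' (\<psi> y) w) = w" if y: "y \<in> T" for y w
 proof -
  have l: "linear (\<phi>' (\<psi> y))" "linear (\<psi>' y)"
   using has_derivative_linear \<phi>(1) \<psi> y by blast+
  have "\<phi>' (\<psi> y) \<circ> \<psi>' y = id" using id[OF y] by (simp add: fun_eq_iff)
  then have "\<psi>' y \<circ> \<phi>' (\<psi> y) = id" using linear_inverse_left[OF l] by blast
  then show ?thesis by (rule pointfree_idE)
 qed
 have "(%x. \<bar>det (matrix (?g' x))\<bar> * f (of_coords (?g x))) absolutely_integrable_on to_coords ` S \<and>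
  integral (to_coords ` S) (%x. \<bar>det (matrix (?g' x))\<bar> * f (of_coords (?g x))) = (LINT y:T|lborel. f y) \<longleftrightarrow>
  (%v. f (of_coords v)) absolutely_integrable_on to_coords ` T \<and> integral (to_coords ` T) (%v. f (of_coords v)) = (LINT y:T|lborel. f y)"
 proof (rule cov_invertible_real[where h = ?h and h' = ?h'])
  show "(?g has_derivative ?g' x) (at x within to_coords ` S)" if "x \<in> to_coords ` S" for x
   using that by (intro der) (auto intro: \<phi>)
  show "(?h has_derivative ?h' x) (at x within to_coords ` T)" if "x \<in> to_coords ` T" for x
   using that by (intro der) (auto intro: \<psi>)
  show "?h' y \<circ> ?g' (?h y) = id" if "y \<in> to_coords ` T" for y
   using that id' by (auto simp: fun_eq_iff)
 qed (use \<phi>(2) \<psi>(2) in auto)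
 then have "integral (to_coords ` S) (%x. \<bar>det (matrix (?g' x))\<bar> * f (of_coords (?g x))) = (LINT y:T|lborel. f y)"
  using set_integral_coords[OF f] by blast
 moreover have "integral (to_coords ` S) (%x. \<bar>det (matrix (?g' x))\<bar> * f (of_coords (?g x))) =
   integral (to_coords ` S) (%x. \<bar>jacobian (\<phi>' (of_coords x))\<bar> * f (\<phi> (of_coords x)))"
  by (rule integral_cong) (auto simp: jacobian_matrix[OF has_derivative_linear[OF \<phi>(1)]])
 ultimately show ?thesis using set_integral_coords(2)[OF f'] by simp
qed

section \<open>Liouville's divergence formula\<close>

context symplectic
begin

abbreviation "om_top X q \<equiv> wedge_power (\<omega> q) n (%i. X i q)"

lemma wedge_power_smooth:
 "(!!i. i < 2 * m ==> X i \<in> V) ==> (%q. wedge_power (\<omega> q) m (%i. X i q)) \<in> C"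
proof (induction m arbitrary: X)
 case (Suc m)
 show ?case
  unfolding wedge_power.simps wedge2_eq
 proof (intro smooth_divide smooth_sum smooth_mult smooth_const)
  fix \<sigma> assume "\<sigma> \<in> {\<sigma>. \<sigma> permutes {..<2 * Suc m}}"
  then have \<sigma>: "i < 2 * Suc m ==> X (\<sigma> i) \<in> V" for i using Suc.prems permutes_lessThan[of \<sigma>] by blast
  show "(%q. \<omega> q (X (\<sigma> 0) q) (X (\<sigma> 1) q)) \<in> C"
   using \<omega>_tensor \<sigma>[of 0] \<sigma>[of 1] unfolding bilinear_tensor_def by simp
  show "(%q. wedge_power (\<omega> q) m (%i. X (\<sigma> (2 + i)) q)) \<in> C" by (rule Suc.IH, rule \<sigma>) simp
 qed
qed simp

text \<open>The product rule for the powers of a form that is parallel along \<open>W\<close>; it is proved at one point and for an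
 arbitrary operator \<open>D\<close>, so that only the rule for \<open>\<omega>\<close> itself is used.\<close>

lemma wedge_power_derivation:
 assumes W: "W \<in> V" and p: "p \<in> M" and D: "!!X. X \<in> V ==> D X \<in> V"
  and om: "!!X Y. X \<in> V ==> Y \<in> V ==> W p (%q. \<omega> q (X q) (Y q)) = \<omega> p (D X p) (Y p) + \<omega> p (X p) (D Y p)"
 shows "(!!i. i < 2 * m ==> X i \<in> V) ==> W p (%q. wedge_power (\<omega> q) m (%i. X i q)) =
  (\<Sum>j<2 * m. wedge_power (\<omega> p) m (%i. (X(j := D (X j))) i p))"
proof (induction m arbitrary: X)
 case 0
 then show ?case using tangent_const[OF vfield_tangent[OF W]] by simp
next
 case (Suc m)
 let ?P = "{\<sigma>. \<sigma> permutes {..<2 * Suc m}}"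
 let ?g = "%Y \<sigma> q. of_int (sign \<sigma>) * \<omega> q (Y (\<sigma> 0) q) (Y (\<sigma> 1) q) * wedge_power (\<omega> q) m (%i. Y (\<sigma> (2 + i)) q)"
 have XV: "X (\<sigma> i) \<in> V" if "\<sigma> permutes {..<2 * Suc m}" "i < 2 * Suc m" for \<sigma> i
  using Suc.prems permutes_lessThan[OF that] by blast
 have om_C: "(%q. \<omega> q (Y q) (Z q)) \<in> C" if "Y \<in> V" "Z \<in> V" for Y Z
  using \<omega>_tensor that unfolding bilinear_tensor_def by blast
 note WT = vfield_tangent[OF W]
 have gC: "?g X \<sigma> \<in> C" if \<sigma>: "\<sigma> permutes {..<2 * Suc m}" for \<sigma>
  by (intro smooth_mult smooth_const om_C wedge_power_smooth XV[OF \<sigma>]) auto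
 have step: "W p (?g X \<sigma>) = (\<Sum>j<2 * Suc m. ?g (X(\<sigma> j := D (X (\<sigma> j)))) \<sigma> p)" if \<sigma>: "\<sigma> permutes {..<2 * Suc m}" for \<sigma>
 proof -
  have inj: "\<sigma> a = \<sigma> b \<longleftrightarrow> a = b" for a b using permutes_inj[OF \<sigma>] by (auto simp: inj_eq)
  let ?a = "%q. \<omega> q (X (\<sigma> 0) q) (X (\<sigma> 1) q)" and ?Z = "%i. X (\<sigma> (2 + i))"
  let ?b = "%q. wedge_power (\<omega> q) m (%i. ?Z i q)"
  have a: "?a \<in> C" and b: "?b \<in> C" and Z: "i < 2 * m ==> ?Z i \<in> V" for i
   using XV[OF \<sigma>] by (auto intro!: om_C wedge_power_smooth)
  have "W p (?g X \<sigma>) = of_int (sign \<sigma>) * (?a p * W p ?b + ?b p * W p ?a)"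
   using tangent_cmult[OF WT smooth_mult[OF a b]] tangent_mult[OF WT a b] by (simp add: mult.assoc)
  also have "W p ?b = (\<Sum>k<2 * m. wedge_power (\<omega> p) m (%i. (?Z(k := D (?Z k))) i p))"
   by (rule Suc.IH[OF Z])
  also have "W p ?a = \<omega> p (D (X (\<sigma> 0)) p) (X (\<sigma> 1) p) + \<omega> p (X (\<sigma> 0) p) (D (X (\<sigma> 1)) p)"
   by (rule om) (use XV[OF \<sigma>] in auto)
  also have "of_int (sign \<sigma>) * (?a p * (\<Sum>k<2 * m. wedge_power (\<omega> p) m (%i. (?Z(k := D (?Z k))) i p)) +
    ?b p * (\<omega> p (D (X (\<sigma> 0)) p) (X (\<sigma> 1) p) + \<omega> p (X (\<sigma> 0) p) (D (X (\<sigma> 1)) p))) =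
   ?g (X(\<sigma> 0 := D (X (\<sigma> 0)))) \<sigma> p + (?g (X(\<sigma> 1 := D (X (\<sigma> 1)))) \<sigma> p +
   (\<Sum>k<2 * m. ?g (X(\<sigma> (2 + k) := D (X (\<sigma> (2 + k))))) \<sigma> p))"
  proof -
   have "?g (X(\<sigma> (2 + k) := D (X (\<sigma> (2 + k))))) \<sigma> p = of_int (sign \<sigma>) * ?a p * wedge_power (\<omega> p) m (%i. (?Z(k := D (?Z k))) i p)" for k
   proof -
    have "(%i. (X(\<sigma> (2 + k) := D (X (\<sigma> (2 + k))))) (\<sigma> (2 + i)) p) = (%i. (?Z(k := D (?Z k))) i p)"
     using inj by (auto simp: fun_eq_iff)
    moreover have "\<sigma> 0 \<noteq> \<sigma> (2 + k)" "\<sigma> 1 \<noteq> \<sigma> (2 + k)" using inj[of 0 "2 + k"] inj[of 1 "2 + k"] by auto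
    ultimately show ?thesis by (simp only: fun_upd_other not_False_eq_True)
   qed
   moreover have "?g (X(\<sigma> j := D (X (\<sigma> j)))) \<sigma> p = of_int (sign \<sigma>) * \<omega> p ((X(\<sigma> j := D (X (\<sigma> j)))) (\<sigma> 0) p) ((X(\<sigma> j := D (X (\<sigma> j)))) (\<sigma> 1) p) * ?b p"
    if "j < 2" for j
   proof -
    have "(X(\<sigma> j := D (X (\<sigma> j)))) (\<sigma> (2 + i)) = X (\<sigma> (2 + i))" for i using that inj[of "2 + i" j] by auto
    then show ?thesis by simp
   qed
   from this[of 0] this[of 1] have "?g (X(\<sigma> 0 := D (X (\<sigma> 0)))) \<sigma> p = of_int (sign \<sigma>) * \<omega> p (D (X (\<sigma> 0)) p) (X (\<sigma> 1) p) * ?b p"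
    "?g (X(\<sigma> 1 := D (X (\<sigma> 1)))) \<sigma> p = of_int (sign \<sigma>) * \<omega> p (X (\<sigma> 0) p) (D (X (\<sigma> 1)) p) * ?b p"
    using inj[of 0 1] by simp_all
   ultimately show ?thesis by (simp only: sum_distrib_left[symmetric]) (simp add: algebra_simps)
  qed
  also have "... = (\<Sum>j<2 * Suc m. ?g (X(\<sigma> j := D (X (\<sigma> j)))) \<sigma> p)"
  proof -
   have "2 * Suc m = Suc (Suc (2 * m))" by simp
   then show ?thesis by (simp only: sum.lessThan_Suc_shift) simp
  qed
  finally show ?thesis .
 qed
 have "W p (%q. wedge_power (\<omega> q) (Suc m) (%i. X i q)) = W p (%q. 1 / (2 * fact (2 * m)) * (\<Sum>\<sigma>\<in>?P. ?g X \<sigma> q))"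
  unfolding wedge_power.simps wedge2_eq by simp
 also have "... = 1 / (2 * fact (2 * m)) * W p (%q. \<Sum>\<sigma>\<in>?P. ?g X \<sigma> q)"
  by (rule tangent_cmult[OF WT smooth_sum]) (rule gC, simp)
 also have "W p (%q. \<Sum>\<sigma>\<in>?P. ?g X \<sigma> q) = (\<Sum>\<sigma>\<in>?P. W p (?g X \<sigma>))"
  by (rule tangent_sum[OF WT]) (rule gC, simp)
 also have "(\<Sum>\<sigma>\<in>?P. W p (?g X \<sigma>)) = (\<Sum>\<sigma>\<in>?P. \<Sum>j<2 * Suc m. ?g (X(j := D (X j))) \<sigma> p)"
 proof (rule sum.cong[OF refl])
  fix \<sigma> assume "\<sigma> \<in> ?P"
  then have \<sigma>: "\<sigma> permutes {..<2 * Suc m}" by simp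
  show "W p (?g X \<sigma>) = (\<Sum>j<2 * Suc m. ?g (X(j := D (X j))) \<sigma> p)"
   unfolding step[OF \<sigma>] using sum.permute[OF \<sigma>, of "%j. ?g (X(j := D (X j))) \<sigma> p"] by (simp only: o_def)
 qed
 also have "... = (\<Sum>j<2 * Suc m. \<Sum>\<sigma>\<in>?P. ?g (X(j := D (X j))) \<sigma> p)" by (rule sum.swap)
 finally show ?case
  unfolding wedge_power.simps wedge2_eq by (simp only: sum_divide_distrib[symmetric]) simp
qed

end

context almost_kaehler
begin

lemma CC_om:
 assumes W: "W \<in> V" and X: "X \<in> V" and Y: "Y \<in> V" and p: "p \<in> M"
 shows "W p (%q. \<omega> q (X q) (Y q)) = \<omega> p (CC W X p) (Y p) + \<omega> p (X p) (CC W Y p)"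
proof -
 note f = con_field[OF CC_connection] JJ_field W X Y
 have om: "\<omega> q (U q) (Z q) = gp (JJ U) Z q" if "U \<in> V" "Z \<in> V" "q \<in> M" for U Z q
  using fun_cong[OF om_gp[OF that(1,2)], of q] that(3) by (simp add: pair_def)
 have "W p (%q. \<omega> q (X q) (Y q)) = W p (gp (JJ X) Y)"
  by (rule tangent_cong[OF p vfield_tangent[OF W] _ gp_smooth[OF JJ_field[OF X] Y]])
   (use \<omega>_tensor X Y om in \<open>auto simp: bilinear_tensor_def\<close>)
 also have "... = gp (CC W (JJ X)) Y p + gp (JJ X) (CC W Y) p"
  by (rule metric_connection_pair[OF conjunct1[OF CC_hermitian[unfolded hermitian_connection_def]] W JJ_field[OF X] Y p])
 finally show ?thesis by (simp add: CC_JJ f om p)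
qed

text \<open>The canonical and the Levi-Civita connection differ by \<open>J\<close> times the derivative of \<open>J\<close>, which is trace-free.\<close>

lemma divergence_CC:
 assumes W: "W \<in> V"
 shows "trace (%Y. LC Y W) p = trace (%Y. CC W Y - bracket W Y) p"
proof -
 have "trace (%Y. CC W Y - bracket W Y) p = trace (%Y. LC Y W - (%p. 1 / 2) *\<^sub>f JJ (DJ W Y)) p"
 proof (rule trace_cong)
  fix Y assume Y: "Y \<in> V"
  note f = con_field[OF LC] JJ_field W Y
  show "(CC W Y - bracket W Y) p = (LC Y W - (%p. 1 / 2) *\<^sub>f JJ (DJ W Y)) p"
   unfolding CC_eq[OF W Y] bracket_LC[OF W Y] endo_der_def
   by (simp add: JJ_simps JJ_JJ f vfield_diff vfield_fscale) (simp add: fun_eq_iff fscale_simps algebra_simps)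
 qed
 then show ?thesis by (simp add: trace_diff trace_fscale trace_JJ_DJ[OF W])
qed

end

context compact_manifold
begin

lemma coord_field_bracket:
 assumes c: "c \<in> A" and \<eta>: "!!x. coord_field c \<eta> x \<in> V" and N: "openin T N" "N \<subseteq> fst c" "!!q. q \<in> N ==> \<eta> q = 1" and p: "p \<in> N"
 shows "bracket (coord_field c \<eta> x) (coord_field c \<eta> y) p = 0"
proof
 fix f
 let ?X = "coord_field c \<eta>"
 have pM: "p \<in> M" using p N chart_subset[OF c] by blast
 have pc: "p \<in> fst c" using p N by blast
 show "bracket (?X x) (?X y) p f = 0 f"
 proof (cases "f \<in> C")
  case True
  let ?F = "%z. f (ic c z)" and ?W = "snd c ` (N \<inter> fst c)"
  have W: "open ?W" "snd c p \<in> ?W" using chart_image_open[OF N(1) c] p pc by auto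
  have val: "?X u q f = frechet_derivative ?F (at (snd c q)) u" if "q \<in> N" for u q
   using that N by (simp add: coord_field_def coord_vec_eq[OF True] tscale_def subset_iff)
  have "?X u p (%q. ?X v q f) = frechet_derivative (%z. frechet_derivative ?F (at z) v) (at (snd c p)) u" for u v
  proof -
   have sm: "smooth_on (%z. frechet_derivative ?F (at z) v) (snd c ` fst c)"
    by (rule smooth_on_derivative(2)[OF chart_open[OF c] smooth_in_chart[OF True c]])
   have "?X u p (%q. ?X v q f) = coord_vec A c p u (%q. ?X v q f)"
    using p pc N(3) by (simp add: coord_field_def tscale_def)
   also have "... = frechet_derivative (%z. frechet_derivative ?F (at z) v) (at (snd c p)) u"
   proof (rule coord_vecI[OF c pc vfield_smooth[OF \<eta> True]])
    have "((%z. frechet_derivative ?F (at z) v) has_derivative frechet_derivative (%z. frechet_derivative ?F (at z) v) (at (snd c p))) (at (snd c p))"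
     by (rule smooth_on_derivative(1)[OF chart_open[OF c] sm]) (use pc in blast)
    then show "((%z. ?X v (ic c z) f) has_derivative frechet_derivative (%z. frechet_derivative ?F (at z) v) (at (snd c p))) (at (snd c p))"
     by (rule has_derivative_transform_within_open[OF _ W]) (use c val in auto)
   qed
   finally show ?thesis .
  qed
  then show ?thesis
   using symmetric_second_derivative[OF fin chart_open[OF c] _ smooth_in_chart[OF True c], of "snd c p" x y] pc
   by (simp add: bracket_def)
 next
  case False
  then show ?thesis using tangent_nonsmooth[OF vfield_tangent[OF vfield_bracket[OF \<eta> \<eta>]] False] by simp
 qed
qed

text \<open>The generators are expanded in the basis \<open>X j p\<close>, whose dual basis is given by the functionals \<open>d j\<close>.\<close>

lemma trace_coord:
 fixes b :: "nat => 'e"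
 assumes S: "tensor_endo S" and p: "p \<in> M" and c: "c \<in> A" "p \<in> fst c"
  and X: "!!j. j < N ==> X j \<in> V" "!!j. j < N ==> X j p = coord_vec A c p (b j)"
  and b: "!!z. z = (\<Sum>j<N. (d j z) *\<^sub>R b j)" and d: "!!j. linear (d j :: 'e => real)"
  and y: "!!j. j < N ==> S (X j) p = coord_vec A c p (y j)"
 shows "trace S p = (\<Sum>j<N. d j (y j))"
proof -
 have "\<forall>k\<in>gen_index. \<exists>z. E k p = coord_vec A c p z"
  using tangent_is_coord_vec[OF c vfield_tangent[OF gen_field]] by metis
 then obtain z where z: "!!k. k \<in> gen_index ==> E k p = coord_vec A c p (z k)" by metis
 have y': "y j = (\<Sum>k\<in>gen_index. S (X j) p (\<beta> k) *\<^sub>R z k)" if j: "j < N" for j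
 proof (rule coord_vec_inj[OF c])
  have "coord_vec A c p (y j) = (\<Sum>k\<in>gen_index. S (X j) p (\<beta> k) *\<^sub>t E k p)"
   using tangent_gen[OF p vfield_tangent[OF tensor_endo_field[OF S X(1)[OF j]]]] y[OF j] by simp
  then show "coord_vec A c p (y j) = coord_vec A c p (\<Sum>k\<in>gen_index. S (X j) p (\<beta> k) *\<^sub>R z k)"
   unfolding coord_vec_sum[OF c] using z by simp
 qed
 have SE: "S (E k) p f = (\<Sum>j<N. d j (z k) * S (X j) p f)" if k: "k \<in> gen_index" for k f
 proof -
  let ?Y = "\<Sum>j<N. (%p. d j (z k)) *\<^sub>f X j"
  have Y: "?Y \<in> V" by (intro vfield_sum vfield_fscale smooth_const X) simp
  have "E k p = (\<Sum>j<N. d j (z k) *\<^sub>t coord_vec A c p (b j))"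
   unfolding z[OF k] coord_vec_sum[OF c, symmetric] using b[of "z k"] by simp
  also have "... = ?Y p" unfolding sum_fun_apply using X(2) by (simp add: fscale_def)
  finally have "S (E k) p = S ?Y p" by (rule tensor_endo_at[OF S gen_field[OF k] Y])
  also have "S ?Y = (\<Sum>j<N. (%p. d j (z k)) *\<^sub>f S (X j))"
   using tensor_endo_sum[OF S, of "{..<N}" "%j. (%p. d j (z k)) *\<^sub>f X j"] X(1)
   by (simp add: tensor_endo_fscale[OF S] vfield_fscale)
  finally show ?thesis by (simp add: sum_vfield_apply fscale_simps)
 qed
 have "trace S p = (\<Sum>k\<in>gen_index. \<Sum>j<N. d j (z k) * S (X j) p (\<beta> k))"
  unfolding trace_def by (rule sum.cong[OF refl]) (rule SE)
 also have "... = (\<Sum>j<N. \<Sum>k\<in>gen_index. S (X j) p (\<beta> k) * d j (z k))"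
  by (subst sum.swap) (simp only: mult.commute)
 also have "... = (\<Sum>j<N. d j (y j))"
  by (rule sum.cong[OF refl]) (simp add: y' linear_sum[OF d] linear_cmul[OF d])
 finally show ?thesis .
qed

end


lemma basis_enum_expand: "z = (\<Sum>j<DIM('e). (z \<bullet> basis_enum j) *\<^sub>R basis_enum j)" for z :: "'e::euclidean_space"
 using sum.reindex_bij_betw[OF basis_enum[where 'e='e], of "%b. (z \<bullet> b) *\<^sub>R b"] by (simp add: euclidean_representation)

context almost_kaehler
begin

lemma top_form_\<omega>: "p \<in> M ==> top_form (2 * n) (TM p) (wedge_power (\<omega> p) n)"
 by (rule wedge_power_top_form[OF \<omega>_tensor])

abbreviation "coord_basis c p \<equiv> %j. coord_vec A c p (basis_enum j)"

lemma top_coord_nonzero: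
 assumes c: "c \<in> A" "p \<in> fst c"
 shows "wedge_power (\<omega> p) n (coord_basis c p) \<noteq> 0"
proof
 assume zero: "wedge_power (\<omega> p) n (coord_basis c p) = 0"
 have p: "p \<in> M" using c chart_subset by blast
 let ?e = "%i. some_frame A g J p i p"
 note e = vfield_tangent[OF some_frame_field[OF p]]
 have "\<forall>i<2 * n. \<exists>y. ?e i = coord_vec A c p y"
  using tangent_is_coord_vec[OF c e] dim_2n by metis
 then obtain y where y: "!!i. i < 2 * n ==> ?e i = coord_vec A c p (y i)" by metis
 have X: "?e i = (\<Sum>k<2 * n. (y i \<bullet> basis_enum k) *\<^sub>t coord_basis c p k) \<and> ?e i \<in> TM p" if "i < 2 * n" for i
 proof
  show "?e i \<in> TM p" by (rule e) (simp add: that dim_2n)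
  show "?e i = (\<Sum>k<2 * n. (y i \<bullet> basis_enum k) *\<^sub>t coord_basis c p k)"
   using y[OF that] basis_enum_expand[of "y i"] coord_vec_sum[OF c, of "%k. y i \<bullet> basis_enum k" basis_enum "{..<2 * n}"]
   by (simp add: dim_2n)
 qed
 have "wedge_power (\<omega> p) n ?e = 0"
  using top_form_expand[OF top_form_\<omega>[OF p] coord_vec_tangent[OF c] X] zero by simp
 moreover obtain m where "n = Suc m" using n_pos by (cases n) auto
 ultimately show False
  using wedge2_adapted(2)[where \<omega> = "\<omega> p" and e = "?e" and m = m and \<beta> = "%_ _. 0"] frame_standard[OF p] by simp
qed

lemma divergence_fscale:
 assumes h: "h \<in> C" and W: "W \<in> V"
 shows "trace (%Z. LC Z (h *\<^sub>f W)) p = W p h + h p * trace (%Z. LC Z W) p"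
proof -
 have "trace (%Z. LC Z (h *\<^sub>f W)) p = trace (%Z. (%p. Z p h) *\<^sub>f W + h *\<^sub>f LC Z W) p"
  by (rule trace_cong) (simp add: con_fscale2[OF LC] W h)
 also have "... = (\<Sum>k\<in>gen_index. E k p h * W p (\<beta> k)) + h p * trace (%Z. LC Z W) p"
  unfolding trace_add trace_fscale by (simp add: trace_def fscale_simps)
 also have "(\<Sum>k\<in>gen_index. E k p h * W p (\<beta> k)) = W p h"
  unfolding field_gen_fun[OF W, of p h] by (simp only: mult.commute)
 finally show ?thesis .
qed

text \<open>The Lie derivative of \<open>h \<omega>\<^sup>n\<close> along a coordinate field \<open>W\<close>, evaluated on the coordinate fields. These
 commute with \<open>W\<close> and \<open>\<omega>\<^sup>n\<close> is parallel for the canonical connection \<open>\<nabla>\<close>, so the derivative of the coefficient is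
 the trace of \<open>\<nabla>\<^sub>W - L\<^sub>W\<close>, which is the divergence of \<open>W\<close>.\<close>

lemma divergence_top:
 assumes c: "c \<in> A" and \<eta>: "!!x. coord_field c \<eta> x \<in> V" and N: "openin T N" "N \<subseteq> fst c" "!!q. q \<in> N ==> \<eta> q = 1"
  and p: "p \<in> N" and h: "h \<in> C"
 shows "trace (%Z. LC Z (h *\<^sub>f coord_field c \<eta> x)) p * om_top (%i. coord_field c \<eta> (basis_enum i)) p =
  coord_field c \<eta> x p (%q. h q * om_top (%i. coord_field c \<eta> (basis_enum i)) q)"
proof -
 have pc: "p \<in> fst c" using p N by blast
 have pM: "p \<in> M" using pc chart_subset[OF c] by blast
 let ?W = "coord_field c \<eta> x" and ?X = "%i. coord_field c \<eta> (basis_enum i)"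
 define S where "S Y = CC ?W Y - bracket ?W Y" for Y
 have S: "tensor_endo S" unfolding S_def[abs_def] by (rule lie_difference_endo[OF CC_connection \<eta>])
 have Xp: "?X j p = coord_vec A c p (basis_enum j)" for j
  using p pc N(3) by (simp add: coord_field_def tscale_def)
 have SX: "S (?X j) p = CC ?W (?X j) p" for j
  using coord_field_bracket[where \<eta> = \<eta>, OF c \<eta> N p] by (simp add: S_def)
 have "\<exists>y. S (?X j) p = coord_vec A c p y" for j
  by (rule tangent_is_coord_vec[OF c pc vfield_tangent[OF tensor_endo_field[OF S \<eta>]]]) (rule exI)
 then obtain y where y: "!!j. S (?X j) p = coord_vec A c p (y j)" by metis
 have lin: "linear (%z::'e. z \<bullet> basis_enum j)" for j by (simp add: linear_iff inner_left_distrib)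
 have 1: "trace S p = (\<Sum>j<2 * n. y j \<bullet> basis_enum j)"
 proof (rule trace_coord[OF S pM c pc, where X = ?X and b = basis_enum and N = "2 * n" and y = y and d = "%j z. z \<bullet> basis_enum j"])
  show "z = (\<Sum>j<2 * n. (z \<bullet> basis_enum j) *\<^sub>R basis_enum j)" for z :: 'e
   using basis_enum_expand[of z] by (simp only: dim_2n)
 qed (rule \<eta> Xp lin y)+
 have 2: "wedge_power (\<omega> p) n (%i. (?X(j := CC ?W (?X j))) i p) = (y j \<bullet> basis_enum j) * om_top ?X p" if j: "j < 2 * n" for j
 proof -
  let ?v = "%i. ?X i p"
  have "(%i. (?X(j := CC ?W (?X j))) i p) = ?v(j := (\<Sum>k<2 * n. (y j \<bullet> basis_enum k) *\<^sub>t ?v k))"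
  proof -
   have "CC ?W (?X j) p = (\<Sum>k<2 * n. (y j \<bullet> basis_enum k) *\<^sub>t ?v k)"
    unfolding SX[symmetric] y Xp using basis_enum_expand[of "y j"]
     coord_vec_sum[OF c pc, of "%k. y j \<bullet> basis_enum k" basis_enum "{..<2 * n}"] by (simp add: dim_2n)
   then show ?thesis by (auto simp: fun_eq_iff)
  qed
  then have "wedge_power (\<omega> p) n (%i. (?X(j := CC ?W (?X j))) i p) =
    (\<Sum>k<2 * n. (y j \<bullet> basis_enum k) * wedge_power (\<omega> p) n (?v(j := ?v k)))"
   using top_form_linear[OF top_form_\<omega>[OF pM], of j ?v "{..<2 * n}" ?v "%k. y j \<bullet> basis_enum k"] vfield_tangent[OF \<eta>] j by simp
  also have "... = (\<Sum>k<2 * n. if k = j then (y j \<bullet> basis_enum j) * om_top ?X p else 0)"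
  proof (rule sum.cong[OF refl])
   fix k assume k: "k \<in> {..<2 * n}"
   show "(y j \<bullet> basis_enum k) * wedge_power (\<omega> p) n (?v(j := ?v k)) = (if k = j then (y j \<bullet> basis_enum j) * om_top ?X p else 0)"
    using top_form_repeat[OF top_form_\<omega>[OF pM], of j k "?v(j := ?v k)"] j k by (auto simp: fun_upd_idem)
  qed
  finally show ?thesis using j by simp
 qed
 have XV: "?X i \<in> V" for i by (rule \<eta>)
 have tr: "?W p (om_top ?X) = trace S p * om_top ?X p"
 proof -
  have "?W p (om_top ?X) = (\<Sum>j<2 * n. wedge_power (\<omega> p) n (%i. (?X(j := CC ?W (?X j))) i p))"
   by (rule wedge_power_derivation[OF \<eta> pM, where D = "CC ?W"])
    (assumption | rule con_field[OF CC_connection \<eta>] CC_om[OF \<eta> _ _ pM] XV)+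
  then show ?thesis using 1 2 by (simp add: sum_distrib_right)
 qed
 have topC: "om_top ?X \<in> C" by (rule wedge_power_smooth[OF XV])
 show ?thesis
  unfolding divergence_fscale[OF h \<eta>] tangent_mult[OF vfield_tangent[OF \<eta>] h topC] tr
  by (simp add: divergence_CC[OF \<eta>] S_def[abs_def] algebra_simps)
qed

end

section \<open>The Liouville integral\<close>

context compact_manifold
begin

definition supported :: "'m set \<times> ('m => 'e) => ('m => real) => bool" where
 "supported c u \<longleftrightarrow> c \<in> A \<and> u \<in> C \<and> T closure_of {p \<in> M. u p \<noteq> 0} \<subseteq> fst c"

lemma supported_mono:
 assumes u: "supported c u" and v: "v \<in> C" "!!p. p \<in> M ==> u p = 0 ==> v p = 0"
 shows "supported c v"
proof -
 have "T closure_of {p \<in> M. v p \<noteq> 0} \<subseteq> T closure_of {p \<in> M. u p \<noteq> 0}"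
  by (rule closure_of_mono) (use v(2) in auto)
 then show ?thesis using u v(1) unfolding supported_def by blast
qed

lemma supported_zero: "supported c u ==> p \<in> M ==> p \<notin> fst c ==> u p = 0"
 using closure_of_subset[of "{p \<in> M. u p \<noteq> 0}" T] unfolding supported_def topspace_eq by blast

lemma chart_compact:
 assumes c: "c \<in> A" and L: "closedin T L" "L \<subseteq> fst c"
 shows "compact (snd c ` L)"
proof -
 have "compactin (subtopology T (fst c)) L"
  using closedin_compact_space[OF compact L(1)] L(2) by (simp add: compactin_subtopology)
 moreover have "continuous_map (subtopology T (fst c)) euclidean (snd c)"
 proof -
  have "openin (subtopology T (fst c)) {x \<in> topspace (subtopology T (fst c)). snd c x \<in> U}" if "open U" for U :: "'e set"
  proof -
   have "{x \<in> topspace (subtopology T (fst c)). snd c x \<in> U} = {p \<in> fst c. snd c p \<in> U}"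
    using chart_subset[OF c] by (auto simp: topspace_eq)
   then show ?thesis
    using openin_chart_vimage[OF c that] unfolding openin_subtopology by (intro exI[of _ "{p \<in> fst c. snd c p \<in> U}"]) auto
  qed
  then show ?thesis unfolding continuous_map_def by simp
 qed
 ultimately have "compactin euclidean (snd c ` L)" by (rule image_compactin)
 then show ?thesis by simp
qed

lemma supported_compact:
 assumes u: "supported c u"
 obtains K where "compact K" "K \<subseteq> snd c ` fst c" "!!x. x \<in> snd c ` fst c ==> x \<notin> K ==> u (ic c x) = 0"
proof -
 let ?L = "T closure_of {p \<in> M. u p \<noteq> 0}"
 have c: "c \<in> A" and L: "?L \<subseteq> fst c" using u by (auto simp: supported_def)
 show ?thesis
 proof (rule that[of "snd c ` ?L"])
  show "compact (snd c ` ?L)" by (rule chart_compact[OF c closedin_closure_of L])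
  show "snd c ` ?L \<subseteq> snd c ` fst c" using L by blast
  fix x assume x: "x \<in> snd c ` fst c" "x \<notin> snd c ` ?L"
  have "ic c x \<notin> ?L"
  proof
   assume "ic c x \<in> ?L"
   then have "snd c (ic c x) \<in> snd c ` ?L" by (rule imageI)
   then show False using x chart_ic[OF x(1)] by simp
  qed
  moreover have "{p \<in> M. u p \<noteq> 0} \<subseteq> ?L" by (rule closure_of_subset) (auto simp: topspace_eq)
  moreover have "ic c x \<in> M" using ic_in[OF x(1)] chart_subset[OF c] by blast
  ultimately show "u (ic c x) = 0" by blast
 qed
qed

lemma coord_vec_change:
 assumes c: "c \<in> A" "p \<in> fst c" and d: "d \<in> A" "p \<in> fst d"
  and \<phi>: "((%x. snd d (ic c x)) has_derivative \<phi>) (at (snd c p))"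
 shows "coord_vec A c p v = coord_vec A d p (\<phi> v)"
proof
 fix f
 show "coord_vec A c p v f = coord_vec A d p (\<phi> v) f"
 proof (cases "f \<in> C")
  case True
  show ?thesis
  proof (rule coord_vecI[OF c True])
   have "((%y. f (ic d y)) has_derivative (%b. coord_vec A d p b f)) (at (snd d (ic c (snd c p))))"
    using chart_derivative[OF d True] c by simp
   from has_derivative_compose[OF \<phi> this]
   have "((%x. f (ic d (snd d (ic c x)))) has_derivative (%v. coord_vec A d p (\<phi> v) f)) (at (snd c p))" .
   then show "((%x. f (ic c x)) has_derivative (%v. coord_vec A d p (\<phi> v) f)) (at (snd c p))"
    by (rule has_derivative_transform_within_open[OF _ transition(1)[OF c(1) d(1)]]) (use c d in auto)
  qed
 qed (simp add: coord_vec_def)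
qed

end

context almost_kaehler
begin

text \<open>The Liouville density in a chart; the absolute value allows charts of either orientation.\<close>

definition dens :: "'m set \<times> ('m => 'e) => 'm => real" where
 "dens c p = \<bar>wedge_power (\<omega> p) n (coord_basis c p)\<bar>"

definition chart_int :: "'m set \<times> ('m => 'e) => ('m => real) => real" where
 "chart_int c u = (LINT x:snd c ` fst c|lborel. u (ic c x) * dens c (ic c x))"

text \<open>Extended by zero, the integrand becomes continuous on the whole space when \<open>u\<close> is supported in the chart.\<close>

definition chart_fun :: "'m set \<times> ('m => 'e) => ('m => real) => 'e => real" where
 "chart_fun c u x = (if x \<in> snd c ` fst c then u (ic c x) * dens c (ic c x) else 0)"

lemma dens_pos: "c \<in> A ==> p \<in> fst c ==> dens c p > 0"
 using top_coord_nonzero by (simp add: dens_def)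

lemma coord_frame:
 assumes c: "c \<in> A" "p \<in> fst c"
 obtains X N where "!!i. X i \<in> V" "openin T N" "p \<in> N" "N \<subseteq> fst c" "!!q i. q \<in> N ==> X i q = coord_basis c q i"
proof -
 obtain \<eta> N where \<eta>: "!!b. coord_cutoff c \<eta> b \<in> C" "\<eta> \<in> C" "openin T N" "p \<in> N" "N \<subseteq> fst c" "!!q. q \<in> N ==> \<eta> q = 1"
  "!!h. smooth_on h (snd c ` fst c) ==> (%q. if q \<in> fst c then \<eta> q * h (snd c q) else 0) \<in> C"
  by (rule coord_cutoff_at[OF c]) (rule that)
 show ?thesis
  by (rule that[of "%i. coord_field c \<eta> (basis_enum i)" N])
   (use coord_field[OF c(1) \<eta>(7)] \<eta>(3-6) in \<open>auto simp: coord_field_def tscale_def\<close>)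
qed

lemma continuous_dens:
 assumes c: "c \<in> A"
 shows "continuous_on (snd c ` fst c) (%x. dens c (ic c x))"
 unfolding continuous_on_eq_continuous_at[OF chart_open[OF c]]
proof
 fix x assume "x \<in> snd c ` fst c"
 then obtain p where p: "p \<in> fst c" "x = snd c p" by blast
 obtain X N where X: "!!i. X i \<in> V" "openin T N" "p \<in> N" "N \<subseteq> fst c" "!!q i. q \<in> N ==> X i q = coord_basis c q i"
  by (rule coord_frame[OF c p(1)]) (rule that)
 let ?W = "snd c ` (N \<inter> fst c)"
 have W: "open ?W" "x \<in> ?W" using chart_image_open[OF X(2) c] X(3) p by auto
 have "continuous_on (snd c ` fst c) (%x. om_top X (ic c x))"
  by (rule smooth_on_continuous[OF smooth_in_chart[OF wedge_power_smooth[OF X(1)] c]])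
 then have cont: "isCont (%x. \<bar>om_top X (ic c x)\<bar>) x"
  using p by (simp add: continuous_on_eq_continuous_at chart_open[OF c] isCont_rabs)
 have "\<forall>\<^sub>F y in nhds x. dens c (ic c y) = \<bar>om_top X (ic c y)\<bar>"
  unfolding eventually_nhds using W X(5) c by (intro exI[of _ ?W]) (auto simp: dens_def)
 from isCont_cong[OF this] cont show "isCont (%x. dens c (ic c x)) x" by (rule iffD2)
qed

lemma chart_fun:
 assumes u: "supported c u"
 shows "continuous_on UNIV (chart_fun c u)" "integrable lborel (chart_fun c u)"
  "chart_int c u = (LINT x|lborel. chart_fun c u x)"
proof -
 have c: "c \<in> A" and uC: "u \<in> C" using u by (auto simp: supported_def)
 obtain K where K: "compact K" "K \<subseteq> snd c ` fst c" "!!x. x \<in> snd c ` fst c ==> x \<notin> K ==> u (ic c x) = 0"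
  by (rule supported_compact[OF u]) (rule that)
 have "continuous_on (snd c ` fst c) (%x. u (ic c x) * dens c (ic c x))"
  by (intro continuous_on_mult continuous_dens c smooth_on_continuous[OF smooth_in_chart[OF uC c]])
 then have 1: "continuous_on (snd c ` fst c) (chart_fun c u)"
  by (rule continuous_on_cong[THEN iffD1, OF refl, rotated]) (simp add: chart_fun_def)
 have 2: "continuous_on (- K) (chart_fun c u)"
  by (rule continuous_on_cong[THEN iffD1, OF refl _ continuous_on_const[of _ 0]]) (simp add: chart_fun_def K(3))
 have "snd c ` fst c \<union> - K = UNIV" using K(2) by blast
 then show cont: "continuous_on UNIV (chart_fun c u)"
  using continuous_on_open_Un[OF chart_open[OF c] _ 1 2] compact_imp_closed[OF K(1)] by (simp add: open_Compl)
 show "integrable lborel (chart_fun c u)"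
  by (rule integrable_compact_support[OF cont K(1)]) (simp add: chart_fun_def K(3))
 show "chart_int c u = (LINT x|lborel. chart_fun c u x)"
  unfolding chart_int_def set_lebesgue_integral_def
  by (rule Bochner_Integration.integral_cong[OF refl]) (simp add: chart_fun_def)
qed

text \<open>The coordinate fields of two charts are related by the derivative of the transition map, and a top form
 scales by its determinant.\<close>

lemma dens_change:
 assumes c: "c \<in> A" "p \<in> fst c" and d: "d \<in> A" "p \<in> fst d"
  and \<phi>: "((%x. snd d (ic c x)) has_derivative \<phi>) (at (snd c p))"
 shows "dens c p = \<bar>jacobian \<phi>\<bar> * dens d p"
proof -
 have p: "p \<in> M" using c chart_subset by blast
 define b where "b i = Abs_basis_index (basis_enum i :: 'e)" for i
 have Rb: "i < 2 * n ==> Rep_basis_index (b i) = basis_enum i" for i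
  using bij_betwE[OF basis_enum[where 'e='e]] by (simp add: b_def Abs_basis_index_inverse dim_2n)
 have b: "bij_betw b {..<2 * n} UNIV"
 proof -
  have "bij_betw (Abs_basis_index :: 'e => _) Basis UNIV"
   by (rule bij_betw_byWitness[where f' = Rep_basis_index]) (auto simp: Rep_basis_index_inverse Abs_basis_index_inverse Rep_basis_index)
  from bij_betw_trans[OF basis_enum this] show ?thesis by (simp add: b_def[abs_def] o_def dim_2n)
 qed
 let ?a = "\<chi> i j. \<phi> (Rep_basis_index i) \<bullet> (Rep_basis_index j :: 'e)"
 have "coord_basis c p i = (\<Sum>k<2 * n. ?a $ b i $ b k *\<^sub>t coord_basis d p k)" if i: "i < 2 * n" for i
 proof -
  have "coord_basis c p i = coord_vec A d p (\<Sum>k<2 * n. (\<phi> (basis_enum i) \<bullet> basis_enum k) *\<^sub>R basis_enum k)"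
   unfolding coord_vec_change[OF c d \<phi>] using basis_enum_expand[of "\<phi> (basis_enum i)"] by (simp add: dim_2n)
  also have "... = (\<Sum>k<2 * n. ?a $ b i $ b k *\<^sub>t coord_basis d p k)"
   unfolding coord_vec_sum[OF d] by (rule sum.cong[OF refl]) (simp add: Rb i)
  finally show ?thesis .
 qed
 then have X: "coord_basis c p i = (\<Sum>k<2 * n. ?a $ b i $ b k *\<^sub>t coord_basis d p k) \<and> coord_basis c p i \<in> TM p"
  if "i < 2 * n" for i using that coord_vec_tangent[OF c] by blast
 have "wedge_power (\<omega> p) n (coord_basis c p) = det ?a * wedge_power (\<omega> p) n (coord_basis d p)"
  by (rule top_form_det[OF top_form_\<omega>[OF p] coord_vec_tangent[OF d] b X])
 then show ?thesis by (simp add: dens_def jacobian_def abs_mult)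
qed

lemma chart_int_change:
 assumes uc: "supported c u" and ud: "supported d u"
 shows "chart_int c u = chart_int d u"
proof -
 have c: "c \<in> A" and d: "d \<in> A" using uc ud by (auto simp: supported_def)
 let ?S = "snd c ` (fst c \<inter> fst d)" and ?T = "snd d ` (fst c \<inter> fst d)"
 let ?\<phi> = "%x. snd d (ic c x)" and ?\<psi> = "%y. snd c (ic d y)"
 have S: "open ?S" and T: "open ?T" using transition(1)[OF c d] transition(1)[OF d c] by (simp_all add: Int_commute)
 have \<phi>: "(?\<phi> has_derivative frechet_derivative ?\<phi> (at x)) (at x)" if "x \<in> ?S" for x
  using smooth_on_derivative(1)[OF transition[OF c d] that] by (simp add: o_def)
 have \<psi>: "(?\<psi> has_derivative frechet_derivative ?\<psi> (at y)) (at y)" if "y \<in> ?T" for y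
  using smooth_on_derivative(1)[OF transition[OF d c], of y] that by (simp add: o_def Int_commute)
 have res: "chart_fun e u = (%x. indicator (snd e ` (fst c \<inter> fst d)) x *\<^sub>R (u (ic e x) * dens e (ic e x)))"
  if e: "e = c \<or> e = d" for e
 proof
  fix x
  have eA: "e \<in> A" and sub: "fst c \<inter> fst d \<subseteq> fst e" using e c d by auto
  show "chart_fun e u x = indicator (snd e ` (fst c \<inter> fst d)) x *\<^sub>R (u (ic e x) * dens e (ic e x))"
  proof (cases "x \<in> snd e ` fst e \<and> x \<notin> snd e ` (fst c \<inter> fst d)")
   case True
   then have ic: "ic e x \<in> fst e" "ic e x \<notin> fst c \<inter> fst d" using chart_ic[of x e] ic_in[of x e] by (metis, metis imageI)
   then have "u (ic e x) = 0"
    using supported_zero[OF uc, of "ic e x"] supported_zero[OF ud, of "ic e x"] chart_subset[OF eA] by blast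
   then show ?thesis by (simp add: chart_fun_def)
  next
   case False
   then show ?thesis using sub by (auto simp: chart_fun_def indicator_def)
  qed
 qed
 have int: "set_integrable lborel (snd e ` (fst c \<inter> fst d)) (%x. u (ic e x) * dens e (ic e x))"
  "chart_int e u = (LINT x:snd e ` (fst c \<inter> fst d)|lborel. u (ic e x) * dens e (ic e x))"
  if e: "e = c \<or> e = d" for e
 proof -
  have s: "supported e u" using e uc ud by blast
  show "set_integrable lborel (snd e ` (fst c \<inter> fst d)) (%x. u (ic e x) * dens e (ic e x))"
   using chart_fun(2)[OF s] unfolding res[OF e] by (simp only: set_integrable_def)
  show "chart_int e u = (LINT x:snd e ` (fst c \<inter> fst d)|lborel. u (ic e x) * dens e (ic e x))"
   using chart_fun(3)[OF s] unfolding res[OF e] by (simp only: set_lebesgue_integral_def)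
 qed
 have cv: "\<bar>jacobian (frechet_derivative ?\<phi> (at x))\<bar> * (u (ic d (?\<phi> x)) * dens d (ic d (?\<phi> x))) = u (ic c x) * dens c (ic c x)"
  if "x \<in> ?S" for x
 proof -
  obtain p where p: "p \<in> fst c" "p \<in> fst d" "x = snd c p" using \<open>x \<in> ?S\<close> by blast
  show ?thesis using dens_change[OF c p(1) d p(2) \<phi>[OF \<open>x \<in> ?S\<close>, unfolded p(3)]] p c d by simp
 qed
 have "(LINT y:?T|lborel. u (ic d y) * dens d (ic d y)) =
   (LINT x:?S|lborel. \<bar>jacobian (frechet_derivative ?\<phi> (at x))\<bar> * (u (ic d (?\<phi> x)) * dens d (ic d (?\<phi> x))))"
 proof (rule change_of_variables[where \<psi> = ?\<psi> and \<psi>' = "%y. frechet_derivative ?\<psi> (at y)"])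
  show "set_integrable lborel ?S (%x. \<bar>jacobian (frechet_derivative ?\<phi> (at x))\<bar> * (u (ic d (?\<phi> x)) * dens d (ic d (?\<phi> x))))"
   by (rule iffD2[OF set_integrable_cong[OF refl refl cv]]) (simp, rule int(1)[of c, simplified])
 qed (use \<phi> \<psi> T int(1)[of d] c d in auto)
 also have "... = (LINT x:?S|lborel. u (ic c x) * dens c (ic c x))"
  unfolding set_lebesgue_integral_def
  by (rule Bochner_Integration.integral_cong[OF refl]) (simp add: indicator_def cv)
 finally show ?thesis using int(2)[of c] int(2)[of d] by simp
qed

text \<open>In the coordinates of \<open>c\<close> the divergence of \<open>h \<partial>\<^sub>b\<close> against the Liouville density is the partial derivative
 of a compactly supported function, so it integrates to 0.\<close>

lemma chart_int_divergence:
 assumes c: "c \<in> A" and \<eta>: "!!x. coord_field c \<eta> x \<in> V" and N: "openin T N" "N \<subseteq> fst c" "!!q. q \<in> N ==> \<eta> q = 1"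
  and h: "h \<in> C" "T closure_of {q \<in> M. h q \<noteq> 0} \<subseteq> N"
 defines "u b \<equiv> trace (%Z. LC Z (h *\<^sub>f coord_field c \<eta> b))"
 shows "supported c (u b)" and "chart_int c (u b) = 0"
proof -
 let ?L = "T closure_of {q \<in> M. h q \<noteq> 0}" and ?X = "%i. coord_field c \<eta> (basis_enum i)"
 have L: "?L \<subseteq> fst c" using h(2) N(2) by blast
 have hs: "supported c h" using c h(1) L by (simp add: supported_def)
 have sub: "{q \<in> M. h q \<noteq> 0} \<subseteq> ?L" by (rule closure_of_subset) (auto simp: topspace_eq)
 have uC: "u b \<in> C" for b
  unfolding u_def by (rule trace_smooth[OF con_endo1[OF LC vfield_fscale[OF h(1) \<eta>]]])
 have u0: "u b p = 0" if p: "p \<in> M" "p \<notin> ?L" for b p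
 proof -
  have "openin T (M - ?L)"
   using closedin_closure_of[of T "{q \<in> M. h q \<noteq> 0}"] unfolding closedin_def topspace_eq by (rule conjunct2)
  then have "coord_field c \<eta> b p h = coord_field c \<eta> b p (%q. 0)"
   by (rule tangent_local[OF vfield_tangent[OF \<eta>] h(1) smooth_const]) (use p sub in auto)
  moreover have "h p = 0" using p sub by blast
  ultimately show ?thesis
   unfolding u_def divergence_fscale[OF h(1) \<eta>] using tangent_const[OF vfield_tangent[OF \<eta>]] by simp
 qed
 have "T closure_of {q \<in> M. u b q \<noteq> 0} \<subseteq> ?L" for b
  by (rule closure_of_minimal[OF _ closedin_closure_of]) (use u0 in blast)
 then show us: "supported c (u b)" for b using c uC L by (auto simp: supported_def)
 have K: "compact (snd c ` ?L)" by (rule chart_compact[OF c closedin_closure_of L])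
 have off: "chart_fun c v x = 0" if "!!p. p \<in> M ==> p \<notin> ?L ==> v p = 0" "x \<notin> snd c ` ?L" for v x
 proof (cases "x \<in> snd c ` fst c")
  case True
  then obtain p where p: "p \<in> fst c" "x = snd c p" by blast
  then have "p \<notin> ?L" using that(2) by blast
  then show ?thesis using p that(1)[of p] c chart_subset[OF c] by (auto simp: chart_fun_def)
 qed (simp add: chart_fun_def)
 have der: "(chart_fun c h has_derivative (%v. chart_fun c (u v) x)) (at x)" for x
 proof (cases "x \<in> snd c ` N")
  case True
  then obtain p where p: "p \<in> N" "x = snd c p" by blast
  have pc: "p \<in> fst c" using p N by blast
  \<comment> \<open>near \<open>p\<close> the density is a constant sign times a smooth function\<close>
  let ?F = "om_top ?X" and ?s = "sgn (om_top ?X p)"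
  have FC: "?F \<in> C" by (rule wedge_power_smooth[OF \<eta>])
  have dF: "dens c q = \<bar>?F q\<bar>" if "q \<in> N" for q
   using that N by (simp add: dens_def coord_field_def tscale_def subset_iff)
  have F0: "?F p \<noteq> 0" using dens_pos[OF c pc] dF[OF p(1)] by simp
  let ?W = "snd c ` (N \<inter> {q \<in> M. 0 < ?s * ?F q} \<inter> fst c)"
  have W: "open ?W" by (intro chart_image_open[OF _ c] openin_Int N(1) openin_less smooth_cmult FC)
  have xW: "x \<in> ?W" using p pc F0 chart_subset[OF c] by (auto simp: sgn_if)
  have "((%y. h (ic c y) * ?F (ic c y)) has_derivative (%v. coord_vec A c p v (%q. h q * ?F q))) (at x)"
   using chart_derivative[OF c pc smooth_mult[OF h(1) FC]] p by simp
  then have "((%y. ?s * (h (ic c y) * ?F (ic c y))) has_derivative (%v. ?s * coord_vec A c p v (%q. h q * ?F q))) (at x)"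
   by (rule has_derivative_mult_right)
  then have "(chart_fun c h has_derivative (%v. ?s * coord_vec A c p v (%q. h q * ?F q))) (at x)"
  proof (rule has_derivative_transform_within_open[OF _ W xW])
   fix y assume "y \<in> ?W"
   then obtain q where q: "q \<in> N" "0 < ?s * ?F q" "q \<in> fst c" "y = snd c q" by blast
   have "\<bar>?F q\<bar> = ?s * ?F q" using q(2) by (auto simp: sgn_if split: if_splits)
   then show "?s * (h (ic c y) * ?F (ic c y)) = chart_fun c h y"
    using q c dF[OF q(1)] by (simp add: chart_fun_def)
  qed
  moreover have "?s * coord_vec A c p v (%q. h q * ?F q) = chart_fun c (u v) x" for v
  proof -
   have "coord_vec A c p v (%q. h q * ?F q) = coord_field c \<eta> v p (%q. h q * ?F q)"
    using N(3)[OF p(1)] pc by (simp add: coord_field_def tscale_def)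
   also have "... = u v p * ?F p" unfolding u_def by (rule divergence_top[OF c \<eta> N p(1) h(1), symmetric])
   finally show ?thesis using p pc c dF[OF p(1)] by (simp add: chart_fun_def abs_sgn mult_ac)
  qed
  ultimately show ?thesis by simp
 next
  case False
  then have x: "x \<in> - (snd c ` ?L)" using h(2) by blast
  have "open (- (snd c ` ?L))" using compact_imp_closed[OF K] by (simp add: open_Compl)
  then have "(chart_fun c h has_derivative (%v. 0)) (at x)"
  proof (rule has_derivative_transform_within_open[OF has_derivative_const[of 0] _ x])
   show "0 = chart_fun c h y" if "y \<in> - (snd c ` ?L)" for y
    by (rule off[symmetric]) (use sub that in blast)+
  qed
  moreover have "chart_fun c (u v) x = 0" for v using off[of "u v" x] u0 x by blast
  ultimately show ?thesis by simp
 qed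
 show "chart_int c (u b) = 0"
  unfolding chart_fun(3)[OF us]
  by (rule integral_partial_derivative[OF der chart_fun(1)[OF us] K]) (use off[of h] sub in blast)
qed

lemma chart_int_add: "supported c u ==> supported c v ==> chart_int c (%p. u p + v p) = chart_int c u + chart_int c v"
proof -
 assume u: "supported c u" and v: "supported c v"
 have "set_integrable lborel (snd c ` fst c) (%x. w (ic c x) * dens c (ic c x))" if "supported c w" for w
  using chart_fun(2)[OF that] unfolding set_integrable_def
  by (rule Bochner_Integration.integrable_cong[THEN iffD1, OF refl, rotated]) (simp add: chart_fun_def)
 from set_integral_add(2)[OF this[OF u] this[OF v]] show ?thesis
  unfolding chart_int_def by (simp add: algebra_simps)
qed

lemma chart_int_cmult: "chart_int c (%p. a * u p) = a * chart_int c u"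
 unfolding chart_int_def by (simp add: mult.assoc)

lemma chart_int_cong: "(!!p. p \<in> fst c ==> u p = v p) ==> chart_int c u = chart_int c v"
 unfolding chart_int_def set_lebesgue_integral_def
 by (rule Bochner_Integration.integral_cong[OF refl]) (simp add: indicator_def ic_in)

lemma partition_exists: "\<exists>k c \<theta>. partition_of_unity A k c \<theta>"
proof -
 have "\<forall>p\<in>M. \<exists>c. c \<in> A \<and> p \<in> fst c" using chart_at by metis
 then obtain ch where ch: "!!p. p \<in> M ==> ch p \<in> A \<and> p \<in> fst (ch p)" by metis
 obtain F \<theta> where F: "finite F" "F \<subseteq> M" "!!p. p \<in> F ==> \<theta> p \<in> C" "!!p q. p \<in> F ==> 0 \<le> \<theta> p q"
  "!!p. p \<in> F ==> T closure_of {q \<in> M. \<theta> p q \<noteq> 0} \<subseteq> fst (ch p)" "!!p q. p \<in> F ==> q \<notin> fst (ch p) ==> \<theta> p q = 0"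
  "!!q. q \<in> M ==> (\<Sum>p\<in>F. \<theta> p q) = 1"
  by (rule smooth_partition[of "%p. fst (ch p)"]) (use ch openin_chart in blast, rule that)
 obtain e where e: "bij_betw e {0..<card F} F" using ex_bij_betw_nat_finite[OF F(1)] by blast
 have eF: "i < card F ==> e i \<in> F" for i using bij_betwE[OF e] by simp
 have "(\<Sum>i<card F. \<theta> (e i) q) = (\<Sum>p\<in>F. \<theta> p q)" for q
  using sum.reindex_bij_betw[OF e] by (simp add: lessThan_atLeast0)
 then have "partition_of_unity A (card F) (%i. ch (e i)) (%i. \<theta> (e i))"
  unfolding partition_of_unity_def using F(2-5,7) eF ch by (simp add: subset_iff)
 then show ?thesis by blast
qed

abbreviation "Liou \<equiv> liouville_integral A n \<omega>"

lemma Liou_partition: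
 obtains k c \<theta> where "partition_of_unity A k c \<theta>" "!!h. Liou h = (\<Sum>i<k. chart_int (c i) (%p. \<theta> i p * h p))"
proof -
 obtain k c \<theta> where P: "(SOME (k, c, \<theta>). partition_of_unity A k c \<theta>) = (k, c, \<theta>)" by (rule prod_cases3)
 have "case (SOME (k, c, \<theta>). partition_of_unity A k c \<theta>) of (k, c, \<theta>) => partition_of_unity A k c \<theta>"
  by (rule someI_ex) (use partition_exists in simp)
 then have "partition_of_unity A k c \<theta>" unfolding P by simp
 moreover have "Liou h = (\<Sum>i<k. chart_int (c i) (%p. \<theta> i p * h p))" for h
  unfolding liouville_integral_def P chart_int_def dens_def by (simp add: Let_def)
 ultimately show ?thesis by (rule that)
qed

lemma partition_supported:
 assumes P: "partition_of_unity A k c \<theta>" and i: "i < k" and h: "h \<in> C"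
 shows "supported (c i) (%p. \<theta> i p * h p)"
proof -
 have s: "supported (c i) (\<theta> i)" and C: "\<theta> i \<in> C" using P i by (auto simp: partition_of_unity_def supported_def)
 show ?thesis by (rule supported_mono[OF s smooth_mult[OF C h]]) simp
qed

lemma Liou_add: "h \<in> C ==> k \<in> C ==> Liou (%p. h p + k p) = Liou h + Liou k"
 by (rule Liou_partition) (simp add: distrib_left chart_int_add partition_supported sum.distrib)

lemma Liou_cmult: "Liou (%p. a * h p) = a * Liou h"
proof -
 have *: "x * (a * y) = a * (x * y)" for x y :: real by simp
 show ?thesis by (rule Liou_partition) (simp add: * chart_int_cmult sum_distrib_left)
qed

lemma Liou_cong:
 assumes "!!p. p \<in> M ==> h p = k p"
 shows "Liou h = Liou k"
proof -
 obtain N c \<theta> where P: "partition_of_unity A N c \<theta>" "!!h. Liou h = (\<Sum>i<N. chart_int (c i) (%p. \<theta> i p * h p))"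
  by (rule Liou_partition) (rule that)
 have "fst (c i) \<subseteq> M" if "i < N" for i using P(1) that chart_subset by (auto simp: partition_of_unity_def)
 then show ?thesis unfolding P(2) by (intro sum.cong refl chart_int_cong) (auto simp: assms subset_iff)
qed

lemma Liou_sum: "finite I ==> (!!i. i \<in> I ==> h i \<in> C) ==> Liou (%p. \<Sum>i\<in>I. h i p) = (\<Sum>i\<in>I. Liou (h i))"
proof (induction I rule: finite_induct)
 case empty
 show ?case using Liou_cmult[of 0 "%p. 0"] by simp
next
 case (insert i I)
 then have "Liou (%p. h i p + (\<Sum>i\<in>I. h i p)) = Liou (h i) + Liou (%p. \<Sum>i\<in>I. h i p)"
  by (intro Liou_add smooth_sum) auto
 then show ?case using insert by simp
qed

text \<open>The Liouville integral is defined by an arbitrary partition of unity. For a function supported in one chart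
 all its terms can be moved to this chart, where the partition adds up to 1.\<close>

lemma Liou_chart:
 assumes u: "supported d u"
 shows "Liou u = chart_int d u"
proof -
 obtain N c \<theta> where P: "partition_of_unity A N c \<theta>" "!!h. Liou h = (\<Sum>i<N. chart_int (c i) (%p. \<theta> i p * h p))"
  by (rule Liou_partition) (rule that)
 have uC: "u \<in> C" and dA: "d \<in> A" using u by (auto simp: supported_def)
 have sd: "supported d (%p. \<theta> i p * u p)" if "i < N" for i
  by (rule supported_mono[OF u]) (use partition_supported[OF P(1) that uC] in \<open>auto simp: supported_def\<close>)
 have s0: "supported d (%p. 0)" by (rule supported_mono[OF u]) auto
 have "(\<Sum>i<m. chart_int d (%p. \<theta> i p * u p)) = chart_int d (%p. \<Sum>i<m. \<theta> i p * u p)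
   \<and> supported d (%p. \<Sum>i<m. \<theta> i p * u p)" if "m \<le> N" for m
  using that
 proof (induction m)
  case 0
  then show ?case using chart_int_cmult[of d 0 u] s0 by simp
 next
  case (Suc m)
  then have IH: "(\<Sum>i<m. chart_int d (%p. \<theta> i p * u p)) = chart_int d (%p. \<Sum>i<m. \<theta> i p * u p)"
   and s: "supported d (%p. \<Sum>i<m. \<theta> i p * u p)" by simp_all
  have m: "m < N" using Suc.prems by simp
  have "supported d (%p. \<Sum>i<Suc m. \<theta> i p * u p)"
  proof (rule supported_mono[OF u])
   show "(%p. \<Sum>i<Suc m. \<theta> i p * u p) \<in> C"
    by (rule smooth_sum) (use partition_supported[OF P(1) _ uC] Suc.prems in \<open>auto simp: supported_def\<close>)
  qed simp
  then show ?case using IH chart_int_add[OF s sd[OF m]] by simp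
 qed
 from this[of N] have "(\<Sum>i<N. chart_int d (%p. \<theta> i p * u p)) = chart_int d (%p. \<Sum>i<N. \<theta> i p * u p)" by simp
 moreover have "chart_int (c i) (%p. \<theta> i p * u p) = chart_int d (%p. \<theta> i p * u p)" if "i < N" for i
  by (rule chart_int_change[OF partition_supported[OF P(1) that uC] sd[OF that]])
 moreover have "chart_int d (%p. \<Sum>i<N. \<theta> i p * u p) = chart_int d u"
 proof (rule chart_int_cong)
  fix p assume "p \<in> fst d"
  then have "(\<Sum>i<N. \<theta> i p) = 1" using P(1) chart_subset[OF dA] by (auto simp: partition_of_unity_def)
  then show "(\<Sum>i<N. \<theta> i p * u p) = u p" by (simp add: sum_distrib_right[symmetric])
 qed
 ultimately show ?thesis unfolding P(2) by simp
qed

text \<open>The vector field is expanded in the generators, each of which lives in a single chart.\<close>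

lemma Liou_divergence:
 assumes W: "W \<in> V"
 shows "Liou (trace (%Z. LC Z W)) = 0"
proof -
 let ?Y = "%k. (%p. W p (\<beta> k)) *\<^sub>f E k"
 have Y: "?Y k \<in> V" if "k \<in> gen_index" for k by (intro vfield_fscale vfield_smooth[OF W] gen_fun gen_field that)
 have tC: "X \<in> V ==> trace (%Z. LC Z X) \<in> C" for X by (rule trace_smooth[OF con_endo1[OF LC]])
 have 0: "Liou (trace (%Z. LC Z (?Y k))) = 0" if k: "k \<in> gen_index" for k
 proof -
  obtain c \<eta> N b \<theta> where l: "c \<in> A" "\<theta> \<in> C" "!!x. coord_field c \<eta> x \<in> V" "openin T N" "N \<subseteq> fst c"
   "!!q. q \<in> N ==> \<eta> q = 1" "T closure_of {q \<in> M. \<theta> q \<noteq> 0} \<subseteq> N" "E k = \<theta> *\<^sub>f coord_field c \<eta> b"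
   using gen_localized[OF k] unfolding localized_def by blast
  let ?h = "%p. W p (\<beta> k) * \<theta> p"
  have h: "?h \<in> C" by (intro smooth_mult vfield_smooth[OF W] gen_fun k l)
  have "T closure_of {q \<in> M. ?h q \<noteq> 0} \<subseteq> T closure_of {q \<in> M. \<theta> q \<noteq> 0}" by (rule closure_of_mono) auto
  then have hN: "T closure_of {q \<in> M. ?h q \<noteq> 0} \<subseteq> N" using l(7) by blast
  have "?Y k = ?h *\<^sub>f coord_field c \<eta> b" unfolding l(8) by (simp add: fun_eq_iff fscale_simps)
  then show ?thesis
   using chart_int_divergence[OF l(1,3,4,5,6) h hN, of b] Liou_chart by simp
 qed
 have "Liou (trace (%Z. LC Z W)) = Liou (%p. \<Sum>k\<in>gen_index. trace (%Z. LC Z (?Y k)) p)"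
 proof (rule Liou_cong)
  fix p
  have "trace (%Z. LC Z W) p = trace (%Z. \<Sum>k\<in>gen_index. LC Z (?Y k)) p"
   by (rule trace_cong) (simp only: con_sum2[OF LC _ Y, symmetric] field_gen[OF W, symmetric])
  then show "trace (%Z. LC Z W) p = (\<Sum>k\<in>gen_index. trace (%Z. LC Z (?Y k)) p)"
   unfolding trace_def by (simp add: sum_vfield_apply) (rule sum.swap)
 qed
 also have "... = 0" using Liou_sum[OF gen_finite tC[OF Y]] 0 by simp
 finally show ?thesis .
qed

lemma Liou_nonneg_eq_0:
 assumes h: "h \<in> C" "!!p. p \<in> M ==> h p \<ge> 0" and z: "Liou h = 0" and p: "p \<in> M"
 shows "h p = 0"
proof -
 obtain N c \<theta> where P: "partition_of_unity A N c \<theta>" "!!h. Liou h = (\<Sum>i<N. chart_int (c i) (%p. \<theta> i p * h p))"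
  by (rule Liou_partition) (rule that)
 let ?u = "%i p. \<theta> i p * h p"
 have s: "supported (c i) (?u i)" if "i < N" for i by (rule partition_supported[OF P(1) that h(1)])
 have cA: "c i \<in> A" if "i < N" for i using s[OF that] by (simp add: supported_def)
 have nn: "chart_fun (c i) (?u i) x \<ge> 0" if i: "i < N" for i x
  using P(1) i h(2) ic_in[of x "c i"] chart_subset[OF cA[OF i]] unfolding partition_of_unity_def
  by (auto simp: chart_fun_def dens_def subset_iff)
 have "chart_int (c i) (?u i) \<ge> 0" if i: "i < N" for i
  unfolding chart_fun(3)[OF s[OF i]] by (rule Bochner_Integration.integral_nonneg) (rule nn[OF i])
 then have z: "chart_int (c i) (?u i) = 0" if i: "i < N" for i
  using z i unfolding P(2) by (subst (asm) sum_nonneg_eq_0_iff) auto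
 have "?u i p = 0" if i: "i < N" for i
 proof (cases "p \<in> fst (c i)")
  case True
  have "chart_fun (c i) (?u i) (snd (c i) p) = 0"
   by (rule continuous_nonneg_integral_0[OF chart_fun(1)[OF s[OF i]] nn[OF i] chart_fun(2)[OF s[OF i]]])
    (use z[OF i] chart_fun(3)[OF s[OF i]] in simp)
  then show ?thesis using True cA[OF i] dens_pos[OF cA[OF i] True] by (simp add: chart_fun_def)
 next
  case False
  then show ?thesis using supported_zero[OF s[OF i] p] by blast
 qed
 then have "(\<Sum>i<N. \<theta> i p * h p) = 0" by (intro sum.neutral ballI) (simp only: lessThan_iff)
 moreover have "(\<Sum>i<N. \<theta> i p) = 1" using P(1) p by (simp add: partition_of_unity_def)
 ultimately show ?thesis by (simp add: sum_distrib_right[symmetric])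
qed

end

section \<open>The fundamental vector field\<close>

context manifold_pair
begin

lemma pushforward_tangent:
 assumes F: "!!w. w \<in> smooth_functions A ==> (%a. w (F a)) \<in> smooth_functions B" and v: "v \<in> tangent_space B a"
 shows "pushforward B A F v \<in> tangent_space A (F a)"
proof (rule R.tangentI)
 fix f g c assume f: "f \<in> smooth_functions A"
 show "pushforward B A F v (%x. c * f x) = c * pushforward B A F v f"
  using L.tangent_cmult[OF v F[OF f]] R.smooth_cmult[OF f] f by (simp add: pushforward_def o_def)
 assume g: "g \<in> smooth_functions A"
 note FF = F[OF f] F[OF g]
 show "pushforward B A F v (%x. f x + g x) = pushforward B A F v f + pushforward B A F v g"
  using L.tangent_add[OF v FF] R.smooth_add[OF f g] f g by (simp add: pushforward_def o_def)
 show "pushforward B A F v (%x. f x * g x) = f (F a) * pushforward B A F v g + g (F a) * pushforward B A F v f"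
  using L.tangent_mult[OF v FF] R.smooth_mult[OF f g] f g by (simp add: pushforward_def o_def)
qed (simp add: pushforward_def)

end

context almost_kaehler
begin

text \<open>Invariance of \<open>J\<close> is an identity between smooth functions on the group, to which the derivation \<open>\<xi>\<close> is
 applied. Derivations in the group variable and in the point commute, which turns the derivative of the
 push-forward of a vector into a bracket.\<close>

lemma fundamental_field_invariance:
 fixes B :: "('m => 'm, 'h::real_normed_vector) atlas"
 assumes lie: "lie_subgroup_Ham A \<omega> G B" and inv: "J \<in> AK_inv A \<omega> G" and \<xi>: "\<xi> \<in> tangent_space B id"
 shows fundamental_field_tangent: "p \<in> M ==> fundamental_field A B \<xi> p \<in> TM p"
  and fundamental_field_bracket: "fundamental_field A B \<xi> \<in> V ==> Y \<in> V ==>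
   bracket (fundamental_field A B \<xi>) (JJ Y) = JJ (bracket (fundamental_field A B \<xi>) Y)"
proof -
 have B: "smooth_manifold B" "pts B = G" "id \<in> G" and act: "smooth_map (prod_atlas B A) A (%(a, p). a p)"
  and ham: "G \<subseteq> Ham A \<omega>"
  using lie unfolding lie_subgroup_Ham_def by blast+
 interpret P: manifold_pair B A by unfold_locales (rule B)
 interpret Q: manifold_pair A B by unfold_locales
 interpret R: manifold_pair A A by unfold_locales
 note js = P.jointly_smooth_action[OF act]
 have left: "(%a. w (a p)) \<in> smooth_functions B" if "w \<in> C" "p \<in> M" for w p
  by (rule Q.jointly_smooth_right[OF P.jointly_smooth_swap[OF js[OF that(1)]] that(2)])
 have right: "(%p. w (a p)) \<in> C" if "w \<in> C" "a \<in> G" for w a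
  using P.jointly_smooth_right[OF js[OF that(1)]] that(2) B(2) by simp
 have aM: "a p \<in> M" if "a \<in> G" "p \<in> M" for a p
 proof -
  have "a \<in> diffeos A" using ham that(1) unfolding Ham_def by blast
  then show ?thesis using permutes_in_image[of a M p] that(2) by (simp add: diffeos_def)
 qed
 let ?X = "fundamental_field A B \<xi>"
 have X: "?X p w = \<xi> (%a. w (a p))" if "p \<in> M" "w \<in> C" for p w
  using that by (simp add: fundamental_field_def pushforward_def o_def)
 have \<xi>B: "\<xi> \<in> tangent_space B id" and idB: "id \<in> pts B" using \<xi> B by auto
 show "?X p \<in> TM p" if p: "p \<in> M"
  using P.pushforward_tangent[OF left[OF _ p] \<xi>] p by (simp add: fundamental_field_def)
 assume XV: "?X \<in> V" and Y: "Y \<in> V"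
 define e where "e k w q = JJ (E k) q w" for k w q
 have eC: "e k w \<in> C" if "k \<in> gen_index" "w \<in> C" for k w
  unfolding e_def[abs_def] by (rule vfield_smooth[OF JJ_field[OF gen_field[OF that(1)]] that(2)])
 have JJe: "JJ Z p w = (\<Sum>k\<in>gen_index. Z p (\<beta> k) * e k w p)" if "Z \<in> V" for Z p w
  unfolding e_def by (rule tensor_endo_gen[OF JJ_endo that])
 \<comment> \<open>invariance of \<open>J\<close> under \<open>a\<close>, with \<open>J\<close> at \<open>a p\<close> expanded in the generators to make the dependence on \<open>a\<close> smooth\<close>
 have equivariance: "J p v (%q. w (a q)) = (\<Sum>k\<in>gen_index. v (%q. \<beta> k (a q)) * e k w (a p))"
  if a: "a \<in> G" and p: "p \<in> M" and v: "v \<in> TM p" and w: "w \<in> C" for a p v w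
 proof -
  let ?u = "pushforward A A a v"
  have u: "?u \<in> TM (a p)" by (rule R.pushforward_tangent[OF right[OF _ a] v])
  obtain Z where Z: "Z \<in> V" "Z (a p) = ?u" by (rule tangent_extend[OF aM[OF a p] u]) (rule that)
  have "J p v (%q. w (a q)) = pushforward A A a (J p v) w" using w by (simp add: pushforward_def o_def)
  also have "... = J (a p) ?u w" using inv a p v unfolding AK_inv_def by simp
  also have "... = JJ Z (a p) w" using Z aM[OF a p] by (simp add: JJ_at)
  also have "... = (\<Sum>k\<in>gen_index. ?u (\<beta> k) * e k w (a p))" unfolding JJe[OF Z(1)] Z(2) ..
  finally show ?thesis by (simp add: pushforward_def o_def gen_fun)
 qed
 show "bracket ?X (JJ Y) = JJ (bracket ?X Y)"
 proof (intro ext)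
  fix p w
  show "bracket ?X (JJ Y) p w = JJ (bracket ?X Y) p w"
  proof (cases "p \<in> M \<and> w \<in> C")
   case False
   have "bracket ?X (JJ Y) \<in> V" "JJ (bracket ?X Y) \<in> V" by (intro vfield_bracket JJ_field XV Y)+
   then show ?thesis using False vfield_outside tangent_nonsmooth vfield_tangent by (metis zero_fun_apply)
  next
   case True
   then have p: "p \<in> M" and w: "w \<in> C" by auto
   note Yp = vfield_tangent[OF Y, of p] and Xp = vfield_tangent[OF XV, of p]
   note JYp = J_tangent[OF p Yp]
   have "J p (Y p) (%q. ?X q w) = J p (Y p) (%q. \<xi> (%a. w (a q)))"
    by (rule tangent_cong[OF p JYp vfield_smooth[OF XV w] Q.derivation_right_smooth(1)[OF P.jointly_smooth_swap[OF js[OF w]] idB \<xi>B]])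
     (simp add: X w)
   also have "... = \<xi> (%a. J p (Y p) (%q. w (a q)))"
    by (rule P.derivations_commute[OF js[OF w] p JYp idB \<xi>B, symmetric])
   also have "... = \<xi> (%a. \<Sum>k\<in>gen_index. Y p (%q. \<beta> k (a q)) * e k w (a p))"
   proof (rule P.L.tangent_local[OF \<xi>B _ _ _ idB])
    show "openin (atlas_topology B) (pts B)"
     using openin_topspace[of "atlas_topology B"] by (simp add: P.L.topspace_eq)
    show "(%a. J p (Y p) (%q. w (a q))) \<in> smooth_functions B"
     by (rule P.derivation_right_smooth(1)[OF js[OF w] p JYp])
    show "(%a. \<Sum>k\<in>gen_index. Y p (%q. \<beta> k (a q)) * e k w (a p)) \<in> smooth_functions B"
     by (intro P.L.smooth_sum P.L.smooth_mult P.derivation_right_smooth(1)[OF js[OF gen_fun] p Yp] left[OF eC[OF _ w] p])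
   qed (use equivariance[OF _ p Yp w] B(2) in simp)
   also have "... = (\<Sum>k\<in>gen_index. \<xi> (%a. Y p (%q. \<beta> k (a q)) * e k w (a p)))"
    by (rule P.L.tangent_sum[OF \<xi>B]) 
     (intro P.L.smooth_mult P.derivation_right_smooth(1)[OF js[OF gen_fun] p Yp] left[OF eC[OF _ w] p])
   also have "... = (\<Sum>k\<in>gen_index. Y p (\<beta> k) * ?X p (e k w) + e k w p * Y p (%q. ?X q (\<beta> k)))"
   proof (rule sum.cong[OF refl])
    fix k assume k: "k \<in> gen_index"
    note s = P.derivation_right_smooth(1)[OF js[OF gen_fun[OF k]] p Yp] left[OF eC[OF k w] p]
    have "\<xi> (%a. Y p (%q. \<beta> k (a q)) * e k w (a p)) =
      Y p (%q. \<beta> k (id q)) * \<xi> (%a. e k w (a p)) + e k w (id p) * \<xi> (%a. Y p (%q. \<beta> k (a q)))"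
     by (rule P.L.tangent_mult[OF \<xi>B s])
    also have "\<xi> (%a. Y p (%q. \<beta> k (a q))) = Y p (%q. \<xi> (%a. \<beta> k (a q)))"
     by (rule P.derivations_commute[OF js[OF gen_fun[OF k]] p Yp idB \<xi>B])
    also have "... = Y p (%q. ?X q (\<beta> k))"
     by (rule tangent_cong[OF p Yp Q.derivation_right_smooth(1)[OF P.jointly_smooth_swap[OF js[OF gen_fun[OF k]]] idB \<xi>B] vfield_smooth[OF XV gen_fun[OF k]]])
      (simp add: X gen_fun[OF k])
    finally show "\<xi> (%a. Y p (%q. \<beta> k (a q)) * e k w (a p)) = Y p (\<beta> k) * ?X p (e k w) + e k w p * Y p (%q. ?X q (\<beta> k))"
     by (simp add: X[OF p eC[OF k w]])
   qed
   finally have 1: "J p (Y p) (%q. ?X q w) = ..." .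
   have "?X p (%q. JJ Y q w) = ?X p (%q. \<Sum>k\<in>gen_index. Y q (\<beta> k) * e k w q)"
    unfolding JJe[OF Y] ..
   also have "... = (\<Sum>k\<in>gen_index. ?X p (%q. Y q (\<beta> k) * e k w q))"
    by (rule tangent_sum[OF Xp]) (intro smooth_mult vfield_smooth[OF Y] gen_fun eC w)
   also have "... = (\<Sum>k\<in>gen_index. Y p (\<beta> k) * ?X p (e k w) + e k w p * ?X p (%q. Y q (\<beta> k)))"
    by (rule sum.cong[OF refl]) (rule tangent_mult[OF Xp vfield_smooth[OF Y gen_fun] eC[OF _ w]])
   finally have "bracket ?X (JJ Y) p w = (\<Sum>k\<in>gen_index. bracket ?X Y p (\<beta> k) * e k w p)"
    using 1 p by (simp add: bracket_def JJ_at sum_subtractf[symmetric] algebra_simps)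
   then show ?thesis unfolding JJe[OF vfield_bracket[OF XV Y]] .
  qed
 qed
qed

end

section \<open>Comparing scalar curvatures\<close>

context almost_kaehler
begin

text \<open>Every 1-form is \<open>\<omega>(W, \<cdot>)\<close> for a field \<open>W\<close>, so contractions of cohomologous forms differ by a divergence.\<close>

lemma contraction_exact:
 assumes a: "!!p. p \<in> M ==> pointwise_form p (\<alpha> p)" "!!p. p \<in> M ==> pointwise_form p (\<alpha>' p)" and \<theta>: "tensor_form \<theta>"
  and eq: "!!X Y p. X \<in> V ==> Y \<in> V ==> p \<in> M ==> \<alpha> p (X p) (Y p) - \<alpha>' p (X p) (Y p) = \<kappa> * d1 \<theta> X Y p"
 obtains W where "W \<in> V" "!!Z p. Z \<in> V ==> p \<in> M ==> \<theta> Z p = om W Z p"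
  "!!p. p \<in> M ==> contraction (\<alpha> p) p - contraction (\<alpha>' p) p = \<kappa> * trace (%Z. LC Z W) p"
proof -
 obtain G where G: "G \<in> V" "!!Z p. Z \<in> V ==> p \<in> M ==> gp G Z p = \<theta> Z p" by (rule riesz[OF \<theta>]) (rule that)
 define W where "W = - JJ G"
 have W: "W \<in> V" unfolding W_def by (intro vfield_minus JJ_field G)
 have JW: "JJ W = G" unfolding W_def tensor_endo_minus[OF JJ_endo JJ_field[OF G(1)]] JJ_JJ[OF G(1)] by simp
 have om: "\<theta> Z p = om W Z p" if "Z \<in> V" "p \<in> M" for Z p
  unfolding om_gp[OF W that(1)] JW using G(2)[OF that] by simp
 have \<theta>C: "\<theta> Z \<in> C" if "Z \<in> V" for Z using \<theta> that by (simp add: tensor_form_def)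
 show ?thesis
 proof (rule that[OF W om])
  fix p assume p: "p \<in> M"
  let ?e = "some_frame A g J p"
  have "contraction (\<alpha> p) p - contraction (\<alpha>' p) p =
    1 / 2 * (\<Sum>i<2 * n. \<alpha> p (?e i p) (J p (?e i p)) - \<alpha>' p (?e i p) (J p (?e i p)))"
   unfolding contraction_frame[OF p a(1)[OF p]] contraction_frame[OF p a(2)[OF p]]
   by (simp add: sum_subtractf right_diff_distrib)
  also have "(\<Sum>i<2 * n. \<alpha> p (?e i p) (J p (?e i p)) - \<alpha>' p (?e i p) (J p (?e i p))) = (\<Sum>i<2 * n. \<kappa> * d1 \<theta> (?e i) (JJ (?e i)) p)"
  proof (rule sum.cong[OF refl])
   fix i assume "i \<in> {..<2 * n}"
   then have e: "?e i \<in> V" by (intro some_frame_field[OF p]) (simp add: dim_2n)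
   show "\<alpha> p (?e i p) (J p (?e i p)) - \<alpha>' p (?e i p) (J p (?e i p)) = \<kappa> * d1 \<theta> (?e i) (JJ (?e i)) p"
    using eq[OF e JJ_field[OF e] p] by (simp only: JJ_at[OF p])
  qed
  also have "... = \<kappa> * (2 * trace (%Z. LC Z W) p)"
   unfolding sum_distrib_left[symmetric] using contraction_d1[OF W om \<theta>C p] by (simp add: dim_2n)
  finally show "contraction (\<alpha> p) p - contraction (\<alpha>' p) p = \<kappa> * trace (%Z. LC Z W) p" by simp
 qed
qed

lemma contraction_\<omega>:
 assumes p: "p \<in> M"
 shows "contraction (\<omega> p) p = real n"
proof -
 let ?e = "%i. some_frame A g J p i p"
 have "(\<Sum>i<2 * n. \<omega> p (?e i) (J p (?e i))) = (\<Sum>i<2 * n. 1)"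
  by (rule sum.cong[OF refl])
   (use some_frame_orthonormal[OF p] in \<open>simp add: orthonormal_def dim_2n induced_metric_def\<close>)
 then show ?thesis unfolding contraction_frame[OF p \<omega>_pointwise_form[OF p]] by simp
qed

lemma Liou_1: "Liou (%p. 1) \<noteq> 0"
proof
 assume "Liou (%p. 1) = 0"
 moreover obtain p where "p \<in> M" using symplectic by (auto simp: symplectic_manifold_def)
 ultimately show False using Liou_nonneg_eq_0[of "%p. 1" p] by simp
qed

text \<open>The form \<open>\<omega>\<close> has contraction \<open>n\<close> and is cohomologous to some Chern-Ricci form, hence by transgression to
 that of \<open>J\<close>. The constant therefore differs from \<open>n\<close> by a divergence, and its integral shows equality.\<close>

lemma fano_constant:
 assumes fano: "symplectic_fano A \<omega>" and const: "!!p. p \<in> M ==> chern_scalar A n \<omega> J p = s"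
 shows "s = real n"
proof -
 \<comment> \<open>\<open>\<omega>\<close> represents its own class, so the Fano condition provides the structure \<open>J1\<close> and its connection \<open>D1\<close>\<close>
 have "cohomologous A \<omega> \<omega>"
  unfolding cohomologous_def is_form1_def d_form1_def
  by (rule exI[of _ "%p v. 0"]) (auto simp: tangent_const[OF vfield_tangent])
 then have "\<omega> \<in> de_rham_class A \<omega>" using \<omega>_closed by (simp add: de_rham_class_def)
 then have "\<omega> \<in> (%\<beta> p u v. 2 * pi * \<beta> p u v) ` first_chern_class A \<omega>" using fano by (simp add: symplectic_fano_def)
 then obtain J1 D1 b where J1: "J1 \<in> AK A \<omega>" and D1: "hermitian_connection A (induced_metric \<omega> J1) J1 D1"
  and b: "b \<in> de_rham_class A (%p u v. 1 / (2 * pi) * ricci_form A (induced_metric \<omega> J1) J1 D1 p u v)"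
  and \<omega>b: "\<omega> = (%p u v. 2 * pi * b p u v)" unfolding first_chern_class_def by blast
 interpret T: two_structures A n \<omega> J J1 by unfold_locales (rule J1)
 let ?\<rho>1 = "ricci_form A (induced_metric \<omega> J1) J1 D1"
 have cD1: "connection A D1" using D1 by (simp add: hermitian_connection_def metric_connection_def)
 obtain \<alpha> where \<alpha>: "is_form1 A \<alpha>" "!!X Y p. X \<in> V ==> Y \<in> V ==> p \<in> M ==>
   b p (X p) (Y p) - 1 / (2 * pi) * ?\<rho>1 p (X p) (Y p) = d_form1 \<alpha> X Y p"
  using b unfolding de_rham_class_def cohomologous_def by blast
 define \<theta> where "\<theta> Z p = \<alpha> p (Z p)" for Z and p :: 'm
 have sc: "\<alpha> p (c *\<^sub>t u) = c * \<alpha> p u" if "p \<in> M" "u \<in> TM p" for p c u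
  using \<alpha>(1) that unfolding is_form1_def by blast
 have \<theta>: "tensor_form \<theta>"
  unfolding tensor_form_def \<theta>_def[abs_def]
  using \<alpha>(1) vfield_tangent unfolding is_form1_def by (simp add: fscale_simps sc vfield_tangent)
 have eq: "\<omega> p (X p) (Y p) - ?\<rho>1 p (X p) (Y p) = 2 * pi * d1 \<theta> X Y p" if "X \<in> V" "Y \<in> V" "p \<in> M" for X Y p
 proof -
  have "d1 \<theta> X Y p = b p (X p) (Y p) - 1 / (2 * pi) * ?\<rho>1 p (X p) (Y p)"
   unfolding \<alpha>(2)[OF that] by (simp add: d1_def d_form1_def \<theta>_def[abs_def])
  moreover have "\<omega> p (X p) (Y p) = 2 * pi * b p (X p) (Y p)" by (subst \<omega>b) simp
  ultimately show ?thesis by (simp add: field_simps)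
 qed
 obtain W where W: "W \<in> V"
  "!!p. p \<in> M ==> contraction (\<omega> p) p - contraction (?\<rho>1 p) p = 2 * pi * trace (%Z. LC Z W) p"
  by (rule contraction_exact[OF \<omega>_pointwise_form T.K0.ricci_pointwise_form[OF cD1] \<theta> eq]) (assumption+, rule that)
 obtain \<theta>' where \<theta>': "tensor_form \<theta>'" "!!X Y p. X \<in> V ==> Y \<in> V ==> p \<in> M ==>
   ?\<rho>1 p (X p) (Y p) - ricci_form A g J CC p (X p) (Y p) = 1 / 2 * d1 \<theta>' X Y p"
  by (rule T.chern_ricci_transgression[OF CC_hermitian D1]) (rule that)
 obtain W' where W': "W' \<in> V"
  "!!p. p \<in> M ==> contraction (?\<rho>1 p) p - contraction (ricci_form A g J CC p) p = 1 / 2 * trace (%Z. LC Z W') p"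
  by (rule contraction_exact[where \<alpha> = "?\<rho>1" and \<alpha>' = "ricci_form A g J CC",
    OF T.K0.ricci_pointwise_form[OF cD1] ricci_pointwise_form[OF CC_connection] \<theta>']) (assumption+, rule that)
 have tC: "X \<in> V ==> trace (%Z. LC Z X) \<in> C" for X by (rule trace_smooth[OF con_endo1[OF LC]])
 have "(real n - s) * Liou (%p. 1) = Liou (%p. (real n - s) * 1)" by (rule Liou_cmult[symmetric])
 also have "... = Liou (%p. 2 * pi * trace (%Z. LC Z W) p + 1 / 2 * trace (%Z. LC Z W') p)"
 proof (rule Liou_cong)
  fix p assume p: "p \<in> M"
  have "s = contraction (ricci_form A g J CC p) p"
   using const[OF p] unfolding chern_scalar_contraction by (simp add: chern_ricci_form_def Let_def)
  then show "(real n - s) * 1 = 2 * pi * trace (%Z. LC Z W) p + 1 / 2 * trace (%Z. LC Z W') p"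
   using W(2)[OF p] W'(2)[OF p] contraction_\<omega>[OF p] by simp
 qed
 also have "... = 2 * pi * Liou (trace (%Z. LC Z W)) + 1 / 2 * Liou (trace (%Z. LC Z W'))"
  unfolding Liou_add[OF smooth_cmult[OF tC[OF W(1)]] smooth_cmult[OF tC[OF W'(1)]]] Liou_cmult ..
 also have "... = 0" by (simp add: Liou_divergence W(1) W'(1))
 finally show ?thesis using Liou_1 by simp
qed

lemma tangent_exp:
 assumes p: "p \<in> M" and v: "v \<in> TM p" and f: "f \<in> C"
 shows "v (%q. exp (a * f q)) = a * exp (a * f p) * v f"
proof -
 obtain c where c: "c \<in> A" "p \<in> fst c" using chart_at[OF p] .
 obtain x where x: "v = coord_vec A c p x" using tangent_is_coord_vec[OF c v] .
 have eC: "(%q. exp (a * f q)) \<in> C" by (rule smooth_compose[OF f open_UNIV smooth_on_exp]) simp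
 have "((%y. exp (a * f (ic c y))) has_derivative (%b. exp (a * f (ic c (snd c p))) * (a * coord_vec A c p b f))) (at (snd c p))"
  by (auto intro!: derivative_eq_intros chart_derivative[OF c f])
 from coord_vecI[OF c eC this] show ?thesis unfolding x using c by simp
qed

text \<open>The divergence of \<open>k \<cdot> grad f\<close> has integral 0.\<close>

lemma weighted_laplacian:
 assumes f: "f \<in> C"
 defines "k \<equiv> %p. exp (- 2 * f p)"
 shows "Liou (%p. k p * laplacian A g J f p) = - 2 * Liou (%p. k p * norm_df_sq A g J f p)"
proof -
 note G = grad_field[OF f]
 have kC: "k \<in> C" unfolding k_def by (rule smooth_compose[OF f open_UNIV smooth_on_exp]) simp
 have LC: "laplacian A g J f \<in> C"
  by (rule smooth_cong[OF smooth_minus[OF trace_smooth[OF con_endo1[OF LC G]]]]) (simp add: laplacian_trace[OF f])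
 have NC: "norm_df_sq A g J f \<in> C"
  by (rule smooth_cong[OF gp_smooth[OF G G]]) (simp add: norm_df_sq_grad[OF f])
 have "0 = Liou (trace (%Z. LC Z (k *\<^sub>f grad f)))" by (rule Liou_divergence[symmetric]) (intro vfield_fscale kC G)
 also have "... = Liou (%p. (- 2) * (k p * norm_df_sq A g J f p) + (- 1) * (k p * laplacian A g J f p))"
 proof (rule Liou_cong)
  fix p assume p: "p \<in> M"
  have "grad f p k = - 2 * k p * gp (grad f) (grad f) p"
   unfolding k_def tangent_exp[OF p vfield_tangent[OF G] f] gp_grad[OF f G p] ..
  then show "trace (%Z. LC Z (k *\<^sub>f grad f)) p = (- 2) * (k p * norm_df_sq A g J f p) + (- 1) * (k p * laplacian A g J f p)"
   unfolding divergence_fscale[OF kC G] laplacian_trace[OF f p] norm_df_sq_grad[OF f p] by simp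
 qed
 finally show ?thesis by (simp only: Liou_add Liou_cmult smooth_cmult smooth_mult kC LC NC)
qed

end

section \<open>Uniqueness\<close>

context two_structures
begin

text \<open>The difference of the Chern scalar curvatures is half the divergence of a field \<open>W\<close> with
 \<open>W f = \<Delta>\<^sub>0 f - \<Delta> f\<close>. Integrating the divergence of \<open>e\<^sup>-\<^sup>2\<^sup>f W\<close> and inserting the soliton equation, all terms with
 the metric of \<open>J\<close> cancel and the integral of \<open>e\<^sup>-\<^sup>2\<^sup>f |df|\<^sup>2\<close> with respect to \<open>J0\<close> remains.\<close>

lemma soliton_trivial:
 assumes f: "f \<in> K.C" and norm: "K.Liou (%p. f p * exp (- 2 * f p)) = 0"
  and \<xi>: "\<xi> \<in> K.V" "potential A \<omega> \<xi> f"
  and inv: "!!Y. Y \<in> K.V ==> bracket \<xi> (\<J> Y) = \<J> (bracket \<xi> Y)" "!!Y. Y \<in> K.V ==> bracket \<xi> (\<J>0 Y) = \<J>0 (bracket \<xi> Y)"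
  and s: "!!p. p \<in> K.M ==> modified_chern_scalar A n \<omega> f J p = 0"
  and s0: "!!p. p \<in> K.M ==> chern_scalar A n \<omega> J0 p = real n"
 shows "\<xi> = 0"
proof -
 define k where "k = (%p. exp (- 2 * f p))"
 have kC: "k \<in> K.C" unfolding k_def by (rule K.smooth_compose[OF f open_UNIV smooth_on_exp]) simp
 have \<xi>J: "\<xi> = \<J> (K.grad f)" and \<xi>J0: "\<xi> = \<J>0 (K0.grad f)"
  using \<xi> K.potential_grad[of \<xi> f] K0.potential_grad[of \<xi> f] K.vfield_tangent[OF \<xi>(1)] K.vfield_outside[OF \<xi>(1)] by auto
 let ?L = "laplacian A K.g J f" and ?Lz = "laplacian A K0.g J0 f"
 let ?N = "norm_df_sq A K.g J f" and ?Nz = "norm_df_sq A K0.g J0 f"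
 obtain \<theta> where \<theta>: "K.tensor_form \<theta>" "!!X Y p. X \<in> K.V ==> Y \<in> K.V ==> p \<in> K.M ==>
   ricci_form A K0.g J0 K0.CC p (X p) (Y p) - ricci_form A K.g J K.CC p (X p) (Y p) = 1 / 2 * K.d1 \<theta> X Y p"
  and \<theta>\<xi>': "!!p. \<theta> \<xi> p = K.trace (%Y. \<J>0 (K0.CC \<xi> Y - bracket \<xi> Y)) p - K.trace (%Y. \<J> (K.CC \<xi> Y - bracket \<xi> Y)) p"
 proof (rule chern_ricci_transgression[OF K.CC_hermitian K0.CC_hermitian])
  fix \<theta>
  assume 1: "K.tensor_form \<theta>" "!!X Y p. X \<in> K.V ==> Y \<in> K.V ==> p \<in> K.M ==>
   ricci_form A K0.g J0 K0.CC p (X p) (Y p) - ricci_form A K.g J K.CC p (X p) (Y p) = 1 / 2 * K.d1 \<theta> X Y p"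
   and 2: "!!\<xi> p. \<xi> \<in> K.V ==> (!!Y. Y \<in> K.V ==> bracket \<xi> (\<J> Y) = \<J> (bracket \<xi> Y)) ==>
   (!!Y. Y \<in> K.V ==> bracket \<xi> (\<J>0 Y) = \<J>0 (bracket \<xi> Y)) ==>
   \<theta> \<xi> p = K.trace (%Y. \<J>0 (K0.CC \<xi> Y - bracket \<xi> Y)) p - K.trace (%Y. \<J> (K.CC \<xi> Y - bracket \<xi> Y)) p"
  show thesis by (rule that[OF 1 2[OF \<xi>(1) inv]])
 qed
 have \<theta>\<xi>: "\<theta> \<xi> p = ?Lz p - ?L p" if p: "p \<in> K.M" for p
  unfolding \<theta>\<xi>' K.moment_laplacian[OF f p, folded \<xi>J] K0.moment_laplacian[OF f p, folded \<xi>J0] ..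
 obtain W where W: "W \<in> K.V" "!!Z p. Z \<in> K.V ==> p \<in> K.M ==> \<theta> Z p = K.om W Z p"
  "!!p. p \<in> K.M ==> K.contraction (ricci_form A K0.g J0 K0.CC p) p - K.contraction (ricci_form A K.g J K.CC p) p =
   1 / 2 * K.trace (%Z. K.LC Z W) p"
  by (rule K.contraction_exact[where \<alpha> = "ricci_form A K0.g J0 K0.CC" and \<alpha>' = "ricci_form A K.g J K.CC",
    OF K0.ricci_pointwise_form[OF K0.CC_connection] K.ricci_pointwise_form[OF K.CC_connection] \<theta>]) (assumption+, rule that)
 have scal: "chern_scalar A n \<omega> J p = real n - 1 / 2 * K.trace (%Z. K.LC Z W) p" if p: "p \<in> K.M" for p
  using W(3)[OF p] s0[OF p] unfolding K.chern_scalar_contraction by (simp add: chern_ricci_form_def Let_def)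
 \<comment> \<open>\<open>W f = \<omega>(W, \<xi>) = \<theta>(\<xi>)\<close> by the choice of \<open>W\<close> and of the potential\<close>
 have Wf: "W p f = ?Lz p - ?L p" if p: "p \<in> K.M" for p
 proof -
  note t = K.vfield_tangent[OF W(1), of p] K.vfield_tangent[OF \<xi>(1), of p]
  have "W p f = \<omega> p (W p) (\<xi> p)"
   using \<xi>(2) t p K.\<omega>_skew[OF p t] unfolding potential_def by force
  then show ?thesis using W(2)[OF \<xi>(1) p] \<theta>\<xi>[OF p] p by (simp add: K.pair_def)
 qed
 have divC: "K.trace (%Z. K.LC Z X) \<in> K.C" if "X \<in> K.V" for X by (rule K.trace_smooth[OF K.con_endo1[OF K.LC that]])
 have LC: "?L \<in> K.C" "?Lz \<in> K.C"
  using K.smooth_cong[OF K.smooth_minus[OF divC[OF K.grad_field[OF f]]], of ?L] K.laplacian_trace[OF f]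
   K.smooth_cong[OF K.smooth_minus[OF K.trace_smooth[OF K.con_endo1[OF K0.LC K0.grad_field[OF f]]]], of ?Lz] K0.laplacian_trace[OF f]
  by simp_all
 have NC: "?N \<in> K.C" "?Nz \<in> K.C"
  using K.smooth_cong[OF K.gp_smooth[OF K.grad_field[OF f] K.grad_field[OF f]], of ?N] K.norm_df_sq_grad[OF f]
   K.smooth_cong[OF K0.gp_smooth[OF K0.grad_field[OF f] K0.grad_field[OF f]], of ?Nz] K0.norm_df_sq_grad[OF f]
  by simp_all
 note add = K.Liou_add and cm = K.Liou_cmult and sm = K.smooth_mult[OF kC]
 have "0 = K.Liou (K.trace (%Z. K.LC Z (k *\<^sub>f W)))" by (rule K.Liou_divergence[symmetric]) (intro K.vfield_fscale kC W(1))
 also have "... = K.Liou (%p. (- 2) * (k p * ?Lz p) + ((- 2) * (k p * ?L p) + (4 * (f p * k p) + (- 4) * (k p * ?N p))))"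
 proof (rule K.Liou_cong)
  fix p assume p: "p \<in> K.M"
  have 1: "W p k = - 2 * k p * (?Lz p - ?L p)"
   unfolding k_def K.tangent_exp[OF p K.vfield_tangent[OF W(1)] f] Wf[OF p] ..
  have 2: "K.trace (%Z. K.LC Z W) p = - 4 * ?L p + 4 * f p - 4 * ?N p"
   using s[OF p] scal[OF p] by (simp add: modified_chern_scalar_def Let_def)
  show "K.trace (%Z. K.LC Z (k *\<^sub>f W)) p = (- 2) * (k p * ?Lz p) + ((- 2) * (k p * ?L p) + (4 * (f p * k p) + (- 4) * (k p * ?N p)))"
   unfolding K.divergence_fscale[OF kC W(1)] 1 2 by (simp add: algebra_simps)
 qed
 also have "... = - 2 * K.Liou (%p. k p * ?Lz p) + (- 2 * K.Liou (%p. k p * ?L p) +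
   (4 * K.Liou (%p. f p * k p) + (- 4) * K.Liou (%p. k p * ?N p)))"
  by (simp only: add cm K.smooth_add K.smooth_cmult sm LC NC K.smooth_mult[OF f kC])
 also have "K.Liou (%p. k p * ?Lz p) = - 2 * K.Liou (%p. k p * ?Nz p)" unfolding k_def by (rule K0.weighted_laplacian[OF f])
 also have "K.Liou (%p. k p * ?L p) = - 2 * K.Liou (%p. k p * ?N p)" unfolding k_def by (rule K.weighted_laplacian[OF f])
 also have "K.Liou (%p. f p * k p) = 0" unfolding k_def by (rule norm)
 finally have "K.Liou (%p. k p * ?Nz p) = 0" by simp
 moreover have "?Nz p \<ge> 0" for p unfolding norm_df_sq_def by (rule sum_nonneg) simp
 ultimately have N0: "?Nz p = 0" if "p \<in> K.M" for p
  using K.Liou_nonneg_eq_0[OF sm[OF NC(2)] _ _ that] by (simp add: k_def)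
 have "K0.grad f = 0"
 proof
  fix p
  note t = K.vfield_tangent[OF K0.grad_field[OF f], of p]
  show "K0.grad f p = 0 p"
  proof (cases "p \<in> K.M")
   case True
   then have "K0.g p (K0.grad f p) (K0.grad f p) = 0"
    using N0[OF True] K0.norm_df_sq_grad[OF f True] by (simp add: K.pair_def)
   then show ?thesis using K0.g_pos[OF True t] by fastforce
  qed (simp add: K.vfield_outside[OF K0.grad_field[OF f]])
 qed
 then show ?thesis using \<xi>J0 K.tensor_endo_0[OF K0.JJ_endo] by simp
qed

end

theorem theorem7:
  fixes A :: "('m, 'e::euclidean_space) atlas"
    and n :: nat
    and \<omega> :: "'m form2"
    and G :: "('m \<Rightarrow> 'm) set"
    and B :: "('m \<Rightarrow> 'm, 'h::real_normed_vector) atlas"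
    and \<xi> :: "('m \<Rightarrow> 'm) tvec"
  assumes "symplectic_manifold A n \<omega>"
    and "compact_space (atlas_topology A)" and "connected_space (atlas_topology A)"
    and "symplectic_fano A \<omega>"
    and "lie_subgroup_Ham A \<omega> G B"
    and "compact_space (atlas_topology B)" and "connected_space (atlas_topology B)"
    and "\<xi> \<in> lie_center B"
    and "\<exists>J \<in> AK_inv A \<omega> G. GeAKRS A n \<omega> (fundamental_field A B \<xi>) J"
    and "\<exists>J \<in> AK_inv A \<omega> G. constant_chern_scalar A n \<omega> J"
  shows "fundamental_field A B \<xi> = 0"
proof -
 obtain J f where J: "J \<in> AK_inv A \<omega> G" and f: "normalized_potential A n \<omega> (fundamental_field A B \<xi>) f"
  and s: "!!p. p \<in> pts A ==> modified_chern_scalar A n \<omega> f J p = 0"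
  using assms(9) unfolding GeAKRS_def by blast
 obtain J0 c where J0: "J0 \<in> AK_inv A \<omega> G" and c: "!!p. p \<in> pts A ==> chern_scalar A n \<omega> J0 p = c"
  using assms(10) unfolding constant_chern_scalar_def by blast
 have AK: "J \<in> AK A \<omega>" "J0 \<in> AK A \<omega>" using J J0 by (auto simp: AK_inv_def)
 have "smooth_manifold A" using assms(1) by (simp add: symplectic_manifold_def)
 then interpret T: two_structures A n \<omega> J J0
  by unfold_locales (use assms(1,2) AK in auto)
 have \<xi>: "\<xi> \<in> tangent_space B id" using assms(8) by (simp add: lie_center_def lie_algebra_def)
 have pot: "potential A \<omega> (fundamental_field A B \<xi>) f"
  and norm: "T.K.Liou (%p. f p * exp (- 2 * f p)) = 0" using f by (simp_all add: normalized_potential_def)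
 then have fC: "f \<in> smooth_functions A" by (simp add: potential_def)
 \<comment> \<open>a field with a smooth potential is \<open>J grad f\<close>, which proves that it is smooth\<close>
 have "fundamental_field A B \<xi> = endo_apply A J (T.K.grad f)"
  by (rule T.K.potential_grad[OF T.K.fundamental_field_tangent[OF assms(5) J \<xi>] _ pot]) (simp_all add: fundamental_field_def)
 then have V: "fundamental_field A B \<xi> \<in> vfields A" using T.K.JJ_field[OF T.K.grad_field[OF fC]] by simp
 have "c = real n" by (rule T.K0.fano_constant[OF assms(4) c])
 then show ?thesis
  using T.soliton_trivial[OF fC norm V pot T.K.fundamental_field_bracket[OF assms(5) J \<xi> V]
    T.K0.fundamental_field_bracket[OF assms(5) J0 \<xi> V] s] c by blast
qed

end
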